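(* Let $\gamma_+>\gamma_->0$ be constants, and let $D$, $h$, $\gamma$, $B$, $f$, $l(D,B)$ and, for $0<T<\infty$ and $\tau>0$, the indicator function $I_f(\tau,T)$ be as described in the context. Then $$\lim_{\tau\to\infty}e^{\tau T}I_f(\tau,T)=\begin{cases}0, & \text{if } T<2l(D,B),\\ -\infty, & \text{if } T>2l(D,B)\text{ and }\gamma\text{ satisfies }(A)_+,\\ +\infty, & \text{if } T>2l(D,B)\text{ and }\gamma\text{ satisfies }(A)_-.\end{cases}$$ Moreover, if $\gamma$ satisfies $(A)_+$ or $\gamma$ satisfies $(A)_-$, then for all $T>2l(D,B)$ $$\lim_{\tau\to\infty}\frac1\tau\log\left|I_f(\tau,T)\right|=-2\,l(D,B).$$
   Context: Write $\mathbb R^3_\pm=\{x=(x_1,x_2,x_3)\in\mathbb R^3 : \pm x_3>0\}$. Let $\gamma_0(x)=\gamma_\pm$ for $\pm x_3>0$. Obstacle and coefficient: $D$ is a nonempty bounded open set with $C^2$ boundary and $\overline D\subset\mathbb R^3_-$. The $3\times 3$ real matrix-valued function $\gamma(x)=(\gamma_{ij}(x))$ is given by $\gamma(x)=\gamma_0(x)I_3$ for $x\in\mathbb R^3\setminus D$ and $\gamma(x)=\gamma_0(x)I_3+h(x)$ for $x\in D$, where $h=(h_{ij})\in L^\infty(D)$. It is assumed that $\gamma_{ij}=\gamma_{ji}\in L^\infty(\mathbb R^3)$ and that there is $C>0$ with $\gamma(x)\xi\cdot\xi\ge C|\xi|^2$ for all $\xi\in\mathbb R^3$ and a.e. $x\in\mathbb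 R^3$. Jump conditions: $(A)_+$ (resp. $(A)_-$) means that there is a constant $C'>0$ such that $h(x)\xi\cdot\xi\ge C'|\xi|^2$ (resp. $-h(x)\xi\cdot\xi\ge C'|\xi|^2$) for all $\xi\in\mathbb R^3$ and a.e. $x\in D$. Source: $B$ is an open ball with $\overline B\subset\mathbb R^3_+$, and $f\in L^2(\mathbb R^3)$ is real-valued with $\operatorname{supp} f\subset\overline B$ and either $\operatorname{ess\,inf}_{x\in B}f(x)>0$ or $\operatorname{ess\,inf}_{x\in B}(-f(x))>0$. Wave: $u=u(t,x)$ is the weak solution of $(\partial_t^2-\nabla\cdot\gamma\nabla)u=0$ in $(0,T)\times\mathbb R^3$, $u(0,x)=0$, $\partial_tu(0,x)=f(x)$; that is, the unique $u\in L^2(0,T;H^1(\mathbb R^3))$ with $\partial_tu\in L^2(0,T;H^1(\mathbb R^3))$, $\partial_t^2u\in L^2(0,T;(H^1(\mathbb R^3))')$ such that for all $\phi\in H^1(\mathbb R^3)$, $\langle\partial_t^2u(t,\cdot),\phi\rangle+\int_{\mathbb R^3}\gamma(x)\nabla_xu(t,x)\cdot\nabla_x\phi(x)\,dx=0$ for a.e. $t\in(0,T)$, and $u(0,\cdot)=0$, $\partial_tu(0,\cdot)=f$. Indicator function: $I_f(\tau,T)=\int_{\mathbb R^3}f(x)\,(w(x,\tau)-v(x,\tau))\,dx$, where $w(x,\tau)=\int_0^Te^{-\tau t}u(t,x)\,dt$ and $v=v(\cdot,\tau)\in H^1(\mathbb R^3)$ is the weak solution of $(\nabla\cdot\gamma_0\nabla-\tau^2)v+f=0$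 in $\mathbb R^3$. Optical distance: for $x\in\mathbb R^3_-$, $y\in\mathbb R^3_+$ and $z'=(z_1,z_2)\in\mathbb R^2$, put $\tilde z'=(z_1,z_2,0)$, $l_{x,y}(z')=\frac{1}{\sqrt{\gamma_-}}|\tilde z'-x|+\frac1{\sqrt{\gamma_+}}|\tilde z'-y|$, $l(x,y)=\inf_{z'\in\mathbb R^2}l_{x,y}(z')$, and $l(D,B)=\inf_{x\in D,\,y\in B}l(x,y)$.
   Formalization: The velocity ∂_t u is required to lie in L²(0,T;L²(R³)) rather than L²(0,T;H¹(R³)): since f jumps across the boundary of B it is not in H¹, so no u in the stated class exists; the standard energy class, where u exists and is unique, is used instead. *)

theory Defs
  imports "HOL-Analysis.Analysis" "HOL-Probability.Essential_Supremum"
begin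

type_synonym R3 = "real^3"

text \<open>\<open>Ck k f\<close>: all partial derivatives of \<open>f\<close> up to order \<open>k\<close> exist and are continuous.\<close>

primrec Ck :: "nat \<Rightarrow> ('a::euclidean_space \<Rightarrow> real) \<Rightarrow> bool" where
  "Ck 0 f \<longleftrightarrow> continuous_on UNIV f"
| "Ck (Suc k) f \<longleftrightarrow> (\<forall>x. f differentiable (at x)) \<and>
     (\<forall>i\<in>Basis. Ck k (\<lambda>x. frechet_derivative f (at x) i))"

text \<open>The space \<open>C\<^sub>c\<^sup>\<infinity>(S)\<close> for open \<open>S\<close>; its elements are extended by zero to the whole space.\<close>

definition test_functions :: "'a::euclidean_space set \<Rightarrow> ('a \<Rightarrow> real) set" where
  "test_functions S = {\<phi>. (\<forall>k. Ck k \<phi>) \<and> compact (closure {x. \<phi> x \<noteq> 0})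
     \<and> closure {x. \<phi> x \<noteq> 0} \<subseteq> S}"

text \<open>Near each boundary point, and after an orthogonal change of coordinates, the set is the part of
  a ball lying strictly above the graph of a \<open>C\<^sup>2\<close> function.\<close>

definition C2_boundary :: "R3 set \<Rightarrow> bool" where
  "C2_boundary D \<longleftrightarrow> (\<forall>p\<in>frontier D. \<exists>r>0. \<exists>Q :: R3 \<Rightarrow> R3. \<exists>g :: real^2 \<Rightarrow> real.
     orthogonal_transformation Q \<and> Ck 2 g \<and>
     D \<inter> ball p r = {x \<in> ball p r. g (vector [Q x $ 1, Q x $ 2]) < Q x $ 3})"

text \<open>Elements of function spaces are represented by functions rather than by classes modulo
  equality almost everywhere, so that the norms below are seminorms.\<close>

definition Linfty :: "R3 set \<Rightarrow> (R3 \<Rightarrow> real) set" where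
  "Linfty S = {g. g \<in> borel_measurable (lebesgue_on S) \<and> (\<exists>M. AE x in lebesgue_on S. \<bar>g x\<bar> \<le> M)}"

definition L2 :: "(R3 \<Rightarrow> 'b::real_normed_vector) set" where
  "L2 = {g. g \<in> borel_measurable lebesgue \<and> integrable lebesgue (\<lambda>x. (norm (g x))\<^sup>2)}"

definition L2_norm :: "(R3 \<Rightarrow> 'b::real_normed_vector) \<Rightarrow> real" where
  "L2_norm g = sqrt (LINT x|lebesgue. (norm (g x))\<^sup>2)"

definition ess_inf :: "'a measure \<Rightarrow> ('a \<Rightarrow> real) \<Rightarrow> ereal" where
  "ess_inf M g = - esssup M (\<lambda>x. - ereal (g x))"

definition is_weak_gradient :: "(R3 \<Rightarrow> real) \<Rightarrow> (R3 \<Rightarrow> R3) \<Rightarrow> bool" where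
  "is_weak_gradient u g \<longleftrightarrow> g \<in> L2 \<and>
     (\<forall>\<phi>\<in>test_functions UNIV. \<forall>i\<in>Basis.
        (LINT x|lebesgue. u x * frechet_derivative \<phi> (at x) i)
          = - (LINT x|lebesgue. (g x \<bullet> i) * \<phi> x))"

definition H1 :: "(R3 \<Rightarrow> real) set" where
  "H1 = {u \<in> L2. \<exists>g. is_weak_gradient u g}"

text \<open>The choice is immaterial: the weak gradient is unique almost everywhere.\<close>

definition weak_gradient :: "(R3 \<Rightarrow> real) \<Rightarrow> R3 \<Rightarrow> R3" where
  "weak_gradient u = (SOME g. is_weak_gradient u g)"

definition H1_norm :: "(R3 \<Rightarrow> real) \<Rightarrow> real" where
  "H1_norm u = sqrt ((L2_norm u)\<^sup>2 + (L2_norm (weak_gradient u))\<^sup>2)"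

text \<open>Only the values of a functional on \<open>H1\<close> matter.\<close>

definition H1_dual :: "((R3 \<Rightarrow> real) \<Rightarrow> real) set" where
  "H1_dual = {F. (\<forall>\<phi>\<in>H1. \<forall>\<psi>\<in>H1. F (\<lambda>x. \<phi> x + \<psi> x) = F \<phi> + F \<psi>) \<and>
     (\<forall>c. \<forall>\<phi>\<in>H1. F (\<lambda>x. c * \<phi> x) = c * F \<phi>) \<and>
     (\<exists>K. \<forall>\<phi>\<in>H1. \<bar>F \<phi>\<bar> \<le> K * H1_norm \<phi>)}"

definition H1_dual_norm :: "((R3 \<Rightarrow> real) \<Rightarrow> real) \<Rightarrow> real" where
  "H1_dual_norm F = (SUP \<phi>\<in>{\<phi>\<in>H1. H1_norm \<phi> \<le> 1}. \<bar>F \<phi>\<bar>)"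

text \<open>The embedding of \<open>L\<^sup>2\<close> into the dual of \<open>H\<^sup>1\<close>.\<close>

definition L2_functional :: "(R3 \<Rightarrow> real) \<Rightarrow> (R3 \<Rightarrow> real) \<Rightarrow> real" where
  "L2_functional g = (\<lambda>\<phi>. LINT x|lebesgue. g x * \<phi> x)"

text \<open>The Bochner space \<open>L\<^sup>2(0,T;V)\<close>, where \<open>V\<close> carries the seminorm \<open>nrm\<close>: strong measurability
  (almost everywhere approximation by simple functions) and square integrability of the norm.\<close>

definition bochner_L2 :: "'v::minus set \<Rightarrow> ('v \<Rightarrow> real) \<Rightarrow> real \<Rightarrow> (real \<Rightarrow> 'v) set" where
  "bochner_L2 V nrm T = {F.
     (AE t in lebesgue_on {0<..<T}. F t \<in> V) \<and>
     (\<exists>s. (\<forall>n::nat. simple_function (lebesgue_on {0<..<T}) (s n) \<and> s n ` {0<..<T} \<subseteq> V) \<and>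
          (AE t in lebesgue_on {0<..<T}. (\<lambda>n. nrm (s n t - F t)) \<longlonglongrightarrow> 0)) \<and>
     integrable (lebesgue_on {0<..<T}) (\<lambda>t. (nrm (F t))\<^sup>2)}"

text \<open>\<open>G\<close> is the distributional derivative of \<open>F\<close> on \<open>(0,T)\<close>, both with values in the dual of \<open>H\<^sup>1\<close>.
  Vector-valued integrals are evaluated at \<open>\<phi>\<close> under the integral sign.\<close>

definition has_time_derivative ::
  "real \<Rightarrow> (real \<Rightarrow> (R3 \<Rightarrow> real) \<Rightarrow> real) \<Rightarrow> (real \<Rightarrow> (R3 \<Rightarrow> real) \<Rightarrow> real) \<Rightarrow> bool" where
  "has_time_derivative T F G \<longleftrightarrow> (\<forall>\<phi>\<in>H1. \<forall>\<psi>\<in>test_functions {0<..<T}.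
     (LINT t|lebesgue_on {0<..<T}. deriv \<psi> t * F t \<phi>)
       = - (LINT t|lebesgue_on {0<..<T}. \<psi> t * G t \<phi>))"

text \<open>\<open>F\<close> agrees almost everywhere on \<open>(0,T)\<close> with a continuous function \<open>U\<close> from \<open>[0,T]\<close> to \<open>V\<close>
  whose value at \<open>0\<close> is \<open>F\<^sub>0\<close>.\<close>

definition has_initial_value ::
  "'v::minus set \<Rightarrow> ('v \<Rightarrow> real) \<Rightarrow> real \<Rightarrow> (real \<Rightarrow> 'v) \<Rightarrow> 'v \<Rightarrow> bool" where
  "has_initial_value V nrm T F F\<^sub>0 \<longleftrightarrow> (\<exists>U.
     (\<forall>t\<in>{0..T}. U t \<in> V) \<and>
     (\<forall>s\<in>{0..T}. ((\<lambda>t. nrm (U t - U s)) \<longlongrightarrow> 0) (at s within {0..T})) \<and>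
     (AE t in lebesgue_on {0<..<T}. nrm (U t - F t) = 0) \<and>
     nrm (U 0 - F\<^sub>0) = 0)"

text \<open>The value on the interface \<open>x\<^sub>3 = 0\<close>, a null set, is irrelevant.\<close>

definition gamma0 :: "real \<Rightarrow> real \<Rightarrow> R3 \<Rightarrow> real" where
  "gamma0 \<gamma>\<^sub>p \<gamma>\<^sub>m x = (if x $ 3 > 0 then \<gamma>\<^sub>p else \<gamma>\<^sub>m)"

definition gamma :: "real \<Rightarrow> real \<Rightarrow> R3 set \<Rightarrow> (R3 \<Rightarrow> real^3^3) \<Rightarrow> R3 \<Rightarrow> real^3^3" where
  "gamma \<gamma>\<^sub>p \<gamma>\<^sub>m D h x = gamma0 \<gamma>\<^sub>p \<gamma>\<^sub>m x *\<^sub>R mat 1 + (if x \<in> D then h x else 0)"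

definition uniformly_elliptic :: "(R3 \<Rightarrow> real^3^3) \<Rightarrow> bool" where
  "uniformly_elliptic a \<longleftrightarrow>
     (\<exists>C>0. AE x in lebesgue. \<forall>\<xi>. (a x *v \<xi>) \<bullet> \<xi> \<ge> C * (norm \<xi>)\<^sup>2)"

definition jump_plus :: "R3 set \<Rightarrow> (R3 \<Rightarrow> real^3^3) \<Rightarrow> bool" where
  "jump_plus D h \<longleftrightarrow>
     (\<exists>C>0. AE x in lebesgue_on D. \<forall>\<xi>. (h x *v \<xi>) \<bullet> \<xi> \<ge> C * (norm \<xi>)\<^sup>2)"

definition jump_minus :: "R3 set \<Rightarrow> (R3 \<Rightarrow> real^3^3) \<Rightarrow> bool" where
  "jump_minus D h \<longleftrightarrow>
     (\<exists>C>0. AE x in lebesgue_on D. \<forall>\<xi>. - ((h x *v \<xi>) \<bullet> \<xi>) \<ge> C * (norm \<xi>)\<^sup>2)"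

text \<open>Weak solution \<open>u\<close> on \<open>(0,T)\<close> of \<open>(\<partial>\<^sub>t\<^sup>2 - \<nabla>\<cdot>a\<nabla>)u = 0\<close> with \<open>u(0) = 0\<close>, \<open>\<partial>\<^sub>tu(0) = f\<close>.

  The velocity lies in the energy class \<open>L\<^sup>2(0,T;L\<^sup>2)\<close>, in which the solution exists and is unique for
  \<open>f \<in> L\<^sup>2\<close>. The stronger requirement \<open>\<partial>\<^sub>tu \<in> L\<^sup>2(0,T;H\<^sup>1)\<close> would force \<open>f \<in> H\<^sup>1\<close>, so that no solution
  would exist for an \<open>f\<close> that jumps across a sphere. A solution meeting that requirement is also a
  solution in the sense below.

  Joint measurability selects a representative of \<open>u\<close> for which the pointwise integrals
  \<open>\<integral> exp(-\<tau>t) u(t,x) dt\<close> make sense for almost every \<open>x\<close>.\<close>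

definition wave_weak_solution ::
  "(R3 \<Rightarrow> real^3^3) \<Rightarrow> (R3 \<Rightarrow> real) \<Rightarrow> real \<Rightarrow> (real \<Rightarrow> R3 \<Rightarrow> real) \<Rightarrow> bool" where
  "wave_weak_solution a f T u \<longleftrightarrow>
     (\<lambda>(t, x). u t x) \<in> borel_measurable (lebesgue_on ({0<..<T} \<times> UNIV)) \<and>
     u \<in> bochner_L2 H1 H1_norm T \<and>
     (\<exists>u' u''.
        u' \<in> bochner_L2 L2 L2_norm T \<and>
        u'' \<in> bochner_L2 H1_dual H1_dual_norm T \<and>
        has_time_derivative T (\<lambda>t. L2_functional (u t)) (\<lambda>t. L2_functional (u' t)) \<and>
        has_time_derivative T (\<lambda>t. L2_functional (u' t)) u'' \<and>
        (\<forall>\<phi>\<in>H1. AE t in lebesgue_on {0<..<T}.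
           u'' t \<phi> + (LINT x|lebesgue. (a x *v weak_gradient (u t) x) \<bullet> weak_gradient \<phi> x) = 0) \<and>
        has_initial_value L2 L2_norm T u (\<lambda>x. 0) \<and>
        has_initial_value H1_dual H1_dual_norm T (\<lambda>t. L2_functional (u' t)) (L2_functional f))"

text \<open>Weak solution \<open>v\<close> of \<open>(\<nabla>\<cdot>a\<nabla> - \<tau>\<^sup>2)v + f = 0\<close> with scalar coefficient \<open>a\<close>.\<close>

definition elliptic_weak_solution ::
  "(R3 \<Rightarrow> real) \<Rightarrow> real \<Rightarrow> (R3 \<Rightarrow> real) \<Rightarrow> (R3 \<Rightarrow> real) \<Rightarrow> bool" where
  "elliptic_weak_solution a \<tau> f v \<longleftrightarrow> v \<in> H1 \<and>
     (\<forall>\<phi>\<in>H1. (LINT x|lebesgue. (a x *\<^sub>R weak_gradient v x) \<bullet> weak_gradient \<phi> x)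
        + \<tau>\<^sup>2 * (LINT x|lebesgue. v x * \<phi> x) = (LINT x|lebesgue. f x * \<phi> x))"

definition laplace_wave :: "(real \<Rightarrow> R3 \<Rightarrow> real) \<Rightarrow> real \<Rightarrow> R3 \<Rightarrow> real \<Rightarrow> real" where
  "laplace_wave u T x \<tau> = (LINT t|lebesgue_on {0<..<T}. exp (- \<tau> * t) * u t x)"

text \<open>Here \<open>v \<tau>\<close> is the elliptic solution for the parameter \<open>\<tau>\<close>.\<close>

definition indicator_function ::
  "(R3 \<Rightarrow> real) \<Rightarrow> (real \<Rightarrow> R3 \<Rightarrow> real) \<Rightarrow> (real \<Rightarrow> R3 \<Rightarrow> real) \<Rightarrow> real \<Rightarrow> real \<Rightarrow> real" where
  "indicator_function f u v \<tau> T = (LINT x|lebesgue. f x * (laplace_wave u T x \<tau> - v \<tau> x))"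

definition path_time :: "real \<Rightarrow> real \<Rightarrow> R3 \<Rightarrow> R3 \<Rightarrow> real^2 \<Rightarrow> real" where
  "path_time \<gamma>\<^sub>p \<gamma>\<^sub>m x y z =
     (let z0 = vector [z $ 1, z $ 2, 0] :: R3
      in 1 / sqrt \<gamma>\<^sub>m * norm (z0 - x) + 1 / sqrt \<gamma>\<^sub>p * norm (z0 - y))"

definition optical_dist :: "real \<Rightarrow> real \<Rightarrow> R3 \<Rightarrow> R3 \<Rightarrow> real" where
  "optical_dist \<gamma>\<^sub>p \<gamma>\<^sub>m x y = (INF z. path_time \<gamma>\<^sub>p \<gamma>\<^sub>m x y z)"

definition optical_setdist :: "real \<Rightarrow> real \<Rightarrow> R3 set \<Rightarrow> R3 set \<Rightarrow> real" where
  "optical_setdist \<gamma>\<^sub>p \<gamma>\<^sub>m D B = (INF (x, y)\<in>D \<times> B. optical_dist \<gamma>\<^sub>p \<gamma>\<^sub>m x y)"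

end

theory Submission
	imports Defs "HOL-Real_Asymp.Real_Asymp"
begin

text \<open>Let \<open>w\<close> be the Laplace transform of \<open>u\<close> over \<open>(0,T)\<close> and \<open>z = w - v\<close>. Integration by parts in time shows
	that \<open>w\<close> solves the elliptic equation with coefficient \<open>\<gamma>\<close> and source \<open>f\<close> up to a term \<open>\<Phi>\<close> of size
	\<open>\<tau> exp (- \<tau> T)\<close> which stems from the time \<open>T\<close>. With the energy forms \<open>A\<^sub>\<gamma>\<close> and \<open>A\<^sub>0\<close> for the coefficients
	\<open>\<gamma>\<close> and \<open>\<gamma>0\<close>, testing the two equations with \<open>v\<close>, \<open>w\<close> and \<open>z\<close> gives
	\<open>I = - \<integral>\<^sub>D h \<nabla>v \<bullet> \<nabla>v + A\<^sub>\<gamma>(z, z) + \<Phi> z - \<Phi> v\<close> and \<open>I = - \<integral>\<^sub>D h \<nabla>w \<bullet> \<nabla>w - A\<^sub>0(z, z) - \<Phi> z - \<Phi> v\<close>.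
	Hence the sign of \<open>h\<close> determines the sign of \<open>I\<close>, and \<open>I\<close> is comparable to \<open>E = \<integral>\<^sub>D \<bar>\<nabla>v\<bar>\<^sup>2\<close> up to an error
	which is small compared with \<open>E\<close> if \<open>T > 2 l\<close>; if \<open>T < 2 l\<close>, both are \<open>o (exp (- \<tau> T))\<close>.

	It remains to see that \<open>E\<close> decays exactly at the rate \<open>2 l\<close>. The upper bound is a weighted energy estimate
	of Agmon type whose weight is the travel time from \<open>B\<close>. For the lower bound, radial subsolutions carry a
	lower bound for \<open>v\<close> from ball to ball along an almost optimal broken segment from \<open>B\<close> to \<open>D\<close>, and testing
	the equation with a bump function in \<open>D\<close> turns it into a lower bound for \<open>\<nabla>v\<close>.\<close>

text \<open>The gradient of \<open>v\<close> may jump across the interface, so both bounds for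
  \<open>E\<close> rest on the weak form alone. What makes them match is that the lower layer is the
  slow one. A profile that decreases away from a centre in the upper layer then has a flux jump of
  the sign a subsolution needs, so one radial barrier works on both sides. The slowness 1 / sqrt
  \<gamma>m is admissible in both layers, so one barrier centred just above the interface reaches
  any point of \<open>D\<close>. And a path that uses the slow speed inside the upper layer never
  beats the optical distance, so the weight has the right value on \<open>D\<close>. The sizes of
  the errors decide the threshold. \<open>\<Phi> z\<close> is absorbed by the energy of
  \<open>z\<close> at the cost of the squared norm of \<open>\<Phi>\<close>, of order \<tau>^2 exp
  (- 2 \<tau> T), which is negligible against exp (- 2 \<tau> l) as soon as T > l. In
  \<open>\<Phi> v\<close> the decay of \<open>v\<close> yields exp (- \<tau> T) / \<tau>; this term
  accounts for the condition T > 2 l, and its factor 1 / \<tau> is what makes it vanish after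
  multiplication by exp (\<tau> T) when T < 2 l.\<close>

abbreviation lebesgue_integral :: "('a::euclidean_space => 'b::{banach, second_countable_topology}) => 'b" (binder "LINT " 60)
	where "lebesgue_integral f \<equiv> integral\<^sup>L lebesgue f"

abbreviation lebesgue_AE :: "('a::euclidean_space => bool) => bool" (binder "AE " 10)
	where "lebesgue_AE P \<equiv> eventually P (ae_filter lebesgue)"

section \<open>Smooth functions and mollification\<close>

lemma Ck_SucI:
	assumes "\<And>x. (f has_derivative f' x) (at x)" "\<And>i. i \<in> Basis ==> Ck k (%x. f' x i)"
	shows "Ck (Suc k) f"
proof -
	have "frechet_derivative f (at x) = f' x" for x
		using frechet_derivative_at[OF assms(1)] by simp
	then show ?thesis using assms by (auto simp: differentiable_def)
qed

lemma Ck_Suc_imp: "Ck (Suc k) f ==> Ck k f"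
proof (induction k arbitrary: f)
	case 0
	then show ?case
		by (auto intro!: continuous_at_imp_continuous_on differentiable_imp_continuous_within)
qed auto

lemma Ck_Suc_ex:
	assumes "Ck (Suc k) f"
	shows "\<exists>f'. (\<forall>x. (f has_derivative f' x) (at x)) \<and> (\<forall>i\<in>Basis. Ck k (%x. f' x i))"
	using assms by (intro exI[of _ "%x. frechet_derivative f (at x)"]) (simp add: frechet_derivative_works)

lemma Ck_const: "Ck k (%x. c)"
proof (induction k arbitrary: c)
	case (Suc k)
	show ?case by (rule Ck_SucI[where f' = "%x h. 0"]) (auto intro: Suc)
qed auto

lemma Ck_add:
	assumes "Ck k f" "Ck k g" shows "Ck k (%x. f x + g x)"
	using assms
proof (induction k arbitrary: f g)
	case 0 then show ?case by (auto intro: continuous_intros)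
next
	case (Suc k)
	obtain f' where f: "\<And>x. (f has_derivative f' x) (at x)" "\<And>i. i \<in> Basis ==> Ck k (%x. f' x i)"
		using Ck_Suc_ex[OF Suc.prems(1)] by blast
	obtain g' where g: "\<And>x. (g has_derivative g' x) (at x)" "\<And>i. i \<in> Basis ==> Ck k (%x. g' x i)"
		using Ck_Suc_ex[OF Suc.prems(2)] by blast
	show ?case
		by (rule Ck_SucI[OF has_derivative_add[OF f(1) g(1)]]) (intro Suc.IH f g)
qed

lemma Ck_mult:
	fixes f g :: "'a::euclidean_space => real"
	assumes "Ck k f" "Ck k g" shows "Ck k (%x. f x * g x)"
	using assms
proof (induction k arbitrary: f g)
	case 0 then show ?case by (auto intro: continuous_intros)
next
	case (Suc k)
	obtain f' where f: "\<And>x. (f has_derivative f' x) (at x)" "\<And>i. i \<in> Basis ==> Ck k (%x. f' x i)" 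
		using Ck_Suc_ex[OF Suc.prems(1)] by blast
	obtain g' where g: "\<And>x. (g has_derivative g' x) (at x)" "\<And>i. i \<in> Basis ==> Ck k (%x. g' x i)" 
		using Ck_Suc_ex[OF Suc.prems(2)] by blast
	show ?case
		by (rule Ck_SucI[OF has_derivative_mult[OF f(1) g(1)]]) (intro Ck_add Suc.IH f g Ck_Suc_imp[OF Suc.prems(1)] Ck_Suc_imp[OF Suc.prems(2)])
qed

lemma Ck_inner: "Ck k (%x::'a::euclidean_space. x \<bullet> a)"
proof (cases k)
	case 0 then show ?thesis by (auto intro: continuous_intros)
next
	case (Suc j)
	show ?thesis unfolding Suc
		by (rule Ck_SucI[where f' = "%x h. h \<bullet> a"])
			(auto intro!: derivative_eq_intros Ck_const)
qed

text \<open>The outer function comes with its whole chain \<open>D\<close> of successive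
  derivatives: differentiating \<open>D n (f x)\<close> produces \<open>D (Suc n) (f x)\<close>, so
  the induction over \<open>k\<close> must cover all \<open>n\<close> at once. The chain used later
  is \<open>flat\<close>.\<close>

lemma Ck_compose:
	fixes f :: "'a::euclidean_space => real"
	assumes D: "\<And>n t. (D n has_real_derivative D (Suc n) t) (at t)" and f: "Ck k f"
	shows "Ck k (%x. D n (f x))"
	using f
proof (induction k arbitrary: f n)
	case 0
	have "continuous_on UNIV (D n)"
		using D by (meson DERIV_isCont continuous_at_imp_continuous_on)
	then show ?case using 0 continuous_on_compose2[of UNIV "D n" UNIV f] by auto
next
	case (Suc k)
	obtain f' where f: "\<And>x. (f has_derivative f' x) (at x)" "\<And>i. i \<in> Basis ==> Ck k (%x. f' x i)" 
		using Ck_Suc_ex[OF Suc.prems(1)] by blast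
	show ?case
	proof (rule Ck_SucI)
		show "((%x. D n (f x)) has_derivative (%h. D (Suc n) (f x) * f' x h)) (at x)" for x
			using has_derivative_compose[OF f(1) D[THEN has_field_derivative_imp_has_derivative]] by simp
		show "Ck k (%x. D (Suc n) (f x) * f' x i)" if "i \<in> Basis" for i
			by (intro Ck_mult Suc.IH f that Ck_Suc_imp[OF Suc.prems])
	qed
qed

lemma Ck_reflect:
	fixes f :: "'a::euclidean_space => real"
	assumes "Ck k f" shows "Ck k (%y. f (x - y))"
	using assms
proof (induction k arbitrary: f)
	case 0
	then show ?case by (auto intro!: continuous_intros continuous_on_compose2[of UNIV f UNIV])
next
	case (Suc k)
	obtain f' where f: "\<And>x. (f has_derivative f' x) (at x)" "\<And>i. i \<in> Basis ==> Ck k (%x. f' x i)"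
		using Ck_Suc_ex[OF Suc.prems(1)] by blast
	have lin: "f' x (- h) = (-1) * f' x h" for x h
		using linear_neg[OF has_derivative_linear[OF f(1)]] by simp
	show ?case
	proof (rule Ck_SucI)
		have "((%y. x - y) has_derivative (%h. - h)) (at y)" for y
			by (auto intro!: derivative_eq_intros)
		from has_derivative_compose[OF this f(1)]
		show "((%y. f (x - y)) has_derivative (%h. (-1) * f' (x - y) h)) (at y)" for y
			by (simp only: lin)
		show "Ck k (%y. (-1) * f' (x - y) i)" if "i \<in> Basis" for i
			by (intro Ck_mult Ck_const Suc.IH f that)
	qed
qed

section \<open>A smooth function that vanishes to infinite order at zero\<close>

fun bump_poly :: "nat => real poly" where
	"bump_poly 0 = 1"
| "bump_poly (Suc n) = [:0, 0, 1:] * (bump_poly n - pderiv (bump_poly n))"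

text \<open>The \<open>n\<close>-th derivative of exp (- 1 / t), extended by 0 to t <= 0. With s = 1
  / t, the product rule turns a factor p(s) into s^2 (p(s) - p'(s)), which is the recursion of
  \<open>bump_poly\<close>.\<close>

definition flat :: "nat => real => real" where
	"flat n t = (if t > 0 then poly (bump_poly n) (1 / t) * exp (- (1 / t)) else 0)"

lemma poly_times_exp_tendsto_0: "((%s::real. poly p s * exp (- s)) \<longlongrightarrow> 0) at_top"
proof -
	\<comment> \<open>The extra power \<open>s^k\<close> absorbs the shift of the coefficients in
	  \<open>pCons\<close> and keeps the induction closed.\<close>
	have "((%s::real. (s^k * poly p s) * exp (- s)) \<longlongrightarrow> 0) at_top" for k
	proof (induction p arbitrary: k)
		case (pCons a p)
		have "((%s::real. a * (s^k / exp s) + (s^(Suc k) * poly p s) * exp (- s)) \<longlongrightarrow> a * 0 + 0) at_top"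
			by (intro tendsto_intros tendsto_power_div_exp_0 pCons)
		then show ?case by (simp add: algebra_simps exp_minus divide_inverse)
	qed auto
	from this[of 0] show ?thesis by simp
qed

lemma flat_tendsto: "((%t. poly p (1 / t) * exp (- (1 / t))) \<longlongrightarrow> 0) (at_right (0::real))"
	using filterlim_compose[OF poly_times_exp_tendsto_0 filterlim_inverse_at_top_right]
	by (simp add: divide_inverse)

lemma flat_deriv: "(flat n has_real_derivative flat (Suc n) t) (at t)"
proof -
	consider "t > 0" | "t < 0" | "t = 0" by linarith
	then show ?thesis
	proof cases
		case 1
		have i: "((%t. 1 / t) has_real_derivative - (1 / t^2)) (at t)"
			using 1 by (auto intro!: derivative_eq_intros simp: power2_eq_square)
		have e: "((%t. exp (- (1 / t))) has_real_derivative exp (- (1 / t)) * (1 / t^2)) (at t)"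
			using DERIV_chain2[OF DERIV_exp DERIV_minus[OF i]] by simp
		have "((%t. poly (bump_poly n) (1 / t) * exp (- (1 / t))) has_real_derivative flat (Suc n) t) (at t)"
			by (rule DERIV_cong[OF DERIV_mult[OF DERIV_chain2[OF poly_DERIV i] e]])
				(use 1 in \<open>simp add: flat_def algebra_simps power2_eq_square\<close>)
		then show ?thesis
			by (rule has_field_derivative_transform_within_open[of _ _ _ "{0<..}"])
				(use 1 in \<open>auto simp: flat_def\<close>)
	next
		case 2
		have "((%t. 0) has_real_derivative flat (Suc n) t) (at t)"
			using 2 by (auto simp: flat_def)
		then show ?thesis
			by (rule has_field_derivative_transform_within_open[of _ _ _ "{..<0}"])
				(use 2 in \<open>auto simp: flat_def\<close>)
	next
		case 3
		have r: "((%h. flat n h / h) \<longlongrightarrow> 0) (at_right 0)"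
		proof (rule Lim_transform_eventually)
			\<comment> \<open>The difference quotient at 0 from the right divides by t, that is, it
			  multiplies the polynomial in 1 / t by its variable; the decay of exp (- 1 / t) absorbs this as
			  well.\<close>
			show "((%t. poly ([:0,1:] * bump_poly n) (1 / t) * exp (- (1 / t))) \<longlongrightarrow> 0) (at_right (0::real))"
				by (rule flat_tendsto)
			show "\<forall>\<^sub>F t in at_right 0. poly ([:0,1:] * bump_poly n) (1 / t) * exp (- (1 / t)) = flat n t / t"
				by (simp add: eventually_at_filter flat_def)
		qed
		have l: "((%h. flat n h / h) \<longlongrightarrow> 0) (at_left 0)"
			by (rule Lim_transform_eventually[OF tendsto_const[of 0]])
				(simp add: eventually_at_filter flat_def)
		have "((%h. flat n h / h) \<longlongrightarrow> 0) (at 0)"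
			using l r by (simp add: filterlim_split_at)
		then show ?thesis using 3 by (simp add: DERIV_def flat_def)
	qed
qed

lemma flat_0_pos: "flat 0 t > 0 \<longleftrightarrow> t > 0" and flat_0_nonneg: "flat 0 t \<ge> 0"
	by (auto simp: flat_def)

section \<open>Functions of class C^1 and their convolution with locally integrable weights\<close>

definition has_C1_gradient :: "('a::euclidean_space => real) => ('a => 'a) => bool" where
	"has_C1_gradient f G \<longleftrightarrow> continuous_on UNIV G \<and> (\<forall>x. (f has_derivative (%h. G x \<bullet> h)) (at x))"

definition vanishes_beyond :: "real => ('a::real_normed_vector => 'b::zero) => bool" where
	"vanishes_beyond R f \<longleftrightarrow> (\<forall>x. norm x > R --> f x = 0)"

definition loc_integrable :: "('a::euclidean_space => real) => bool" where
	"loc_integrable w \<longleftrightarrow> (\<forall>r. integrable lebesgue (%y. indicator (cball 0 r) y * w y))"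

text \<open>The kernel may be vector valued while the weight is scalar, so that the gradient of
  \<open>conv F w\<close> is \<open>conv G w\<close> for the gradient field \<open>G\<close> of
  \<open>F\<close>. Regularity may sit in either place: \<open>conv (mollifier e) w\<close>
  regularises a rough \<open>w\<close>, and \<open>conv H (mollifier d)\<close> averages a
  continuous \<open>H\<close>; \<open>conv_commute\<close> identifies the two for scalar
  functions.\<close>

definition conv :: "('a::euclidean_space => 'b::euclidean_space) => ('a => real) => 'a => 'b" where
	"conv F w x = (LINT y. w y *\<^sub>R F (x - y))"

lemma has_C1_gradient_continuous: "has_C1_gradient f G ==> continuous_on UNIV f"
	unfolding has_C1_gradient_def
	by (meson continuous_at_imp_continuous_on has_derivative_continuous)

lemma has_C1_gradient_vanishes:
	fixes f :: "'a::euclidean_space => real"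
	assumes "has_C1_gradient f G" "vanishes_beyond R f" shows "vanishes_beyond R G"
	unfolding vanishes_beyond_def
proof (intro allI impI)
	fix x :: 'a assume x: "norm x > R"
	have "((%x. 0) has_derivative (%h. G x \<bullet> h)) (at x)"
	proof (rule has_derivative_transform_within_open[of f _ _ _ "- cball 0 R"])
		show "(f has_derivative (\<bullet>) (G x)) (at x)" using assms by (auto simp: has_C1_gradient_def)
	qed (use x assms in \<open>auto simp: vanishes_beyond_def\<close>)
	then have "(%h. G x \<bullet> h) = (%h. 0)"
		using has_derivative_unique has_derivative_const by blast
	then have "G x \<bullet> G x = 0" by metis
	then show "G x = 0" by simp
qed

lemma vanishes_bounded:
	fixes g :: "'a::euclidean_space => 'b::real_normed_vector"
	assumes "continuous_on UNIV g" "vanishes_beyond R g"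
	obtains B where "B > 0" "\<And>x. norm (g x) \<le> B"
proof -
	have "compact (g ` cball 0 R)"
		using assms by (intro compact_continuous_image) (auto intro: continuous_on_subset)
	then obtain B where B: "B > 0" "\<And>x. x \<in> cball 0 R ==> norm (g x) \<le> B"
		by (metis bounded_pos compact_imp_bounded image_eqI)
	have "norm (g x) \<le> B" for x
	proof (cases "norm x \<le> R")
		case True then show ?thesis using B by simp
	next
		case False then show ?thesis using B assms by (simp add: vanishes_beyond_def)
	qed
	then show ?thesis using that B by blast
qed

lemma vanishes_uniformly_continuous:
	fixes g :: "'a::euclidean_space => 'b::real_normed_vector"
	assumes "continuous_on UNIV g" "vanishes_beyond R g" "e > 0"
	obtains d where "d > 0" "\<And>x y. norm (x - y) < d ==> norm (g x - g y) < e"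
proof -
	have "uniformly_continuous_on (cball 0 (R + 1)) g"
		using assms by (intro compact_uniformly_continuous) (auto intro: continuous_on_subset)
	then obtain d where d: "d > 0" "\<And>x y. x \<in> cball 0 (R+1) ==> y \<in> cball 0 (R+1) ==> norm (x - y) < d ==> norm (g x - g y) < e"
		using \<open>e > 0\<close> unfolding uniformly_continuous_on_def dist_norm by metis
	have "norm (g x - g y) < e" if "norm (x - y) < min d 1" for x y
	proof (cases "norm x \<le> R + 1 \<and> norm y \<le> R + 1")
		case True then show ?thesis using d that by simp
	next
		case False
		have "norm x \<le> norm y + norm (x - y)" "norm y \<le> norm x + norm (x - y)"
			using norm_triangle_sub[of x y] norm_triangle_sub[of y x] by (simp_all add: norm_minus_commute)
		then have "norm x > R" "norm y > R" using False that by auto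
		then show ?thesis using assms by (simp add: vanishes_beyond_def)
	qed
	then show ?thesis using that[of "min d 1"] d by auto
qed

lemma continuous_lebesgue_measurable:
	fixes g :: "'a::euclidean_space => 'b::euclidean_space"
	assumes "continuous_on UNIV g" shows "g \<in> borel_measurable lebesgue"
	using borel_measurable_continuous_onI[OF assms] by (simp add: measurable_completion)

lemma loc_integrable_cong_ball:
	assumes "loc_integrable w" "\<And>y. norm y > r ==> H y = 0" "H \<in> borel_measurable lebesgue"
		"\<And>y. norm (H y) \<le> B"
	shows "integrable lebesgue (%y. w y *\<^sub>R (H y :: 'b::euclidean_space))"
proof -
	have i: "integrable lebesgue (%y. indicator (cball 0 r) y * w y)"
		using assms by (simp add: loc_integrable_def)
	have eq: "(%y. w y *\<^sub>R H y) = (%y. (indicator (cball 0 r) y * w y) *\<^sub>R H y)"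
	proof
		show "w y *\<^sub>R H y = (indicator (cball 0 r) y * w y) *\<^sub>R H y" for y
			using assms(2)[of y] by (cases "norm y \<le> r") auto
	qed
	show ?thesis unfolding eq
	proof (rule Bochner_Integration.integrable_bound)
		show "integrable lebesgue (%y. B * \<bar>indicator (cball 0 r) y * w y\<bar>)"
			using i by simp
		show "(%y. (indicator (cball 0 r) y * w y) *\<^sub>R H y) \<in> borel_measurable lebesgue"
			using i assms(3) by (intro borel_measurable_scaleR) auto
		show "AE y. norm ((indicator (cball 0 r) y * w y) *\<^sub>R H y) \<le> norm (B * \<bar>indicator (cball 0 r) y * w y\<bar>)"
		proof (rule AE_I2)
			fix y
			have "norm ((indicator (cball 0 r) y * w y) *\<^sub>R H y) = \<bar>indicator (cball 0 r) y * w y\<bar> * norm (H y)" by simp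
			also have "\<dots> \<le> \<bar>indicator (cball 0 r) y * w y\<bar> * B" by (intro mult_left_mono assms) auto
			also have "\<dots> \<le> norm (B * \<bar>indicator (cball 0 r) y * w y\<bar>)" by (simp add: mult.commute)
			finally show "norm ((indicator (cball 0 r) y * w y) *\<^sub>R H y) \<le> norm (B * \<bar>indicator (cball 0 r) y * w y\<bar>)" .
		qed
	qed
qed

lemma conv_estimate:
	fixes H :: "'a::euclidean_space => 'b::euclidean_space"
	assumes "loc_integrable w" "\<And>y. norm y > r ==> H y = 0" "H \<in> borel_measurable lebesgue"
		"\<And>y. norm (H y) \<le> e"
	shows "norm (LINT y. w y *\<^sub>R H y) \<le> e * (LINT y. \<bar>indicator (cball 0 r) y * w y\<bar>)"
proof -
	have i: "integrable lebesgue (%y. indicator (cball 0 r) y * w y)"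
		using assms by (simp add: loc_integrable_def)
	have "norm (LINT y. w y *\<^sub>R H y) \<le> (LINT y. norm (w y *\<^sub>R H y))"
		by (rule integral_norm_bound)
	also have "\<dots> \<le> (LINT y. e * \<bar>indicator (cball 0 r) y * w y\<bar>)"
	proof (rule integral_mono)
		show "integrable lebesgue (%y. norm (w y *\<^sub>R H y))"
			using loc_integrable_cong_ball[OF assms] by (rule integrable_norm)
		show "integrable lebesgue (%y. e * \<bar>indicator (cball 0 r) y * w y\<bar>)" using i by simp
		fix y :: 'a
		show "norm (w y *\<^sub>R H y) \<le> e * \<bar>indicator (cball 0 r) y * w y\<bar>"
		proof (cases "norm y \<le> r")
			case True
			have "\<bar>w y\<bar> * norm (H y) \<le> \<bar>w y\<bar> * e" by (intro mult_left_mono assms) auto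
			then show ?thesis using True by (simp add: mult.commute)
		next
			case False then show ?thesis using assms(2) by (simp add: indicator_def)
		qed
	qed
	also have "\<dots> = e * (LINT y. \<bar>indicator (cball 0 r) y * w y\<bar>)" by simp
	finally show ?thesis .
qed

lemma continuous_reflect_measurable:
	fixes F :: "'a::euclidean_space => 'b::euclidean_space"
	assumes "continuous_on UNIV F"
	shows "(%y. F (x - y)) \<in> borel_measurable lebesgue"
	by (intro continuous_lebesgue_measurable continuous_on_compose2[OF assms] continuous_intros) auto

lemma vanishes_reflect:
	assumes "vanishes_beyond R F" "norm y > norm x + R" shows "F (x - y) = 0"
proof -
	have "norm y \<le> norm x + norm (x - y)"
		by (metis norm_minus_commute norm_triangle_sub)
	then show ?thesis using assms by (simp add: vanishes_beyond_def)
qed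

lemma conv_integrable:
	fixes F :: "'a::euclidean_space => 'b::euclidean_space"
	assumes "continuous_on UNIV F" "vanishes_beyond R F" "loc_integrable w"
	shows "integrable lebesgue (%y. w y *\<^sub>R F (x - y))"
proof -
	obtain B where B: "\<And>x. norm (F x) \<le> B" using vanishes_bounded[OF assms(1,2)] by blast
	show ?thesis
	proof (rule loc_integrable_cong_ball[OF assms(3)])
		show "norm y > norm x + R ==> F (x - y) = 0" for y using assms(2) by (rule vanishes_reflect)
		show "norm (F (x - y)) \<le> B" for y by (rule B)
	qed (rule continuous_reflect_measurable[OF assms(1)])
qed

lemma conv_continuous:
	fixes F :: "'a::euclidean_space => 'b::euclidean_space"
	assumes "continuous_on UNIV F" "vanishes_beyond R F" "loc_integrable w"
	shows "continuous_on UNIV (conv F w)"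
proof (rule continuous_at_imp_continuous_on, rule ballI)
	fix x :: 'a
	\<comment> \<open>For points within distance 1 of \<open>x\<close> the kernel only sees
	  \<open>w\<close> on the ball of radius \<open>norm x + 1 + R\<close>; \<open>M\<close> is the
	  mass of \<open>w\<close> there. Dividing by \<open>M + 1\<close> rather than \<open>M\<close>
	  covers M = 0.\<close>
	define M where "M = (LINT y. \<bar>indicator (cball 0 (norm x + 1 + R)) y * w y\<bar>)"
	have M: "M \<ge> 0" by (simp add: M_def)
	show "isCont (conv F w) x"
		unfolding continuous_at_eps_delta
	proof (intro allI impI)
		fix e :: real assume "e > 0"
		then have e': "e / (M + 1) > 0" using M by simp
		from vanishes_uniformly_continuous[OF assms(1,2) this]
		obtain d where d: "d > 0" "\<And>x y. norm (x - y) < d ==> norm (F x - F y) < e / (M + 1)" by metis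
		have "dist (conv F w x') (conv F w x) < e" if "dist x' x < min d 1" for x'
		proof -
			have x': "norm x' \<le> norm x + 1" using that norm_triangle_sub[of x' x] by (simp add: dist_norm)
			have "conv F w x' - conv F w x = (LINT y. w y *\<^sub>R (F (x' - y) - F (x - y)))"
				unfolding conv_def scaleR_diff_right
				using conv_integrable[OF assms] by (simp add: Bochner_Integration.integral_diff)
			also have "norm \<dots> \<le> e / (M + 1) * (LINT y. \<bar>indicator (cball 0 (norm x + 1 + R)) y * w y\<bar>)"
			proof (rule conv_estimate[OF assms(3)])
				fix y :: 'a
				show "norm (F (x' - y) - F (x - y)) \<le> e / (M + 1)"
					using d(2)[of "x' - y" "x - y"] that by (simp add: dist_norm less_imp_le)
				assume "norm y > norm x + 1 + R"
				then show "F (x' - y) - F (x - y) = 0"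
					using x' by (simp add: vanishes_reflect[OF assms(2)])
			qed (intro borel_measurable_diff continuous_reflect_measurable assms)
			also have "\<dots> = e * (M / (M + 1))" by (simp only: M_def times_divide_eq_left times_divide_eq_right)
			also have "\<dots> < e * 1" using \<open>e > 0\<close> M by (intro mult_strict_left_mono) auto
			finally show ?thesis by (simp add: dist_norm)
		qed
		then show "\<exists>d>0. \<forall>x'. dist x' x < d --> dist (conv F w x') (conv F w x) < e"
			using d(1) by (intro exI[of _ "min d 1"]) auto
	qed
qed

lemma C1_remainder:
	fixes f :: "'a::euclidean_space => real"
	assumes "has_C1_gradient f G" "\<And>z. norm (z - a) \<le> norm (b - a) ==> norm (G z - G a) \<le> e"
	shows "\<bar>f b - f a - G a \<bullet> (b - a)\<bar> \<le> e * norm (b - a)"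
proof -
	have "norm (f b - f a - G a \<bullet> (b - a)) \<le> norm (b - a) * e"
	proof (rule differentiable_bound_linearization[where S = "cball a (norm (b - a))" and f' = "%x h. G x \<bullet> h"])
		show "a + t *\<^sub>R (b - a) \<in> cball a (norm (b - a))" if "t \<in> {0..1}" for t
			using that by (simp add: dist_norm mult_left_le_one_le)
		show "(f has_derivative (\<bullet>) (G x)) (at x within cball a (norm (b - a)))" for x
			using assms(1) by (simp add: has_C1_gradient_def has_derivative_at_withinI)
		fix x assume "x \<in> cball a (norm (b - a))"
		then have "norm (x - a) \<le> norm (b - a)" by (metis dist_commute dist_norm mem_cball)
		then have "norm (G x - G a) \<le> e" by (rule assms(2))
		then show "onorm ((\<bullet>) (G x) - (\<bullet>) (G a)) \<le> e"
		proof (intro onorm_le)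
			fix h
			have "\<bar>(G x - G a) \<bullet> h\<bar> \<le> norm (G x - G a) * norm h" by (rule Cauchy_Schwarz_ineq2)
			also have "\<dots> \<le> e * norm h" using \<open>norm (G x - G a) \<le> e\<close> by (rule mult_right_mono) simp
			finally show "norm (((\<bullet>) (G x) - (\<bullet>) (G a)) h) \<le> e * norm h" by (simp add: inner_diff_left)
		qed
	qed simp
	then show ?thesis by (simp add: mult.commute)
qed

text \<open>Since \<open>G\<close> vanishes far out it is uniformly continuous, hence the first
  order remainder of \<open>F\<close> is small uniformly in the base point and can be integrated
  against the local mass of \<open>w\<close>. This replaces dominated convergence.\<close>

lemma conv_derivative:
	fixes F :: "'a::euclidean_space => real"
	assumes F: "has_C1_gradient F G" and R: "vanishes_beyond R F" and w: "loc_integrable w"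
	shows "has_C1_gradient (conv F w) (conv G w)"
proof -
	have cF: "continuous_on UNIV F" using F by (rule has_C1_gradient_continuous)
	have cG: "continuous_on UNIV G" using F by (simp add: has_C1_gradient_def)
	have RG: "vanishes_beyond R G" using F R by (rule has_C1_gradient_vanishes)
	have "(conv F w has_derivative (%h. conv G w x \<bullet> h)) (at x)" for x
		unfolding has_derivative_at_alt
	proof (intro conjI allI impI)
		show "bounded_linear (%h. conv G w x \<bullet> h)" by (rule bounded_linear_inner_right)
		define M where "M = (LINT y. \<bar>indicator (cball 0 (norm x + 1 + R)) y * w y\<bar>)"
		have M: "M \<ge> 0" by (simp add: M_def)
		fix e :: real assume "e > 0"
		then have e': "e / (M + 1) > 0" using M by simp
		from vanishes_uniformly_continuous[OF cG RG this]
		obtain d where d: "d > 0" "\<And>x y. norm (x - y) < d ==> norm (G x - G y) < e / (M + 1)" by metis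
		have "norm (conv F w x' - conv F w x - conv G w x \<bullet> (x' - x)) \<le> e * norm (x' - x)" if "norm (x' - x) < min d 1" for x'
		proof -
			have x': "norm x' \<le> norm x + 1" using that norm_triangle_sub[of x' x] by simp
			have "conv G w x \<bullet> (x' - x) = (LINT y. (w y *\<^sub>R G (x - y)) \<bullet> (x' - x))"
				unfolding conv_def using conv_integrable[OF cG RG w]
				by (intro integral_inner_left[symmetric]) auto
			moreover have "integrable lebesgue (%y. (w y *\<^sub>R G (x - y)) \<bullet> (x' - x))"
				using conv_integrable[OF cG RG w] by (intro integrable_inner_left) auto
			ultimately have "conv F w x' - conv F w x - conv G w x \<bullet> (x' - x)
					= (LINT y. w y *\<^sub>R (F (x' - y) - F (x - y) - G (x - y) \<bullet> (x' - x)))"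
				unfolding conv_def scaleR_diff_right
				using conv_integrable[OF cF R w] by (simp add: Bochner_Integration.integral_diff)
			also have "norm \<dots> \<le> (e / (M + 1) * norm (x' - x)) * (LINT y. \<bar>indicator (cball 0 (norm x + 1 + R)) y * w y\<bar>)"
			proof (rule conv_estimate[OF w])
				fix y :: 'a
				have "\<bar>F (x' - y) - F (x - y) - G (x - y) \<bullet> ((x' - y) - (x - y))\<bar> \<le> e / (M + 1) * norm ((x' - y) - (x - y))"
				proof (rule C1_remainder[OF F])
					fix z assume "norm (z - (x - y)) \<le> norm ((x' - y) - (x - y))"
					then show "norm (G z - G (x - y)) \<le> e / (M + 1)"
						using d(2)[of z "x - y"] that by simp
				qed
				then show "norm (F (x' - y) - F (x - y) - G (x - y) \<bullet> (x' - x)) \<le> e / (M + 1) * norm (x' - x)"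
					by simp
				assume "norm y > norm x + 1 + R"
				then show "F (x' - y) - F (x - y) - G (x - y) \<bullet> (x' - x) = 0"
					using x' by (simp add: vanishes_reflect[OF R] vanishes_reflect[OF RG])
			qed (intro borel_measurable_diff borel_measurable_inner continuous_reflect_measurable cF cG borel_measurable_const)
			also have "\<dots> = e * norm (x' - x) * (M / (M + 1))" by (simp add: M_def[symmetric])
			also have "\<dots> \<le> e * norm (x' - x) * 1" using \<open>e > 0\<close> M by (intro mult_left_mono) auto
			finally show ?thesis by simp
		qed
		then show "\<exists>d>0. \<forall>y. norm (y - x) < d --> norm (conv F w y - conv F w x - conv G w x \<bullet> (y - x)) \<le> e * norm (y - x)"
			using d(1) by (intro exI[of _ "min d 1"]) auto
	qed
	then show ?thesis
		unfolding has_C1_gradient_def using conv_continuous[OF cG RG w] by blast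
qed

lemma Ck_has_C1_gradient:
	fixes F :: "'a::euclidean_space => real"
	assumes "\<And>k. Ck k F"
	obtains G where "has_C1_gradient F G" "\<And>i k. i \<in> Basis ==> Ck k (%x. G x \<bullet> i)"
		"\<And>x i. i \<in> Basis ==> G x \<bullet> i = frechet_derivative F (at x) i"
proof -
	define G where "G x = (\<Sum>i\<in>Basis. frechet_derivative F (at x) i *\<^sub>R i)" for x
	have d: "(F has_derivative frechet_derivative F (at x)) (at x)"
		and c: "i \<in> Basis ==> Ck k (%x. frechet_derivative F (at x) i)" for x i k
		using assms[of "Suc k"] by (auto simp: frechet_derivative_works)
	have Gi: "G x \<bullet> i = frechet_derivative F (at x) i" if "i \<in> Basis" for x i
		using that by (simp add: G_def)
	have "frechet_derivative F (at x) = (%h. G x \<bullet> h)" for x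
	proof
		fix h
		interpret linear "frechet_derivative F (at x)" using d by (rule has_derivative_linear)
		have "frechet_derivative F (at x) h = frechet_derivative F (at x) (\<Sum>i\<in>Basis. (h \<bullet> i) *\<^sub>R i)"
			by (simp add: euclidean_representation)
		also have "\<dots> = G x \<bullet> h"
			unfolding euclidean_inner[of "G x" h] by (simp add: sum scale Gi mult.commute)
		finally show "frechet_derivative F (at x) h = G x \<bullet> h" .
	qed
	moreover have "continuous_on UNIV G"
		unfolding G_def using c[of _ 0] by (intro continuous_intros) auto
	ultimately have "has_C1_gradient F G" using d by (simp add: has_C1_gradient_def)
	then show ?thesis using that Gi c by auto
qed

lemma conv_inner:
	assumes "continuous_on UNIV G" "vanishes_beyond R G" "loc_integrable w"
	shows "conv G w x \<bullet> i = conv (%z. G z \<bullet> i) w x"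
	unfolding conv_def using conv_integrable[OF assms]
	by (subst integral_inner_left[symmetric]) auto

lemma Ck_conv:
	fixes F :: "'a::euclidean_space => real"
	assumes "\<And>k. Ck k F" "vanishes_beyond R F" "loc_integrable w"
	shows "Ck k (conv F w)"
	using assms
proof (induction k arbitrary: F)
	case 0
	then show ?case using conv_continuous[of F R w] Ck.simps(1) by metis
next
	case (Suc k)
	obtain G where G: "has_C1_gradient F G" "\<And>i k. i \<in> Basis ==> Ck k (%x. G x \<bullet> i)"
		using Ck_has_C1_gradient Suc.prems(1) by metis
	have RG: "vanishes_beyond R G" by (rule has_C1_gradient_vanishes[OF G(1) Suc.prems(2)])
	show ?case
	proof (rule Ck_SucI)
		show "(conv F w has_derivative (%h. conv G w x \<bullet> h)) (at x)" for x
			using conv_derivative[OF G(1) Suc.prems(2,3)] by (simp add: has_C1_gradient_def)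
		fix i :: 'a assume i: "i \<in> Basis"
		have "Ck k (conv (%z. G z \<bullet> i) w)"
			using RG by (intro Suc.IH G i Suc.prems) (simp add: vanishes_beyond_def)
		then show "Ck k (%x. conv G w x \<bullet> i)"
			using conv_inner[OF _ RG Suc.prems(3)] G(1) by (simp add: has_C1_gradient_def)
	qed
qed

lemma lebesgue_reflect: "distr lebesgue lebesgue (%y. x - y) = (lebesgue :: 'a::euclidean_space measure)"
	and lebesgue_reflect_measurable: "(%y. x - y) \<in> lebesgue \<rightarrow>\<^sub>M (lebesgue :: 'a measure)"
proof -
	\<comment> \<open>Reflection is the affine map with all scale factors -1, whose Jacobian has
	  absolute value 1.\<close>
	have eq: "(%y. x + (\<Sum>j\<in>Basis. ((-1) * (y \<bullet> j)) *\<^sub>R j)) = (%y::'a. x - y)"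
		by (simp add: euclidean_representation sum_negf)
	show "distr lebesgue lebesgue (%y. x - y) = (lebesgue :: 'a measure)"
		using lebesgue_affine_euclidean[of "%_. -1" x] unfolding eq by (simp add: density_1)
	show "(%y. x - y) \<in> lebesgue \<rightarrow>\<^sub>M (lebesgue :: 'a measure)"
		using lebesgue_affine_measurable[of "%_. -1" x] unfolding eq by simp
qed

lemma conv_commute:
	fixes F w :: "'a::euclidean_space => real"
	assumes "F \<in> borel_measurable lebesgue" "w \<in> borel_measurable lebesgue"
	shows "conv F w = conv w F"
proof
	fix x
	have m: "(%y. w y * F (x - y)) \<in> borel_measurable lebesgue"
		using measurable_compose[OF lebesgue_reflect_measurable assms(1)] assms(2) by simp
	have "conv F w x = (LINT y|distr lebesgue lebesgue (%y. x - y). w y * F (x - y))"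
		by (simp add: conv_def lebesgue_reflect)
	also have "\<dots> = (LINT y. w (x - y) * F (x - (x - y)))"
		by (rule integral_distr[OF lebesgue_reflect_measurable m])
	finally show "conv F w x = conv w F x" by (simp add: conv_def mult.commute)
qed

section \<open>Test functions, mollifiers and approximation in C^1 and L^1\<close>

lemma test_functionsI:
	assumes "\<And>k. Ck k p" "compact K" "K \<subseteq> S" "\<And>x. x \<notin> K ==> p x = 0"
	shows "p \<in> test_functions S"
proof -
	have "closure {x. p x \<noteq> 0} \<subseteq> K"
		using assms(2,4) by (intro closure_minimal) (auto intro: compact_imp_closed)
	then show ?thesis
		using assms bounded_subset[OF compact_imp_bounded[OF assms(2)]]
		by (auto simp: test_functions_def compact_eq_bounded_closed)
qed

lemma test_functionsE:
	assumes "p \<in> test_functions S"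
	obtains G R where "has_C1_gradient p G" "vanishes_beyond R p"
		"\<And>x i. i \<in> Basis ==> frechet_derivative p (at x) i = G x \<bullet> i"
proof -
	have k: "\<And>k. Ck k p" and c: "compact (closure {x. p x \<noteq> 0})"
		using assms by (auto simp: test_functions_def)
	obtain G where G: "has_C1_gradient p G"
		"\<And>x i. i \<in> Basis ==> G x \<bullet> i = frechet_derivative p (at x) i"
		using Ck_has_C1_gradient[OF k] by metis
	obtain R where "\<forall>x\<in>closure {x. p x \<noteq> 0}. norm x \<le> R"
		using compact_imp_bounded[OF c] unfolding bounded_iff by blast
	then have "vanishes_beyond R p"
		using closure_subset[of "{x. p x \<noteq> 0}"] by (force simp: vanishes_beyond_def)
	then show ?thesis using that G by metis
qed

lemma continuous_vanishes_integrable: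
	fixes g :: "'a::euclidean_space => 'b::euclidean_space"
	assumes "continuous_on UNIV g" "vanishes_beyond R g"
	shows "integrable lebesgue g"
proof -
	have "integrable lborel (%x. indicator (cball 0 R) x *\<^sub>R g x)"
		using assms by (intro borel_integrable_compact) (auto intro: continuous_on_subset)
	moreover have "(%x. indicator (cball 0 R) x *\<^sub>R g x) = g"
		using assms(2) by (auto simp: fun_eq_iff indicator_def vanishes_beyond_def not_le)
	ultimately show ?thesis
		using borel_measurable_continuous_onI[OF assms(1)] by (simp add: integrable_completion)
qed

lemma continuous_loc_integrable:
	fixes g :: "'a::euclidean_space => real"
	assumes "continuous_on UNIV g" shows "loc_integrable g"
proof -
	have "integrable lborel (%x. indicator (cball 0 r) x *\<^sub>R g x)" for r
		using assms by (intro borel_integrable_compact) (auto intro: continuous_on_subset)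
	then show ?thesis
		using borel_measurable_continuous_onI[OF assms(1)] by (simp add: integrable_completion loc_integrable_def)
qed

lemma integrable_loc_integrable: "integrable lebesgue g ==> loc_integrable g"
	unfolding loc_integrable_def
	using integrable_mult_indicator[of _ lebesgue g] by auto

text \<open>Convolving \<open>F\<close> with the constant 1 gives the constant function with value
  the integral of \<open>F\<close>. Its gradient, the convolution of \<open>G\<close> with 1, is
  therefore zero, and this is the integral of \<open>G\<close>.\<close>

lemma integral_C1_gradient:
	fixes F :: "'a::euclidean_space => real"
	assumes F: "has_C1_gradient F G" and R: "vanishes_beyond R F"
	shows "(LINT x. G x \<bullet> i) = 0"
proof -
	have cF: "continuous_on UNIV F" using F by (rule has_C1_gradient_continuous)
	have cG: "continuous_on UNIV G" using F by (simp add: has_C1_gradient_def)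
	have RG: "vanishes_beyond R G" using F R by (rule has_C1_gradient_vanishes)
	have one: "loc_integrable (%_::'a. 1)" by (rule continuous_loc_integrable) auto
	have "conv F (%_. 1) = conv (%_. 1) F"
		by (intro conv_commute continuous_lebesgue_measurable cF) auto
	then have "conv F (%_. 1) = (%x. LINT y. F y)" by (simp add: conv_def fun_eq_iff)
	moreover have "(conv F (%_. 1) has_derivative (%h. conv G (%_. 1) 0 \<bullet> h)) (at 0)"
		using conv_derivative[OF F R one] by (simp add: has_C1_gradient_def)
	ultimately have "(%h. conv G (%_. 1) 0 \<bullet> h) = (%h. 0)"
		using has_derivative_unique has_derivative_const by metis
	then have "conv G (%_. 1) 0 \<bullet> i = 0" by metis
	then have "conv (%z. G z \<bullet> i) (%_. 1) 0 = 0"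
		using conv_inner[OF cG RG one] by metis
	moreover have "conv (%z. G z \<bullet> i) (%_. 1) = conv (%_. 1) (%z. G z \<bullet> i)"
		by (intro conv_commute continuous_lebesgue_measurable continuous_intros cG)
	ultimately show ?thesis by (simp add: conv_def)
qed

lemma Ck_bump: "Ck k (%x::'a::euclidean_space. flat 0 (e^2 - x \<bullet> x))"
proof -
	have *: "x \<bullet> x = (\<Sum>i\<in>Basis. (x \<bullet> i) * (x \<bullet> i))" for x :: 'a
		by (simp add: euclidean_inner[of x x])
	have sum: "finite I ==> Ck k (%x::'a. \<Sum>i\<in>I. (x \<bullet> i) * (x \<bullet> i))" for k I
		by (induction I rule: finite_induct) (auto intro!: Ck_const Ck_add Ck_mult Ck_inner)
	have "Ck k (%x::'a. e^2 + (-1) * (x \<bullet> x))" for k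
		unfolding * by (intro Ck_add Ck_mult Ck_const sum finite_Basis)
	from Ck_compose[where D = flat and n = 0, OF flat_deriv this]
	show ?thesis by simp
qed

lemma bump_pos_iff:
	fixes x :: "'a::euclidean_space"
	assumes "e > 0" shows "flat 0 (e^2 - x \<bullet> x) > 0 \<longleftrightarrow> norm x < e"
proof -
	have "flat 0 (e^2 - x \<bullet> x) > 0 \<longleftrightarrow> (norm x)\<^sup>2 < e^2"
		unfolding flat_0_pos by (simp add: dot_square_norm)
	also have "\<dots> \<longleftrightarrow> norm x < e" using assms by (meson less_imp_le norm_ge_zero power2_less_imp_less power_strict_mono zero_less_numeral)
	finally show ?thesis .
qed

definition mollifier :: "real => 'a::euclidean_space => real" where
	"mollifier e x = flat 0 (e^2 - x \<bullet> x) / (LINT y. flat 0 (e^2 - (y::'a) \<bullet> y))"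

lemma
	assumes "e > 0"
	shows Ck_mollifier: "Ck k (mollifier e :: 'a::euclidean_space => real)"
		and mollifier_vanishes: "vanishes_beyond e (mollifier e :: 'a => real)"
		and mollifier_nonneg: "mollifier e (x::'a) \<ge> 0"
		and mollifier_integral: "(LINT x. mollifier e (x::'a)) = 1"
		and mollifier_integrable: "integrable lebesgue (mollifier e :: 'a => real)"
		and mollifier_continuous: "continuous_on UNIV (mollifier e :: 'a => real)"
proof -
	let ?f = "%x::'a. flat 0 (e^2 - x \<bullet> x)"
	let ?c = "LINT y. ?f y"
	have f0: "?f x = 0 \<longleftrightarrow> \<not> norm x < e" for x
		using bump_pos_iff[OF assms, of x] flat_0_nonneg[of "e^2 - x \<bullet> x"] by linarith
	have v: "vanishes_beyond e ?f" using f0 by (simp add: vanishes_beyond_def)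
	have c: "continuous_on UNIV ?f" using Ck_bump[of 0 e] by simp
	have int: "integrable lebesgue ?f" by (rule continuous_vanishes_integrable[OF c v])
	have "?c \<noteq> 0"
	proof
		assume "?c = 0"
		then have "AE x. ?f x = 0"
			using integral_nonneg_eq_0_iff_AE[OF int] flat_0_nonneg by auto
		then have "AE x. x \<notin> ball (0::'a) e"
			by (rule eventually_mono) (metis f0 dist_0_norm mem_ball)
		then have "negligible (ball (0::'a) e)"
			unfolding negligible_iff_null_sets by (simp add: AE_iff_null_sets)
		then show False using open_not_negligible[of "ball (0::'a) e"] assms by simp
	qed
	moreover have "?c \<ge> 0" by (simp add: flat_0_nonneg)
	ultimately have pos: "?c > 0" by simp
	have m: "mollifier e = (%x. (1 / ?c) * ?f x)" by (auto simp: mollifier_def fun_eq_iff)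
	show "Ck k (mollifier e :: 'a => real)" unfolding m by (intro Ck_mult Ck_const Ck_bump)
	show "vanishes_beyond e (mollifier e :: 'a => real)" using v unfolding m vanishes_beyond_def by simp
	show "mollifier e (x::'a) \<ge> 0" unfolding m using pos flat_0_nonneg by simp
	show "(LINT x. mollifier e (x::'a)) = 1" unfolding m using pos by simp
	show "integrable lebesgue (mollifier e :: 'a => real)" unfolding m using int by simp
	show "continuous_on UNIV (mollifier e :: 'a => real)" unfolding m using c by (intro continuous_intros)
qed

lemma mollify_uniform:
	fixes H :: "'a::euclidean_space => 'b::euclidean_space"
	assumes "d > 0" "continuous_on UNIV H" "\<And>y. norm (x - y) \<le> d ==> norm (H y - H x) \<le> e"
	shows "norm (conv H (mollifier d) x - H x) \<le> e"
proof -
	let ?m = "mollifier d :: 'a => real"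
	have c: "continuous_on UNIV (%y. H (x - y))"
		by (intro continuous_on_compose2[OF assms(2)] continuous_intros) auto
	have v: "vanishes_beyond d (%y. ?m y *\<^sub>R H (x - y))" 
		using mollifier_vanishes[OF assms(1), where 'a = 'a] by (simp add: vanishes_beyond_def)
	have i1: "integrable lebesgue (%y. ?m y *\<^sub>R H (x - y))"
		by (intro continuous_vanishes_integrable[OF _ v] continuous_intros mollifier_continuous assms c)
	have i2: "integrable lebesgue (%y. ?m y *\<^sub>R H x)"
		by (intro integrable_scaleR_left mollifier_integrable assms)
	have "H x = (LINT y. ?m y *\<^sub>R H x)"
		using mollifier_integral[OF assms(1), where 'a = 'a] mollifier_integrable[OF assms(1), where 'a = 'a] by simp
	then have "conv H ?m x - H x = (LINT y. ?m y *\<^sub>R (H (x - y) - H x))"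
		unfolding conv_def scaleR_diff_right using Bochner_Integration.integral_diff[OF i1 i2] by simp
	also have "norm \<dots> \<le> (LINT y. norm (?m y *\<^sub>R (H (x - y) - H x)))"
		by (rule integral_norm_bound)
	also have "\<dots> \<le> (LINT y. ?m y * e)"
	proof (rule integral_mono)
		show "integrable lebesgue (%y. norm (?m y *\<^sub>R (H (x - y) - H x)))"
			using Bochner_Integration.integrable_diff[OF i1 i2] unfolding scaleR_diff_right by (rule integrable_norm)
		show "integrable lebesgue (%y. ?m y * e)"
			by (intro integrable_mult_left mollifier_integrable assms)
		fix y :: 'a
		show "norm (?m y *\<^sub>R (H (x - y) - H x)) \<le> ?m y * e"
		proof (cases "norm y \<le> d")
			case True
			then have "norm (H (x - y) - H x) \<le> e" using assms(3)[of "x - y"] by simp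
			then show ?thesis using mollifier_nonneg[OF assms(1), of y] by (simp add: mult_left_mono)
		next
			case False
			then show ?thesis using mollifier_vanishes[OF assms(1), where 'a = 'a] by (simp add: vanishes_beyond_def)
		qed
	qed
	also have "\<dots> = e" using mollifier_integral[OF assms(1), where 'a = 'a] by simp
	finally show ?thesis .
qed

text \<open>Mollifications of \<open>p\<close> converge uniformly together with their gradients,
  because \<open>p\<close> and \<open>G\<close> are uniformly continuous. The support grows only by
  the width \<open>d\<close>, so it stays in \<open>S\<close> and in a fixed ball.\<close>

lemma C1_approx_test_function:
	fixes p :: "'a::euclidean_space => real"
	assumes G: "has_C1_gradient p G" and K: "compact K" "K \<subseteq> S" "K \<subseteq> cball 0 R" and "open S"
		and z: "\<And>x. x \<notin> K ==> p x = 0" and "e > 0"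
	obtains \<phi>' G' where "\<phi>' \<in> test_functions S" "has_C1_gradient \<phi>' G'"
		"\<And>x. \<bar>\<phi>' x - p x\<bar> \<le> e" "\<And>x. norm (G' x - G x) \<le> e" "vanishes_beyond (R + 1) \<phi>'"
proof -
	have R: "vanishes_beyond R p" using z K(3) by (force simp: vanishes_beyond_def)
	have c\<phi>: "continuous_on UNIV p" using G by (rule has_C1_gradient_continuous)
	have cG: "continuous_on UNIV G" using G by (simp add: has_C1_gradient_def)
	have RG: "vanishes_beyond R G" using G R by (rule has_C1_gradient_vanishes)
	obtain d1 where d1: "d1 > 0" "\<And>x y. norm (x - y) < d1 ==> norm (p x - p y) < e"
		using vanishes_uniformly_continuous[OF c\<phi> R \<open>e > 0\<close>] by metis
	obtain d2 where d2: "d2 > 0" "\<And>x y. norm (x - y) < d2 ==> norm (G x - G y) < e"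
		using vanishes_uniformly_continuous[OF cG RG \<open>e > 0\<close>] by metis
	obtain d3 where d3: "d3 > 0" "(\<Union>x\<in>K. cball x d3) \<subseteq> S"
		using compact_subset_open_imp_cball_epsilon_subset[OF K(1) \<open>open S\<close> K(2)] by metis
	\<comment> \<open>\<open>d1\<close> and \<open>d2\<close> control the oscillation of
	  \<open>p\<close> and \<open>G\<close>, \<open>d3\<close> keeps the enlarged support inside
	  \<open>S\<close>, and the bound 1 keeps it in the ball of radius \<open>R + 1\<close>.\<close>
	define d where "d = min (min (d1 / 2) (d2 / 2)) (min d3 1)"
	have d: "d > 0" "d < d1" "d < d2" "d \<le> d3" "d \<le> 1" using d1 d2 d3 by (auto simp: d_def)
	let ?m = "mollifier d :: 'a => real"
	have li: "loc_integrable ?m" by (intro continuous_loc_integrable mollifier_continuous d)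
	have "conv p ?m = conv ?m p"
		by (intro conv_commute continuous_lebesgue_measurable c\<phi> mollifier_continuous d)
	then have Ck: "Ck k (conv p ?m)" for k
		using Ck_conv[OF Ck_mollifier[OF d(1)] mollifier_vanishes[OF d(1)] continuous_loc_integrable[OF c\<phi>]] by simp
	define K' where "K' = (%(x, y). x + y) ` (K \<times> cball 0 d)"
	have K'c: "compact K'"
		unfolding K'_def case_prod_unfold
		by (intro compact_continuous_image continuous_intros compact_Times K) auto
	have K'S: "K' \<subseteq> S"
	proof
		fix z assume "z \<in> K'"
		then obtain x y where "x \<in> K" "norm y \<le> d" "z = x + y" by (auto simp: K'_def)
		then have "z \<in> cball x d3" using d by (simp add: dist_norm)
		then show "z \<in> S" using d3 \<open>x \<in> K\<close> by blast
	qed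
	have zero: "conv p ?m x = 0" if "x \<notin> K'" for x
	proof -
		have "?m y *\<^sub>R p (x - y) = 0" for y
		proof (cases "norm y \<le> d")
			case True
			have "x - y \<notin> K"
			proof
				assume "x - y \<in> K"
				then have "(%(x, y). x + y) (x - y, y) \<in> K'" unfolding K'_def using True by (intro imageI) auto
				then show False using that by simp
			qed
			then show ?thesis using z by simp
		next
			case False
			then show ?thesis using mollifier_vanishes[OF d(1), where 'a = 'a] by (simp add: vanishes_beyond_def)
		qed
		then have "(%y. ?m y *\<^sub>R p (x - y)) = (%y. 0)" by (rule ext)
		then show ?thesis by (simp only: conv_def Bochner_Integration.integral_zero)
	qed
	have K'R: "norm x \<le> R + 1" if "x \<in> K'" for x
	proof -
		obtain a y where *: "a \<in> K" "norm y \<le> d" "x = a + y" using \<open>x \<in> K'\<close> by (auto simp: K'_def)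
		then have "norm a \<le> R" using K(3) by auto
		then show ?thesis using norm_triangle_ineq[of a y] * d by simp
	qed
	show ?thesis
	proof (rule that)
		show "conv p ?m \<in> test_functions S" by (rule test_functionsI[OF Ck K'c K'S zero])
		show "has_C1_gradient (conv p ?m) (conv G ?m)" by (rule conv_derivative[OF G R li])
		show "\<bar>conv p ?m x - p x\<bar> \<le> e" for x
			using mollify_uniform[OF d(1) c\<phi>, of x e] d1(2) d by (simp add: norm_minus_commute less_imp_le)
		show "norm (conv G ?m x - G x) \<le> e" for x
			using mollify_uniform[OF d(1) cG, of x e] d2(2) d by (simp add: norm_minus_commute less_imp_le)
		show "vanishes_beyond (R + 1) (conv p ?m)"
			unfolding vanishes_beyond_def
		proof (intro allI impI)
			fix x :: 'a assume "norm x > R + 1"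
			then show "conv p ?m x = 0" using zero[of x] K'R[of x] by linarith
		qed
	qed
qed

text \<open>Weak identities are given for smooth test functions only; uniform C^1 approximation with
  supports in one ball extends them to C^1 functions, such as the piecewise polynomial cut-offs used
  later. The form with an open set in any Euclidean space serves both the whole space and the time
  interval (0,T).\<close>

lemma weak_derivative_C1:
	fixes u g :: "'a::euclidean_space => real"
	assumes u: "loc_integrable u" and g: "loc_integrable g" and i: "i \<in> Basis" and S: "open S"
		and weak: "\<And>p. p \<in> test_functions S ==>
			(LINT x. u x * frechet_derivative p (at x) i) = - (LINT x. g x * p x)"
		and G: "has_C1_gradient p G" and K: "compact K" "K \<subseteq> S" and z: "\<And>x. x \<notin> K ==> p x = 0"
	shows "(LINT x. u x * (G x \<bullet> i)) = - (LINT x. g x * p x)"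
proof -
	obtain R where "\<forall>x\<in>K. norm x \<le> R" using compact_imp_bounded[OF K(1)] by (auto simp: bounded_iff)
	then have KR: "K \<subseteq> cball 0 R" by auto
	define M where "M = (LINT y. \<bar>indicator (cball 0 (R + 1)) y * u y\<bar>) + (LINT y. \<bar>indicator (cball 0 (R + 1)) y * g y\<bar>)"
	have R: "vanishes_beyond R p" using z KR by (force simp: vanishes_beyond_def)
	have c\<phi>: "continuous_on UNIV p" using G by (rule has_C1_gradient_continuous)
	have cG: "continuous_on UNIV G" using G by (simp add: has_C1_gradient_def)
	have RG: "vanishes_beyond R G" using G R by (rule has_C1_gradient_vanishes)
	have int: "integrable lebesgue (%y. w y * H y)"
		if "loc_integrable w" and H: "continuous_on UNIV H" "vanishes_beyond r H" for w H :: "'a => real" and r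
	proof -
		obtain B where B: "\<And>x. norm (H x) \<le> B" using vanishes_bounded[OF H] by blast
		have "integrable lebesgue (%y. w y *\<^sub>R H y)"
			using that B by (intro loc_integrable_cong_ball[where r = r and B = B] continuous_lebesgue_measurable)
				(auto simp: vanishes_beyond_def)
		then show ?thesis by simp
	qed
	have "\<bar>(LINT x. u x * (G x \<bullet> i)) + (LINT x. g x * p x)\<bar> \<le> e * M" if "e > 0" for e
	proof -
		obtain \<phi>' G' where \<phi>': "\<phi>' \<in> test_functions S" "has_C1_gradient \<phi>' G'"
			"\<And>x. \<bar>\<phi>' x - p x\<bar> \<le> e" "\<And>x. norm (G' x - G x) \<le> e" "vanishes_beyond (R + 1) \<phi>'"
			using C1_approx_test_function[OF G K KR S z \<open>e > 0\<close>] by metis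
		have c: "continuous_on UNIV \<phi>'" "continuous_on UNIV G'" "vanishes_beyond (R + 1) G'"
			using \<phi>'(2) has_C1_gradient_continuous[OF \<phi>'(2)] has_C1_gradient_vanishes[OF \<phi>'(2,5)]
			by (simp_all add: has_C1_gradient_def)
		have fd: "frechet_derivative \<phi>' (at x) i = G' x \<bullet> i" for x
			using \<phi>'(2) frechet_derivative_at[of \<phi>' "%h. G' x \<bullet> h" x] unfolding has_C1_gradient_def by metis
		have eq: "(LINT x. u x * (G' x \<bullet> i)) = - (LINT x. g x * \<phi>' x)"
			using weak[OF \<phi>'(1)] by (simp add: fd)
		have "(LINT x. u x * (G' x \<bullet> i)) - (LINT x. u x * (G x \<bullet> i))
				= (LINT x. u x *\<^sub>R (G' x \<bullet> i - G x \<bullet> i))"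
			unfolding real_scaleR_def right_diff_distrib using c cG RG
			by (intro Bochner_Integration.integral_diff[symmetric] int[OF u, where r = "R + 1"] int[OF u, where r = R] continuous_intros)
				(auto simp: vanishes_beyond_def)
		moreover have "norm (LINT x. u x *\<^sub>R (G' x \<bullet> i - G x \<bullet> i)) \<le> e * (LINT y. \<bar>indicator (cball 0 (R + 1)) y * u y\<bar>)"
		proof (rule conv_estimate[OF u])
			fix x :: 'a
			have "\<bar>(G' x - G x) \<bullet> i\<bar> \<le> norm (G' x - G x)" using i by (rule Basis_le_norm)
			then show "norm (G' x \<bullet> i - G x \<bullet> i) \<le> e" using \<phi>'(4)[of x] by (simp add: inner_diff_left)
			show "norm x > R + 1 ==> G' x \<bullet> i - G x \<bullet> i = 0" using c RG by (simp add: vanishes_beyond_def)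
		qed (intro continuous_lebesgue_measurable continuous_intros c cG)
		moreover have "(LINT x. g x * \<phi>' x) - (LINT x. g x * p x)
				= (LINT x. g x *\<^sub>R (\<phi>' x - p x))"
			unfolding real_scaleR_def right_diff_distrib using c c\<phi> R \<phi>'
			by (intro Bochner_Integration.integral_diff[symmetric] int[OF g, where r = "R + 1"] int[OF g, where r = R] continuous_intros)
				(auto simp: vanishes_beyond_def)
		moreover have "norm (LINT x. g x *\<^sub>R (\<phi>' x - p x)) \<le> e * (LINT y. \<bar>indicator (cball 0 (R + 1)) y * g y\<bar>)"
		proof (rule conv_estimate[OF g])
			fix x :: 'a
			show "norm (\<phi>' x - p x) \<le> e" using \<phi>'(3)[of x] by simp
			show "norm x > R + 1 ==> \<phi>' x - p x = 0" using \<phi>' R by (simp add: vanishes_beyond_def)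
		qed (intro continuous_lebesgue_measurable continuous_intros c c\<phi>)
		ultimately show ?thesis using eq unfolding M_def real_norm_def distrib_left by linarith
	qed
	moreover have "((%e. e * M) \<longlongrightarrow> 0 * M) (at_right 0)" by (intro tendsto_intros)
	ultimately have "\<bar>(LINT x. u x * (G x \<bullet> i)) + (LINT x. g x * p x)\<bar> \<le> 0 * M"
		by (intro tendsto_lowerbound[where F = "at_right 0" and f = "%e. e * M"])
			(auto simp: eventually_at_filter)
	then show ?thesis by simp
qed

text \<open>Induction over integrable functions. For an indicator, the set is first cut to a ball
  and then enclosed between a closed and an open set of nearly the same measure; Urysohn's lemma
  interpolates between them.\<close>

lemma L1_approx_continuous:
	fixes f :: "'a::euclidean_space => real"
	assumes "integrable lebesgue f" "e > 0"
	shows "\<exists>g R. continuous_on UNIV g \<and> vanishes_beyond R g \<and> (LINT x. \<bar>f x - g x\<bar>) < e"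
	using assms
proof (induction arbitrary: e rule: integrable_induct)
	case (base A c)
	\<comment> \<open>Three error sets of measure below \<open>e'\<close> arise, and |c| times 3
	  \<open>e'\<close> equals e |c| / (|c| + 1), which is below \<open>e\<close>.\<close>
	define e' where "e' = e / (3 * (\<bar>c\<bar> + 1))"
	have e': "e' > 0" using base by (simp add: e'_def)
	obtain n where n: "measure lebesgue (A - cball 0 n) < e'"
	proof -
		have fm: "A \<in> lmeasurable" using base by (simp add: fmeasurable_def)
		have "(%n. measure lebesgue (A - cball 0 (real n))) \<longlonglongrightarrow> measure lebesgue (\<Inter>n. A - cball 0 (real n))"
		proof (rule Lim_measure_decseq)
			show "range (%n. A - cball 0 (real n)) \<subseteq> sets lebesgue" using fm by auto
			show "decseq (%n. A - cball 0 (real n))" by (auto simp: decseq_def)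
			show "emeasure lebesgue (A - cball 0 (real i)) \<noteq> \<infinity>" for i
				using fmeasurableD2[OF fmeasurable.Diff[OF fm lmeasurable_cball, of 0 "real i"]] by (simp only: infinity_ennreal_def not_False_eq_True)
		qed
		note L = this
		have eq: "(\<Inter>n. A - cball 0 (real n)) = {}"
			by (auto simp: not_le) (meson linorder_not_less real_arch_simple)
		have "measure lebesgue (\<Inter>n. A - cball 0 (real n)) = 0" unfolding eq by (rule measure_empty)
		then have "(%n. measure lebesgue (A - cball 0 (real n))) \<longlonglongrightarrow> 0"
			using L by (rule subst[where P = "%z. (%n. measure lebesgue (A - cball 0 (real n))) \<longlonglongrightarrow> z"])
		then have "\<forall>\<^sub>F n in sequentially. measure lebesgue (A - cball 0 (real n)) < e'"
			using e' by (rule order_tendstoD)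
		from eventually_happens'[OF sequentially_bot this] show ?thesis using that by blast
	qed
	define A' where "A' = A \<inter> cball 0 n"
	have A': "A' \<in> sets lebesgue" using base by (auto simp: A'_def)
	obtain T where T: "closed T" "T \<subseteq> A'" "A' - T \<in> lmeasurable" "emeasure lebesgue (A' - T) < ennreal e'"
		using sets_lebesgue_inner_closed[OF A' e'] by metis
	obtain U where U: "open U" "A' \<subseteq> U" "U - A' \<in> lmeasurable" "emeasure lebesgue (U - A') < ennreal e'"
		using sets_lebesgue_outer_open[OF A' e'] by metis
	\<comment> \<open>The intersection with a ball gives the interpolating function bounded
	  support.\<close>
	define U' where "U' = U \<inter> ball 0 (n + 1)"
	have "closed (- U')" "T \<inter> - U' = {}" using U T by (auto simp: U'_def A'_def open_Int)
	obtain g :: "'a => real" where g: "continuous_on UNIV g" "\<And>x. g x \<in> closed_segment 1 0"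
		"\<And>x. x \<in> T ==> g x = 1" "\<And>x. x \<in> - U' ==> g x = 0"
		using Urysohn[OF \<open>closed T\<close> \<open>closed (- U')\<close> \<open>T \<inter> - U' = {}\<close>, of 1 "0::real"] by metis
	have g01: "0 \<le> g x" "g x \<le> 1" for x using g(2)[of x] by (auto simp: closed_segment_eq_real_ivl)
	let ?E = "(A - cball 0 n) \<union> (A' - T) \<union> (U - A')"
	have le: "\<bar>indicator A x - g x\<bar> \<le> indicator (A - cball 0 n) x + indicator (A' - T) x + indicator (U - A') x" for x
		using g01[of x] g(3,4)[of x] T(2) by (auto simp: indicator_def A'_def U'_def)
	have m: "A - cball 0 n \<in> lmeasurable"
		by (rule fmeasurable.Diff[OF _ lmeasurable_cball]) (use base in \<open>simp add: fmeasurable_def\<close>)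
	have lt: "measure lebesgue S < e'" if "S \<in> lmeasurable" "emeasure lebesgue S < ennreal e'" for S :: "'a set"
		using that e' by (simp add: emeasure_eq_measure2 ennreal_less_iff)
	have ind: "integrable lebesgue (indicator S :: 'a => real)" if "S \<in> lmeasurable" for S :: "'a set"
		using that by (auto simp: fmeasurable_def)
	have gc: "continuous_on UNIV (%x. c * g x)" by (intro continuous_intros g)
	have gR: "vanishes_beyond (n + 1) (%x. c * g x)"
		using g(4) by (auto simp: vanishes_beyond_def U'_def)
	have "(LINT x. \<bar>indicator A x *\<^sub>R c - c * g x\<bar>)
		\<le> (LINT x. \<bar>c\<bar> * (indicator (A - cball 0 n) x + indicator (A' - T) x + indicator (U - A') x))"
	proof (rule integral_mono)
		show "integrable lebesgue (%x. \<bar>indicator A x *\<^sub>R c - c * g x\<bar>)"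
			using base continuous_vanishes_integrable[OF gc gR] by simp
		show "integrable lebesgue (%x. \<bar>c\<bar> * (indicator (A - cball 0 n) x + indicator (A' - T) x + indicator (U - A') x))"
			using T U m by (intro integrable_mult_right Bochner_Integration.integrable_add)
				(auto simp: fmeasurable_def)
		show "\<bar>indicator A x *\<^sub>R c - c * g x\<bar> \<le> \<bar>c\<bar> * (indicator (A - cball 0 n) x + indicator (A' - T) x + indicator (U - A') x)" for x
			using mult_left_mono[OF le[of x] abs_ge_zero[of c]]
			by (simp add: abs_mult[symmetric] algebra_simps)
	qed
	also have "\<dots> = \<bar>c\<bar> * (measure lebesgue (A - cball 0 n) + measure lebesgue (A' - T) + measure lebesgue (U - A'))"
		using ind[OF T(3)] ind[OF U(3)] ind[OF m] T(3) U(3) m by (simp add: Bochner_Integration.integral_add fmeasurableD)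
	also have "\<dots> \<le> \<bar>c\<bar> * (e' + e' + e')"
		using n lt[OF T(3,4)] lt[OF U(3,4)] by (intro mult_left_mono) auto
	also have "\<dots> = e * (\<bar>c\<bar> / (\<bar>c\<bar> + 1))" by (simp add: e'_def divide_simps)
	also have "\<dots> < e * 1" using base by (intro mult_strict_left_mono) auto
	finally show ?case using gc gR by auto
next
	case (add f1 f2)
	obtain g1 R1 where 1: "continuous_on UNIV g1" "vanishes_beyond R1 g1" "(LINT x. \<bar>f1 x - g1 x\<bar>) < e / 2"
		using add.IH(1)[OF half_gt_zero[OF add.prems]] by blast
	obtain g2 R2 where 2: "continuous_on UNIV g2" "vanishes_beyond R2 g2" "(LINT x. \<bar>f2 x - g2 x\<bar>) < e / 2"
		using add.IH(2)[OF half_gt_zero[OF add.prems]] by blast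
	have i: "integrable lebesgue (%x. \<bar>f1 x - g1 x\<bar>)" "integrable lebesgue (%x. \<bar>f2 x - g2 x\<bar>)"
		using add.hyps continuous_vanishes_integrable[OF 1(1,2)] continuous_vanishes_integrable[OF 2(1,2)] by auto
	have "(LINT x. \<bar>f1 x + f2 x - (g1 x + g2 x)\<bar>) \<le> (LINT x. \<bar>f1 x - g1 x\<bar> + \<bar>f2 x - g2 x\<bar>)"
		using add.hyps continuous_vanishes_integrable[OF 1(1,2)] continuous_vanishes_integrable[OF 2(1,2)] i
		by (intro integral_mono) auto
	also have "\<dots> < e" using i 1 2 by simp
	finally have "(LINT x. \<bar>f1 x + f2 x - (g1 x + g2 x)\<bar>) < e" .
	moreover have "continuous_on UNIV (%x. g1 x + g2 x)" "vanishes_beyond (max R1 R2) (%x. g1 x + g2 x)"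
		using 1 2 by (auto intro: continuous_intros simp: vanishes_beyond_def)
	ultimately show ?case by blast
next
	case (lim f s)
	have "(%n. LINT x. \<bar>f x - s n x\<bar>) \<longlonglongrightarrow> (LINT x|(lebesgue :: 'a measure). 0)"
	proof (rule integral_dominated_convergence[where w = "%x. 3 * \<bar>f x\<bar>"])
		show "AE x. (%n. \<bar>f x - s n x\<bar>) \<longlonglongrightarrow> 0"
		proof (rule AE_I2)
			fix x :: 'a assume "x \<in> space lebesgue"
			then have "(%n. \<bar>f x - s n x\<bar>) \<longlonglongrightarrow> \<bar>f x - f x\<bar>" by (intro tendsto_intros lim.hyps)
			then show "(%n. \<bar>f x - s n x\<bar>) \<longlonglongrightarrow> 0" by simp
		qed
		show "AE x. norm \<bar>f x - s n x\<bar> \<le> 3 * \<bar>f x\<bar>" for n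
		proof (rule AE_I2)
			fix x :: 'a assume "x \<in> space lebesgue"
			then have "\<bar>s n x\<bar> \<le> 2 * \<bar>f x\<bar>" using lim.hyps(3)[of x n] by simp
			then show "norm \<bar>f x - s n x\<bar> \<le> 3 * \<bar>f x\<bar>" by simp
		qed
	qed (use lim.hyps in auto)
	then have "\<forall>\<^sub>F n in sequentially. (LINT x. \<bar>f x - s n x\<bar>) < e / 2"
		using lim.prems by (intro order_tendstoD) auto
	then obtain n where n: "(LINT x. \<bar>f x - s n x\<bar>) < e / 2"
		using eventually_happens'[OF sequentially_bot] by blast
	obtain g R where g: "continuous_on UNIV g" "vanishes_beyond R g" "(LINT x. \<bar>s n x - g x\<bar>) < e / 2"
		using lim.IH[OF half_gt_zero[OF lim.prems], of n] by blast
	have i: "integrable lebesgue (%x. \<bar>f x - s n x\<bar>)" "integrable lebesgue (%x. \<bar>s n x - g x\<bar>)"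
		"integrable lebesgue (%x. \<bar>f x - g x\<bar>)"
		using lim.hyps continuous_vanishes_integrable[OF g(1,2)] by auto
	have "(LINT x. \<bar>f x - g x\<bar>) \<le> (LINT x. \<bar>f x - s n x\<bar> + \<bar>s n x - g x\<bar>)"
		using i by (intro integral_mono) auto
	also have "\<dots> < e" using i n g by simp
	finally show ?case using g by blast
qed

text \<open>Young's inequality for a probability density. Tonelli's theorem is applied to the
  product of \<open>lborel\<close> with itself, so \<open>w\<close> is first replaced by a Borel
  function \<open>w'\<close> that equals it almost everywhere.\<close>

lemma conv_L1_le:
	fixes w :: "'a::euclidean_space => real"
	assumes w: "integrable lebesgue w" and d: "e > 0"
	shows "integrable lebesgue (conv (mollifier e) w)"
		and "(LINT x. \<bar>conv (mollifier e) w x\<bar>) \<le> (LINT x. \<bar>w x\<bar>)"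
proof -
	let ?m = "mollifier e :: 'a => real"
	obtain w' where w': "w' \<in> borel_measurable lborel" "AE x in lborel. w x = w' x"
		using completion_ex_borel_measurable_real[of w lborel] w by auto
	have w'm [measurable]: "w' \<in> borel_measurable borel" using w' by simp
	have mm [measurable]: "?m \<in> borel_measurable borel"
		using mollifier_continuous[OF d] by (rule borel_measurable_continuous_onI)
	have ae: "AE x. w x = w' x" using w'(2) by (rule AE_completion)
	have w'i: "integrable lborel w'"
		using integrable_cong_AE_imp[OF w _ ae] w'm integrable_completion[of w' lborel]
		by (metis measurable_completion measurable_lborel1 w'(1) AE_symmetric)
	have eq: "conv ?m w = conv ?m w'"
	proof
		fix x
		show "conv ?m w x = conv ?m w' x"
			unfolding conv_def real_scaleR_def using ae w measurable_completion[OF w'(1)]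
			by (intro integral_cong_AE borel_measurable_times continuous_reflect_measurable mollifier_continuous d) auto
	qed
	have c: "continuous_on UNIV (conv ?m w)"
		by (intro conv_continuous[OF mollifier_continuous[OF d] mollifier_vanishes[OF d]] integrable_loc_integrable w)
	have int1: "(\<integral>\<^sup>+x. ennreal (?m (x - y)) \<partial>lborel) = 1" for y :: 'a
	proof -
		have "(\<integral>\<^sup>+x. ennreal (?m (x - y)) \<partial>lborel) = (\<integral>\<^sup>+x. ennreal (?m (x - y)) \<partial>distr lborel borel ((+) y))"
			by (simp add: lborel_distr_plus)
		also have "\<dots> = (\<integral>\<^sup>+x. ennreal (?m x) \<partial>lborel)" by (subst nn_integral_distr) auto
		also have "\<dots> = (\<integral>\<^sup>+x. ennreal (?m x) \<partial>lebesgue)" by (simp add: nn_integral_completion)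
		also have "\<dots> = 1"
			using nn_integral_eq_integral[OF mollifier_integrable[OF d]] mollifier_nonneg[OF d] mollifier_integral[OF d]
			by (metis AE_I2 ennreal_1)
		finally show ?thesis .
	qed
	have "(\<integral>\<^sup>+x. ennreal \<bar>conv ?m w x\<bar> \<partial>lborel) \<le> (\<integral>\<^sup>+x. (\<integral>\<^sup>+y. ennreal (\<bar>w' y\<bar> * ?m (x - y)) \<partial>lborel) \<partial>lborel)"
	proof (rule nn_integral_mono)
		fix x :: 'a
		have i: "integrable lebesgue (%y. w' y *\<^sub>R ?m (x - y))"
			using w'i w'm by (intro conv_integrable[OF mollifier_continuous[OF d] mollifier_vanishes[OF d]] integrable_loc_integrable)
				(simp add: integrable_completion)
		have "ennreal \<bar>conv ?m w x\<bar> = ennreal (norm (LINT y. w' y *\<^sub>R ?m (x - y)))"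
			unfolding eq by (simp add: conv_def)
		also have "\<dots> \<le> (\<integral>\<^sup>+y. ennreal (norm (w' y *\<^sub>R ?m (x - y))) \<partial>lebesgue)"
			by (rule integral_norm_bound_ennreal[OF i])
		also have "\<dots> = (\<integral>\<^sup>+y. ennreal (\<bar>w' y\<bar> * ?m (x - y)) \<partial>lborel)"
			by (simp add: nn_integral_completion abs_mult mollifier_nonneg[OF d])
		finally show "ennreal \<bar>conv ?m w x\<bar> \<le> (\<integral>\<^sup>+y. ennreal (\<bar>w' y\<bar> * ?m (x - y)) \<partial>lborel)" .
	qed
	also have "\<dots> = (\<integral>\<^sup>+y. (\<integral>\<^sup>+x. ennreal (\<bar>w' y\<bar> * ?m (x - y)) \<partial>lborel) \<partial>lborel)"
		by (rule lborel_pair.Fubini'[symmetric]) measurable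
	also have "\<dots> = (\<integral>\<^sup>+y. ennreal \<bar>w' y\<bar> * (\<integral>\<^sup>+x. ennreal (?m (x - y)) \<partial>lborel) \<partial>lborel)"
		by (intro nn_integral_cong, subst nn_integral_cmult[symmetric])
			(auto simp: ennreal_mult mollifier_nonneg[OF d])
	also have "\<dots> = (\<integral>\<^sup>+y. ennreal \<bar>w' y\<bar> \<partial>lborel)" by (simp add: int1)
	also have "\<dots> = (\<integral>\<^sup>+y. ennreal \<bar>w' y\<bar> \<partial>lebesgue)" by (simp add: nn_integral_completion)
	also have "\<dots> = (\<integral>\<^sup>+y. ennreal \<bar>w y\<bar> \<partial>lebesgue)" using ae by (intro nn_integral_cong_AE) auto
	also have "\<dots> = ennreal (LINT y. \<bar>w y\<bar>)" using w by (intro nn_integral_eq_integral) auto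
	finally have le: "(\<integral>\<^sup>+x. ennreal \<bar>conv ?m w x\<bar> \<partial>lebesgue) \<le> ennreal (LINT y. \<bar>w y\<bar>)"
		by (simp add: nn_integral_completion)
	show i: "integrable lebesgue (conv ?m w)"
		using le continuous_lebesgue_measurable[OF c]
		by (intro integrableI_bounded) (auto intro: le_less_trans simp: ennreal_less_top)
	have "ennreal (LINT x. \<bar>conv ?m w x\<bar>) \<le> ennreal (LINT y. \<bar>w y\<bar>)"
		using le i by (subst nn_integral_eq_integral[symmetric]) auto
	then show "(LINT x. \<bar>conv ?m w x\<bar>) \<le> (LINT x. \<bar>w x\<bar>)"
		by (simp add: ennreal_le_iff)
qed

text \<open>The usual three term argument: a continuous approximation \<open>g\<close> of bounded
  support, the contraction property for \<open>w - g\<close>, and uniform closeness of the mollified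
  \<open>g\<close> to \<open>g\<close> on a ball of volume \<open>V\<close>.\<close>

lemma mollify_L1:
	fixes w :: "'a::euclidean_space => real"
	assumes w: "integrable lebesgue w" and e: "e > 0"
	obtains d where "d > 0" "\<And>h. 0 < h ==> h < d ==> (LINT x. \<bar>conv (mollifier h) w x - w x\<bar>) < e"
proof -
	obtain g R where g: "continuous_on UNIV g" "vanishes_beyond R g" "(LINT x. \<bar>w x - g x\<bar>) < e / 3"
		using L1_approx_continuous[OF w, of "e / 3"] e by auto
	have gi: "integrable lebesgue g" by (rule continuous_vanishes_integrable[OF g(1,2)])
	define V where "V = measure lebesgue (cball (0::'a) (R + 1))"
	have V: "V \<ge> 0" by (simp add: V_def)
	have "e / (3 * (V + 1)) > 0" using e V by simp
	from vanishes_uniformly_continuous[OF g(1,2) this]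
	obtain d where d: "d > 0" "\<And>x y. norm (x - y) < d ==> norm (g x - g y) < e / (3 * (V + 1))" by metis
	have "(LINT x. \<bar>conv (mollifier h) w x - w x\<bar>) < e" if h: "0 < h" "h < min d 1" for h
	proof -
		let ?m = "mollifier h :: 'a => real"
		have dec: "conv ?m w x = conv ?m (%x. w x - g x) x + conv ?m g x" for x
			using conv_integrable[OF mollifier_continuous[OF h(1)] mollifier_vanishes[OF h(1)] integrable_loc_integrable[OF w], of x]
				conv_integrable[OF mollifier_continuous[OF h(1)] mollifier_vanishes[OF h(1)] integrable_loc_integrable[OF gi], of x]
			by (simp add: conv_def left_diff_distrib)
		have cm: "conv ?m g = conv g ?m"
			by (intro conv_commute continuous_lebesgue_measurable g mollifier_continuous h)
		have near: "\<bar>conv ?m g x - g x\<bar> \<le> e / (3 * (V + 1)) * indicator (cball 0 (R + 1)) x" for x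
		proof (cases "norm x \<le> R + 1")
			case True
			have "norm (conv g ?m x - g x) \<le> e / (3 * (V + 1))"
				using h d(2) by (intro mollify_uniform g) (auto simp: norm_minus_commute intro!: less_imp_le)
			then show ?thesis using True by (simp add: cm)
		next
			case False
			have "?m y *\<^sub>R g (x - y) = 0" for y
			proof (cases "norm y \<le> h")
				case True
				then have "norm (x - y) > R" using False h norm_triangle_ineq2[of x y] by simp
				then show ?thesis using g by (simp add: vanishes_beyond_def)
			next
				case False
				then show ?thesis using mollifier_vanishes[OF h(1), where 'a = 'a] by (simp add: vanishes_beyond_def)
			qed
			then have "(%y. ?m y *\<^sub>R g (x - y)) = (%y. 0)" by (rule ext)
			then have "conv g ?m x = 0" by (simp only: conv_def Bochner_Integration.integral_zero)
			then show ?thesis using False g by (simp add: cm vanishes_beyond_def)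
		qed
		have wg: "integrable lebesgue (%x. w x - g x)" using w gi by simp
		note c1 = conv_L1_le[OF wg h(1)]
		note c2 = conv_L1_le[OF gi h(1)]
		have ib: "integrable lebesgue (%x. e / (3 * (V + 1)) * indicator (cball (0::'a) (R + 1)) x)"
			by (intro integrable_mult_right integrable_real_indicator) (use fmeasurableD2[OF lmeasurable_cball[of "0::'a" "R + 1"]] in \<open>auto simp: less_top\<close>)
		have "(LINT x. \<bar>conv ?m w x - w x\<bar>)
			 \<le> (LINT x. \<bar>conv ?m (%x. w x - g x) x\<bar> + \<bar>w x - g x\<bar> + e / (3 * (V + 1)) * indicator (cball 0 (R + 1)) x)"
		proof (rule integral_mono)
			show "integrable lebesgue (%x. \<bar>conv ?m w x - w x\<bar>)" unfolding dec using c1 c2 w by simp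
			show "integrable lebesgue (%x. \<bar>conv ?m (%x. w x - g x) x\<bar> + \<bar>w x - g x\<bar> + e / (3 * (V + 1)) * indicator (cball 0 (R + 1)) x)"
				using c1 wg ib by (intro Bochner_Integration.integrable_add) auto
			show "\<bar>conv ?m w x - w x\<bar> \<le> \<bar>conv ?m (%x. w x - g x) x\<bar> + \<bar>w x - g x\<bar> + e / (3 * (V + 1)) * indicator (cball 0 (R + 1)) x" for x
				using near[of x] unfolding dec[of x] by linarith
		qed
		also have "\<dots> = (LINT x. \<bar>conv ?m (%x. w x - g x) x\<bar>) + (LINT x. \<bar>w x - g x\<bar>) + e / (3 * (V + 1)) * V"
		proof -
			have "(LINT x. e / (3 * (V + 1)) * indicator (cball (0::'a) (R + 1)) x) = e / (3 * (V + 1)) * V"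
				by (simp add: V_def)
			then show ?thesis using c1 wg ib by simp
		qed
		also have "\<dots> < e / 3 + e / 3 + e / 3"
		proof (intro add_strict_mono)
			show "(LINT x. \<bar>w x - g x\<bar>) < e / 3" by (rule g)
			then show "(LINT x. \<bar>conv ?m (%x. w x - g x) x\<bar>) < e / 3" using c1(2) by simp
			have "e / (3 * (V + 1)) * V = e / 3 * (V / (V + 1))" using V by (simp add: divide_simps)
			also have "\<dots> < e / 3 * 1" using e V by (intro mult_strict_left_mono) auto
			finally show "e / (3 * (V + 1)) * V < e / 3" by simp
		qed
		finally show ?thesis by simp
	qed
	then show ?thesis using that[of "min d 1"] d(1) by auto
qed

section \<open>Square integrable functions\<close>

lemma L2_measurable: "f \<in> L2 ==> f \<in> borel_measurable lebesgue"
	and L2_integrable_square: "f \<in> L2 ==> integrable lebesgue (%x. (norm (f x))^2)"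
	by (auto simp: L2_def)

lemma L2_norm_nonneg [simp]: "L2_norm f \<ge> 0"
	by (simp add: L2_norm_def)

lemma L2_norm_power2: "(L2_norm f)^2 = (LINT x. (norm (f x))^2)"
	by (simp add: L2_norm_def)

lemma L2_norm_integrable:
	fixes f g :: "R3 => _::euclidean_space"
	assumes "f \<in> L2" "g \<in> L2"
	shows "integrable lebesgue (%x. norm (f x) * norm (g x))"
proof (rule Bochner_Integration.integrable_bound)
	show "integrable lebesgue (%x. (norm (f x))^2 + (norm (g x))^2)"
		using assms by (simp add: L2_def)
	show "(%x. norm (f x) * norm (g x)) \<in> borel_measurable lebesgue"
		using assms by (auto simp: L2_def)
	show "AE x. norm (norm (f x) * norm (g x)) \<le> norm ((norm (f x))^2 + (norm (g x))^2)"
	proof (rule AE_I2)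
		fix x
		have "0 \<le> norm (f x) * norm (g x)" by simp
		then show "norm (norm (f x) * norm (g x)) \<le> norm ((norm (f x))^2 + (norm (g x))^2)"
			using sum_squares_bound[of "norm (f x)" "norm (g x)"] unfolding real_norm_def mult.assoc by linarith
	qed
qed

lemma L2_dominated:
	fixes f :: "R3 => 'b::euclidean_space" and g :: "R3 => 'c::euclidean_space"
	assumes "f \<in> L2" "g \<in> borel_measurable lebesgue" "AE x. norm (g x) \<le> c * norm (f x)"
	shows "g \<in> L2"
proof -
	have "integrable lebesgue (%x. (norm (g x))^2)"
	proof (rule Bochner_Integration.integrable_bound)
		show "integrable lebesgue (%x. c^2 * (norm (f x))^2)" using assms by (simp add: L2_def)
		show "(%x. (norm (g x))^2) \<in> borel_measurable lebesgue" using assms by simp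
		show "AE x. norm ((norm (g x))^2) \<le> norm (c^2 * (norm (f x))^2)"
			using assms(3)
		proof (rule eventually_mono)
			fix x assume "norm (g x) \<le> c * norm (f x)"
			then have "(norm (g x))^2 \<le> (c * norm (f x))^2" by (rule power_mono) simp
			then show "norm ((norm (g x))^2) \<le> norm (c^2 * (norm (f x))^2)" by (simp add: power_mult_distrib)
		qed
	qed
	then show ?thesis using assms by (simp add: L2_def)
qed

lemma L2_add:
	fixes f g :: "R3 => 'b::euclidean_space"
	assumes "f \<in> L2" "g \<in> L2" shows "(%x. f x + g x) \<in> L2"
proof -
	have "integrable lebesgue (%x. (norm (f x + g x))^2)"
	proof (rule Bochner_Integration.integrable_bound)
		show "integrable lebesgue (%x. 2 * (norm (f x))^2 + 2 * (norm (g x))^2)"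
			using assms by (simp add: L2_def)
		show "(%x. (norm (f x + g x))^2) \<in> borel_measurable lebesgue"
			using assms by (auto simp: L2_def)
		show "AE x. norm ((norm (f x + g x))^2) \<le> norm (2 * (norm (f x))^2 + 2 * (norm (g x))^2)"
		proof (rule AE_I2)
			fix x
			have "(norm (f x + g x))^2 \<le> (norm (f x) + norm (g x))^2"
				by (intro power_mono norm_triangle_ineq) simp
			moreover have "0 \<le> (norm (f x) - norm (g x))^2" by simp
			ultimately show "norm ((norm (f x + g x))^2) \<le> norm (2 * (norm (f x))^2 + 2 * (norm (g x))^2)"
				by (simp add: power2_diff power2_sum)
		qed
	qed
	then show ?thesis using assms by (auto simp: L2_def)
qed

lemma L2_scale:
	fixes f :: "R3 => 'b::euclidean_space"
	assumes "f \<in> L2" shows "(%x. c *\<^sub>R f x) \<in> L2"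
	using assms by (intro L2_dominated[OF assms, where c = "\<bar>c\<bar>"]) (auto simp: L2_def)

lemma L2_minus:
	fixes f :: "R3 => 'b::euclidean_space"
	assumes "f \<in> L2" shows "(%x. - f x) \<in> L2"
	using L2_scale[OF assms, of "-1"] by simp

lemma L2_diff:
	fixes f g :: "R3 => 'b::euclidean_space"
	assumes "f \<in> L2" "g \<in> L2" shows "(%x. f x - g x) \<in> L2"
	using L2_add[OF assms(1) L2_minus[OF assms(2)]] by simp

lemma L2_zero: "(%x. 0) \<in> L2"
	by (simp add: L2_def)

lemma L2_continuous_vanishes:
	fixes g :: "R3 => 'b::euclidean_space"
	assumes "continuous_on UNIV g" "vanishes_beyond R g"
	shows "g \<in> L2"
proof -
	have "integrable lebesgue (%x. (norm (g x))^2)"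
		using assms
		by (intro continuous_vanishes_integrable[where R = R] continuous_intros) (auto simp: vanishes_beyond_def)
	then show ?thesis using continuous_lebesgue_measurable[OF assms(1)] by (simp add: L2_def)
qed

lemma L2_inner_integrable:
	fixes f g :: "R3 => 'b::euclidean_space"
	assumes "f \<in> L2" "g \<in> L2" shows "integrable lebesgue (%x. f x \<bullet> g x)"
proof (rule Bochner_Integration.integrable_bound[OF L2_norm_integrable[OF assms]])
	show "(%x. f x \<bullet> g x) \<in> borel_measurable lebesgue"
		using assms by (auto simp: L2_def)
	show "AE x. norm (f x \<bullet> g x) \<le> norm (norm (f x) * norm (g x))"
		by (simp add: Cauchy_Schwarz_ineq2)
qed

lemma L2_mult_integrable:
	fixes f g :: "R3 => real"
	assumes "f \<in> L2" "g \<in> L2" shows "integrable lebesgue (%x. f x * g x)"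
	using L2_inner_integrable[OF assms] by simp

lemma L2_norm_eq_0:
	assumes "f \<in> L2" "L2_norm f = 0" shows "AE x. f x = 0"
proof -
	have "(LINT x. (norm (f x))^2) = 0" using assms(2) L2_norm_power2[of f] by simp
	then show ?thesis
		using integral_nonneg_eq_0_iff_AE[OF L2_integrable_square[OF assms(1)]] by simp
qed

lemma L2_Cauchy_Schwarz_norm:
	fixes f :: "R3 => 'b::euclidean_space" and g :: "R3 => 'c::euclidean_space"
	assumes f: "f \<in> L2" and g: "g \<in> L2"
	shows "(LINT x. norm (f x) * norm (g x)) \<le> L2_norm f * L2_norm g"
proof -
	define a b c where "a = (L2_norm f)^2" and "b = (LINT x. norm (f x) * norm (g x))" and "c = (L2_norm g)^2"
	have "(%x. norm (f x)) \<in> L2" "(%x. norm (g x)) \<in> L2" using f g by (auto simp: L2_def)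
	then have i: "integrable lebesgue (%x. norm (f x) * norm (g x))"
		using L2_mult_integrable by blast
	have b0: "b \<ge> 0" by (simp add: b_def)
	\<comment> \<open>Integration of 0 <= (norm (f x) - t norm (g x))^2; the choice t = b / c yields
	  the claim for c > 0.\<close>
	have q: "2 * t * b \<le> a + t^2 * c" for t
	proof -
		have "(LINT x. (2 * t) * (norm (f x) * norm (g x))) \<le> (LINT x. (norm (f x))^2 + t^2 * (norm (g x))^2)"
		proof (rule integral_mono)
			show "integrable lebesgue (%x. 2 * t * (norm (f x) * norm (g x)))" using i by simp
			show "integrable lebesgue (%x. (norm (f x))^2 + t^2 * (norm (g x))^2)" using f g by (simp add: L2_def)
			show "2 * t * (norm (f x) * norm (g x)) \<le> (norm (f x))^2 + t^2 * (norm (g x))^2" for x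
				using zero_le_power2[of "norm (f x) - t * norm (g x)"] unfolding power2_diff by (simp add: power_mult_distrib algebra_simps)
		qed
		then show ?thesis using f g i by (simp add: a_def b_def c_def L2_norm_power2 L2_def)
	qed
	have "b^2 \<le> a * c"
	proof (cases "c = 0")
		case True
		then have "AE x. g x = 0" using g by (intro L2_norm_eq_0) (auto simp: c_def)
		then have "b = (LINT x|(lebesgue :: R3 measure). 0)"
			unfolding b_def using i by (intro integral_cong_AE) auto
		then show ?thesis using True by simp
	next
		case False
		then have "c > 0" by (simp add: c_def)
		then show ?thesis using q[of "b / c"] by (simp add: field_simps power2_eq_square)
	qed
	also have "a * c = (L2_norm f * L2_norm g)^2" by (simp add: a_def c_def power_mult_distrib)
	finally show ?thesis unfolding b_def[symmetric] by (rule power2_le_imp_le) simp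
qed

lemma L2_Cauchy_Schwarz:
	fixes f g :: "R3 => 'b::euclidean_space"
	assumes "f \<in> L2" "g \<in> L2"
	shows "\<bar>LINT x. f x \<bullet> g x\<bar> \<le> L2_norm f * L2_norm g"
proof -
	have "\<bar>LINT x. f x \<bullet> g x\<bar> \<le> (LINT x. norm (f x \<bullet> g x))"
		using integral_norm_bound[of lebesgue "%x. f x \<bullet> g x"] by simp
	also have "\<dots> \<le> (LINT x. norm (f x) * norm (g x))"
		using L2_inner_integrable[OF assms] L2_norm_integrable[OF assms]
		by (intro integral_mono) (auto simp: Cauchy_Schwarz_ineq2)
	also have "\<dots> \<le> L2_norm f * L2_norm g" by (rule L2_Cauchy_Schwarz_norm[OF assms])
	finally show ?thesis .
qed

lemma L2_norm_scale: "L2_norm (%x. c *\<^sub>R f x) = \<bar>c\<bar> * L2_norm f"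
	by (simp add: L2_norm_def power_mult_distrib real_sqrt_mult)

lemma L2_norm_uminus: "L2_norm (%x. - f x) = L2_norm f"
	by (simp add: L2_norm_def)

lemma L2_norm_triangle:
	fixes f g :: "R3 => 'b::euclidean_space"
	assumes f: "f \<in> L2" and g: "g \<in> L2"
	shows "L2_norm (%x. f x + g x) \<le> L2_norm f + L2_norm g"
proof (rule power2_le_imp_le)
	have "(L2_norm (%x. f x + g x))^2 = (LINT x. (norm (f x))^2 + 2 * (f x \<bullet> g x) + (norm (g x))^2)"
		unfolding L2_norm_power2 by (simp add: power2_norm_eq_inner algebra_simps inner_commute)
	also have "\<dots> = (L2_norm f)^2 + 2 * (LINT x. f x \<bullet> g x) + (L2_norm g)^2"
		unfolding L2_norm_power2 using f g L2_inner_integrable[OF f g] by (simp add: L2_def)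
	also have "\<dots> \<le> (L2_norm f + L2_norm g)^2"
		using L2_Cauchy_Schwarz[OF f g] by (simp add: power2_sum)
	finally show "(L2_norm (%x. f x + g x))^2 \<le> (L2_norm f + L2_norm g)^2" .
qed simp

lemma L2_norm_cong_AE:
	fixes f g :: "R3 => 'b::euclidean_space"
	assumes "f \<in> borel_measurable lebesgue" "g \<in> borel_measurable lebesgue" "AE x. f x = g x"
	shows "L2_norm f = L2_norm g"
	unfolding L2_norm_def using assms
	by (intro arg_cong[where f = sqrt] integral_cong_AE) (auto elim: eventually_mono)

lemma L2_norm_mono:
	fixes f :: "R3 => 'b::euclidean_space" and g :: "R3 => 'c::euclidean_space"
	assumes "f \<in> L2" "g \<in> L2" "AE x. norm (g x) \<le> c * norm (f x)" "c \<ge> 0"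
	shows "L2_norm g \<le> c * L2_norm f"
proof (rule power2_le_imp_le)
	have "(L2_norm g)^2 \<le> (LINT x. c^2 * (norm (f x))^2)"
		unfolding L2_norm_power2
	proof (rule integral_mono_AE)
		show "AE x. (norm (g x))^2 \<le> c^2 * (norm (f x))^2"
			using assms(3) by (rule eventually_mono) (metis norm_ge_zero power_mono power_mult_distrib)
	qed (use assms in \<open>auto simp: L2_def\<close>)
	then show "(L2_norm g)^2 \<le> (c * L2_norm f)^2" by (simp add: L2_norm_power2 power_mult_distrib)
qed (use assms in simp)

lemma L2_loc_integrable:
	fixes f :: "R3 => real"
	assumes "f \<in> L2" shows "loc_integrable f"
	unfolding loc_integrable_def
proof
	fix r :: real
	have "(%x. indicator (cball 0 r) x :: real) \<in> L2"
	proof -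
		have "integrable lebesgue (indicator (cball (0::R3) r) :: R3 => real)"
			using lmeasurable_cball[of "0::R3" r] by (auto simp: fmeasurable_def)
		moreover have "(norm (indicator (cball 0 r) x :: real))^2 = indicator (cball 0 r) x" for x :: R3
			by (simp add: indicator_def)
		ultimately show ?thesis by (auto simp: L2_def)
	qed
	from L2_mult_integrable[OF this assms]
	show "integrable lebesgue (%y. indicator (cball 0 r) y * f y)" .
qed

text \<open>Riesz-Fischer for functions rather than classes: a subsequence with summable increments
  converges almost everywhere, and Fatou's lemma shows that its limit is also the limit in
  norm.\<close>

lemma L2_complete:
	fixes f :: "nat => R3 => 'b::euclidean_space"
	assumes f: "\<And>n. f n \<in> L2"
		and Cauchy: "\<And>e. e > 0 ==> \<exists>N. \<forall>m\<ge>N. \<forall>n\<ge>N. L2_norm (%x. f m x - f n x) < e"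
	obtains g where "g \<in> L2" "(%n. L2_norm (%x. f n x - g x)) \<longlonglongrightarrow> 0"
proof -
	have [measurable]: "f n \<in> borel_measurable lebesgue" for n using f L2_measurable by blast
	have "\<forall>k. \<exists>N. \<forall>m\<ge>N. \<forall>n\<ge>N. L2_norm (%x. f m x - f n x) < (1/2)^k"
		using Cauchy by simp
	then obtain N where N: "\<And>k m n. m \<ge> N k ==> n \<ge> N k ==> L2_norm (%x. f m x - f n x) < (1/2)^k"
		by metis
	\<comment> \<open>Partial sums of the thresholds form a monotone sequence that dominates each of
	  them.\<close>
	define r where "r k = (\<Sum>j\<le>k. N j)" for k
	have r: "r k \<ge> N k" "r (Suc k) \<ge> r k" "r (Suc k) \<ge> N k" for k
	proof -
		show a: "r k \<ge> N k" for k unfolding r_def by (rule member_le_sum) auto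
		show b: "r (Suc k) \<ge> r k" by (simp add: r_def)
		show "r (Suc k) \<ge> N k" using a[of k] b by linarith
	qed
	define D where "D k x = norm (f (r (Suc k)) x - f (r k) x)" for k x
	have D: "D k \<in> L2" for k
		unfolding D_def using L2_diff[OF f f] by (auto simp: L2_def)
	have Dn: "L2_norm (D k) \<le> (1/2)^k" for k
	proof -
		have "L2_norm (D k) = L2_norm (%x. f (r (Suc k)) x - f (r k) x)" by (simp add: D_def[abs_def] L2_norm_def)
		then show ?thesis using N[OF r(3) r(1), of k] by simp
	qed
	have S: "(%x. \<Sum>k<n. D k x) \<in> L2 \<and> L2_norm (%x. \<Sum>k<n. D k x) \<le> 2 - 2 * (1/2)^n" for n
	proof (induction n)
		case 0 then show ?case by (simp add: L2_zero L2_norm_def)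
	next
		case (Suc n)
		then show ?case
			using L2_add[OF _ D[of n]] L2_norm_triangle[OF _ D[of n]] Dn[of n] by (force simp: L2_norm_nonneg)
	qed
	have mono: "(\<Sum>k<n. D k x) \<le> (\<Sum>k<Suc n. D k x)" and nn: "0 \<le> (\<Sum>k<n. D k x)" for n x
		by (auto simp: D_def intro: sum_nonneg)
	\<comment> \<open>Monotone convergence for the squares of the partial sums of increments, whose
	  norms stay below the geometric sum 2.\<close>
	have bound: "(\<integral>\<^sup>+x. (SUP n. ennreal ((\<Sum>k<n. D k x)^2)) \<partial>lebesgue) \<le> ennreal 4"
	proof -
		have "(\<integral>\<^sup>+x. (SUP n. ennreal ((\<Sum>k<n. D k x)^2)) \<partial>lebesgue) = (SUP n. \<integral>\<^sup>+x. ennreal ((\<Sum>k<n. D k x)^2) \<partial>lebesgue)"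
		proof (rule nn_integral_monotone_convergence_SUP)
			show "incseq (%n x. ennreal ((\<Sum>k<n. D k x)^2))"
				using mono nn by (intro incseq_SucI le_funI ennreal_leI power_mono) auto
			show "(%x. ennreal ((\<Sum>k<n. D k x)^2)) \<in> borel_measurable lebesgue" for n
				using S[of n] by (auto simp: L2_def)
		qed
		also have "\<dots> \<le> ennreal 4"
		proof (rule SUP_least)
			fix n
			have "(\<integral>\<^sup>+x. ennreal ((\<Sum>k<n. D k x)^2) \<partial>lebesgue) = ennreal ((L2_norm (%x. \<Sum>k<n. D k x))^2)"
				unfolding L2_norm_power2 using S[of n] by (subst nn_integral_eq_integral) (auto simp: L2_def)
			also have "\<dots> \<le> ennreal (2^2)"
				using S[of n] by (intro ennreal_leI power_mono) (auto intro: order_trans)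
			finally show "(\<integral>\<^sup>+x. ennreal ((\<Sum>k<n. D k x)^2) \<partial>lebesgue) \<le> ennreal 4" by simp
		qed
		finally show ?thesis .
	qed
	have "AE x. (SUP n. ennreal ((\<Sum>k<n. D k x)^2)) \<noteq> \<infinity>"
	proof (rule nn_integral_noteq_infinite)
		show "(%x. SUP n. ennreal ((\<Sum>k<n. D k x)^2)) \<in> borel_measurable lebesgue"
			using S by (intro borel_measurable_SUP) (auto simp: L2_def)
		show "(\<integral>\<^sup>+x. (SUP n. ennreal ((\<Sum>k<n. D k x)^2)) \<partial>lebesgue) \<noteq> \<infinity>"
			using le_less_trans[OF bound ennreal_less_top] by auto
	qed
	then have conv: "AE x. convergent (%k. f (r k) x)"
	proof (rule eventually_mono)
		fix x assume "(SUP n. ennreal ((\<Sum>k<n. D k x)^2)) \<noteq> \<infinity>"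
		then obtain c where c: "c \<ge> 0" "(SUP n. ennreal ((\<Sum>k<n. D k x)^2)) = ennreal c"
			by (metis ennreal_cases infinity_ennreal_def)
		have "(\<Sum>k<n. D k x)^2 \<le> c" for n
			using SUP_upper[of n UNIV "%n. ennreal ((\<Sum>k<n. D k x)^2)"] c by (simp add: ennreal_le_iff)
		then have "(\<Sum>k<n. D k x) \<le> sqrt c" for n by (rule real_le_rsqrt)
		then have "summable (%k. D k x)"
			by (intro bounded_imp_summable[where B = "sqrt c"]) (auto simp: D_def lessThan_Suc_atMost[symmetric] simp del: sum.lessThan_Suc)
		then have "summable (%k. f (r (Suc k)) x - f (r k) x)"
			unfolding D_def by (rule summable_norm_cancel)
		then have "convergent (%n. \<Sum>k<n. f (r (Suc k)) x - f (r k) x)"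
			by (simp add: summable_iff_convergent)
		then have "convergent (%n. (f (r n) x - f (r 0) x) + f (r 0) x)"
			unfolding sum_lessThan_telescope[where f = "%k. f (r k) x"] by (intro convergent_add convergent_const)
		then show "convergent (%k. f (r k) x)" by simp
	qed
	define g where "g x = lim (%k. f (r k) x)" for x
	have gm [measurable]: "g \<in> borel_measurable lebesgue"
		unfolding g_def[abs_def] by (rule borel_measurable_lim_metric) measurable
	have lim: "AE x. (%k. f (r k) x) \<longlonglongrightarrow> g x"
		using conv by (rule eventually_mono) (simp add: g_def convergent_LIMSEQ_iff)
	\<comment> \<open>Fatou along the subsequence: \<open>f n - g\<close> is the pointwise limit of
	  \<open>f n - f (r k)\<close>, whose norm is below (1/2)^j once both indices pass
	  \<open>N j\<close>.\<close>
	have key: "(\<integral>\<^sup>+x. ennreal ((norm (f n x - g x))^2) \<partial>lebesgue) \<le> ennreal (((1/2)^j)^2)" if n: "n \<ge> N j" for n j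
	proof -
		have "(\<integral>\<^sup>+x. ennreal ((norm (f n x - g x))^2) \<partial>lebesgue)
				= (\<integral>\<^sup>+x. liminf (%k. ennreal ((norm (f n x - f (r k) x))^2)) \<partial>lebesgue)"
		proof (rule nn_integral_cong_AE, use lim in \<open>rule eventually_mono\<close>)
			fix x assume "(%k. f (r k) x) \<longlonglongrightarrow> g x"
			then have "(%k. ennreal ((norm (f n x - f (r k) x))^2)) \<longlonglongrightarrow> ennreal ((norm (f n x - g x))^2)"
				by (intro tendsto_intros)
			then show "ennreal ((norm (f n x - g x))^2) = liminf (%k. ennreal ((norm (f n x - f (r k) x))^2))"
				by (metis lim_imp_Liminf sequentially_bot)
		qed
		also have "\<dots> \<le> liminf (%k. \<integral>\<^sup>+x. ennreal ((norm (f n x - f (r k) x))^2) \<partial>lebesgue)"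
			by (rule nn_integral_liminf) measurable
		also have "\<dots> \<le> ennreal (((1/2)^j)^2)"
		proof (rule Liminf_le)
			show "\<forall>\<^sub>F k in sequentially. (\<integral>\<^sup>+x. ennreal ((norm (f n x - f (r k) x))^2) \<partial>lebesgue) \<le> ennreal (((1/2)^j)^2)"
				unfolding eventually_sequentially
			proof (intro exI[of _ j] allI impI)
				fix k assume "k \<ge> j"
				have "incseq r" using r(2) by (intro incseq_SucI)
				then have "r k \<ge> N j" using r(1)[of j] \<open>k \<ge> j\<close> by (meson incseqD order_trans)
				then have "L2_norm (%x. f n x - f (r k) x) \<le> (1/2)^j" using N[OF n] by (simp add: less_imp_le)
				then have "(L2_norm (%x. f n x - f (r k) x))^2 \<le> ((1/2)^j)^2" by (rule power_mono) simp
				moreover have "(\<integral>\<^sup>+x. ennreal ((norm (f n x - f (r k) x))^2) \<partial>lebesgue) = ennreal ((L2_norm (%x. f n x - f (r k) x))^2)"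
					unfolding L2_norm_power2 using L2_diff[OF f f] by (subst nn_integral_eq_integral) (auto simp: L2_def)
				ultimately show "(\<integral>\<^sup>+x. ennreal ((norm (f n x - f (r k) x))^2) \<partial>lebesgue) \<le> ennreal (((1/2)^j)^2)"
					by (simp add: ennreal_leI)
			qed
		qed simp
		finally show ?thesis .
	qed
	have d: "(%x. f n x - g x) \<in> L2 \<and> L2_norm (%x. f n x - g x) \<le> (1/2)^j" if n: "n \<ge> N j" for n j
	proof -
		have i: "integrable lebesgue (%x. (norm (f n x - g x))^2)"
			using key[OF n] by (intro integrableI_bounded) (auto intro: le_less_trans simp: ennreal_less_top)
		then have "ennreal ((L2_norm (%x. f n x - g x))^2) \<le> ennreal (((1/2)^j)^2)"
			unfolding L2_norm_power2 using key[OF n] by (subst nn_integral_eq_integral[symmetric]) auto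
		then have "(L2_norm (%x. f n x - g x))^2 \<le> ((1/2)^j)^2" by (simp add: ennreal_le_iff)
		then have "L2_norm (%x. f n x - g x) \<le> (1/2)^j" by (rule power2_le_imp_le) simp
		then show ?thesis using i by (simp add: L2_def)
	qed
	have "g \<in> L2"
		using L2_diff[OF f[of "N 0"] d[of 0 "N 0", THEN conjunct1]] by simp
	moreover have "(%n. L2_norm (%x. f n x - g x)) \<longlonglongrightarrow> 0"
	proof (rule LIMSEQ_I)
		fix e :: real assume "e > 0"
		then obtain j where j: "(1/2::real)^j < e" using real_arch_pow_inv[of e "1/2"] by auto
		have "norm (L2_norm (%x. f n x - g x) - 0) < e" if "n \<ge> N j" for n
			using d[OF that] j L2_norm_nonneg[of "%x. f n x - g x"] by simp
		then show "\<exists>no. \<forall>n\<ge>no. norm (L2_norm (%x. f n x - g x) - 0) < e" by blast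
	qed
	ultimately show ?thesis by (rule that)
qed

section \<open>Weak gradients\<close>

lemma mollify_loc_integrable:
	fixes w :: "'a::euclidean_space => real"
	assumes "loc_integrable w" "d > 0"
	shows "integrable lebesgue (%x. indicator (cball 0 R) x * \<bar>conv (mollifier d) w x - w x\<bar>)"
proof -
	have "loc_integrable (conv (mollifier d) w)"
		by (intro continuous_loc_integrable conv_continuous[OF mollifier_continuous mollifier_vanishes] assms)
	then have "integrable lebesgue (%x. indicator (cball 0 R) x * conv (mollifier d) w x - indicator (cball 0 R) x * w x)"
		using assms(1) by (auto simp: loc_integrable_def)
	then have "integrable lebesgue (%x. \<bar>indicator (cball 0 R) x * conv (mollifier d) w x - indicator (cball 0 R) x * w x\<bar>)"
		by simp
	moreover have "\<bar>indicator (cball 0 R) x * conv (mollifier d) w x - indicator (cball 0 R) x * w x\<bar>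
			= indicator (cball 0 R) x * \<bar>conv (mollifier d) w x - w x\<bar>" for x
		by (simp add: indicator_def)
	ultimately show ?thesis by simp
qed

lemma mollify_loc_tendsto:
	fixes w :: "'a::euclidean_space => real"
	assumes w: "loc_integrable w"
	shows "(%n. LINT x. indicator (cball 0 R) x * \<bar>conv (mollifier (1 / Suc n)) w x - w x\<bar>) \<longlonglongrightarrow> 0"
proof (rule LIMSEQ_I)
	fix e :: real assume "e > 0"
	\<comment> \<open>On the ball of radius \<open>R\<close> a mollification of width at most 1 depends
	  only on \<open>w\<close> inside radius \<open>R + 1\<close>, so \<open>w\<close> may be cut off
	  to an integrable function.\<close>
	define w1 where "w1 x = indicator (cball 0 (R + 1)) x * w x" for x
	have w1: "integrable lebesgue w1" using w by (simp add: w1_def[abs_def] loc_integrable_def)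
	obtain d where d: "d > 0" "\<And>h. 0 < h ==> h < d ==> (LINT x. \<bar>conv (mollifier h) w1 x - w1 x\<bar>) < e"
		using mollify_L1[OF w1 \<open>e > 0\<close>] by metis
	obtain N where N: "1 / Suc N < d" using d(1) by (rule nat_approx_posE)
	have "norm ((LINT x. indicator (cball 0 R) x * \<bar>conv (mollifier (1 / Suc n)) w x - w x\<bar>) - 0) < e" if "n \<ge> N" for n
	proof -
		define h where "h = 1 / real (Suc n)"
		have "h \<le> 1 / Suc N" using that by (simp add: h_def frac_le)
		then have h: "0 < h" "h < d" "h \<le> 1" using N by (auto simp: h_def)
		have eq: "indicator (cball 0 R) x * \<bar>conv (mollifier h) w x - w x\<bar> = indicator (cball 0 R) x * \<bar>conv (mollifier h) w1 x - w1 x\<bar>" for x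
		proof (cases "norm x \<le> R")
			case True
			have "w y *\<^sub>R mollifier h (x - y) = w1 y *\<^sub>R mollifier h (x - y)" for y
			proof (cases "norm (x - y) \<le> h")
				case le: True
				then have "norm y \<le> R + 1" using True h norm_triangle_sub[of y x] by (simp add: norm_minus_commute)
				then show ?thesis by (simp add: w1_def)
			next
				case False
				then show ?thesis using mollifier_vanishes[OF h(1), where 'a = 'a] by (simp add: vanishes_beyond_def)
			qed
			then have "(%y. w y *\<^sub>R mollifier h (x - y)) = (%y. w1 y *\<^sub>R mollifier h (x - y))" by (rule ext)
			then have "conv (mollifier h) w x = conv (mollifier h) w1 x" by (simp only: conv_def)
			then show ?thesis using True by (simp add: w1_def)
		qed simp
		have "(LINT x. indicator (cball 0 R) x * \<bar>conv (mollifier h) w1 x - w1 x\<bar>) \<le> (LINT x. \<bar>conv (mollifier h) w1 x - w1 x\<bar>)"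
			using mollify_loc_integrable[OF integrable_loc_integrable[OF w1] h(1)] conv_L1_le(1)[OF w1 h(1)] w1
			by (intro integral_mono) (auto simp: indicator_def)
		also have "\<dots> < e" using d(2) h by simp
		finally show ?thesis unfolding h_def[symmetric] eq by simp
	qed
	then show "\<exists>N. \<forall>n\<ge>N. norm ((LINT x. indicator (cball 0 R) x * \<bar>conv (mollifier (1 / Suc n)) w x - w x\<bar>) - 0) < e"
		by blast
qed

lemma mollifier_reflect_test:
	assumes "d > 0"
	shows "(%y. mollifier d (x - y)) \<in> test_functions (UNIV :: 'a::euclidean_space set)"
proof (rule test_functionsI)
	show "Ck k (%y. mollifier d (x - y))" for k by (intro Ck_reflect Ck_mollifier assms)
	show "mollifier d (x - y) = 0" if "y \<notin> cball x d" for y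
		using that mollifier_vanishes[OF assms, where 'a = 'a] by (simp add: vanishes_beyond_def dist_norm)
qed auto

text \<open>Mollifying amounts to testing with reflected mollifiers, hence all mollifications of
  \<open>w\<close> vanish; yet they converge to \<open>w\<close> in L^1 on every ball.\<close>

lemma fundamental_lemma:
	fixes w :: "'a::euclidean_space => real"
	assumes w: "loc_integrable w"
		and zero: "\<And>p. p \<in> test_functions UNIV ==> (LINT x. w x * p x) = 0"
	shows "AE x. w x = 0"
proof -
	have c0: "conv (mollifier d) w x = 0" if "d > 0" for d x
		unfolding conv_def using zero[OF mollifier_reflect_test[OF that]] by simp
	have "AE x. norm x \<le> real k --> w x = 0" for k
	proof -
		have "(%n::nat. LINT x. indicator (cball 0 (real k)) x * \<bar>w x\<bar>) \<longlonglongrightarrow> 0"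
			using mollify_loc_tendsto[OF w, of "real k"] by (simp add: c0)
		then have "(LINT x. indicator (cball 0 (real k)) x * \<bar>w x\<bar>) = 0"
			by (simp add: LIMSEQ_const_iff)
		moreover have "integrable lebesgue (%x. indicator (cball 0 (real k)) x * \<bar>w x\<bar>)"
		proof -
			have "integrable lebesgue (%x. \<bar>indicator (cball 0 (real k)) x * w x\<bar>)"
				using w by (simp add: loc_integrable_def)
			then show ?thesis by (simp add: abs_mult)
		qed
		ultimately have "AE x. indicator (cball 0 (real k)) x * \<bar>w x\<bar> = 0"
			by (subst (asm) integral_nonneg_eq_0_iff_AE) auto
		then show ?thesis by (rule eventually_mono) (auto simp: indicator_def)
	qed
	then have "AE x. \<forall>k::nat. norm x \<le> real k --> w x = 0"
		by (subst AE_all_countable) simp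
	then show ?thesis by (rule eventually_mono) (use real_arch_simple in blast)
qed

lemma has_C1_gradient_mult:
	assumes "has_C1_gradient f F" "has_C1_gradient g G"
	shows "has_C1_gradient (%x. f x * g x) (%x. f x *\<^sub>R G x + g x *\<^sub>R F x)"
	unfolding has_C1_gradient_def
proof (intro conjI allI)
	show "continuous_on UNIV (%x. f x *\<^sub>R G x + g x *\<^sub>R F x)"
		using assms has_C1_gradient_continuous[OF assms(1)] has_C1_gradient_continuous[OF assms(2)]
		by (auto simp: has_C1_gradient_def intro!: continuous_intros)
	fix x
	have "((%x. f x * g x) has_derivative (%h. f x * (G x \<bullet> h) + F x \<bullet> h * g x)) (at x)"
		using assms by (intro has_derivative_mult) (auto simp: has_C1_gradient_def)
	then show "((%x. f x * g x) has_derivative (\<bullet>) (f x *\<^sub>R G x + g x *\<^sub>R F x)) (at x)"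
		by (rule has_derivative_eq_rhs) (simp add: fun_eq_iff inner_add_left)
qed

lemma has_C1_gradient_compose:
	assumes "has_C1_gradient f F" "\<And>t. (n has_real_derivative \<eta>' t) (at t)" "continuous_on UNIV \<eta>'"
	shows "has_C1_gradient (%x. n (f x)) (%x. \<eta>' (f x) *\<^sub>R F x)"
	unfolding has_C1_gradient_def
proof (intro conjI allI)
	show "continuous_on UNIV (%x. \<eta>' (f x) *\<^sub>R F x)"
		using assms has_C1_gradient_continuous[OF assms(1)]
		by (auto simp: has_C1_gradient_def intro!: continuous_intros continuous_on_compose2[OF assms(3)])
	fix x
	have "(f has_derivative (%h. F x \<bullet> h)) (at x)" using assms by (simp add: has_C1_gradient_def)
	from has_derivative_compose[OF this assms(2)[THEN has_field_derivative_imp_has_derivative]]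
	show "((%x. n (f x)) has_derivative (\<bullet>) (\<eta>' (f x) *\<^sub>R F x)) (at x)"
		by (rule has_derivative_eq_rhs) (simp add: fun_eq_iff)
qed

lemma weak_gradient_pairing:
	assumes u: "u \<in> L2" and wg: "is_weak_gradient u g"
		and G: "has_C1_gradient p G" "vanishes_beyond R p" and i: "i \<in> Basis"
	shows "(LINT x. u x * (G x \<bullet> i)) = - (LINT x. (g x \<bullet> i) * p x)"
proof (rule weak_derivative_C1[OF L2_loc_integrable[OF u] _ i open_UNIV _ G(1) compact_cball[of 0 R]])
	have "g \<in> L2" using wg by (simp add: is_weak_gradient_def)
	then have "(%x. g x \<bullet> i) \<in> L2"
		using i by (rule_tac L2_dominated[where c = 1]) (auto simp: L2_def Basis_le_norm)
	then show "loc_integrable (%x. g x \<bullet> i)" by (rule L2_loc_integrable)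
qed (use wg i G in \<open>auto simp: is_weak_gradient_def vanishes_beyond_def\<close>)

lemma is_weak_gradientI:
	assumes "g \<in> L2"
		and "\<And>p G R i. has_C1_gradient p G ==> vanishes_beyond R p ==> i \<in> Basis ==>
			(LINT x. u x * (G x \<bullet> i)) = - (LINT x. (g x \<bullet> i) * p x)"
	shows "is_weak_gradient u g"
	unfolding is_weak_gradient_def
proof (intro conjI ballI)
	fix p :: "R3 => real" and i :: R3 assume "p \<in> test_functions UNIV" and i: "i \<in> Basis"
	then obtain G R where G: "has_C1_gradient p G" "vanishes_beyond R p"
		"\<And>x i. i \<in> Basis ==> frechet_derivative p (at x) i = G x \<bullet> i"
		using test_functionsE by metis
	show "(LINT x. u x * frechet_derivative p (at x) i) = - (LINT x. g x \<bullet> i * p x)"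
		using assms(2)[OF G(1,2) i] G(3)[OF i] by simp
qed (rule assms)

lemma weak_gradient_L2: "is_weak_gradient u g ==> g \<in> L2"
	by (simp add: is_weak_gradient_def)

lemma L2_component: "g \<in> L2 ==> (%x. g x \<bullet> (i :: R3)) \<in> L2"
	by (rule L2_dominated[where f = g and c = "norm i"])
		(auto simp: L2_def mult.commute intro!: AE_I2 order_trans[OF Cauchy_Schwarz_ineq2])

lemma C1_vanishes_L2:
	fixes p :: "R3 => real"
	assumes "has_C1_gradient p G" "vanishes_beyond R p"
	shows "p \<in> L2" "G \<in> L2"
	using assms has_C1_gradient_continuous[OF assms(1)] has_C1_gradient_vanishes[OF assms]
	by (auto intro!: L2_continuous_vanishes simp: has_C1_gradient_def)

lemma is_weak_gradient_unique:
	assumes u: "u \<in> L2" and g: "is_weak_gradient u g" "is_weak_gradient u g'"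
	shows "AE x. g x = g' x"
proof -
	have "AE x. g x \<bullet> i - g' x \<bullet> i = 0" if i: "i \<in> Basis" for i
	proof (rule fundamental_lemma)
		have gi: "(%x. g x \<bullet> i) \<in> L2" "(%x. g' x \<bullet> i) \<in> L2"
			using g by (auto intro: L2_component weak_gradient_L2)
		show "loc_integrable (%x. g x \<bullet> i - g' x \<bullet> i)"
			by (intro L2_loc_integrable L2_diff gi)
		fix q :: "R3 => real" assume t: "q \<in> test_functions UNIV"
		then obtain G R where G: "has_C1_gradient q G" "vanishes_beyond R q"
			using test_functionsE by metis
		have p: "q \<in> L2" using C1_vanishes_L2[OF G] by simp
		show "(LINT x. (g x \<bullet> i - g' x \<bullet> i) * q x) = 0"
			using weak_gradient_pairing[OF u g(1) G i] weak_gradient_pairing[OF u g(2) G i]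
				L2_mult_integrable[OF gi(1) p] L2_mult_integrable[OF gi(2) p]
			by (simp add: left_diff_distrib)
	qed
	then have "\<forall>i\<in>Basis. AE x. g x \<bullet> i - g' x \<bullet> i = 0" by (rule ballI)
	then have "AE x. \<forall>i\<in>Basis. g x \<bullet> i - g' x \<bullet> i = 0"
		unfolding AE_ball_countable[OF countable_finite[OF finite_Basis]] .
	then show ?thesis
	proof (rule eventually_mono)
		fix x assume "\<forall>i\<in>Basis. g x \<bullet> i - g' x \<bullet> i = 0"
		then show "g x = g' x" by (intro euclidean_eqI[of "g x" "g' x"]) simp
	qed
qed

lemma H1_L2: "u \<in> H1 ==> u \<in> L2"
	by (simp add: H1_def)

lemma H1_weak_gradient: "u \<in> H1 ==> is_weak_gradient u (weak_gradient u)"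
	unfolding weak_gradient_def H1_def using someI_ex[of "is_weak_gradient u"] by simp

lemma H1_gradient_L2: "u \<in> H1 ==> weak_gradient u \<in> L2"
	using H1_weak_gradient weak_gradient_L2 by blast

lemma H1I: "u \<in> L2 ==> is_weak_gradient u g ==> u \<in> H1"
	by (auto simp: H1_def)

lemma weak_gradient_AE:
	assumes "u \<in> L2" "is_weak_gradient u g"
	shows "AE x. weak_gradient u x = g x"
	using is_weak_gradient_unique[OF assms(1) H1_weak_gradient[OF H1I[OF assms]] assms(2)] .

lemma is_weak_gradient_add:
	assumes "u \<in> L2" "is_weak_gradient u g" "v \<in> L2" "is_weak_gradient v h"
	shows "is_weak_gradient (%x. u x + v x) (%x. g x + h x)"
proof (rule is_weak_gradientI)
	show "(%x. g x + h x) \<in> L2" using assms by (intro L2_add weak_gradient_L2)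
	fix q :: "R3 => real" and G R and i :: R3 assume G: "has_C1_gradient q G" "vanishes_beyond R q" and i: "i \<in> Basis"
	note p = C1_vanishes_L2[OF G] and gi = L2_component[OF weak_gradient_L2[OF assms(2)], of i] L2_component[OF weak_gradient_L2[OF assms(4)], of i]
	show "(LINT x. (u x + v x) * (G x \<bullet> i)) = - (LINT x. (g x + h x) \<bullet> i * q x)"
		using weak_gradient_pairing[OF assms(1,2) G i] weak_gradient_pairing[OF assms(3,4) G i]
			L2_mult_integrable[OF assms(1) L2_component[OF p(2)]] L2_mult_integrable[OF assms(3) L2_component[OF p(2)]]
			L2_mult_integrable[OF gi(1) p(1)] L2_mult_integrable[OF gi(2) p(1)]
		by (simp add: distrib_right inner_add_left)
qed

lemma is_weak_gradient_scale:
	assumes "is_weak_gradient u g"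
	shows "is_weak_gradient (%x. c * u x) (%x. c *\<^sub>R g x)"
	using assms L2_scale[of g c] by (auto simp: is_weak_gradient_def mult.assoc)

lemma is_weak_gradient_C1:
	assumes s: "has_C1_gradient s S" "vanishes_beyond R s"
	shows "is_weak_gradient s S"
proof (rule is_weak_gradientI)
	show "S \<in> L2" using C1_vanishes_L2[OF s] by simp
	fix y :: "R3 => real" and G R' and i :: R3 assume G: "has_C1_gradient y G" "vanishes_beyond R' y" and i: "i \<in> Basis"
	note p = C1_vanishes_L2[OF G] and q = C1_vanishes_L2[OF s]
	have "(LINT x. (s x *\<^sub>R G x + y x *\<^sub>R S x) \<bullet> i) = 0"
		by (rule integral_C1_gradient[OF has_C1_gradient_mult[OF s(1) G(1)], where R = R])
			(use s in \<open>auto simp: vanishes_beyond_def\<close>)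
	then show "(LINT x. s x * (G x \<bullet> i)) = - (LINT x. S x \<bullet> i * y x)"
		using L2_mult_integrable[OF q(1) L2_component[OF p(2)]] L2_mult_integrable[OF p(1) L2_component[OF q(2)]]
		by (simp add: inner_add_left mult.commute)
qed

text \<open>Testing \<open>u\<close> with the product of \<open>z\<close> and a test function, which
  is only C^1, moves the Leibniz rule to the classical side. Boundedness of \<open>z\<close> and
  \<open>Z\<close> keeps every term square integrable.\<close>

lemma is_weak_gradient_mult:
	assumes u: "u \<in> L2" "is_weak_gradient u g" and Z: "has_C1_gradient z Z"
		and B: "\<And>x. \<bar>z x\<bar> \<le> B" "\<And>x. norm (Z x) \<le> B"
	shows "(%x. z x * u x) \<in> L2" "is_weak_gradient (%x. z x * u x) (%x. z x *\<^sub>R g x + u x *\<^sub>R Z x)"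
proof -
	have m: "z \<in> borel_measurable lebesgue" "Z \<in> borel_measurable lebesgue"
		using has_C1_gradient_continuous[OF Z] Z by (auto intro!: continuous_lebesgue_measurable simp: has_C1_gradient_def)
	show zu: "(%x. z x * u x) \<in> L2"
		using m(1) L2_measurable[OF u(1)]
		by (intro L2_dominated[OF u(1), where c = B]) (auto simp: abs_mult intro!: mult_right_mono B AE_I2)
	have zg: "(%x. z x *\<^sub>R g x) \<in> L2"
		using m(1) L2_measurable[OF weak_gradient_L2[OF u(2)]]
		by (intro L2_dominated[OF weak_gradient_L2[OF u(2)], where c = B]) (auto intro!: mult_right_mono B AE_I2)
	have uZ: "(%x. u x *\<^sub>R Z x) \<in> L2"
		using m(2) L2_measurable[OF u(1)]
		by (intro L2_dominated[OF u(1), where c = B]) (auto simp: mult.commute[of _ "norm (Z _)"] intro!: mult_right_mono B AE_I2)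
	show "is_weak_gradient (%x. z x * u x) (%x. z x *\<^sub>R g x + u x *\<^sub>R Z x)"
	proof (rule is_weak_gradientI)
		show "(%x. z x *\<^sub>R g x + u x *\<^sub>R Z x) \<in> L2" by (rule L2_add[OF zg uZ])
		fix q :: "R3 => real" and G R and i :: R3 assume G: "has_C1_gradient q G" "vanishes_beyond R q" and i: "i \<in> Basis"
		note p = C1_vanishes_L2[OF G]
		have v: "vanishes_beyond R (%x. z x * q x)" using G by (simp add: vanishes_beyond_def)
		have "(LINT x. u x * ((z x *\<^sub>R G x + q x *\<^sub>R Z x) \<bullet> i)) = - (LINT x. g x \<bullet> i * (z x * q x))"
			by (rule weak_gradient_pairing[OF u has_C1_gradient_mult[OF Z G(1)] v i])
		moreover have "(LINT x. u x * ((z x *\<^sub>R G x + q x *\<^sub>R Z x) \<bullet> i))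
				= (LINT x. (z x * u x) * (G x \<bullet> i)) + (LINT x. ((u x *\<^sub>R Z x) \<bullet> i) * q x)"
			using L2_mult_integrable[OF zu L2_component[OF p(2), of i]] L2_mult_integrable[OF L2_component[OF uZ, of i] p(1)]
			by (simp add: inner_add_left algebra_simps)
		moreover have "(LINT x. ((z x *\<^sub>R g x + u x *\<^sub>R Z x) \<bullet> i) * q x)
				= (LINT x. g x \<bullet> i * (z x * q x)) + (LINT x. ((u x *\<^sub>R Z x) \<bullet> i) * q x)"
			using L2_mult_integrable[OF L2_component[OF zg, of i] p(1)] L2_mult_integrable[OF L2_component[OF uZ, of i] p(1)]
			by (simp add: inner_add_left algebra_simps)
		ultimately show "(LINT x. z x * u x * (G x \<bullet> i)) = - (LINT x. (z x *\<^sub>R g x + u x *\<^sub>R Z x) \<bullet> i * q x)"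
			by simp
	qed
qed

lemma L2_tendsto_pairing:
	fixes f :: "nat => R3 => 'b::euclidean_space"
	assumes "\<And>n. f n \<in> L2" "g \<in> L2" "h \<in> L2" "(%n. L2_norm (%x. f n x - g x)) \<longlonglongrightarrow> 0"
	shows "(%n. LINT x. f n x \<bullet> h x) \<longlonglongrightarrow> (LINT x. g x \<bullet> h x)"
proof (rule LIM_zero_cancel, rule tendsto_rabs_zero_cancel, rule tendsto_sandwich[where f = "%_. 0"])
	show "(%n. L2_norm (%x. f n x - g x) * L2_norm h) \<longlonglongrightarrow> 0"
		using tendsto_mult_left_zero[OF assms(4)] .
	show "\<forall>\<^sub>F n in sequentially. \<bar>(LINT x. f n x \<bullet> h x) - (LINT x. g x \<bullet> h x)\<bar> \<le> L2_norm (%x. f n x - g x) * L2_norm h"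
	proof (rule always_eventually, rule allI)
		fix n
		have "(LINT x. f n x \<bullet> h x) - (LINT x. g x \<bullet> h x) = (LINT x. (f n x - g x) \<bullet> h x)"
			using L2_inner_integrable[OF assms(1)[of n] assms(3)] L2_inner_integrable[OF assms(2,3)]
			by (simp add: inner_diff_left)
		then show "\<bar>(LINT x. f n x \<bullet> h x) - (LINT x. g x \<bullet> h x)\<bar> \<le> L2_norm (%x. f n x - g x) * L2_norm h"
			using L2_Cauchy_Schwarz[OF L2_diff[OF assms(1)[of n] assms(2)] assms(3)] by simp
	qed
qed auto

lemma is_weak_gradient_limit:
	assumes "\<And>n. u n \<in> L2" "\<And>n. is_weak_gradient (u n) (g n)" "v \<in> L2" "h \<in> L2"
		"(%n. L2_norm (%x. u n x - v x)) \<longlonglongrightarrow> 0" "(%n. L2_norm (%x. g n x - h x)) \<longlonglongrightarrow> 0"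
	shows "is_weak_gradient v h"
proof (rule is_weak_gradientI[OF assms(4)])
	fix q :: "R3 => real" and G R and i :: R3 assume G: "has_C1_gradient q G" "vanishes_beyond R q" and i: "i \<in> Basis"
	note p = C1_vanishes_L2[OF G]
	have gn: "g n \<in> L2" for n using assms(2) by (rule weak_gradient_L2)
	have "(%n. LINT x. u n x \<bullet> (G x \<bullet> i)) \<longlonglongrightarrow> (LINT x. v x \<bullet> (G x \<bullet> i))"
		by (intro L2_tendsto_pairing assms L2_component p)
	moreover have "(%n. - (LINT x. g n x \<bullet> (q x *\<^sub>R i))) \<longlonglongrightarrow> - (LINT x. h x \<bullet> (q x *\<^sub>R i))"
		using p(1) L2_measurable[OF p(1)]
		by (intro tendsto_minus L2_tendsto_pairing assms gn L2_dominated[OF p(1), where c = "norm i"]) auto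
	moreover have "(LINT x. u n x \<bullet> (G x \<bullet> i)) = - (LINT x. g n x \<bullet> (q x *\<^sub>R i))" for n
		using weak_gradient_pairing[OF assms(1,2) G i, of n] by (simp add: mult.commute)
	ultimately have "(LINT x. v x \<bullet> (G x \<bullet> i)) = - (LINT x. h x \<bullet> (q x *\<^sub>R i))"
		using LIMSEQ_unique by simp
	then show "(LINT x. v x * (G x \<bullet> i)) = - (LINT x. h x \<bullet> i * q x)"
		by (simp add: mult.commute)
qed

section \<open>Chain rule and truncation for weak gradients\<close>

lemma has_C1_gradient_reflect:
	assumes "has_C1_gradient F G" shows "has_C1_gradient (%y. F (x - y)) (%y. - G (x - y))"
	unfolding has_C1_gradient_def
proof (intro conjI allI)
	show "continuous_on UNIV (%y. - G (x - y))"
		using assms by (auto simp: has_C1_gradient_def intro!: continuous_intros continuous_on_compose2[of UNIV G])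
	fix y
	have "((%y. x - y) has_derivative (%h. - h)) (at y)"
		by (auto intro!: derivative_eq_intros)
	moreover have "(F has_derivative (%h. G (x - y) \<bullet> h)) (at (x - y))"
		using assms by (simp add: has_C1_gradient_def)
	ultimately have "((%y. F (x - y)) has_derivative (%h. G (x - y) \<bullet> (- h))) (at y)"
		by (rule has_derivative_compose)
	then show "((%y. F (x - y)) has_derivative (\<bullet>) (- G (x - y))) (at y)"
		by (rule has_derivative_eq_rhs) (simp add: fun_eq_iff)
qed

text \<open>The weak identity, tested with the reflected mollifier, moves the derivative from the
  kernel to \<open>u\<close>: mollification commutes with the gradient.\<close>

lemma mollify_weak_gradient:
	assumes u: "u \<in> L2" "is_weak_gradient u g" and d: "e > 0"
	obtains U where "has_C1_gradient (conv (mollifier e) u) U"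
		"\<And>x i. i \<in> Basis ==> U x \<bullet> i = conv (mollifier e) (%y. g y \<bullet> i) x"
proof -
	let ?m = "mollifier e :: R3 => real"
	obtain M where M: "has_C1_gradient ?m M" using Ck_has_C1_gradient[OF Ck_mollifier[OF d]] by metis
	have v: "vanishes_beyond e ?m" by (rule mollifier_vanishes[OF d])
	have vM: "vanishes_beyond e M" by (rule has_C1_gradient_vanishes[OF M v])
	have "conv M u x \<bullet> i = conv ?m (%y. g y \<bullet> i) x" if i: "i \<in> Basis" for x i
	proof -
		have "(LINT y. u y * (- M (x - y) \<bullet> i)) = - (LINT y. (g y \<bullet> i) * ?m (x - y))"
			by (rule weak_gradient_pairing[OF u has_C1_gradient_reflect[OF M] _ i, where R = "norm x + e"])
				(simp add: vanishes_beyond_def vanishes_reflect[OF v])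
		moreover have "conv M u x \<bullet> i = conv (%z. M z \<bullet> i) u x"
			using M by (intro conv_inner[OF _ vM L2_loc_integrable[OF u(1)]]) (simp add: has_C1_gradient_def)
		ultimately show ?thesis by (simp add: conv_def)
	qed
	then show ?thesis using that[OF conv_derivative[OF M v L2_loc_integrable[OF u(1)]]] by blast
qed

lemma L2_bounded_mult:
	fixes f :: "R3 => 'b::euclidean_space"
	assumes "f \<in> L2" "a \<in> borel_measurable lebesgue" "\<And>x. \<bar>a x\<bar> \<le> B"
	shows "(%x. a x *\<^sub>R f x) \<in> L2"
	using assms L2_measurable[OF assms(1)]
	by (intro L2_dominated[OF assms(1), where c = B]) (auto intro!: mult_right_mono AE_I2)

text \<open>For the mollified \<open>un\<close> the identity is the classical chain rule together
  with the vanishing integral of a gradient. On the left the limit uses that \<open>h\<close> is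
  Lipschitz; on the right the mollified gradient is replaced first, then the argument of
  \<open>\<eta>'\<close>.\<close>

lemma is_weak_gradient_compose:
	assumes u: "u \<in> L2" "is_weak_gradient u g"
		and h: "\<And>t. (h has_real_derivative \<eta>' t) (at t)" "continuous_on UNIV \<eta>'" "\<And>t. \<bar>\<eta>' t\<bar> \<le> 1" "h 0 = 0"
	shows "(%x. h (u x)) \<in> L2" "is_weak_gradient (%x. h (u x)) (%x. \<eta>' (u x) *\<^sub>R g x)"
proof -
	have c\<eta>: "continuous_on UNIV h" using h(1) by (meson DERIV_isCont continuous_at_imp_continuous_on)
	have lip: "\<bar>h a - h b\<bar> \<le> \<bar>a - b\<bar>" for a b
		using field_differentiable_bound[of UNIV h \<eta>' 1 a b] h(1,3) by auto
	have le: "\<bar>h t\<bar> \<le> \<bar>t\<bar>" for t using lip[of t 0] h(4) by simp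
	have um: "u \<in> borel_measurable lebesgue" and gm: "g \<in> borel_measurable lebesgue"
		using u weak_gradient_L2 L2_measurable by blast+
	have \<eta>m: "h \<in> borel_measurable borel" "\<eta>' \<in> borel_measurable borel"
		using c\<eta> h(2) by (auto intro: borel_measurable_continuous_onI)
	note m = measurable_compose[OF um \<eta>m(1)] measurable_compose[OF um \<eta>m(2)]
	show \<eta>u: "(%x. h (u x)) \<in> L2" using m le by (intro L2_dominated[OF u(1), where c = 1]) auto
	have \<eta>g: "(%x. \<eta>' (u x) *\<^sub>R g x) \<in> L2"
		by (rule L2_bounded_mult[OF weak_gradient_L2[OF u(2)] m(2) h(3)])
	show "is_weak_gradient (%x. h (u x)) (%x. \<eta>' (u x) *\<^sub>R g x)"
	proof (rule is_weak_gradientI[OF \<eta>g])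
		fix q :: "R3 => real" and G R and i :: R3
		assume G: "has_C1_gradient q G" "vanishes_beyond R q" and i: "i \<in> Basis"
		have RG: "vanishes_beyond R G" by (rule has_C1_gradient_vanishes[OF G])
		have c\<phi>: "continuous_on UNIV q" using G(1) by (rule has_C1_gradient_continuous)
		have cG: "continuous_on UNIV G" using G by (simp add: has_C1_gradient_def)
		note p = C1_vanishes_L2[OF G]
		obtain B1 where B1: "\<And>x. norm (q x) \<le> B1" "B1 > 0" using vanishes_bounded[OF c\<phi> G(2)] by metis
		obtain B2 where B2: "\<And>x. norm (G x) \<le> B2" "B2 > 0" using vanishes_bounded[OF cG RG] by metis
		define gi where "gi x = g x \<bullet> i" for x
		have gi: "gi \<in> L2" unfolding gi_def[abs_def] using weak_gradient_L2[OF u(2)] by (rule L2_component)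
		define un where "un n = conv (mollifier (1 / real (Suc n))) u" for n
		define gn where "gn n = conv (mollifier (1 / real (Suc n))) gi" for n
		have "\<exists>U. \<forall>n. has_C1_gradient (un n) (U n) \<and> (\<forall>x. U n x \<bullet> i = gn n x)"
		proof (rule choice, rule allI)
			fix n
			obtain U where "has_C1_gradient (un n) U" "\<And>x. U x \<bullet> i = gn n x"
				unfolding un_def gn_def gi_def[abs_def] using mollify_weak_gradient[OF u, of "1 / real (Suc n)"] i
				by (metis divide_pos_pos of_nat_0_less_iff zero_less_Suc zero_less_one)
			then show "\<exists>U. has_C1_gradient (un n) U \<and> (\<forall>x. U x \<bullet> i = gn n x)" by blast
		qed
		then obtain U where U: "\<And>n. has_C1_gradient (un n) (U n)" "\<And>n x. U n x \<bullet> i = gn n x" by metis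
		have cun: "continuous_on UNIV (un n)" for n using U(1) by (rule has_C1_gradient_continuous)
		have cU: "continuous_on UNIV (U n)" for n using U(1) by (simp add: has_C1_gradient_def)
		have cgn: "continuous_on UNIV (gn n)" for n unfolding U(2)[symmetric] by (intro continuous_intros cU)
		have c1: "continuous_on UNIV (%x. h (un n x))" "continuous_on UNIV (%x. \<eta>' (un n x))" for n
			by (auto intro!: continuous_on_compose2[OF c\<eta> cun] continuous_on_compose2[OF h(2) cun])
		have id: "(LINT x. h (un n x) * (G x \<bullet> i)) = - (LINT x. \<eta>' (un n x) * gn n x * q x)" for n
		proof -
			have "(LINT x. (h (un n x) *\<^sub>R G x + q x *\<^sub>R (\<eta>' (un n x) *\<^sub>R U n x)) \<bullet> i) = 0"
				using G(2)
				by (intro integral_C1_gradient[OF has_C1_gradient_mult[OF has_C1_gradient_compose[OF U(1) h(1,2)] G(1)], where R = R])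
					(simp add: vanishes_beyond_def)
			moreover have "integrable lebesgue (%x. h (un n x) * (G x \<bullet> i))"
				using RG by (intro continuous_vanishes_integrable[where R = R] continuous_intros c1 cG) (simp add: vanishes_beyond_def)
			moreover have "integrable lebesgue (%x. \<eta>' (un n x) * gn n x * q x)"
				using G(2) by (intro continuous_vanishes_integrable[where R = R] continuous_intros c1 cgn c\<phi>) (simp add: vanishes_beyond_def)
			ultimately show ?thesis by (simp add: inner_add_left U(2) algebra_simps)
		qed
		have lim1: "(%n. LINT x. indicator (cball 0 R) x * \<bar>un n x - u x\<bar>) \<longlonglongrightarrow> 0"
			unfolding un_def by (rule mollify_loc_tendsto[OF L2_loc_integrable[OF u(1)]])
		have lim2: "(%n. LINT x. indicator (cball 0 R) x * \<bar>gn n x - gi x\<bar>) \<longlonglongrightarrow> 0"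
			unfolding gn_def by (rule mollify_loc_tendsto[OF L2_loc_integrable[OF gi]])
		have int1: "integrable lebesgue (%x. indicator (cball 0 R) x * \<bar>un n x - u x\<bar>)" for n
			unfolding un_def by (rule mollify_loc_integrable[OF L2_loc_integrable[OF u(1)]]) simp
		have int2: "integrable lebesgue (%x. indicator (cball 0 R) x * \<bar>gn n x - gi x\<bar>)" for n
			unfolding gn_def by (rule mollify_loc_integrable[OF L2_loc_integrable[OF gi]]) simp
		\<comment> \<open>As \<open>\<eta>'\<close> is merely continuous, convergence of
		  \<open>\<eta>' (un n x)\<close> needs convergence almost everywhere, which convergence in L^1
		  provides along a subsequence.\<close>
		obtain r where r: "strict_mono r" "AE x. (%n. indicator (cball 0 R) x * \<bar>un (r n) x - u x\<bar>) \<longlonglongrightarrow> 0"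
			using tendsto_L1_AE_subseq[where u = "%n x. indicator (cball 0 R) x * \<bar>un n x - u x\<bar>", OF int1] lim1
			by (auto simp: abs_mult)
		have L: "(%n. LINT x. h (un n x) * (G x \<bullet> i)) \<longlonglongrightarrow> (LINT x. h (u x) * (G x \<bullet> i))"
		proof (rule LIM_zero_cancel, rule Lim_null_comparison)
			show "(%n. B2 * (LINT x. indicator (cball 0 R) x * \<bar>un n x - u x\<bar>)) \<longlonglongrightarrow> 0"
				using tendsto_mult_right_zero[OF lim1] .
			show "\<forall>\<^sub>F n in sequentially. norm ((LINT x. h (un n x) * (G x \<bullet> i)) - (LINT x. h (u x) * (G x \<bullet> i)))
					\<le> B2 * (LINT x. indicator (cball 0 R) x * \<bar>un n x - u x\<bar>)"
			proof (rule always_eventually, rule allI)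
				fix n
				have i1: "integrable lebesgue (%x. h (un n x) * (G x \<bullet> i))"
					using RG by (intro continuous_vanishes_integrable[where R = R] continuous_intros c1 cG) (simp add: vanishes_beyond_def)
				have i2: "integrable lebesgue (%x. h (u x) * (G x \<bullet> i))"
					by (rule L2_mult_integrable[OF \<eta>u L2_component[OF p(2)]])
				have "norm ((LINT x. h (un n x) * (G x \<bullet> i)) - (LINT x. h (u x) * (G x \<bullet> i)))
						= norm (LINT x. h (un n x) * (G x \<bullet> i) - h (u x) * (G x \<bullet> i))"
					using i1 i2 by simp
				also have "\<dots> \<le> (LINT x. norm (h (un n x) * (G x \<bullet> i) - h (u x) * (G x \<bullet> i)))"
					by (rule integral_norm_bound)
				also have "\<dots> \<le> (LINT x. B2 * (indicator (cball 0 R) x * \<bar>un n x - u x\<bar>))"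
				proof (rule integral_mono)
					fix x
					show "norm (h (un n x) * (G x \<bullet> i) - h (u x) * (G x \<bullet> i)) \<le> B2 * (indicator (cball 0 R) x * \<bar>un n x - u x\<bar>)"
					proof (cases "norm x \<le> R")
						case True
						have "\<bar>G x \<bullet> i\<bar> \<le> B2" using B2(1)[of x] Basis_le_norm[OF i, of "G x"] by linarith
						then have "\<bar>h (un n x) - h (u x)\<bar> * \<bar>G x \<bullet> i\<bar> \<le> \<bar>un n x - u x\<bar> * B2"
							by (intro mult_mono lip) auto
						moreover have "h (un n x) * (G x \<bullet> i) - h (u x) * (G x \<bullet> i) = (h (un n x) - h (u x)) * (G x \<bullet> i)"
							by (simp only: left_diff_distrib)
						ultimately show ?thesis using True by (simp add: abs_mult mult.commute)
					next
						case False
						then show ?thesis using RG by (simp add: vanishes_beyond_def)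
					qed
				qed (use i1 i2 int1 in auto)
				finally show "norm ((LINT x. h (un n x) * (G x \<bullet> i)) - (LINT x. h (u x) * (G x \<bullet> i)))
					\<le> B2 * (LINT x. indicator (cball 0 R) x * \<bar>un n x - u x\<bar>)" by simp
			qed
		qed
		have i0: "integrable lebesgue (%x. gi x * q x)" by (rule L2_mult_integrable[OF gi p(1)])
		have un_m: "un n \<in> borel_measurable lebesgue" for n by (rule continuous_lebesgue_measurable[OF cun])
		have i3: "integrable lebesgue (%x. (\<eta>' (un n x)) * (gi x * q x))" for n
			using i0 by (rule Bochner_Integration.integrable_bound)
				(use measurable_compose[OF un_m \<eta>m(2)] i0 h(3) in \<open>auto simp: abs_mult intro!: mult_left_le_one_le\<close>)
		have i4: "integrable lebesgue (%x. (\<eta>' (u x)) * (gi x * q x))"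
			using i0 by (rule Bochner_Integration.integrable_bound)
				(use m(2) i0 h(3) in \<open>auto simp: abs_mult intro!: mult_left_le_one_le\<close>)
		have i5: "integrable lebesgue (%x. \<eta>' (un n x) * gn n x * q x)" for n
			using G(2) by (intro continuous_vanishes_integrable[where R = R] continuous_intros c1 cgn c\<phi>) (simp add: vanishes_beyond_def)
		\<comment> \<open>First stage: \<open>\<eta>'\<close> is bounded by 1, so L^1 convergence of the
		  mollified gradient on the support of \<open>q\<close> suffices.\<close>
		have R1: "(%n. (LINT x. \<eta>' (un n x) * gn n x * q x) - (LINT x. \<eta>' (un n x) * (gi x * q x))) \<longlonglongrightarrow> 0"
		proof (rule Lim_null_comparison)
			show "(%n. B1 * (LINT x. indicator (cball 0 R) x * \<bar>gn n x - gi x\<bar>)) \<longlonglongrightarrow> 0"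
				using tendsto_mult_right_zero[OF lim2] .
			show "\<forall>\<^sub>F n in sequentially. norm ((LINT x. \<eta>' (un n x) * gn n x * q x) - (LINT x. \<eta>' (un n x) * (gi x * q x)))
					\<le> B1 * (LINT x. indicator (cball 0 R) x * \<bar>gn n x - gi x\<bar>)"
			proof (rule always_eventually, rule allI)
				fix n
				have "norm ((LINT x. \<eta>' (un n x) * gn n x * q x) - (LINT x. \<eta>' (un n x) * (gi x * q x)))
						= norm (LINT x. \<eta>' (un n x) * gn n x * q x - \<eta>' (un n x) * (gi x * q x))"
					using i3 i5 by simp
				also have "\<dots> \<le> (LINT x. norm (\<eta>' (un n x) * gn n x * q x - \<eta>' (un n x) * (gi x * q x)))"
					by (rule integral_norm_bound)
				also have "\<dots> \<le> (LINT x. B1 * (indicator (cball 0 R) x * \<bar>gn n x - gi x\<bar>))"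
				proof (rule integral_mono)
					fix x
					show "norm (\<eta>' (un n x) * gn n x * q x - \<eta>' (un n x) * (gi x * q x)) \<le> B1 * (indicator (cball 0 R) x * \<bar>gn n x - gi x\<bar>)"
					proof (cases "norm x \<le> R")
						case True
						have "\<bar>\<eta>' (un n x)\<bar> * (\<bar>gn n x - gi x\<bar> * \<bar>q x\<bar>) \<le> 1 * (\<bar>gn n x - gi x\<bar> * B1)"
							using h(3) B1(1)[of x] by (intro mult_mono) auto
						moreover have "\<eta>' (un n x) * gn n x * q x - \<eta>' (un n x) * (gi x * q x) = \<eta>' (un n x) * ((gn n x - gi x) * q x)"
							by (simp add: algebra_simps)
						ultimately show ?thesis using True by (simp add: abs_mult mult.commute)
					next
						case False
						then show ?thesis using G(2) by (simp add: vanishes_beyond_def)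
					qed
				qed (use i3 i5 int2 in auto)
				finally show "norm ((LINT x. \<eta>' (un n x) * gn n x * q x) - (LINT x. \<eta>' (un n x) * (gi x * q x)))
					\<le> B1 * (LINT x. indicator (cball 0 R) x * \<bar>gn n x - gi x\<bar>)" by simp
			qed
		qed
		have R2: "(%n. LINT x. \<eta>' (un (r n) x) * (gi x * q x)) \<longlonglongrightarrow> (LINT x. \<eta>' (u x) * (gi x * q x))"
		proof (rule integral_dominated_convergence[where w = "%x. \<bar>gi x * q x\<bar>"])
			show "AE x. (%n. \<eta>' (un (r n) x) * (gi x * q x)) \<longlonglongrightarrow> \<eta>' (u x) * (gi x * q x)"
				using r(2)
			proof (rule eventually_mono)
				fix x assume x: "(%n. indicator (cball 0 R) x * \<bar>un (r n) x - u x\<bar>) \<longlonglongrightarrow> 0"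
				show "(%n. \<eta>' (un (r n) x) * (gi x * q x)) \<longlonglongrightarrow> \<eta>' (u x) * (gi x * q x)"
				proof (cases "norm x \<le> R")
					case True
					then have "(%n. un (r n) x) \<longlonglongrightarrow> u x" using x by (simp add: tendsto_rabs_zero_iff LIM_zero_iff)
					then have "(%n. \<eta>' (un (r n) x)) \<longlonglongrightarrow> \<eta>' (u x)"
						using h(2) by (intro isCont_tendsto_compose[of "u x" \<eta>']) (auto simp: continuous_on_eq_continuous_at)
					then show ?thesis by (intro tendsto_intros)
				next
					case False then show ?thesis using G(2) by (simp add: vanishes_beyond_def)
				qed
			qed
			show "AE x. norm (\<eta>' (un (r n) x) * (gi x * q x)) \<le> \<bar>gi x * q x\<bar>" for n
				using h(3) by (auto simp: abs_mult intro!: mult_left_le_one_le)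
		qed (use i0 i3 i4 in auto)
		have "(%n. (LINT x. \<eta>' (un (r n) x) * gn (r n) x * q x) - (LINT x. \<eta>' (un (r n) x) * (gi x * q x))) \<longlonglongrightarrow> 0"
			using LIMSEQ_subseq_LIMSEQ[OF R1 r(1)] by (simp add: o_def)
		from tendsto_minus[OF tendsto_add[OF this R2]]
		have "(%n. LINT x. h (un (r n) x) * (G x \<bullet> i)) \<longlonglongrightarrow> - (LINT x. \<eta>' (u x) * (gi x * q x))"
			by (simp add: id)
		moreover have "(%n. LINT x. h (un (r n) x) * (G x \<bullet> i)) \<longlonglongrightarrow> (LINT x. h (u x) * (G x \<bullet> i))"
			using LIMSEQ_subseq_LIMSEQ[OF L r(1)] by (simp add: o_def)
		ultimately have "(LINT x. h (u x) * (G x \<bullet> i)) = - (LINT x. \<eta>' (u x) * (gi x * q x))"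
			using LIMSEQ_unique by blast
		then show "(LINT x. h (u x) * (G x \<bullet> i)) = - (LINT x. (\<eta>' (u x) *\<^sub>R g x) \<bullet> i * q x)"
			by (simp add: gi_def mult.assoc)
	qed
qed

lemma DERIV_max_0_square: "((%t. (max 0 t)^2) has_real_derivative 2 * max 0 t) (at (t::real))"
proof -
	consider "t > 0" | "t < 0" | "t = 0" by linarith
	then show ?thesis
	proof cases
		case 1
		have "((%t. t^2) has_real_derivative 2 * max 0 t) (at t)"
			using 1 by (auto intro!: derivative_eq_intros)
		then show ?thesis
			by (rule has_field_derivative_transform_within_open[of _ _ _ "{0<..}"]) (use 1 in auto)
	next
		case 2
		have "((%t. 0) has_real_derivative 2 * max 0 t) (at t)" using 2 by simp
		then show ?thesis
			by (rule has_field_derivative_transform_within_open[of _ _ _ "{..<0}"]) (use 2 in auto)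
	next
		case 3
		have "((%h::real. (max 0 h)^2 / h) \<longlongrightarrow> 0) (at 0)"
		proof (rule Lim_null_comparison)
			show "((%h::real. \<bar>h\<bar>) \<longlongrightarrow> 0) (at 0)" by (intro tendsto_rabs_zero tendsto_ident_at)
			show "\<forall>\<^sub>F h::real in at 0. norm ((max 0 h)^2 / h) \<le> \<bar>h\<bar>"
				by (auto simp: eventually_at_filter max_def power2_eq_square)
		qed
		then show ?thesis using 3 by (simp add: DERIV_def)
	qed
qed

text \<open>The positive part is not C^1. The functions \<open>h e\<close> are C^1: they have slope
  between 0 and 1, vanish for t <= 0 and tend to the positive part with \<open>e\<close>. Their
  derivatives converge to 1 for t > 0 and to 0 elsewhere, which fixes the value of the gradient on
  the zero set of \<open>u\<close>.\<close>

lemma is_weak_gradient_pos_part: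
	assumes u: "u \<in> L2" "is_weak_gradient u g"
	shows "(%x. max 0 (u x)) \<in> L2" "is_weak_gradient (%x. max 0 (u x)) (%x. if u x > 0 then g x else 0)"
proof -
	define h where "h e t = sqrt ((max 0 t)^2 + e^2) - e" for e t :: real
	define \<eta>' where "\<eta>' e t = max 0 t / sqrt ((max 0 t)^2 + e^2)" for e t :: real
	have pos: "(max 0 t)^2 + e^2 > 0" if "e > 0" for e t :: real
		using that by (intro add_nonneg_pos) auto
	have d: "(h e has_real_derivative \<eta>' e t) (at t)" if "e > 0" for e t
		unfolding h_def[abs_def] \<eta>'_def
		by (rule DERIV_cong[OF DERIV_diff[OF DERIV_chain2[OF DERIV_real_sqrt[OF pos[OF that]] DERIV_add[OF DERIV_max_0_square DERIV_const]] DERIV_const]])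
			(simp add: divide_simps)
	have c: "continuous_on UNIV (\<eta>' e)" if "e > 0" for e
		unfolding \<eta>'_def[abs_def] using that by (intro continuous_intros) auto
	have b: "\<bar>\<eta>' e t\<bar> \<le> 1" if "e > 0" for e t
	proof -
		have "max 0 t \<le> sqrt ((max 0 t)^2 + e^2)" by (rule real_le_rsqrt) simp
		then show ?thesis unfolding \<eta>'_def using pos[OF that, of t] by (simp add: divide_le_eq)
	qed
	have z: "h e 0 = 0" if "e > 0" for e using that by (simp add: h_def)
	have le: "\<bar>h e t\<bar> \<le> \<bar>t\<bar>" if "e > 0" for e t
		using field_differentiable_bound[of UNIV "h e" "\<eta>' e" 1 t 0] d[OF that] b[OF that] z[OF that] by auto
	define en where "en n = 1 / real (Suc n)" for n
	have en: "en n > 0" for n by (simp add: en_def)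
	have en0: "en \<longlonglongrightarrow> 0" unfolding en_def[abs_def] by (rule LIMSEQ_Suc[OF lim_1_over_n])
	have lim1: "(%n. h (en n) t) \<longlonglongrightarrow> max 0 t" for t
	proof -
		have "(%n. h (en n) t) \<longlonglongrightarrow> sqrt ((max 0 t)^2 + 0^2) - 0"
			unfolding h_def by (intro tendsto_intros en0)
		then show ?thesis by simp
	qed
	have lim2: "(%n. \<eta>' (en n) t) \<longlonglongrightarrow> (if t > 0 then 1 else 0)" for t
	proof (cases "t > 0")
		case True
		have "(%n. \<eta>' (en n) t) \<longlonglongrightarrow> max 0 t / sqrt ((max 0 t)^2 + 0^2)"
			unfolding \<eta>'_def using True by (intro tendsto_intros en0) auto
		then show ?thesis using True by simp
	next
		case False then show ?thesis by (simp add: \<eta>'_def)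
	qed
	have um [measurable]: "u \<in> borel_measurable lebesgue" and gm [measurable]: "g \<in> borel_measurable lebesgue"
		using u weak_gradient_L2 L2_measurable by blast+
	show pu: "(%x. max 0 (u x)) \<in> L2" by (rule L2_dominated[OF u(1), where c = 1]) auto
	have pg: "(%x. if u x > 0 then g x else 0) \<in> L2"
		by (rule L2_dominated[OF weak_gradient_L2[OF u(2)], where c = 1]) auto
	show "is_weak_gradient (%x. max 0 (u x)) (%x. if u x > 0 then g x else 0)"
	proof (rule is_weak_gradientI[OF pg])
		fix q :: "R3 => real" and G R and i :: R3
		assume G: "has_C1_gradient q G" "vanishes_beyond R q" and i: "i \<in> Basis"
		note p = C1_vanishes_L2[OF G]
		note gi = L2_component[OF weak_gradient_L2[OF u(2)], of i]
		note w = is_weak_gradient_compose[OF u d[OF en] c[OF en] b[OF en] z[OF en]]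
		have id: "(LINT x. h (en n) (u x) * (G x \<bullet> i)) = - (LINT x. (\<eta>' (en n) (u x) *\<^sub>R g x) \<bullet> i * q x)" for n
			by (rule weak_gradient_pairing[OF w G i])
		have "(%n. LINT x. h (en n) (u x) * (G x \<bullet> i)) \<longlonglongrightarrow> (LINT x. max 0 (u x) * (G x \<bullet> i))"
		proof (rule integral_dominated_convergence[where w = "%x. \<bar>u x * (G x \<bullet> i)\<bar>"])
			show "integrable lebesgue (%x. \<bar>u x * (G x \<bullet> i)\<bar>)"
				using L2_mult_integrable[OF u(1) L2_component[OF p(2)]] by simp
			show "AE x. (%n. h (en n) (u x) * (G x \<bullet> i)) \<longlonglongrightarrow> max 0 (u x) * (G x \<bullet> i)"
				by (intro AE_I2 tendsto_intros lim1)
			show "AE x. norm (h (en n) (u x) * (G x \<bullet> i)) \<le> \<bar>u x * (G x \<bullet> i)\<bar>" for n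
				using le[OF en] by (auto simp: abs_mult intro!: mult_right_mono)
			show "(%x. h (en n) (u x) * (G x \<bullet> i)) \<in> borel_measurable lebesgue" for n
				using L2_measurable[OF w(1)] L2_measurable[OF L2_component[OF p(2)]] by (rule borel_measurable_times)
			show "(%x. max 0 (u x) * (G x \<bullet> i)) \<in> borel_measurable lebesgue"
				using L2_measurable[OF pu] L2_measurable[OF L2_component[OF p(2)]] by (rule borel_measurable_times)
		qed
		moreover have "(%n. LINT x. (\<eta>' (en n) (u x) *\<^sub>R g x) \<bullet> i * q x) \<longlonglongrightarrow> (LINT x. (if u x > 0 then g x else 0) \<bullet> i * q x)"
		proof (rule integral_dominated_convergence[where w = "%x. \<bar>(g x \<bullet> i) * q x\<bar>"])
			show "integrable lebesgue (%x. \<bar>(g x \<bullet> i) * q x\<bar>)"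
				using L2_mult_integrable[OF gi p(1)] by simp
			show "AE x. (%n. (\<eta>' (en n) (u x) *\<^sub>R g x) \<bullet> i * q x) \<longlonglongrightarrow> (if u x > 0 then g x else 0) \<bullet> i * q x"
			proof (rule AE_I2)
				fix x
				have "(%n. (\<eta>' (en n) (u x) *\<^sub>R g x) \<bullet> i * q x) \<longlonglongrightarrow> ((if u x > 0 then 1 else 0) *\<^sub>R g x) \<bullet> i * q x"
					by (intro tendsto_intros lim2)
				then show "(%n. (\<eta>' (en n) (u x) *\<^sub>R g x) \<bullet> i * q x) \<longlonglongrightarrow> (if u x > 0 then g x else 0) \<bullet> i * q x"
					by (simp split: if_splits)
			qed
			show "AE x. norm ((\<eta>' (en n) (u x) *\<^sub>R g x) \<bullet> i * q x) \<le> \<bar>(g x \<bullet> i) * q x\<bar>" for n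
				using b[OF en] by (auto simp: abs_mult mult.assoc intro!: mult_left_le_one_le)
			show "(%x. (\<eta>' (en n) (u x) *\<^sub>R g x) \<bullet> i * q x) \<in> borel_measurable lebesgue" for n
				using L2_measurable[OF L2_component[OF weak_gradient_L2[OF w(2)]]] L2_measurable[OF p(1)] by (rule borel_measurable_times)
			show "(%x. (if u x > 0 then g x else 0) \<bullet> i * q x) \<in> borel_measurable lebesgue"
				using L2_measurable[OF L2_component[OF pg]] L2_measurable[OF p(1)] by (rule borel_measurable_times)
		qed
		ultimately show "(LINT x. max 0 (u x) * (G x \<bullet> i)) = - (LINT x. (if 0 < u x then g x else 0) \<bullet> i * q x)"
			using LIMSEQ_unique tendsto_minus unfolding id by blast
	qed
qed

section \<open>The comparison principle\<close>

lemma is_weak_gradient_diff: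
	assumes "u \<in> L2" "is_weak_gradient u g" "v \<in> L2" "is_weak_gradient v h"
	shows "is_weak_gradient (%x. u x - v x) (%x. g x - h x)"
proof -
	have m: "(%x. - 1 * v x) \<in> L2" using L2_scale[OF assms(3), of "-1"] by simp
	show ?thesis
		using is_weak_gradient_add[OF assms(1,2) m is_weak_gradient_scale[OF assms(4), of "-1"]] by simp
qed

locale two_layer =
	fixes \<gamma>p \<gamma>m :: real
	assumes gamma_m_pos: "0 < \<gamma>m" and gamma_m_less: "\<gamma>m < \<gamma>p"
begin

abbreviation \<gamma>0 :: "R3 => real" where "\<gamma>0 \<equiv> gamma0 \<gamma>p \<gamma>m"

lemma gamma0_bounds: "\<gamma>m \<le> \<gamma>0 x" "\<gamma>0 x \<le> \<gamma>p" "0 < \<gamma>0 x" "\<bar>\<gamma>0 x\<bar> \<le> \<gamma>p"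
	using gamma_m_pos gamma_m_less by (auto simp: gamma0_def)

lemma gamma0_measurable: "\<gamma>0 \<in> borel_measurable lebesgue"
proof -
	have "open {x::R3. x $ 3 > 0}" by (intro open_Collect_less continuous_intros)
	then have [measurable]: "{x::R3. x $ 3 > 0} \<in> sets lebesgue"
		using borel_open by (simp add: sets_completionI_sets)
	have "gamma0 \<gamma>p \<gamma>m = (%x. if x \<in> {x::R3. x $ 3 > 0} then \<gamma>p else \<gamma>m)"
		by (auto simp: gamma0_def fun_eq_iff)
	also have "\<dots> \<in> borel_measurable lebesgue" by measurable
	finally show ?thesis .
qed

lemma gamma0_L2: "f \<in> L2 ==> (%x. \<gamma>0 x *\<^sub>R (f x :: 'b::euclidean_space)) \<in> L2"
	by (rule L2_bounded_mult[OF _ gamma0_measurable gamma0_bounds(4)])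

lemma gamma0_inner_integrable:
	fixes f g :: "R3 => 'b::euclidean_space"
	assumes "f \<in> L2" "g \<in> L2" shows "integrable lebesgue (%x. \<gamma>0 x * (f x \<bullet> g x))"
	using L2_inner_integrable[OF gamma0_L2[OF assms(1)] assms(2)] by simp

text \<open>\<open>weak_gradient p\<close> is an unspecified choice; uniqueness almost everywhere
  lets the equation be tested with any given weak gradient \<open>P\<close>.\<close>

lemma elliptic_test:
	assumes v: "elliptic_weak_solution \<gamma>0 s f v" and p: "p \<in> L2" "is_weak_gradient p P"
	shows "(LINT x. \<gamma>0 x * (weak_gradient v x \<bullet> P x)) + s^2 * (LINT x. v x * p x) = (LINT x. f x * p x)"
proof -
	have h: "p \<in> H1" by (rule H1I[OF p])
	have vL: "weak_gradient v \<in> L2" using v by (auto simp: elliptic_weak_solution_def intro: H1_gradient_L2)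
	have "(LINT x. (\<gamma>0 x *\<^sub>R weak_gradient v x) \<bullet> weak_gradient p x) = (LINT x. \<gamma>0 x * (weak_gradient v x \<bullet> P x))"
	proof (rule integral_cong_AE)
		show "(%x. (\<gamma>0 x *\<^sub>R weak_gradient v x) \<bullet> weak_gradient p x) \<in> borel_measurable lebesgue"
			using L2_inner_integrable[OF gamma0_L2[OF vL] H1_gradient_L2[OF h]] by (rule borel_measurable_integrable)
		show "(%x. \<gamma>0 x * (weak_gradient v x \<bullet> P x)) \<in> borel_measurable lebesgue"
			using gamma0_inner_integrable[OF vL weak_gradient_L2[OF p(2)]] by (rule borel_measurable_integrable)
		show "AE x. (\<gamma>0 x *\<^sub>R weak_gradient v x) \<bullet> weak_gradient p x = \<gamma>0 x * (weak_gradient v x \<bullet> P x)"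
			using weak_gradient_AE[OF p] by (rule eventually_mono) simp
	qed
	moreover have "(LINT x. (\<gamma>0 x *\<^sub>R weak_gradient v x) \<bullet> weak_gradient p x) + s^2 * (LINT x. v x * p x) = (LINT x. f x * p x)"
		using v h unfolding elliptic_weak_solution_def by blast
	ultimately show ?thesis by (simp only:)
qed

end

text \<open>Componentwise integration by parts of the field \<open>z\<close> times \<open>S\<close>
  against \<open>P\<close>. With \<open>H i\<close> the gradient of the component
  \<open>S x \<bullet> i\<close>, the sum of all \<open>H i x \<bullet> i\<close> is the Laplacian
  of \<open>s\<close>. The weight \<open>z\<close> will be 1 or a smoothed step across the
  interface.\<close>

lemma divergence_pairing:
	assumes S: "has_C1_gradient s S" "vanishes_beyond R s"
		and H: "\<And>i. i \<in> Basis ==> has_C1_gradient (%x. S x \<bullet> i) (H i)"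
		and p: "p \<in> L2" "is_weak_gradient p P"
		and Z: "has_C1_gradient z Z"
	shows "(LINT x. z x * (S x \<bullet> P x)) = - (LINT x. (z x * (\<Sum>i\<in>Basis. H i x \<bullet> i) + Z x \<bullet> S x) * p x)"
		and "integrable lebesgue (%x. (z x * (\<Sum>i\<in>Basis. H i x \<bullet> i) + Z x \<bullet> S x) * p x)"
		and "integrable lebesgue (%x. z x * (S x \<bullet> P x))"
proof -
	let ?F = "%i x. z x * (S x \<bullet> i)" and ?G = "%i x. z x *\<^sub>R H i x + (S x \<bullet> i) *\<^sub>R Z x"
	have RS: "vanishes_beyond R S" by (rule has_C1_gradient_vanishes[OF S])
	have F: "has_C1_gradient (?F i) (?G i)" "vanishes_beyond R (?F i)" if "i \<in> Basis" for i
		using has_C1_gradient_mult[OF Z H[OF that]] RS by (auto simp: vanishes_beyond_def)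
	have FL: "?F i \<in> L2" "?G i \<in> L2" if "i \<in> Basis" for i using C1_vanishes_L2[OF F[OF that]] by auto
	have Pi: "(%x. P x \<bullet> i) \<in> L2" for i by (rule L2_component[OF weak_gradient_L2[OF p(2)]])
	have eq: "(LINT x. p x * (?G i x \<bullet> i)) = - (LINT x. (P x \<bullet> i) * ?F i x)" if i: "i \<in> Basis" for i
		by (rule weak_gradient_pairing[OF p F[OF i] i])
	have i1: "integrable lebesgue (%x. p x * (?G i x \<bullet> i))" if i: "i \<in> Basis" for i
		by (rule L2_mult_integrable[OF p(1) L2_component[OF FL(2)[OF i]]])
	have i2: "integrable lebesgue (%x. (P x \<bullet> i) * ?F i x)" if i: "i \<in> Basis" for i
		by (rule L2_mult_integrable[OF Pi FL(1)[OF i]])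
	have e1: "(\<Sum>i\<in>Basis. p x * (?G i x \<bullet> i)) = (z x * (\<Sum>i\<in>Basis. H i x \<bullet> i) + Z x \<bullet> S x) * p x" for x
		unfolding euclidean_inner[of "Z x" "S x"]
		by (simp add: inner_add_left sum.distrib sum_distrib_left sum_distrib_right algebra_simps)
	have e2: "(\<Sum>i\<in>Basis. (P x \<bullet> i) * ?F i x) = z x * (S x \<bullet> P x)" for x
		unfolding euclidean_inner[of "S x" "P x"] by (simp add: sum_distrib_left algebra_simps)
	have s1: "integrable lebesgue (%x. \<Sum>i\<in>Basis. p x * (?G i x \<bullet> i))"
		by (intro Bochner_Integration.integrable_sum i1)
	have s2: "integrable lebesgue (%x. \<Sum>i\<in>Basis. (P x \<bullet> i) * ?F i x)"
		by (intro Bochner_Integration.integrable_sum i2)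
	show "integrable lebesgue (%x. (z x * (\<Sum>i\<in>Basis. H i x \<bullet> i) + Z x \<bullet> S x) * p x)" using s1 unfolding e1 .
	show "integrable lebesgue (%x. z x * (S x \<bullet> P x))" using s2 unfolding e2 .
	have "(LINT x. (\<Sum>i\<in>Basis. p x * (?G i x \<bullet> i))) = - (LINT x. (\<Sum>i\<in>Basis. (P x \<bullet> i) * ?F i x))"
	proof -
		have "(LINT x. (\<Sum>i\<in>Basis. p x * (?G i x \<bullet> i))) = (\<Sum>i\<in>Basis. LINT x. p x * (?G i x \<bullet> i))"
			by (rule Bochner_Integration.integral_sum) (rule i1)
		also have "\<dots> = (\<Sum>i\<in>Basis. - (LINT x. (P x \<bullet> i) * ?F i x))"
			by (rule sum.cong[OF refl]) (rule eq)
		also have "\<dots> = - (\<Sum>i\<in>Basis. LINT x. (P x \<bullet> i) * ?F i x)" by (rule sum_negf)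
		also have "(\<Sum>i\<in>Basis. LINT x. (P x \<bullet> i) * ?F i x) = (LINT x. (\<Sum>i\<in>Basis. (P x \<bullet> i) * ?F i x))"
			by (rule Bochner_Integration.integral_sum[symmetric]) (rule i2)
		finally show ?thesis .
	qed
	then show "(LINT x. z x * (S x \<bullet> P x)) = - (LINT x. (z x * (\<Sum>i\<in>Basis. H i x \<bullet> i) + Z x \<bullet> S x) * p x)"
		unfolding e1 e2 by simp
qed

text \<open>A C^1 approximation of the Heaviside function: 0 for t <= 0, nondecreasing, 1 from 1 /
  (n + 1) on. Squares of positive parts make the derivative continuous. It serves both as a smoothed
  coefficient jump and as a cut-off in time.\<close>

definition smooth_step :: "nat => real => real" where
	"smooth_step n t = 1 - (max 0 (1 - (real (Suc n))^2 * (max 0 t)^2))^2"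

definition smooth_step' :: "nat => real => real" where
	"smooth_step' n t = 2 * max 0 (1 - (real (Suc n))^2 * (max 0 t)^2) * ((real (Suc n))^2 * (2 * max 0 t))"

lemma DERIV_smooth_step: "(smooth_step n has_real_derivative smooth_step' n t) (at t)"
proof -
	have "((%t. 1 - (real (Suc n))^2 * (max 0 t)^2) has_real_derivative 0 - (real (Suc n))^2 * (2 * max 0 t)) (at t)"
		by (intro DERIV_diff DERIV_const DERIV_cmult DERIV_max_0_square)
	from DERIV_diff[OF DERIV_const[of 1] DERIV_chain2[OF DERIV_max_0_square this]]
	show ?thesis unfolding smooth_step_def[abs_def] smooth_step'_def by simp
qed

lemma continuous_smooth_step': "continuous_on UNIV (smooth_step' n)"
	unfolding smooth_step'_def[abs_def] by (intro continuous_intros)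

lemma smooth_step_bounds: "0 \<le> smooth_step n t" "smooth_step n t \<le> 1"
proof -
	have "(max 0 (1 - (real (Suc n))^2 * (max 0 t)^2))^2 \<le> 1^2" by (rule power_mono) auto
	then show "0 \<le> smooth_step n t" by (simp add: smooth_step_def)
	show "smooth_step n t \<le> 1" by (simp add: smooth_step_def)
qed

lemma smooth_step'_nonneg: "0 \<le> smooth_step' n t"
	by (simp add: smooth_step'_def)

lemma smooth_step_eq_0: "t \<le> 0 ==> smooth_step n t = 0" "t \<le> 0 ==> smooth_step' n t = 0"
	by (simp_all add: smooth_step_def smooth_step'_def)

lemma smooth_step_eq_1:
	assumes "t \<ge> 1 / real (Suc n)" shows "smooth_step n t = 1" "smooth_step' n t = 0"
proof -
	have "t > 0" using assms by (rule less_le_trans[rotated]) simp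
	have "1 \<le> real (Suc n) * t" using assms by (simp add: field_simps)
	then have "1^2 \<le> (real (Suc n) * t)^2" by (intro power_mono) auto
	then have "1 - (real (Suc n))^2 * (max 0 t)^2 \<le> 0" using \<open>t > 0\<close> by (simp add: power_mult_distrib)
	then show "smooth_step n t = 1" "smooth_step' n t = 0" by (simp_all add: smooth_step_def smooth_step'_def)
qed

lemma smooth_step_tendsto: "(%n. smooth_step n t) \<longlonglongrightarrow> (if t > 0 then 1 else 0)"
proof (cases "t > 0")
	case True
	then obtain N where N: "1 / real (Suc N) < t" by (rule nat_approx_posE)
	have "smooth_step n t = 1" if "n \<ge> N" for n
	proof -
		have "1 / real (Suc n) \<le> 1 / real (Suc N)" using that by (simp add: frac_le)
		then show ?thesis using N by (intro smooth_step_eq_1) simp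
	qed
	then have "\<forall>\<^sub>F n in sequentially. smooth_step n t = 1" by (auto simp: eventually_sequentially)
	then show ?thesis using True by (simp add: tendsto_eventually)
next
	case False then show ?thesis by (simp add: smooth_step_eq_0)
qed

lemma component_axis: "x $ k = x \<bullet> (axis k 1 :: R3)"
	by (simp add: inner_axis)

context two_layer begin

text \<open>The flux of \<open>\<gamma>0 \<nabla>s\<close> jumps upwards across the interface by \<open>(\<gamma>p - \<gamma>m) \<partial>\<^sub>3 s\<close>, which has the right sign
	for a subsolution. Traces are avoided by smoothing the step of \<open>\<gamma>0\<close> from above.\<close>

lemma subsolution_pairing:
	assumes S: "has_C1_gradient s S" "vanishes_beyond R s"
		and H: "\<And>i. i \<in> Basis ==> has_C1_gradient (%x. S x \<bullet> i) (H i)"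
		and c: "c > 0" "\<And>x. 0 \<le> x $ 3 ==> x $ 3 \<le> c ==> S x $ 3 \<ge> 0"
		and p: "p \<in> L2" "is_weak_gradient p P" "\<And>x. p x \<ge> 0"
	shows "(LINT x. \<gamma>0 x * (S x \<bullet> P x)) \<le> (LINT x. - (\<gamma>0 x * (\<Sum>i\<in>Basis. H i x \<bullet> i)) * p x)"
		and "integrable lebesgue (%x. - (\<gamma>0 x * (\<Sum>i\<in>Basis. H i x \<bullet> i)) * p x)"
proof -
	define L where "L x = (\<Sum>i\<in>Basis. H i x \<bullet> i)" for x
	have one: "has_C1_gradient (%x::R3. 1) (%x. 0)"
		by (simp add: has_C1_gradient_def)
	note d1 = divergence_pairing[OF S H p(1,2) one, folded L_def]
	have iL: "integrable lebesgue (%x. L x * p x)" and iS: "integrable lebesgue (%x. S x \<bullet> P x)"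
		and eq1: "(LINT x. S x \<bullet> P x) = - (LINT x. L x * p x)"
		using d1 by simp_all
	have gm: "integrable lebesgue (%x. a x * g x)"
		if "a \<in> borel_measurable lebesgue" "\<And>x. \<bar>a x\<bar> \<le> B" "integrable lebesgue g" for a g :: "R3 => real" and B
	proof (rule Bochner_Integration.integrable_bound)
		show "integrable lebesgue (%x. B * \<bar>g x\<bar>)" using that by simp
		show "AE x. norm (a x * g x) \<le> norm (B * \<bar>g x\<bar>)"
		proof (rule AE_I2)
			fix x
			have "B \<ge> 0" using that(2)[of 0] by linarith
			then show "norm (a x * g x) \<le> norm (B * \<bar>g x\<bar>)" using that(2)[of x] by (simp add: abs_mult mult_right_mono)
		qed
	qed (use that in auto)
	have "integrable lebesgue (%x. \<gamma>0 x * (L x * p x))"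
		by (rule gm[OF gamma0_measurable gamma0_bounds(4) iL])
	then show "integrable lebesgue (%x. - (\<gamma>0 x * (\<Sum>i\<in>Basis. H i x \<bullet> i)) * p x)"
		unfolding L_def[symmetric] by (simp add: mult.assoc)
	have proj: "has_C1_gradient (%x::R3. x $ 3) (%x. axis 3 1)"
		unfolding component_axis has_C1_gradient_def by (auto intro!: derivative_eq_intros simp: inner_commute)
	have hn: "has_C1_gradient (%x::R3. smooth_step n (x $ 3)) (%x. smooth_step' n (x $ 3) *\<^sub>R axis 3 1)" for n
		by (rule has_C1_gradient_compose[OF proj DERIV_smooth_step continuous_smooth_step'])
	note d2 = divergence_pairing[OF S H p(1,2) hn, folded L_def]
	have hm: "(%x::R3. smooth_step n (x $ 3)) \<in> borel_measurable lebesgue" for n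
		by (intro continuous_lebesgue_measurable has_C1_gradient_continuous[OF hn])
	have iLh: "integrable lebesgue (%x. smooth_step n (x $ 3) * (L x * p x))" for n
		by (rule gm[OF hm _ iL, where B = 1]) (use smooth_step_bounds in simp)
	have step: "(LINT x. smooth_step n (x $ 3) * (S x \<bullet> P x)) \<le> - (LINT x. smooth_step n (x $ 3) * (L x * p x))"
		if n: "1 / real (Suc n) \<le> c" for n
	proof -
		have sg: "(smooth_step' n (x $ 3) *\<^sub>R axis 3 1) \<bullet> S x \<ge> 0" for x
		proof -
			have *: "(smooth_step' n (x $ 3) *\<^sub>R axis 3 1) \<bullet> S x = smooth_step' n (x $ 3) * S x $ 3"
				by (simp add: component_axis inner_commute)
			show ?thesis
			proof (cases "0 < x $ 3 \<and> x $ 3 \<le> c")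
				case True then show ?thesis unfolding * using c(2)[of x] smooth_step'_nonneg by simp
			next
				case False
				then have "smooth_step' n (x $ 3) = 0"
					using n by (cases "x $ 3 > 0") (auto intro: smooth_step_eq_0 smooth_step_eq_1)
				then show ?thesis unfolding * by simp
			qed
		qed
		have "(LINT x. smooth_step n (x $ 3) * (L x * p x)) \<le> (LINT x. (smooth_step n (x $ 3) * L x + (smooth_step' n (x $ 3) *\<^sub>R axis 3 1) \<bullet> S x) * p x)"
		proof (rule integral_mono[OF iLh])
			show "integrable lebesgue (%x. (smooth_step n (x $ 3) * L x + (smooth_step' n (x $ 3) *\<^sub>R axis 3 1) \<bullet> S x) * p x)"
				by (rule d2(2))
			show "smooth_step n (x $ 3) * (L x * p x) \<le> (smooth_step n (x $ 3) * L x + (smooth_step' n (x $ 3) *\<^sub>R axis 3 1) \<bullet> S x) * p x" for x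
				using mult_nonneg_nonneg[OF sg[of x] p(3)[of x]] by (simp only: distrib_right mult.assoc)
		qed
		then show ?thesis using d2(1) by simp
	qed
	define J where "J x = (if (x::R3) $ 3 > 0 then 1 else 0 :: real)" for x
	have Jm: "J \<in> borel_measurable lebesgue"
	proof (rule borel_measurable_LIMSEQ_metric)
		show "(%x::R3. smooth_step n (x $ 3)) \<in> borel_measurable lebesgue" for n by (rule hm)
		show "(%n. smooth_step n (x $ 3)) \<longlonglongrightarrow> J x" for x unfolding J_def by (rule smooth_step_tendsto)
	qed
	have J1: "\<bar>J x\<bar> \<le> 1" for x by (simp add: J_def)
	have dom: "(%n. LINT x. smooth_step n (x $ 3) * g x) \<longlonglongrightarrow> (LINT x. J x * g x)" if "integrable lebesgue g" for g :: "R3 => real"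
	proof (rule integral_dominated_convergence[where w = "%x. \<bar>g x\<bar>"])
		show "AE x. (%n. smooth_step n (x $ 3) * g x) \<longlonglongrightarrow> J x * g x"
			unfolding J_def by (intro AE_I2 tendsto_intros smooth_step_tendsto)
		show "AE x. norm (smooth_step n (x $ 3) * g x) \<le> \<bar>g x\<bar>" for n
			using smooth_step_bounds by (auto simp: abs_mult intro!: mult_left_le_one_le)
	qed (use that Jm hm in auto)
	have "(LINT x. J x * (S x \<bullet> P x)) \<le> - (LINT x. J x * (L x * p x))"
	proof (rule LIMSEQ_le[OF dom[OF iS] tendsto_minus[OF dom[OF iL]]])
		obtain N where N: "1 / real (Suc N) < c" using c(1) by (rule nat_approx_posE)
		have "1 / real (Suc n) \<le> c" if "n \<ge> N" for n
		proof -
			have "1 / real (Suc n) \<le> 1 / real (Suc N)" using that by (simp add: frac_le)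
			then show ?thesis using N by simp
		qed
		then show "\<exists>N. \<forall>n\<ge>N. (LINT x. smooth_step n (x $ 3) * (S x \<bullet> P x)) \<le> - (LINT x. smooth_step n (x $ 3) * (L x * p x))"
			using step by blast
	qed
	then have "(\<gamma>p - \<gamma>m) * (LINT x. J x * (S x \<bullet> P x)) \<le> (\<gamma>p - \<gamma>m) * - (LINT x. J x * (L x * p x))"
		using gamma_m_less by (intro mult_left_mono) auto
	\<comment> \<open>\<open>\<gamma>0\<close> is a constant plus a positive multiple of the step
	  \<open>J\<close>. Positivity of \<open>\<gamma>p - \<gamma>m\<close> preserves the inequality
	  obtained for \<open>J\<close>; for the constant part equality holds.\<close>
	moreover have split: "(LINT x. \<gamma>0 x * g x) = \<gamma>m * (LINT x. g x) + (\<gamma>p - \<gamma>m) * (LINT x. J x * g x)"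
		if "integrable lebesgue g" for g :: "R3 => real"
	proof -
		have "\<gamma>0 x * g x = \<gamma>m * g x + (\<gamma>p - \<gamma>m) * (J x * g x)" for x
			by (simp add: gamma0_def J_def algebra_simps)
		then show ?thesis using that gm[OF Jm J1 that] by simp
	qed
	ultimately have "(LINT x. \<gamma>0 x * (S x \<bullet> P x)) \<le> - (LINT x. \<gamma>0 x * (L x * p x))"
		unfolding split[OF iS] split[OF iL] eq1 by simp
	then show "(LINT x. \<gamma>0 x * (S x \<bullet> P x)) \<le> (LINT x. - (\<gamma>0 x * (\<Sum>i\<in>Basis. H i x \<bullet> i)) * p x)"
		unfolding L_def[symmetric] by (simp add: mult.assoc)
qed

text \<open>The equation for \<open>v\<close> and the inequality for \<open>s\<close> are tested
  with the positive part \<open>p\<close> of \<open>s - v\<close>; the energy of \<open>p\<close>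
  comes out nonpositive. Where \<open>v x \<ge> s x\<close> is known beforehand \<open>p\<close>
  vanishes, so the differential inequality may fail there. This lets a barrier be a subsolution only
  outside the ball in which it is already dominated.\<close>

lemma comparison_principle:
	assumes t: "t > 0" and v: "elliptic_weak_solution \<gamma>0 t f v" and f: "f \<in> L2"
		and S: "has_C1_gradient s S" "vanishes_beyond R s"
		and H: "\<And>i. i \<in> Basis ==> has_C1_gradient (%x. S x \<bullet> i) (H i)"
		and c: "c > 0" "\<And>x. 0 \<le> x $ 3 ==> x $ 3 \<le> c ==> S x $ 3 \<ge> 0"
		and sub: "AE x. v x \<ge> s x \<or> t^2 * s x - \<gamma>0 x * (\<Sum>i\<in>Basis. H i x \<bullet> i) \<le> f x"
	shows "AE x. v x \<ge> s x"
proof -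
	have vH: "v \<in> H1" using v by (simp add: elliptic_weak_solution_def)
	note vL = H1_L2[OF vH] and vg = H1_weak_gradient[OF vH]
	note sL = C1_vanishes_L2[OF S] and sg = is_weak_gradient_C1[OF S]
	define L where "L x = (\<Sum>i\<in>Basis. H i x \<bullet> i)" for x
	define p where "p x = max 0 (s x - v x)" for x
	define P where "P x = (if s x - v x > 0 then S x - weak_gradient v x else 0)" for x
	have p: "p \<in> L2" "is_weak_gradient p P"
		unfolding p_def[abs_def] P_def[abs_def]
		using is_weak_gradient_pos_part[OF L2_diff[OF sL(1) vL] is_weak_gradient_diff[OF sL(1) sg vL vg]] by auto
	have \<phi>0: "p x \<ge> 0" for x by (simp add: p_def)
	have P: "P \<in> L2" by (rule weak_gradient_L2[OF p(2)])
	note sp = subsolution_pairing[OF S H c p \<phi>0, folded L_def]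
	note vt = elliptic_test[OF v p]
	have i: "integrable lebesgue (%x. s x * p x)" "integrable lebesgue (%x. f x * p x)" "integrable lebesgue (%x. v x * p x)"
		by (intro L2_mult_integrable sL f vL p)+
	have gi: "integrable lebesgue (%x. \<gamma>0 x * (S x \<bullet> P x))" "integrable lebesgue (%x. \<gamma>0 x * (weak_gradient v x \<bullet> P x))"
		by (intro gamma0_inner_integrable sL P H1_gradient_L2 vH)+
	have "(LINT x. \<gamma>0 x * (S x \<bullet> P x)) - (LINT x. \<gamma>0 x * (weak_gradient v x \<bullet> P x)) = (LINT x. \<gamma>0 x * (P x \<bullet> P x))"
		unfolding Bochner_Integration.integral_diff[OF gi, symmetric]
		by (intro Bochner_Integration.integral_cong) (auto simp: P_def inner_diff_left right_diff_distrib)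
	moreover have "(LINT x. \<gamma>0 x * (P x \<bullet> P x)) \<ge> 0"
		using gamma0_bounds(3) by (intro Bochner_Integration.integral_nonneg) (simp add: less_imp_le)
	moreover have "(LINT x. s x * p x) - (LINT x. v x * p x) = (LINT x. p x * p x)"
		unfolding Bochner_Integration.integral_diff[OF i(1,3), symmetric]
		by (intro Bochner_Integration.integral_cong) (auto simp: p_def max_def algebra_simps)
	moreover have "(LINT x. - (\<gamma>0 x * L x) * p x) + t^2 * (LINT x. s x * p x) - (LINT x. f x * p x) \<le> 0"
	proof -
		have "(LINT x. - (\<gamma>0 x * L x) * p x + t^2 * (s x * p x) - f x * p x) \<le> (LINT x|(lebesgue :: R3 measure). 0)"
		proof (rule integral_mono_AE)
			show "AE x. - (\<gamma>0 x * L x) * p x + t^2 * (s x * p x) - f x * p x \<le> 0"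
				using sub
			proof (rule eventually_mono)
				fix x assume *: "v x \<ge> s x \<or> t^2 * s x - \<gamma>0 x * (\<Sum>i\<in>Basis. H i x \<bullet> i) \<le> f x"
				show "- (\<gamma>0 x * L x) * p x + t^2 * (s x * p x) - f x * p x \<le> 0"
				proof (cases "v x \<ge> s x")
					case True then show ?thesis by (simp add: p_def)
				next
					case False
					then have "(t^2 * s x - \<gamma>0 x * L x - f x) * p x \<le> 0"
						using * \<phi>0[of x] by (intro mult_nonpos_nonneg) (auto simp: L_def)
					then show ?thesis by (simp add: algebra_simps)
				qed
			qed
		qed (use sp(2) i in auto)
		then show ?thesis using sp(2) i by simp
	qed
	ultimately have "t^2 * (LINT x. p x * p x) \<le> 0"
		using sp(1) vt by (simp add: algebra_simps)
	then have "(LINT x. p x * p x) \<le> 0" using t by (simp add: mult_le_0_iff)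
	moreover have "(L2_norm p)^2 = (LINT x. p x * p x)" unfolding L2_norm_power2 by (simp add: power2_eq_square)
	ultimately have "L2_norm p = 0" by (metis power2_less_eq_zero_iff)
	then have "AE x. p x = 0" by (rule L2_norm_eq_0[OF p(1)])
	then show ?thesis by (rule eventually_mono) (auto simp: p_def max_def split: if_splits)
qed

end

section \<open>Radial subsolutions and the lower bound\<close>

lemma has_C1_gradient_compose_on:
	assumes "has_C1_gradient f F" "\<And>x. (n has_real_derivative \<eta>' (f x)) (at (f x))" "continuous_on UNIV (%x. \<eta>' (f x))"
	shows "has_C1_gradient (%x. n (f x)) (%x. \<eta>' (f x) *\<^sub>R F x)"
	unfolding has_C1_gradient_def
proof (intro conjI allI)
	show "continuous_on UNIV (%x. \<eta>' (f x) *\<^sub>R F x)"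
		using assms by (auto simp: has_C1_gradient_def intro!: continuous_intros)
	fix x
	have "(f has_derivative (%h. F x \<bullet> h)) (at x)" using assms by (simp add: has_C1_gradient_def)
	from has_derivative_compose[OF this assms(2)[THEN has_field_derivative_imp_has_derivative]]
	show "((%x. n (f x)) has_derivative (\<bullet>) (\<eta>' (f x) *\<^sub>R F x)) (at x)"
		by (rule has_derivative_eq_rhs) (simp add: fun_eq_iff)
qed

text \<open>Profiles depend on the squared distance, which is smooth at the centre as well; hence
  derivatives of \<open>F\<close> are asked for t >= 0 only.\<close>

lemma radial_C2:
	fixes p :: "'a::euclidean_space" and F F' F'' :: "real => real"
	assumes F: "\<And>t. t \<ge> 0 ==> (F has_real_derivative F' t) (at t)"
		"\<And>t. t \<ge> 0 ==> (F' has_real_derivative F'' t) (at t)" "continuous_on {0..} F''"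
	shows "has_C1_gradient (%x. F ((x - p) \<bullet> (x - p))) (%x. (2 * F' ((x - p) \<bullet> (x - p))) *\<^sub>R (x - p))"
		and "has_C1_gradient (%x. ((2 * F' ((x - p) \<bullet> (x - p))) *\<^sub>R (x - p)) \<bullet> i)
			(%x. (2 * F' ((x - p) \<bullet> (x - p))) *\<^sub>R i + (4 * F'' ((x - p) \<bullet> (x - p)) * ((x - p) \<bullet> i)) *\<^sub>R (x - p))"
proof -
	let ?q = "%x. (x - p) \<bullet> (x - p)"
	have q: "has_C1_gradient ?q (%x. 2 *\<^sub>R (x - p))"
		unfolding has_C1_gradient_def
		by (auto intro!: continuous_intros derivative_eq_intros simp: inner_commute fun_eq_iff)
	have cF': "continuous_on {0..} F'" using F(2) by (meson DERIV_isCont atLeast_iff continuous_at_imp_continuous_on)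
	have cq: "continuous_on UNIV ?q" by (intro continuous_intros)
	have c1: "continuous_on UNIV (%x. F' (?q x))" by (rule continuous_on_compose2[OF cF' cq]) auto
	have c2: "continuous_on UNIV (%x. F'' (?q x))" by (rule continuous_on_compose2[OF F(3) cq]) auto
	have "has_C1_gradient (%x. F (?q x)) (%x. F' (?q x) *\<^sub>R (2 *\<^sub>R (x - p)))"
		by (rule has_C1_gradient_compose_on[OF q F(1) c1]) simp
	then show "has_C1_gradient (%x. F (?q x)) (%x. (2 * F' (?q x)) *\<^sub>R (x - p))"
		by (simp add: mult.commute)
	have "has_C1_gradient (%x. F' (?q x)) (%x. F'' (?q x) *\<^sub>R (2 *\<^sub>R (x - p)))"
		by (rule has_C1_gradient_compose_on[OF q F(2) c2]) simp
	moreover have "has_C1_gradient (%x. 2 * ((x - p) \<bullet> i)) (%x. 2 *\<^sub>R i)"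
		unfolding has_C1_gradient_def
		by (auto intro!: continuous_intros derivative_eq_intros simp: inner_commute)
	ultimately have "has_C1_gradient (%x. F' (?q x) * (2 * ((x - p) \<bullet> i)))
		 (%x. F' (?q x) *\<^sub>R (2 *\<^sub>R i) + (2 * ((x - p) \<bullet> i)) *\<^sub>R (F'' (?q x) *\<^sub>R (2 *\<^sub>R (x - p))))"
		by (rule has_C1_gradient_mult)
	then show "has_C1_gradient (%x. ((2 * F' (?q x)) *\<^sub>R (x - p)) \<bullet> i)
			(%x. (2 * F' (?q x)) *\<^sub>R i + (4 * F'' (?q x) * ((x - p) \<bullet> i)) *\<^sub>R (x - p))"
		by (simp add: algebra_simps)
qed

text \<open>As a function of t = |x - p|^2: decay at rate \<open>a\<close> in the distance, made
  smooth at the centre by the parameter \<open>j\<close>, cut off at radius \<open>R\<close>. The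
  third power of the cut-off makes the profile C^2 across the sphere. \<open>prof1\<close> and
  \<open>prof2\<close> are the first two derivatives in t.\<close>

definition prof :: "real => real => real => real => real" where
	"prof a j R t = exp (- a * sqrt (t + j^2)) * (max 0 (R^2 - t))^3"

definition prof1 :: "real => real => real => real => real" where
	"prof1 a j R t = exp (- a * sqrt (t + j^2)) *
		 (- (a * (max 0 (R^2 - t))^3 / (2 * sqrt (t + j^2))) - 3 * (max 0 (R^2 - t))^2)"

definition prof2 :: "real => real => real => real => real" where
	"prof2 a j R t = exp (- a * sqrt (t + j^2)) *
		 ((a^2 / (4 * (t + j^2)) + a / (4 * (t + j^2) * sqrt (t + j^2))) * (max 0 (R^2 - t))^3
			+ 3 * a * (max 0 (R^2 - t))^2 / sqrt (t + j^2) + 6 * max 0 (R^2 - t))"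

lemma DERIV_max_0_cube: "((%t. (max 0 t)^3) has_real_derivative 3 * (max 0 t)^2) (at (t::real))"
proof -
	consider "t > 0" | "t < 0" | "t = 0" by linarith
	then show ?thesis
	proof cases
		case 1
		have "((%t. t^3) has_real_derivative 3 * (max 0 t)^2) (at t)"
			using 1 by (auto intro!: derivative_eq_intros)
		then show ?thesis
			by (rule has_field_derivative_transform_within_open[of _ _ _ "{0<..}"]) (use 1 in auto)
	next
		case 2
		have "((%t. 0) has_real_derivative 3 * (max 0 t)^2) (at t)" using 2 by simp
		then show ?thesis
			by (rule has_field_derivative_transform_within_open[of _ _ _ "{..<0}"]) (use 2 in auto)
	next
		case 3
		have "((%h::real. (max 0 h)^3 / h) \<longlongrightarrow> 0) (at 0)"
		proof (rule Lim_null_comparison)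
			have "((%h::real. h^2) \<longlongrightarrow> 0\<^sup>2) (at 0)" by (intro tendsto_power tendsto_ident_at)
			then show "((%h::real. h^2) \<longlongrightarrow> 0) (at 0)" by simp
			show "\<forall>\<^sub>F h::real in at 0. norm ((max 0 h)^3 / h) \<le> h^2"
				by (auto simp: eventually_at_filter max_def power2_eq_square power3_eq_cube)
		qed
		then show ?thesis using 3 by (simp add: DERIV_def)
	qed
qed

lemma DERIV_prof:
	assumes "t + j^2 > 0"
	shows "(prof a j R has_real_derivative prof1 a j R t) (at t)"
		and "(prof1 a j R has_real_derivative prof2 a j R t) (at t)"
proof -
	define g where "g t = sqrt (t + j^2)" for t
	define m where "m t = max 0 (R^2 - t)" for t
	have gp: "g t > 0" and g2: "t + j^2 = (g t)^2" using assms by (auto simp: g_def)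
	have dg: "(g has_real_derivative 1 / (2 * g t)) (at t)"
		unfolding g_def[abs_def] using assms
		by (auto intro!: derivative_eq_intros simp: divide_simps)
	have dE: "((%t. exp (- a * g t)) has_real_derivative exp (- a * g t) * (- a * (1 / (2 * g t)))) (at t)"
		by (rule DERIV_chain2[OF DERIV_exp DERIV_cmult[OF dg]])
	have lin: "((%t. R^2 - t) has_real_derivative - 1) (at t)" by (auto intro!: derivative_eq_intros)
	have dm3: "((%t. m t ^ 3) has_real_derivative 3 * (m t)^2 * - 1) (at t)"
		unfolding m_def by (rule DERIV_chain2[OF DERIV_max_0_cube lin])
	have dm2: "((%t. (m t)^2) has_real_derivative 2 * m t * - 1) (at t)"
		unfolding m_def by (rule DERIV_chain2[OF DERIV_max_0_square lin])
	have "((%t. exp (- a * g t) * m t ^ 3) has_real_derivative prof1 a j R t) (at t)"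
		by (rule DERIV_cong[OF DERIV_mult[OF dE dm3]])
			(use gp in \<open>simp add: prof1_def g_def[symmetric] m_def[symmetric] algebra_simps\<close>)
	then show "(prof a j R has_real_derivative prof1 a j R t) (at t)"
		by (simp add: prof_def[abs_def] g_def m_def)
	have di: "((%t. a * m t ^ 3 / (2 * g t)) has_real_derivative
		 ((a * (3 * (m t)^2 * - 1)) * (2 * g t) - (a * m t ^ 3) * (2 * (1 / (2 * g t)))) / ((2 * g t) * (2 * g t))) (at t)"
		by (rule DERIV_divide[OF DERIV_cmult[OF dm3] DERIV_cmult[OF dg]]) (use gp in simp)
	have "((%t. exp (- a * g t) * (- (a * m t ^ 3 / (2 * g t)) - 3 * (m t)^2)) has_real_derivative prof2 a j R t) (at t)"
		by (rule DERIV_cong[OF DERIV_mult[OF dE DERIV_diff[OF DERIV_minus[OF di] DERIV_cmult[OF dm2]]]])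
			(use gp in \<open>simp add: prof2_def g_def[symmetric] m_def[symmetric] g2, simp add: field_simps power2_eq_square power3_eq_cube\<close>)
	then show "(prof1 a j R has_real_derivative prof2 a j R t) (at t)"
		by (simp add: prof1_def[abs_def] g_def m_def)
qed

lemma prof2_continuous: "j > 0 ==> continuous_on {0..} (prof2 a j R)"
proof -
	assume k: "j > 0"
	have pos: "t + j^2 \<noteq> 0" if "t \<ge> 0" for t
	proof -
		have "t + j^2 > 0" using that k by (intro add_nonneg_pos) auto
		then show ?thesis by simp
	qed
	have g: "continuous_on {0..} (%t. sqrt (t + j^2))" by (intro continuous_intros)
	have nz: "\<forall>t\<in>{0..}. 4 * (t + j^2) \<noteq> 0" "\<forall>t\<in>{0..}. sqrt (t + j^2) \<noteq> 0"
		"\<forall>t\<in>{0..}. 4 * (t + j^2) * sqrt (t + j^2) \<noteq> 0"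
	proof -
		show a: "\<forall>t\<in>{0..}. 4 * (t + j^2) \<noteq> 0"
		proof
			fix t :: real assume "t \<in> {0..}"
			then have "t + j^2 \<noteq> 0" using pos by simp
			then show "4 * (t + j^2) \<noteq> 0" unfolding mult_eq_0_iff by simp
		qed
		show b: "\<forall>t\<in>{0..}. sqrt (t + j^2) \<noteq> 0" using pos by simp
		show "\<forall>t\<in>{0..}. 4 * (t + j^2) * sqrt (t + j^2) \<noteq> 0" using a b unfolding mult_eq_0_iff by blast
	qed
	have m: "continuous_on {0..} (%t. max 0 (R^2 - t))" by (intro continuous_intros)
	have d: "continuous_on {0..} (%t. a^2 / (4 * (t + j^2)))" "continuous_on {0..} (%t. a / (4 * (t + j^2) * sqrt (t + j^2)))"
		"continuous_on {0..} (%t. 3 * a * (max 0 (R^2 - t))^2 / sqrt (t + j^2))"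
		by (rule continuous_on_divide; (rule nz)?; intro continuous_intros)+
	show ?thesis unfolding prof2_def[abs_def]
		by (intro continuous_on_mult continuous_on_add continuous_on_exp continuous_on_power continuous_on_const d g m)
qed

text \<open>The third claim is the Laplacian, in dimension three, of a function F of |x - p|^2: it
  equals 6 F' + 4 t F'' at t = |x - p|^2.\<close>

lemma prof_C2:
	fixes p :: R3
	assumes "j > 0"
	defines "q \<equiv> %x. (x - p) \<bullet> (x - p)"
	shows "has_C1_gradient (%x. M * prof a j R (q x)) (%x. (2 * (M * prof1 a j R (q x))) *\<^sub>R (x - p))"
		and "has_C1_gradient (%x. ((2 * (M * prof1 a j R (q x))) *\<^sub>R (x - p)) \<bullet> i)
			(%x. (2 * (M * prof1 a j R (q x))) *\<^sub>R i + (4 * (M * prof2 a j R (q x)) * ((x - p) \<bullet> i)) *\<^sub>R (x - p))"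
		and "(\<Sum>i\<in>Basis. ((2 * (M * prof1 a j R (q x))) *\<^sub>R i + (4 * (M * prof2 a j R (q x)) * ((x - p) \<bullet> i)) *\<^sub>R (x - p)) \<bullet> i)
			= M * (6 * prof1 a j R (q x) + 4 * q x * prof2 a j R (q x))"
proof -
	have pos: "t + j^2 > 0" if "t \<ge> 0" for t using that assms(1) by (intro add_nonneg_pos) auto
	note d = DERIV_cmult[OF DERIV_prof(1)[OF pos]] DERIV_cmult[OF DERIV_prof(2)[OF pos]]
	have c: "continuous_on {0..} (%t. M * prof2 a j R t)" by (intro continuous_intros prof2_continuous assms)
	show "has_C1_gradient (%x. M * prof a j R (q x)) (%x. (2 * (M * prof1 a j R (q x))) *\<^sub>R (x - p))"
		"has_C1_gradient (%x. ((2 * (M * prof1 a j R (q x))) *\<^sub>R (x - p)) \<bullet> i)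
			(%x. (2 * (M * prof1 a j R (q x))) *\<^sub>R i + (4 * (M * prof2 a j R (q x)) * ((x - p) \<bullet> i)) *\<^sub>R (x - p))"
		unfolding q_def using radial_C2[OF d c, of p] by blast+
	have "(\<Sum>i\<in>Basis. ((2 * (M * prof1 a j R (q x))) *\<^sub>R i + (4 * (M * prof2 a j R (q x)) * ((x - p) \<bullet> i)) *\<^sub>R (x - p)) \<bullet> i)
		 = (\<Sum>i\<in>(Basis :: R3 set). 2 * (M * prof1 a j R (q x)) + 4 * (M * prof2 a j R (q x)) * (((x - p) \<bullet> i) * ((x - p) \<bullet> i)))"
		by (rule sum.cong[OF refl]) (simp add: inner_add_left inner_Basis algebra_simps)
	also have "\<dots> = 3 * (2 * (M * prof1 a j R (q x))) + 4 * (M * prof2 a j R (q x)) * q x"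
		unfolding sum.distrib sum_distrib_left[symmetric] q_def euclidean_inner[of "x - p" "x - p"] by simp
	finally show "(\<Sum>i\<in>Basis. ((2 * (M * prof1 a j R (q x))) *\<^sub>R i + (4 * (M * prof2 a j R (q x)) * ((x - p) \<bullet> i)) *\<^sub>R (x - p)) \<bullet> i)
			= M * (6 * prof1 a j R (q x) + 4 * q x * prof2 a j R (q x))"
		by (simp add: algebra_simps)
qed

lemma prof_vanishes:
	fixes p :: R3
	assumes "R > 0" shows "vanishes_beyond (norm p + R) (%x. M * prof a j R ((x - p) \<bullet> (x - p)))"
	unfolding vanishes_beyond_def
proof (intro allI impI)
	fix x :: R3 assume "norm x > norm p + R"
	then have "R \<le> norm (x - p)" using norm_triangle_ineq2[of x p] by linarith
	then have "R^2 \<le> (norm (x - p))^2" using assms by (intro power_mono) auto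
	then show "M * prof a j R ((x - p) \<bullet> (x - p)) = 0"
		by (simp add: prof_def dot_square_norm)
qed

lemma prof1_nonpos: "t \<ge> 0 ==> a \<ge> 0 ==> prof1 a j R t \<le> 0"
proof -
	assume *: "t \<ge> 0" "a \<ge> 0"
	then have "0 \<le> a * (max 0 (R^2 - t))^3 / (2 * sqrt (t + j^2))"
		by (intro divide_nonneg_nonneg mult_nonneg_nonneg) auto
	moreover have "0 \<le> 3 * (max 0 (R^2 - t))^2" by simp
	ultimately show ?thesis unfolding prof1_def by (intro mult_nonneg_nonpos[OF exp_ge_zero]) linarith
qed

text \<open>Up to the exponential factor, with m the positive part of R^2 - t and g = sqrt (t +
  j^2), the Laplacian is a polynomial in m. Its leading term t a^2 m^3 / g^2 is at least 1 + d times
  s^2 m^3 / g0 by \<open>cond\<close>. The surplus pays for - 3 a m^3 / g (\<open>c1\<close>), the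
  term 12 t a m^2 / g pays for - 18 m^2 (\<open>c2\<close>), and the remaining terms are
  nonnegative. The two lower bounds on \<open>s\<close> make these two payments possible.\<close>

lemma radial_laplacian_bound:
	fixes a N s d r j R t g0 gp :: real
	assumes a: "a = s * N" "N > 0" and r: "0 < r" "0 < j" "j \<le> r" "r^2 \<le> t" and d: "d > 0"
		and g0: "0 < g0" "g0 \<le> gp" and cond: "(1 + d) * (t + j^2) \<le> N^2 * g0 * t"
		and s: "s \<ge> 3 * N * gp / (d * r)" "s \<ge> 3 / (N * r)"
	shows "s^2 * prof a j R t \<le> g0 * (6 * prof1 a j R t + 4 * t * prof2 a j R t)"
proof -
	define g where "g = sqrt (t + j^2)"
	define m where "m = max 0 (R^2 - t)"
	have t: "t > 0" using r by (meson less_le_trans zero_less_power)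
	have tk: "t + j^2 > 0" using t by (simp add: add_pos_nonneg)
	have g: "g > 0" "t + j^2 = g^2" using tk by (auto simp: g_def)
	have m: "m \<ge> 0" by (simp add: m_def)
	have \<tau>p: "s > 0" using s(2) a r by (meson divide_pos_pos less_le_trans mult_pos_pos zero_less_numeral)
	have gr: "g \<ge> r" unfolding g_def using r by (intro real_le_rsqrt) (simp add: add_increasing2)
	have "j^2 \<le> t" using r(4) power_mono[OF r(3) less_imp_le[OF r(2)], of 2] by linarith
	then have g2t: "g^2 \<le> 2 * t" using g by simp
	have c1: "3 * a * g0 / g \<le> d * s^2"
	proof -
		have "3 * N * g0 \<le> 3 * N * gp" using a g0 by simp
		also have "\<dots> \<le> s * (d * r)" using s(1) d r by (simp add: divide_le_eq)
		also have "\<dots> \<le> s * (d * g)" using gr \<tau>p d by (intro mult_left_mono) auto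
		finally have "s * (3 * N * g0) \<le> s * (s * (d * g))" using \<tau>p by (intro mult_left_mono) auto
		then show ?thesis using g by (simp add: divide_le_eq a power2_eq_square algebra_simps)
	qed
	have c2: "18 \<le> 12 * t * a / g"
	proof -
		have "3 \<le> s * (N * r)" using s(2) a r by (simp add: divide_le_eq)
		also have "\<dots> \<le> s * (N * g)" using gr \<tau>p a by (intro mult_left_mono) auto
		finally have "3 * g \<le> s * (N * g) * g" using g by (intro mult_right_mono) auto
		also have "\<dots> = a * g^2" by (simp add: a power2_eq_square)
		also have "\<dots> \<le> a * (2 * t)" using g2t \<tau>p a by (intro mult_left_mono) auto
		finally show ?thesis using g by (simp add: le_divide_eq)
	qed
	have c3: "(1 + d) * s^2 \<le> g0 * (t * a^2 / g^2)"
	proof -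
		have "s^2 * ((1 + d) * g^2) \<le> s^2 * (N^2 * g0 * t)" using cond g by (intro mult_left_mono) auto
		then show ?thesis using g by (simp add: le_divide_eq a power_mult_distrib algebra_simps)
	qed
	have "s^2 * m^3 \<le> (g0 * (t * a^2 / g^2) - 3 * a * g0 / g) * m^3"
		using c1 c3 m by (intro mult_right_mono) (auto simp: algebra_simps)
	moreover have "0 \<le> g0 * ((12 * t * a / g - 18) * m^2)" using c2 g0 by (intro mult_nonneg_nonneg) auto
	moreover have "0 \<le> g0 * (t * a / (g^2 * g) * m^3 + 24 * t * m)"
		using g0 t m g a \<tau>p by (intro mult_nonneg_nonneg add_nonneg_nonneg divide_nonneg_nonneg) auto
	ultimately have "s^2 * m^3 \<le> (g0 * (t * a^2 / g^2) - 3 * a * g0 / g) * m^3 + g0 * ((12 * t * a / g - 18) * m^2)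
			+ g0 * (t * a / (g^2 * g) * m^3 + 24 * t * m)" by linarith
	also have "\<dots> = g0 * (6 * (- (a * m^3 / (2 * g)) - 3 * m^2) + 4 * t * ((a^2 / (4 * g^2) + a / (4 * g^2 * g)) * m^3 + 3 * a * m^2 / g + 6 * m))"
		by (simp add: algebra_simps)
	finally have "exp (- a * g) * (s^2 * m^3) \<le> exp (- a * g) * (g0 * (6 * (- (a * m^3 / (2 * g)) - 3 * m^2) + 4 * t * ((a^2 / (4 * g^2) + a / (4 * g^2 * g)) * m^3 + 3 * a * m^2 / g + 6 * m)))"
		by (rule mult_left_mono) simp
	then show ?thesis
		unfolding prof_def prof1_def prof2_def g_def[symmetric] m_def[symmetric] g(2)
		by (simp add: algebra_simps abs_of_pos[OF g(1)])
qed

section \<open>Propagation of exponential lower bounds from ball to ball\<close>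

context two_layer begin

text \<open>The scaled profile lies below \<open>m\<close> everywhere, hence below \<open>v\<close>
  in the inner ball; between the radii \<open>r\<close> and \<open>R\<close> it is a subsolution,
  and beyond \<open>R\<close> it vanishes. A lower bound on a small ball is thus carried to the ball
  of radius \<open>R\<close> with exponential rate \<open>s * N\<close>.\<close>

lemma barrier_step:
	assumes s: "s > 0" and v: "elliptic_weak_solution \<gamma>0 s f v" and f: "f \<in> L2" "AE x. f x \<ge> 0"
		and p: "p $ 3 > 0" and N: "N > 0" and r: "0 < r" "r < R" and j: "0 < j" "j \<le> r" and d: "d > 0"
		and cond: "\<And>x. r \<le> norm (x - p) ==> norm (x - p) < R ==>
			(1 + d) * ((x - p) \<bullet> (x - p) + j^2) \<le> N^2 * \<gamma>0 x * ((x - p) \<bullet> (x - p))"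
		and big: "s \<ge> 3 * N * \<gamma>p / (d * r)" "s \<ge> 3 / (N * r)"
		and m: "m \<ge> 0" "AE x. x \<in> ball p r --> m \<le> v x"
	shows "AE x. v x \<ge> m * exp (s * N * j) / R^6 * prof (s * N) j R ((x - p) \<bullet> (x - p))"
proof -
	\<comment> \<open>\<open>prof\<close> is at most exp (- s N j) R^6, so this factor keeps the
	  barrier below \<open>m\<close>.\<close>
	define M where "M = m * exp (s * N * j) / R^6"
	have M: "M \<ge> 0" using m r by (simp add: M_def)
	note C = prof_C2[OF j(1), where M = M and a = "s * N" and R = R and p = p]
	have R: "R > 0" using r by simp
	have upper: "M * prof (s * N) j R ((x - p) \<bullet> (x - p)) \<le> m" for x
	proof -
		let ?t = "(x - p) \<bullet> (x - p)"
		have "j \<le> sqrt (?t + j^2)" by (rule real_le_rsqrt) simp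
		then have "s * N * j \<le> s * N * sqrt (?t + j^2)" using s N by (intro mult_left_mono) auto
		then have e: "exp (- (s * N) * sqrt (?t + j^2)) \<le> exp (- (s * N * j))" by simp
		have "(max 0 (R^2 - ?t))^3 \<le> (R^2)^3" by (intro power_mono) auto
		then have "prof (s * N) j R ?t \<le> exp (- (s * N * j)) * (R^2)^3"
			unfolding prof_def using e by (intro mult_mono) auto
		then have "M * prof (s * N) j R ?t \<le> M * (exp (- (s * N * j)) * (R^2)^3)" using M by (intro mult_left_mono)
		also have "\<dots> = m * (exp (s * N * j) * exp (- (s * N * j)))" using R by (simp add: M_def power_mult[symmetric])
		also have "\<dots> = m" unfolding exp_add[symmetric] by simp
		finally show ?thesis .
	qed
	have "AE x. v x \<ge> M * prof (s * N) j R ((x - p) \<bullet> (x - p))"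
	proof (rule comparison_principle[OF s v f(1) C(1) prof_vanishes[OF R] C(2) p])
		\<comment> \<open>Below the height of the centre, x - p points downwards while the profile
		  decreases with the distance, so the gradient has a nonnegative vertical component, as the
		  comparison requires in a layer above the interface.\<close>
		fix x :: R3 assume "0 \<le> x $ 3" "x $ 3 \<le> p $ 3"
		moreover have "M * prof1 (s * N) j R ((x - p) \<bullet> (x - p)) \<le> 0"
			using M prof1_nonpos[of "(x - p) \<bullet> (x - p)" "s * N"] s N by (intro mult_nonneg_nonpos) auto
		ultimately show "0 \<le> ((2 * (M * prof1 (s * N) j R ((x - p) \<bullet> (x - p)))) *\<^sub>R (x - p)) $ 3"
			by (simp add: mult_nonpos_nonpos)
	next
		show "AE x. M * prof (s * N) j R ((x - p) \<bullet> (x - p)) \<le> v x \<or>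
			s^2 * (M * prof (s * N) j R ((x - p) \<bullet> (x - p))) - \<gamma>0 x *
			(\<Sum>i\<in>Basis. ((2 * (M * prof1 (s * N) j R ((x - p) \<bullet> (x - p)))) *\<^sub>R i +
				(4 * (M * prof2 (s * N) j R ((x - p) \<bullet> (x - p))) * ((x - p) \<bullet> i)) *\<^sub>R (x - p)) \<bullet> i) \<le> f x"
			using m(2) f(2)
		proof eventually_elim
			case (elim x)
			let ?t = "(x - p) \<bullet> (x - p)"
			show ?case
			proof (cases "norm (x - p) < r")
				case True
				then have "m \<le> v x" using elim by (simp add: dist_norm norm_minus_commute)
				then show ?thesis using upper[of x] by linarith
			next
				case out: False
				have "s^2 * prof (s * N) j R ?t \<le> \<gamma>0 x * (6 * prof1 (s * N) j R ?t + 4 * ?t * prof2 (s * N) j R ?t)"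
				proof (cases "norm (x - p) < R")
					case True
					have "r^2 \<le> ?t" using out r by (simp add: dot_square_norm power_mono)
					then show ?thesis
						using out True
						by (intro radial_laplacian_bound[OF refl N r(1) j _ d gamma0_bounds(3) gamma0_bounds(2) cond big]) auto
				next
					case False
					then have "R^2 \<le> ?t" using R by (simp add: dot_square_norm power_mono)
					then show ?thesis by (simp add: prof_def prof1_def prof2_def)
				qed
				from mult_left_mono[OF this M]
				show ?thesis unfolding C(3) using elim(2) by (simp add: algebra_simps)
			qed
		qed
	qed
	then show ?thesis unfolding M_def .
qed

text \<open>Inside a ball on which \<open>f\<close> is at least \<open>c\<close> the source itself
  carries a polynomial bump; the denominator bounds s^2 times the unscaled bump minus
  \<open>\<gamma>0\<close> times its Laplacian.\<close>

lemma barrier_base: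
	assumes s: "s > 0" and v: "elliptic_weak_solution \<gamma>0 s f v" and f: "f \<in> L2" "AE x. f x \<ge> 0"
		and p: "p $ 3 > 0" and r: "r > 0" and c: "c > 0" "AE x. x \<in> ball p r --> c \<le> f x"
	shows "AE x. v x \<ge> c / (18 * \<gamma>p * r^4 + s^2 * r^6) * (max 0 (r^2 - (x - p) \<bullet> (x - p)))^3"
proof -
	define K where "K = 18 * \<gamma>p * r^4 + s^2 * r^6"
	have gp: "\<gamma>p > 0" using gamma_m_pos gamma_m_less by simp
	have K: "K > 0" using gp r by (simp add: K_def add_pos_nonneg)
	define M where "M = c / K"
	have M: "M > 0" using c K by (simp add: M_def)
	\<comment> \<open>With a = 0 the exponential factor is 1, and the value 1 of \<open>j\<close> has
	  no effect.\<close>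
	note C = prof_C2[OF zero_less_one, where M = M and a = 0 and R = r and p = p]
	have "AE x. v x \<ge> M * prof 0 1 r ((x - p) \<bullet> (x - p))"
	proof (rule comparison_principle[OF s v f(1) C(1) prof_vanishes[OF r] C(2) p])
		fix x :: R3 assume "0 \<le> x $ 3" "x $ 3 \<le> p $ 3"
		moreover have "M * prof1 0 1 r ((x - p) \<bullet> (x - p)) \<le> 0"
			using M prof1_nonpos[of "(x - p) \<bullet> (x - p)" 0] by (intro mult_nonneg_nonpos) auto
		ultimately show "0 \<le> ((2 * (M * prof1 0 1 r ((x - p) \<bullet> (x - p)))) *\<^sub>R (x - p)) $ 3"
			by (simp add: mult_nonpos_nonpos)
	next
		show "AE x. M * prof 0 1 r ((x - p) \<bullet> (x - p)) \<le> v x \<or>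
			s^2 * (M * prof 0 1 r ((x - p) \<bullet> (x - p))) - \<gamma>0 x *
			(\<Sum>i\<in>Basis. ((2 * (M * prof1 0 1 r ((x - p) \<bullet> (x - p)))) *\<^sub>R i +
				(4 * (M * prof2 0 1 r ((x - p) \<bullet> (x - p))) * ((x - p) \<bullet> i)) *\<^sub>R (x - p)) \<bullet> i) \<le> f x"
			using c(2) f(2)
		proof eventually_elim
			case (elim x)
			define t where "t = (x - p) \<bullet> (x - p)"
			define m where "m = max 0 (r^2 - t)"
			have t: "t \<ge> 0" by (simp add: t_def)
			have m: "0 \<le> m" "m \<le> r^2" using t by (auto simp: m_def)
			have eq: "s^2 * (M * prof 0 1 r t) - \<gamma>0 x * (M * (6 * prof1 0 1 r t + 4 * t * prof2 0 1 r t))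
				 = M * (s^2 * m^3 + 18 * \<gamma>0 x * m^2 - 24 * \<gamma>0 x * t * m)"
				unfolding prof_def prof1_def prof2_def m_def[symmetric] by (simp add: algebra_simps)
			have "M * (s^2 * m^3 + 18 * \<gamma>0 x * m^2 - 24 * \<gamma>0 x * t * m) \<le> f x"
			proof (cases "norm (x - p) < r")
				case True
				then have cf: "c \<le> f x" using elim by (simp add: dist_norm norm_minus_commute)
				have "m^3 \<le> (r^2)^3" using m by (intro power_mono) auto
				then have "s^2 * m^3 \<le> s^2 * r^6" by (intro mult_left_mono) (auto simp: power_mult[symmetric])
				moreover have "m^2 \<le> (r^2)^2" using m by (intro power_mono) auto
				then have "\<gamma>0 x * m^2 \<le> \<gamma>p * r^4" using gamma0_bounds(2)[of x] gp by (intro mult_mono) (auto simp: power_mult[symmetric])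
				moreover have "0 \<le> \<gamma>0 x * t * m" using gamma0_bounds(3)[of x] t m by simp
				ultimately have "s^2 * m^3 + 18 * \<gamma>0 x * m^2 - 24 * \<gamma>0 x * t * m \<le> K"
					unfolding K_def by linarith
				then have "M * (s^2 * m^3 + 18 * \<gamma>0 x * m^2 - 24 * \<gamma>0 x * t * m) \<le> M * K" using M by (intro mult_left_mono) auto
				then show ?thesis using cf K by (simp add: M_def)
			next
				case False
				then have "r^2 \<le> t" using r by (simp add: t_def dot_square_norm power_mono)
				then have "m = 0" by (simp add: m_def)
				then show ?thesis using elim by simp
			qed
			then show ?case unfolding C(3) unfolding t_def[symmetric] eq by simp
		qed
	qed
	then show ?thesis by (simp add: M_def K_def prof_def)
qed

text \<open>At \<open>x\<close> the solutions decay at most at the exponential rate \<open>c\<close>.\<close>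

definition reaches :: "(real => R3 => real) => real => R3 => bool" where
	"reaches v c x \<longleftrightarrow> (\<forall>e>0. \<exists>r>0. \<exists>\<tau>0. \<forall>s\<ge>\<tau>0. AE z. z \<in> ball x r --> exp (- s * (c + e)) \<le> v s z)"

text \<open>One barrier centred at \<open>p\<close> carries the rate from \<open>p\<close> to
  \<open>x\<close> at the price of the distance times a slowness \<open>N0\<close> that is valid
  throughout the ball. The margin \<open>h\<close> is spent on the rate at \<open>p\<close> (h/4),
  on the larger slowness \<open>N\<close> and the radius of the new ball (h/8 each), and on the
  constant \<open>K\<close> (h/2), which is dominated for large \<open>s\<close>.\<close>

lemma reaches_step:
	assumes v: "\<forall>s>0. elliptic_weak_solution \<gamma>0 s f (v s)"
		and f: "f \<in> L2" "AE x. f x \<ge> 0"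
		and reach: "reaches v c p" and p: "p $ 3 > 0" and x: "norm (x - p) < R"
		and N0: "N0 > 0" "\<And>z. norm (z - p) < R ==> 1 \<le> N0^2 * \<gamma>0 z"
	shows "reaches v (c + N0 * norm (x - p)) x"
	unfolding reaches_def
proof (intro allI impI)
	fix h :: real assume h: "h > 0"
	define D where "D = norm (x - p)"
	have D: "0 \<le> D" "D < R" using x by (auto simp: D_def)
	then have R: "R > 0" by simp
	obtain r1 \<tau>1 where r1: "r1 > 0" and \<tau>1: "\<And>s. s \<ge> \<tau>1 ==> AE z. z \<in> ball p r1 --> exp (- s * (c + h / 4)) \<le> v s z"
		using reach[unfolded reaches_def, rule_format, of "h / 4"] h by auto
	define d where "d = min 1 (h / (8 * N0 * (D + 1)))"
	have d: "0 < d" "d \<le> 1" and \<delta>2: "N0 * d * (D + 1) \<le> h / 8"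
	proof -
		show "0 < d" "d \<le> 1" using h N0 D by (auto simp: d_def)
		have "d \<le> h / (8 * N0 * (D + 1))" by (simp add: d_def)
		moreover have "0 < 8 * N0 * (D + 1)" using N0 D by simp
		ultimately have "d * (8 * N0 * (D + 1)) \<le> h" by (simp only: pos_le_divide_eq)
		then show "N0 * d * (D + 1) \<le> h / 8" by (simp add: algebra_simps)
	qed
	define N where "N = N0 * (1 + d)"
	have N: "N > 0" using N0 d by (simp add: N_def)
	define r where "r = min r1 (R / 2)"
	have r: "0 < r" "r < R" "r \<le> r1" using r1 R by (auto simp: r_def)
	\<comment> \<open>With this smoothing parameter k^2 <= d t holds outside the inner ball, so the
	  passage from \<open>N0\<close> to \<open>N0 * (1 + d)\<close> pays for both the smoothing and the
	  factor 1 + d in \<open>cond\<close>.\<close>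
	define k where "k = r * d"
	have k: "0 < k" "k \<le> r" using r d by (auto simp: k_def mult_le_cancel_left1)
	have cond: "(1 + d) * ((z - p) \<bullet> (z - p) + k^2) \<le> N^2 * \<gamma>0 z * ((z - p) \<bullet> (z - p))"
		if z: "r \<le> norm (z - p)" "norm (z - p) < R" for z
	proof -
		let ?t = "(z - p) \<bullet> (z - p)"
		have "r^2 \<le> ?t" using z r by (simp add: dot_square_norm power_mono)
		moreover have "d^2 \<le> d" using d by (simp add: power2_eq_square mult_le_cancel_left1)
		ultimately have "r^2 * d^2 \<le> ?t * d" by (intro mult_mono) auto
		then have "k^2 \<le> ?t * d" by (simp add: k_def power_mult_distrib)
		then have "(1 + d) * (?t + k^2) \<le> (1 + d) * (?t + ?t * d)" using d by (intro mult_left_mono) auto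
		also have "\<dots> = 1 * ((1 + d)^2 * ?t)" by (simp add: power2_eq_square algebra_simps)
		also have "\<dots> \<le> (N0^2 * \<gamma>0 z) * ((1 + d)^2 * ?t)" using N0(2)[OF z(2)] by (intro mult_right_mono) auto
		also have "\<dots> = N^2 * \<gamma>0 z * ?t" by (simp only: N_def power_mult_distrib mult_ac)
		finally show ?thesis .
	qed
	define j where "j = min ((R - D) / 2) (min (h / (8 * N0)) 1)"
	have j: "j > 0" "D + j < R" "j \<le> 1" "N0 * j \<le> h / 8"
	proof -
		show "j > 0" "j \<le> 1" using D h N0 by (auto simp: j_def)
		have "j \<le> (R - D) / 2" unfolding j_def by (rule min.cobounded1)
		also have "\<dots> < R - D" using D by simp
		finally show "D + j < R" by simp
		have "j \<le> h / (8 * N0)" unfolding j_def by (intro min.coboundedI2 min.cobounded1)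
		then show "N0 * j \<le> h / 8" using N0 by (simp add: field_simps)
	qed
	\<comment> \<open>A lower bound for the cut-off factor of the barrier on the ball around
	  \<open>x\<close>, relative to its value R^6 at the centre.\<close>
	define K where "K = (R^2 - (D + j)^2)^3 / R^6"
	have RD: "(D + j)^2 < R^2" using j D by (intro power_strict_mono) auto
	then have K: "K > 0" using R by (simp add: K_def)
	have ND: "N * (D + j) \<le> N0 * D + h / 4"
	proof -
		have "N0 * d * (D + j) \<le> N0 * d * (D + 1)" using N0 d j by (intro mult_left_mono) auto
		moreover have "N * (D + j) = N0 * D + N0 * j + N0 * d * (D + j)" by (simp add: N_def algebra_simps)
		ultimately show ?thesis using j(4) \<delta>2 by linarith
	qed
	define \<tau>0 where "\<tau>0 = max (max \<tau>1 1) (max (max (3 * N * \<gamma>p / (d * r)) (3 / (N * r))) (- 2 * ln K / h))"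
	have "AE z. z \<in> ball x j --> exp (- s * (c + N0 * norm (x - p) + h)) \<le> v s z" if s: "s \<ge> \<tau>0" for s
	proof -
		have t: "s \<ge> \<tau>1" "s \<ge> 1" "s \<ge> 3 * N * \<gamma>p / (d * r)" "s \<ge> 3 / (N * r)" "s \<ge> - 2 * ln K / h"
			using s by (auto simp: \<tau>0_def)
		have tp: "s > 0" using t by simp
		let ?m = "exp (- s * (c + h / 4))"
		have "AE z. z \<in> ball p r --> ?m \<le> v s z"
			using \<tau>1[OF t(1)] r(3) by (auto elim!: eventually_mono)
		from barrier_step[OF tp v[rule_format, OF tp] f p N r(1,2) k d(1) cond t(3,4) _ this]
		have "AE z. v s z \<ge> ?m * exp (s * N * k) / R^6 * prof (s * N) k R ((z - p) \<bullet> (z - p))" by simp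
		then show ?thesis
		proof (rule eventually_mono, intro impI)
			fix z assume vz: "?m * exp (s * N * k) / R^6 * prof (s * N) k R ((z - p) \<bullet> (z - p)) \<le> v s z" and z: "z \<in> ball x j"
			have zp: "norm (z - p) \<le> D + j"
				using z norm_triangle_ineq[of "z - x" "x - p"] by (simp add: D_def dist_norm norm_minus_commute)
			have q: "(z - p) \<bullet> (z - p) \<le> (D + j)^2" unfolding dot_square_norm using zp by (intro power_mono) auto
			\<comment> \<open>Smoothing the distance loses a factor exp (- s N k), which the normalisation of
			  the barrier gives back.\<close>
			have "sqrt ((z - p) \<bullet> (z - p) + k^2) \<le> norm (z - p) + k"
				unfolding dot_square_norm using k by (intro real_le_lsqrt) (auto simp: power2_sum)
			then have "s * N * sqrt ((z - p) \<bullet> (z - p) + k^2) \<le> s * N * (D + j + k)"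
				using tp N zp by (intro mult_left_mono) auto
			then have e: "exp (- (s * N * (D + j + k))) \<le> exp (- (s * N) * sqrt ((z - p) \<bullet> (z - p) + k^2))" by simp
			have "R^2 - (D + j)^2 \<le> max 0 (R^2 - (z - p) \<bullet> (z - p))" using q by simp
			then have "(R^2 - (D + j)^2)^3 \<le> (max 0 (R^2 - (z - p) \<bullet> (z - p)))^3" using RD by (intro power_mono) auto
			then have pr: "exp (- (s * N * (D + j + k))) * (R^2 - (D + j)^2)^3 \<le> prof (s * N) k R ((z - p) \<bullet> (z - p))"
				unfolding prof_def using e RD by (intro mult_mono) auto
			have "- s * (c + N0 * norm (x - p) + h) \<le> - s * (c + h / 4) - s * N * (D + j) + ln K"
			proof -
				have "- 2 * ln K \<le> s * h" using t(5) by (simp only: pos_divide_le_eq[OF h])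
				moreover have "s * (N * (D + j)) \<le> s * (N0 * D + h / 4)" using tp by (intro mult_left_mono ND) auto
				ultimately show ?thesis unfolding D_def[symmetric] by (simp add: algebra_simps)
			qed
			then have "exp (- s * (c + N0 * norm (x - p) + h)) \<le> exp (- s * (c + h / 4) - s * N * (D + j) + ln K)" by simp
			also have "\<dots> = ?m * exp (- (s * N * (D + j))) * K" by (simp only: diff_conv_add_uminus exp_add exp_ln[OF K])
			also have "\<dots> = ?m * exp (s * N * k) / R^6 * (exp (- (s * N * (D + j + k))) * (R^2 - (D + j)^2)^3)"
			proof -
				have "exp (- (s * N * (D + j))) = exp (s * N * k) * exp (- (s * N * (D + j + k)))"
					unfolding exp_add[symmetric] by (rule arg_cong[where f = exp]) (simp add: algebra_simps)
				then show ?thesis by (simp add: K_def)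
			qed
			also have "\<dots> \<le> ?m * exp (s * N * k) / R^6 * prof (s * N) k R ((z - p) \<bullet> (z - p))"
				using pr R by (intro mult_left_mono) auto
			also have "\<dots> \<le> v s z" by (rule vz)
			finally show "exp (- s * (c + N0 * norm (x - p) + h)) \<le> v s z" .
		qed
	qed
	then show "\<exists>r>0. \<exists>\<tau>0. \<forall>s\<ge>\<tau>0. AE z. z \<in> ball x r --> exp (- s * (c + N0 * norm (x - p) + h)) \<le> v s z"
		using j(1) by blast
qed

text \<open>The bound of \<open>barrier_base\<close> decays only like 1 / s^2, which is slower than
  any exponential.\<close>

lemma reaches_base:
	assumes v: "\<forall>s>0. elliptic_weak_solution \<gamma>0 s f (v s)"
		and f: "f \<in> L2" "AE x. f x \<ge> 0"
		and p: "p $ 3 > 0" and r: "r > 0" and c: "c > 0" "AE x. x \<in> ball p r --> c \<le> f x"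
	shows "reaches v 0 p"
	unfolding reaches_def
proof (intro allI impI)
	fix e :: real assume e: "e > 0"
	have gp: "\<gamma>p > 0" using gamma_m_pos gamma_m_less by simp
	define A where "A = c * (3 / 4 * r^2)^3"
	define K where "K = 18 * \<gamma>p * r^4"
	have A: "A > 0" using c r by (simp add: A_def)
	have K: "K > 0" using gp r by (simp add: K_def)
	have "((%s. (K + s^2 * r^6) * exp (- s * e)) \<longlongrightarrow> 0) at_top" using e by real_asymp
	then have "\<forall>\<^sub>F s in at_top. (K + s^2 * r^6) * exp (- s * e) < A" using A by (rule order_tendstoD)
	then obtain \<tau>1 where \<tau>1: "\<And>s. s \<ge> \<tau>1 ==> (K + s^2 * r^6) * exp (- s * e) < A"
		by (auto simp: eventually_at_top_linorder)
	have "AE z. z \<in> ball p (r / 2) --> exp (- s * (0 + e)) \<le> v s z" if s: "s \<ge> max \<tau>1 1" for s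
	proof -
		have tp: "s > 0" using s by simp
		show ?thesis using barrier_base[OF tp v[rule_format, OF tp] f p r c]
		proof (rule eventually_mono, intro impI)
			fix z assume vz: "c / (18 * \<gamma>p * r^4 + s^2 * r^6) * (max 0 (r^2 - (z - p) \<bullet> (z - p)))^3 \<le> v s z" and z: "z \<in> ball p (r / 2)"
			have "norm (z - p) \<le> r / 2" using z by (simp add: dist_norm norm_minus_commute)
			then have "(norm (z - p))^2 \<le> (r / 2)^2" by (intro power_mono) auto
			then have "3 / 4 * r^2 \<le> r^2 - (z - p) \<bullet> (z - p)" unfolding dot_square_norm power_divide by simp
			then have "3 / 4 * r^2 \<le> max 0 (r^2 - (z - p) \<bullet> (z - p))" by (rule max.coboundedI2)
			then have "(3 / 4 * r^2)^3 \<le> (max 0 (r^2 - (z - p) \<bullet> (z - p)))^3" by (intro power_mono) auto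
			then have "c * (3 / 4 * r^2)^3 \<le> c * (max 0 (r^2 - (z - p) \<bullet> (z - p)))^3" using c by (intro mult_left_mono) auto
			moreover have "K + s^2 * r^6 > 0" using K by (simp add: add_pos_nonneg)
			moreover have "(K + s^2 * r^6) * exp (- s * e) < A" using \<tau>1 s by simp
			ultimately have "exp (- s * e) \<le> c * (max 0 (r^2 - (z - p) \<bullet> (z - p)))^3 / (K + s^2 * r^6)"
				by (simp add: le_divide_eq A_def mult.commute)
			then show "exp (- s * (0 + e)) \<le> v s z" using vz by (simp add: K_def)
		qed
	qed
	then show "\<exists>r>0. \<exists>\<tau>0. \<forall>s\<ge>\<tau>0. AE z. z \<in> ball p r --> exp (- s * (0 + e)) \<le> v s z"
		using half_gt_zero[OF r] by blast
qed

text \<open>Balls of radius \<open>h\<close> around points of the segment stay in the upper layer,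
  where the smaller slowness 1 / sqrt \<gamma>p is valid. The segment is cut into \<open>n\<close>
  pieces shorter than \<open>h\<close>, with one barrier for each.\<close>

lemma reaches_upper_segment:
	assumes v: "\<forall>t>0. elliptic_weak_solution \<gamma>0 t f (v t)"
		and f: "f \<in> L2" "AE x. f x \<ge> 0"
		and y: "reaches v 0 y" "y $ 3 > 0" and z: "z $ 3 > 0"
	shows "reaches v (1 / sqrt \<gamma>p * norm (z - y)) z"
proof -
	have gp: "\<gamma>p > 0" using gamma_m_pos gamma_m_less by simp
	define h where "h = min (y $ 3) (z $ 3)"
	have h: "h > 0" using y z by (simp add: h_def)
	obtain n where n: "norm (z - y) / h < real n" using reals_Archimedean2 by blast
	have n0: "real n > 0" using n h by (meson divide_nonneg_pos le_less_trans norm_ge_zero)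
	define P where "P k = y + (real k / real n) *\<^sub>R (z - y)" for k
	have P3: "P k $ 3 \<ge> h" if "k \<le> n" for k
	proof -
		define s where "s = real k / real n"
		have s: "0 \<le> s" "s \<le> 1" using that n0 by (auto simp: s_def)
		have "P k $ 3 = (1 - s) * y $ 3 + s * z $ 3" by (simp add: P_def s_def[symmetric] algebra_simps)
		moreover have "(1 - s) * h \<le> (1 - s) * y $ 3" "s * h \<le> s * z $ 3" using s by (auto intro!: mult_left_mono simp: h_def)
		ultimately show ?thesis by (simp add: algebra_simps)
	qed
	have step: "norm (P (Suc k) - P k) = norm (z - y) / n" for k
	proof -
		have "P (Suc k) - P k = (real (Suc k) / real n - real k / real n) *\<^sub>R (z - y)" by (simp add: P_def scaleR_diff_left)
		also have "real (Suc k) / real n - real k / real n = 1 / real n" by (simp add: diff_divide_distrib[symmetric])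
		finally show ?thesis by simp
	qed
	have "reaches v (real k * (1 / sqrt \<gamma>p * (norm (z - y) / n))) (P k)" if "k \<le> n" for k
		using that
	proof (induction k)
		case 0 then show ?case using y by (simp add: P_def)
	next
		case (Suc k)
		have pk: "P k $ 3 \<ge> h" using P3 Suc by simp
		have "reaches v (real k * (1 / sqrt \<gamma>p * (norm (z - y) / n)) + 1 / sqrt \<gamma>p * norm (P (Suc k) - P k)) (P (Suc k))"
		proof (rule reaches_step[OF v f])
			show "reaches v (real k * (1 / sqrt \<gamma>p * (norm (z - y) / n))) (P k)" using Suc by simp
			show "0 < P k $ 3" using pk h by simp
			show "norm (P (Suc k) - P k) < h" unfolding step using n n0 h by (simp add: field_simps)
			show "1 / sqrt \<gamma>p > 0" using gp by simp
			fix x :: R3 assume "norm (x - P k) < h"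
			then have "\<bar>(x - P k) $ 3\<bar> < h" using component_le_norm_cart[of "x - P k" 3] by linarith
			then have "x $ 3 > 0" using pk by simp
			then show "1 \<le> (1 / sqrt \<gamma>p)^2 * \<gamma>0 x" using gp by (simp add: gamma0_def power_divide)
		qed
		moreover have "real k * c + c = real (Suc k) * c" for c by (simp add: distrib_right)
		ultimately show ?case unfolding step by (simp only:)
	qed
	from this[of n] show ?thesis using n0 by (simp add: P_def)
qed

text \<open>The crossing point is lifted by \<open>s\<close> into the upper layer, because barriers
  have their centre there. From the lifted point one barrier with slowness 1 / sqrt \<gamma>m
  reaches \<open>x\<close> across the interface, since \<open>\<gamma>m\<close> bounds
  \<open>\<gamma>0\<close> from below everywhere. The lift costs at most \<open>h\<close>, which
  determines \<open>s\<close>.\<close>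

lemma reaches_below:
	assumes v: "\<forall>t>0. elliptic_weak_solution \<gamma>0 t f (v t)"
		and f: "f \<in> L2" "AE x. f x \<ge> 0"
		and y: "reaches v 0 y" "y $ 3 > 0" and h: "h > 0"
	shows "reaches v (path_time \<gamma>p \<gamma>m x y z + h) x"
proof -
	have gp: "\<gamma>p > 0" using gamma_m_pos gamma_m_less by simp
	define z0 where "z0 = (vector [z $ 1, z $ 2, 0] :: R3)"
	define s where "s = h / (1 / sqrt \<gamma>m + 1 / sqrt \<gamma>p)"
	have den: "1 / sqrt \<gamma>m + 1 / sqrt \<gamma>p > 0" using gp gamma_m_pos by (simp add: add_pos_pos)
	have s: "s > 0" using h den by (simp add: s_def)
	define p where "p = z0 + s *\<^sub>R axis 3 1"
	have p3: "p $ 3 > 0" using s by (simp add: p_def z0_def axis_def)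
	have pz: "norm (p - z0) = s" using s by (simp add: p_def)
	have r1: "reaches v (1 / sqrt \<gamma>p * norm (p - y)) p" by (rule reaches_upper_segment[OF v f y p3])
	have "reaches v (1 / sqrt \<gamma>p * norm (p - y) + 1 / sqrt \<gamma>m * norm (x - p)) x"
	proof (rule reaches_step[OF v f r1 p3])
		show "norm (x - p) < norm (x - p) + 1" by simp
		show "0 < 1 / sqrt \<gamma>m" using gamma_m_pos by simp
		show "1 \<le> (1 / sqrt \<gamma>m)^2 * \<gamma>0 w" for w
			using gamma_m_pos gamma0_bounds(1)[of w] by (simp add: power_divide)
	qed
	moreover have "1 / sqrt \<gamma>p * norm (p - y) + 1 / sqrt \<gamma>m * norm (x - p) \<le> path_time \<gamma>p \<gamma>m x y z + h"
	proof -
		have "norm (p - y) \<le> norm (z0 - y) + s"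
			using norm_triangle_ineq[of "p - z0" "z0 - y"] pz by simp
		then have a: "1 / sqrt \<gamma>p * norm (p - y) \<le> 1 / sqrt \<gamma>p * (norm (z0 - y) + s)" using gp by (intro mult_left_mono) auto
		have "norm (x - p) \<le> norm (z0 - x) + s"
			using norm_triangle_ineq[of "x - z0" "z0 - p"] pz by (simp add: norm_minus_commute)
		then have b: "1 / sqrt \<gamma>m * norm (x - p) \<le> 1 / sqrt \<gamma>m * (norm (z0 - x) + s)" using gamma_m_pos by (intro mult_left_mono) auto
		have "(1 / sqrt \<gamma>m + 1 / sqrt \<gamma>p) * s = h" using den by (simp add: s_def)
		moreover have "path_time \<gamma>p \<gamma>m x y z = 1 / sqrt \<gamma>m * norm (z0 - x) + 1 / sqrt \<gamma>p * norm (z0 - y)"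
			by (simp add: path_time_def z0_def Let_def)
		ultimately show ?thesis using a b by (simp add: algebra_simps)
	qed
	ultimately show ?thesis
		unfolding reaches_def
	proof (intro allI impI)
		fix e :: real assume r: "\<forall>e>0. \<exists>r>0. \<exists>\<tau>0. \<forall>t\<ge>\<tau>0. AE w. w \<in> ball x r --> exp (- t * (1 / sqrt \<gamma>p * norm (p - y) + 1 / sqrt \<gamma>m * norm (x - p) + e)) \<le> v t w"
			and le: "1 / sqrt \<gamma>p * norm (p - y) + 1 / sqrt \<gamma>m * norm (x - p) \<le> path_time \<gamma>p \<gamma>m x y z + h" and "e > 0"
		then obtain r \<tau>0 where *: "r > 0" "\<And>t. t \<ge> \<tau>0 ==> AE w. w \<in> ball x r --> exp (- t * (1 / sqrt \<gamma>p * norm (p - y) + 1 / sqrt \<gamma>m * norm (x - p) + e)) \<le> v t w"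
			by blast
		have "AE w. w \<in> ball x r --> exp (- t * (path_time \<gamma>p \<gamma>m x y z + h + e)) \<le> v t w" if "t \<ge> max \<tau>0 0" for t
		proof -
			have "t * (1 / sqrt \<gamma>p * norm (p - y) + 1 / sqrt \<gamma>m * norm (x - p) + e) \<le> t * (path_time \<gamma>p \<gamma>m x y z + h + e)"
				using le that by (intro mult_left_mono) auto
			then have "exp (- t * (path_time \<gamma>p \<gamma>m x y z + h + e)) \<le> exp (- t * (1 / sqrt \<gamma>p * norm (p - y) + 1 / sqrt \<gamma>m * norm (x - p) + e))"
				by simp
			then show ?thesis
				using that by (intro eventually_mono[OF *(2)[of t]]) (auto intro: order_trans simp del: exp_le_cancel_iff)
		qed
		then show "\<exists>r>0. \<exists>\<tau>0. \<forall>t\<ge>\<tau>0. AE w. w \<in> ball x r --> exp (- t * (path_time \<gamma>p \<gamma>m x y z + h + e)) \<le> v t w"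
			using *(1) by blast
	qed
qed

end

section \<open>Optical distance, lower bound for the gradient in \<open>D\<close>, and the weighted
  energy estimate\<close>

context two_layer begin

lemma path_time_nonneg: "0 \<le> path_time \<gamma>p \<gamma>m x y z"
	using gamma_m_pos gamma_m_less by (simp add: path_time_def Let_def)

lemma optical_dist_le: "optical_dist \<gamma>p \<gamma>m x y \<le> path_time \<gamma>p \<gamma>m x y z"
	unfolding optical_dist_def using path_time_nonneg by (intro cINF_lower bdd_belowI2[where m = 0]) auto

lemma optical_dist_nonneg: "0 \<le> optical_dist \<gamma>p \<gamma>m x y"
	unfolding optical_dist_def using path_time_nonneg by (intro cINF_greatest) auto

lemma optical_setdist_le:
	assumes "x \<in> D" "y \<in> B" shows "optical_setdist \<gamma>p \<gamma>m D B \<le> path_time \<gamma>p \<gamma>m x y z"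
proof -
	have "optical_setdist \<gamma>p \<gamma>m D B \<le> (case (x, y) of (x, y) => optical_dist \<gamma>p \<gamma>m x y)"
		unfolding optical_setdist_def using assms optical_dist_nonneg
		by (intro cINF_lower bdd_belowI2[where m = 0]) auto
	then show ?thesis using optical_dist_le order_trans by simp blast
qed

lemma optical_setdist_nonneg:
	assumes "D \<noteq> {}" "B \<noteq> {}" shows "0 \<le> optical_setdist \<gamma>p \<gamma>m D B"
	unfolding optical_setdist_def using optical_dist_nonneg assms by (intro cINF_greatest) auto

lemma optical_setdist_approx:
	assumes "D \<noteq> {}" "B \<noteq> {}" "e > 0"
	obtains x y z where "x \<in> D" "y \<in> B" "path_time \<gamma>p \<gamma>m x y z < optical_setdist \<gamma>p \<gamma>m D B + e"
proof -
	have "Inf ((%(x, y). optical_dist \<gamma>p \<gamma>m x y) ` (D \<times> B)) < optical_setdist \<gamma>p \<gamma>m D B + e"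
		using assms by (simp add: optical_setdist_def)
	from cInf_lessD[OF _ this] assms(1,2)
	obtain d where "d \<in> (%(x, y). optical_dist \<gamma>p \<gamma>m x y) ` (D \<times> B)" "d < optical_setdist \<gamma>p \<gamma>m D B + e"
		by blast
	then obtain x y where xy: "x \<in> D" "y \<in> B" and "optical_dist \<gamma>p \<gamma>m x y < optical_setdist \<gamma>p \<gamma>m D B + e"
		by auto
	then obtain z where "path_time \<gamma>p \<gamma>m x y z < optical_setdist \<gamma>p \<gamma>m D B + e"
		unfolding optical_dist_def using cInf_lessD[of "range (path_time \<gamma>p \<gamma>m x y)"] by auto
	then show ?thesis using that xy by blast
qed

text \<open>The equation is tested with a bump \<open>b\<close> supported in \<open>D\<close>, where
  the source vanishes, so s^2 times the integral of \<open>v b\<close> is balanced by the gradients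
  alone. That integral is at least the given exponential times \<open>A\<close>, while the gradient
  term is at most \<open>K\<close> times the L^2 norm of the gradient of \<open>v\<close> over
  \<open>D\<close>.\<close>

lemma gradient_lower_bound_ball:
	assumes v: "\<forall>s>0. elliptic_weak_solution \<gamma>0 s f (v s)"
		and D: "open D" "x \<in> D" and f: "f \<in> L2" "AE z. z \<in> D --> f z = 0"
		and reach: "reaches v c x" and e: "e > 0"
	shows "\<exists>C>0. \<exists>\<tau>0. \<forall>s\<ge>\<tau>0. C * exp (- 2 * s * (c + e)) \<le> (LINT z. indicator D z * (norm (weak_gradient (v s) z))^2)"
proof -
	have gp: "\<gamma>p > 0" using gamma_m_pos gamma_m_less by simp
	obtain r1 \<tau>1 where r1: "r1 > 0" and \<tau>1: "\<And>s. s \<ge> \<tau>1 ==> AE z. z \<in> ball x r1 --> exp (- s * (c + e)) \<le> v s z"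
		using reach[unfolded reaches_def, rule_format, OF e] by auto
	obtain r2 where r2: "r2 > 0" "cball x r2 \<subseteq> D" using D open_contains_cball by metis
	define r where "r = min r1 r2"
	have r: "r > 0" "r \<le> r1" "r \<le> r2" using r1 r2 by (auto simp: r_def)
	define b where "b z = 1 * prof 0 1 r ((z - x) \<bullet> (z - x))" for z
	define X where "X z = (2 * (1 * prof1 0 1 r ((z - x) \<bullet> (z - x)))) *\<^sub>R (z - x)" for z
	have C1: "has_C1_gradient b X"
		unfolding b_def[abs_def] X_def[abs_def] by (rule prof_C2(1)) simp
	have van: "vanishes_beyond (norm x + r) b" unfolding b_def[abs_def] by (rule prof_vanishes[OF r(1)])
	note L = C1_vanishes_L2[OF C1 van] and wg = is_weak_gradient_C1[OF C1 van]
	have out: "b z = 0 \<and> X z = 0" if "r \<le> norm (z - x)" for z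
	proof -
		have "r^2 \<le> (z - x) \<bullet> (z - x)" using that r by (simp add: dot_square_norm power_mono)
		then show ?thesis by (simp add: b_def X_def prof_def prof1_def)
	qed
	have inD: "z \<in> D" if "norm (z - x) < r" for z
		using that r r2 by (auto simp: subset_iff dist_norm norm_minus_commute)
	have \<beta>0: "b z \<ge> 0" for z by (simp add: b_def prof_def)
	have \<beta>i: "integrable lebesgue b" by (rule continuous_vanishes_integrable[OF has_C1_gradient_continuous[OF C1] van])
	define A where "A = (LINT z. b z)"
	have A: "A > 0"
	proof (rule ccontr)
		assume "\<not> A > 0"
		moreover have "A \<ge> 0" unfolding A_def using \<beta>0 by (intro Bochner_Integration.integral_nonneg) auto
		ultimately have "(LINT z. b z) = 0" by (simp add: A_def)
		then have "AE z. b z = 0"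
			using integral_nonneg_eq_0_iff_AE[OF \<beta>i] \<beta>0 by auto
		then have "AE z. z \<notin> ball x r"
		proof (rule eventually_mono)
			fix z assume z: "b z = 0"
			show "z \<notin> ball x r"
			proof
				assume "z \<in> ball x r"
				then have "(norm (z - x))^2 < r^2" by (intro power_strict_mono) (auto simp: dist_norm norm_minus_commute)
				then show False using z by (simp add: b_def prof_def dot_square_norm)
			qed
		qed
		then have "negligible (ball x r)" unfolding negligible_iff_null_sets by (simp add: AE_iff_null_sets)
		then show False using open_not_negligible[of "ball x r"] r by simp
	qed
	define K where "K = \<gamma>p * L2_norm X + 1"
	have K: "K > 0" using gp by (simp add: K_def add_nonneg_pos)
	have "(A / K)^2 * exp (- 2 * s * (c + e)) \<le> (LINT z. indicator D z * (norm (weak_gradient (v s) z))^2)"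
		if s: "s \<ge> max \<tau>1 1" for s
	proof -
		have tp: "s \<ge> 1" "s > 0" using s by auto
		have vH: "v s \<in> H1" using v[rule_format, OF tp(2)] by (simp add: elliptic_weak_solution_def)
		define g where "g = weak_gradient (v s)"
		have g: "g \<in> L2" unfolding g_def by (rule H1_gradient_L2[OF vH])
		have Dm: "(indicator D :: R3 => real) \<in> borel_measurable lebesgue"
			using D(1) by (intro borel_measurable_indicator) (simp add: sets_completionI_sets)
		have gD: "(%z. indicator D z *\<^sub>R g z) \<in> L2" by (rule L2_bounded_mult[OF g Dm, of 1]) (simp add: indicator_def)
		have "(LINT z. \<gamma>0 z * (g z \<bullet> X z)) + s^2 * (LINT z. v s z * b z) = (LINT z. f z * b z)"
			unfolding g_def by (rule elliptic_test[OF v[rule_format, OF tp(2)] L(1) wg])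
		moreover have "(LINT z. f z * b z) = (LINT z|(lebesgue :: R3 measure). 0)"
		proof (rule integral_cong_AE)
			show "AE z. f z * b z = 0"
				using f(2)
			proof (rule eventually_mono)
				fix z assume "z \<in> D --> f z = 0"
				then show "f z * b z = 0" using out[of z] inD[of z] by (cases "norm (z - x) < r") auto
			qed
		qed (use L2_mult_integrable[OF f(1) L(1)] in auto)
		ultimately have eq: "s^2 * (LINT z. v s z * b z) = - (LINT z. \<gamma>0 z * (g z \<bullet> X z))" by simp
		have "exp (- s * (c + e)) * A = (LINT z. exp (- s * (c + e)) * b z)" by (simp add: A_def)
		also have "\<dots> \<le> (LINT z. v s z * b z)"
		proof (rule integral_mono_AE)
			show "AE z. exp (- s * (c + e)) * b z \<le> v s z * b z"
			proof (rule eventually_mono[OF \<tau>1[of s]])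
				show "\<tau>1 \<le> s" using s by simp
				fix z assume z: "z \<in> ball x r1 --> exp (- s * (c + e)) \<le> v s z"
				show "exp (- s * (c + e)) * b z \<le> v s z * b z"
				proof (cases "norm (z - x) < r")
					case True
					then have "exp (- s * (c + e)) \<le> v s z" using z r by (simp add: dist_norm norm_minus_commute)
					then show ?thesis using \<beta>0 by (intro mult_right_mono) auto
				next
					case False then show ?thesis using out[of z] by simp
				qed
			qed
		qed (use \<beta>i L2_mult_integrable[OF H1_L2[OF vH] L(1)] in auto)
		also have "\<dots> \<le> s^2 * (LINT z. v s z * b z)"
		proof -
			have "0 \<le> (LINT z. v s z * b z)"
				using calculation A by (meson exp_ge_zero less_imp_le mult_nonneg_nonneg order_trans)
			then show ?thesis using tp by (simp add: mult_le_cancel_right1 power2_eq_square mult_ge1_I)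
		qed
		also have "\<dots> \<le> (LINT z. \<gamma>p * (norm (indicator D z *\<^sub>R g z) * norm (X z)))"
		proof -
			have "- (LINT z. \<gamma>0 z * (g z \<bullet> X z)) \<le> (LINT z. norm (\<gamma>0 z * (g z \<bullet> X z)))"
				using integral_norm_bound[of lebesgue "%z. \<gamma>0 z * (g z \<bullet> X z)"] unfolding real_norm_def by linarith
			also have "\<dots> \<le> (LINT z. \<gamma>p * (norm (indicator D z *\<^sub>R g z) * norm (X z)))"
			proof (rule integral_mono)
				show "integrable lebesgue (%z. norm (\<gamma>0 z * (g z \<bullet> X z)))"
					by (rule integrable_norm[OF gamma0_inner_integrable[OF g L(2)]])
				show "integrable lebesgue (%z. \<gamma>p * (norm (indicator D z *\<^sub>R g z) * norm (X z)))"
					by (rule integrable_mult_right[OF L2_norm_integrable[OF gD L(2)]])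
				fix z
				show "norm (\<gamma>0 z * (g z \<bullet> X z)) \<le> \<gamma>p * (norm (indicator D z *\<^sub>R g z) * norm (X z))"
				proof (cases "norm (z - x) < r")
					case True
					then have "norm (indicator D z *\<^sub>R g z) = norm (g z)" using inD by simp
					moreover have "\<bar>g z \<bullet> X z\<bar> \<le> norm (g z) * norm (X z)" by (rule Cauchy_Schwarz_ineq2)
					ultimately show ?thesis
						unfolding real_norm_def abs_mult using gamma0_bounds(4)[of z] gp by (intro mult_mono) auto
				next
					case False then show ?thesis using out[of z] by simp
				qed
			qed
			finally show ?thesis unfolding eq .
		qed
		also have "\<dots> = \<gamma>p * (LINT z. norm (indicator D z *\<^sub>R g z) * norm (X z))" by simp
		also have "\<dots> \<le> \<gamma>p * (L2_norm (%z. indicator D z *\<^sub>R g z) * L2_norm X)"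
			using gp L2_Cauchy_Schwarz_norm[OF gD L(2)] by (intro mult_left_mono) auto
		also have "\<dots> \<le> L2_norm (%z. indicator D z *\<^sub>R g z) * K"
			by (simp add: K_def algebra_simps)
		finally have "exp (- s * (c + e)) * A / K \<le> L2_norm (%z. indicator D z *\<^sub>R g z)" using K by (simp only: pos_divide_le_eq)
		then have "(exp (- s * (c + e)) * A / K)^2 \<le> (L2_norm (%z. indicator D z *\<^sub>R g z))^2"
			using A K by (intro power_mono) auto
		moreover have "(exp (- s * (c + e)) * A / K)^2 = (A / K)^2 * exp (- 2 * s * (c + e))"
		proof -
			have "(exp (- s * (c + e)))^2 = exp (- 2 * s * (c + e))"
				unfolding power2_eq_square exp_add[symmetric] by (rule arg_cong[where f = exp]) simp
			then show ?thesis by (simp add: power_divide power_mult_distrib)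
		qed
		moreover have "(L2_norm (%z. indicator D z *\<^sub>R g z))^2 = (LINT z. indicator D z * (norm (g z))^2)"
			unfolding L2_norm_power2 by (intro Bochner_Integration.integral_cong) (auto simp: indicator_def)
		ultimately show ?thesis unfolding g_def by simp
	qed
	moreover have "(A / K)^2 > 0" using A K by simp
	ultimately show ?thesis by blast
qed

lemma gradient_lower_bound:
	assumes v: "\<forall>s>0. elliptic_weak_solution \<gamma>0 s f (v s)"
		and f: "f \<in> L2" "AE x. f x \<ge> 0" "c0 > 0" "AE x. x \<in> B --> c0 \<le> f x"
		and B: "open B" "B \<noteq> {}" "B \<subseteq> {x. x $ 3 > 0}"
		and D: "open D" "D \<noteq> {}" "AE x. x \<in> D --> f x = 0" and d: "d > 0"
	shows "\<exists>C>0. \<exists>\<tau>0. \<forall>s\<ge>\<tau>0. C * exp (- 2 * s * (optical_setdist \<gamma>p \<gamma>m D B + d))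
		\<le> (LINT z. indicator D z * (norm (weak_gradient (v s) z))^2)"
proof -
	let ?l = "optical_setdist \<gamma>p \<gamma>m D B"
	\<comment> \<open>A third of \<open>d\<close> each for the almost optimal path, for the lift over
	  the interface and for the accuracy of the rate.\<close>
	have e: "d / 3 > 0" using d by simp
	obtain x y z where xyz: "x \<in> D" "y \<in> B" "path_time \<gamma>p \<gamma>m x y z < ?l + d / 3"
		using optical_setdist_approx[OF D(2) B(2) e] by blast
	obtain r where r: "r > 0" "ball y r \<subseteq> B" using B(1) xyz(2) open_contains_ball by metis
	have y3: "y $ 3 > 0" using B(3) xyz by auto
	have "AE x. x \<in> ball y r --> c0 \<le> f x" using f(4) r(2) by (auto elim!: eventually_mono)
	then have "reaches v 0 y" by (rule reaches_base[OF v f(1,2) y3 r(1) f(3)])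
	then have "reaches v (path_time \<gamma>p \<gamma>m x y z + d / 3) x" by (rule reaches_below[OF v f(1,2) _ y3 e])
	from gradient_lower_bound_ball[OF v D(1) xyz(1) f(1) D(3) this e]
	obtain C \<tau>0 where C: "C > 0" and
		b: "\<And>s. s \<ge> \<tau>0 ==> C * exp (- 2 * s * (path_time \<gamma>p \<gamma>m x y z + d / 3 + d / 3)) \<le> (LINT z. indicator D z * (norm (weak_gradient (v s) z))^2)"
		by blast
	have "C * exp (- 2 * s * (?l + d)) \<le> (LINT z. indicator D z * (norm (weak_gradient (v s) z))^2)"
		if s: "s \<ge> max \<tau>0 0" for s
	proof -
		have "path_time \<gamma>p \<gamma>m x y z + d / 3 + d / 3 \<le> ?l + d" using xyz(3) by simp
		then have "2 * s * (path_time \<gamma>p \<gamma>m x y z + d / 3 + d / 3) \<le> 2 * s * (?l + d)"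
			using s by (intro mult_left_mono) auto
		then have "exp (- 2 * s * (?l + d)) \<le> exp (- 2 * s * (path_time \<gamma>p \<gamma>m x y z + d / 3 + d / 3))" by simp
		then have "C * exp (- 2 * s * (?l + d)) \<le> C * exp (- 2 * s * (path_time \<gamma>p \<gamma>m x y z + d / 3 + d / 3))"
			using C by (intro mult_left_mono) auto
		then show ?thesis using b[of s] s by linarith
	qed
	then show ?thesis using C by blast
qed

text \<open>Testing with \<open>z v\<close> for z = exp (2 q) and completing the square: with V =
  exp (q) v, P the gradient of \<open>v\<close> times exp (q), and Q = V a, the sum P + Q is the
  gradient of V and the energy density becomes \<open>\<gamma>0\<close> times |P + Q|^2 - |Q|^2. The
  eikonal condition with margin \<open>j\<close> lets s^2 |V|^2 absorb the Q term. Where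
  \<open>f\<close> is nonzero the exponent is at most \<open>b\<close>.\<close>

lemma agmon_estimate:
	assumes s: "s \<ge> 1" and v: "elliptic_weak_solution \<gamma>0 s f v" and f: "f \<in> L2"
		and q: "has_C1_gradient q a" "\<And>x. \<bar>q x\<bar> \<le> S" "\<And>x. norm (a x) \<le> S"
		and j: "0 < j" "j \<le> 1" "\<And>x. \<gamma>0 x * (norm (a x))^2 \<le> (1 - j) * s^2"
		and b: "AE x. f x \<noteq> 0 --> q x \<le> b"
	shows "(LINT x. (norm (exp (q x) *\<^sub>R weak_gradient v x))^2) \<le> 4 / (\<gamma>m * j^2) * (exp b * L2_norm f)^2"
		and "(%x. exp (q x) *\<^sub>R weak_gradient v x) \<in> L2"
proof -
	have vH: "v \<in> H1" using v by (simp add: elliptic_weak_solution_def)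
	define g where "g = weak_gradient v"
	have vL: "v \<in> L2" and vg: "is_weak_gradient v g" and gL: "g \<in> L2"
		unfolding g_def by (intro H1_L2 H1_weak_gradient H1_gradient_L2 vH)+
	define E where "E x = exp (q x)" for x
	have E0: "E x > 0" for x by (simp add: E_def)
	have c\<psi>: "continuous_on UNIV q" using q(1) by (rule has_C1_gradient_continuous)
	have Em: "E \<in> borel_measurable lebesgue"
		unfolding E_def[abs_def] by (intro continuous_lebesgue_measurable continuous_intros c\<psi>)
	have Eb: "\<bar>E x\<bar> \<le> exp S" for x using q(2)[of x] by (simp add: E_def)
	have S0: "S \<ge> 0" using q(2)[of 0] by linarith
	define z where "z x = exp (2 * q x)" for x
	have \<zeta>E: "z x = E x * E x" for x by (simp add: z_def E_def exp_add[symmetric])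
	have z: "has_C1_gradient z (%x. (2 * z x) *\<^sub>R a x)"
	proof -
		have "((%t. exp (2 * t)) has_real_derivative 2 * exp (2 * t)) (at t)" for t :: real
			by (auto intro!: derivative_eq_intros)
		from has_C1_gradient_compose[OF q(1) this] show ?thesis
			unfolding z_def[abs_def] by (simp add: continuous_intros)
	qed
	define M where "M = exp (2 * S) * (1 + 2 * S)"
	have \<zeta>b: "\<bar>z x\<bar> \<le> exp (2 * S)" for x using q(2)[of x] by (simp add: z_def)
	have M1: "\<bar>z x\<bar> \<le> M" for x
		using \<zeta>b[of x] S0 by (auto simp: M_def distrib_left intro: order_trans)
	have M2: "norm ((2 * z x) *\<^sub>R a x) \<le> M" for x
	proof -
		have "2 * \<bar>z x\<bar> * norm (a x) \<le> 2 * exp (2 * S) * S"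
			using \<zeta>b[of x] q(3)[of x] S0 by (intro mult_mono) auto
		also have "\<dots> \<le> M" by (simp add: M_def distrib_left)
		finally show ?thesis by (simp add: abs_mult)
	qed
	note w = is_weak_gradient_mult[OF vL vg z M1 M2]
	have test: "(LINT x. \<gamma>0 x * (g x \<bullet> (z x *\<^sub>R g x + v x *\<^sub>R ((2 * z x) *\<^sub>R a x)))) + s^2 * (LINT x. v x * (z x * v x)) = (LINT x. f x * (z x * v x))"
		unfolding g_def by (rule elliptic_test[OF v w[unfolded g_def]])
	define P where "P x = E x *\<^sub>R g x" for x
	define V where "V x = E x * v x" for x
	define Q where "Q x = V x *\<^sub>R a x" for x
	have PL: "P \<in> L2" unfolding P_def[abs_def] by (rule L2_bounded_mult[OF gL Em Eb])
	have VL: "V \<in> L2" unfolding V_def[abs_def] using L2_bounded_mult[OF vL Em Eb] by simp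
	have \<Psi>m: "a \<in> borel_measurable lebesgue"
		using q(1) by (intro continuous_lebesgue_measurable) (simp add: has_C1_gradient_def)
	have QL: "Q \<in> L2"
		unfolding Q_def[abs_def] using L2_measurable[OF VL] \<Psi>m q(3)
		by (intro L2_dominated[OF VL, where c = S]) (auto simp: mult.commute[of _ "norm (a _)"] intro!: mult_right_mono AE_I2)
	have PQ: "(%x. P x + Q x) \<in> L2" by (rule L2_add[OF PL QL])
	have alg: "\<gamma>0 x * (g x \<bullet> (z x *\<^sub>R g x + v x *\<^sub>R ((2 * z x) *\<^sub>R a x))) = \<gamma>0 x * ((P x + Q x) \<bullet> (P x + Q x)) - \<gamma>0 x * (Q x \<bullet> Q x)" for x
		by (simp add: P_def Q_def V_def \<zeta>E inner_add_left inner_add_right inner_commute algebra_simps)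
	define X Y F where "X = L2_norm V" and "Y = L2_norm (%x. P x + Q x)" and "F = exp b * L2_norm f"
	have X0: "X \<ge> 0" and F0: "F \<ge> 0" by (simp_all add: X_def F_def)
	have X2: "X^2 = (LINT x. v x * (z x * v x))"
		unfolding X_def L2_norm_power2 by (intro Bochner_Integration.integral_cong) (auto simp: V_def \<zeta>E power2_eq_square)
	have Qg: "(LINT x. \<gamma>0 x * (Q x \<bullet> Q x)) \<le> (1 - j) * s^2 * X^2"
	proof -
		have "(LINT x. \<gamma>0 x * (Q x \<bullet> Q x)) \<le> (LINT x. (1 - j) * s^2 * (norm (V x))^2)"
		proof (rule integral_mono)
			show "integrable lebesgue (%x. \<gamma>0 x * (Q x \<bullet> Q x))" by (rule gamma0_inner_integrable[OF QL QL])
			show "integrable lebesgue (%x. (1 - j) * s^2 * (norm (V x))^2)" using VL by (simp add: L2_def)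
			show "\<gamma>0 x * (Q x \<bullet> Q x) \<le> (1 - j) * s^2 * (norm (V x))^2" for x
				using mult_right_mono[OF j(3)[of x], of "(V x)^2"]
				by (simp add: Q_def dot_square_norm power2_eq_square algebra_simps)
		qed
		then show ?thesis by (simp add: X_def L2_norm_power2)
	qed
	have PQg: "\<gamma>m * Y^2 \<le> (LINT x. \<gamma>0 x * ((P x + Q x) \<bullet> (P x + Q x)))"
	proof -
		have "(LINT x. \<gamma>m * (norm (P x + Q x))^2) \<le> (LINT x. \<gamma>0 x * ((P x + Q x) \<bullet> (P x + Q x)))"
		proof (rule integral_mono)
			show "integrable lebesgue (%x. \<gamma>m * (norm (P x + Q x))^2)" using PQ by (simp add: L2_def)
			show "integrable lebesgue (%x. \<gamma>0 x * ((P x + Q x) \<bullet> (P x + Q x)))" by (rule gamma0_inner_integrable[OF PQ PQ])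
			show "\<gamma>m * (norm (P x + Q x))^2 \<le> \<gamma>0 x * ((P x + Q x) \<bullet> (P x + Q x))" for x
				using gamma0_bounds(1)[of x] by (simp add: dot_square_norm mult_right_mono)
		qed
		then show ?thesis by (simp add: Y_def L2_norm_power2)
	qed
	have rhs: "(LINT x. f x * (z x * v x)) \<le> F * X"
	proof -
		have Ef: "(%x. E x * f x) \<in> L2" using L2_bounded_mult[OF f Em Eb] by simp
		have "(LINT x. f x * (z x * v x)) = (LINT x. (E x * f x) \<bullet> V x)"
			by (intro Bochner_Integration.integral_cong) (auto simp: V_def \<zeta>E)
		also have "\<dots> \<le> L2_norm (%x. E x * f x) * X"
			using L2_Cauchy_Schwarz[OF Ef VL] by (simp add: X_def)
		also have "\<dots> \<le> F * X"
		proof (rule mult_right_mono)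
			show "L2_norm (%x. E x * f x) \<le> F"
				unfolding F_def
			proof (rule L2_norm_mono[OF f Ef])
				show "AE x. norm (E x * f x) \<le> exp b * norm (f x)"
					using b
				proof (rule eventually_mono)
					fix x assume "f x \<noteq> 0 --> q x \<le> b"
					then show "norm (E x * f x) \<le> exp b * norm (f x)"
						by (cases "f x = 0") (auto simp: E_def abs_mult)
				qed
			qed simp
		qed (rule X0)
		finally show ?thesis .
	qed
	\<comment> \<open>The weighted energy inequality, with X the norm of V and Y that of P + Q. It
	  bounds X by F / (j s^2), and then Y.\<close>
	have main: "\<gamma>m * Y^2 + j * s^2 * X^2 \<le> F * X"
	proof -
		have "(LINT x. \<gamma>0 x * ((P x + Q x) \<bullet> (P x + Q x))) - (LINT x. \<gamma>0 x * (Q x \<bullet> Q x)) + s^2 * X^2 \<le> F * X"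
			using test rhs unfolding alg X2
			using gamma0_inner_integrable[OF PQ PQ] gamma0_inner_integrable[OF QL QL] by simp
		then show ?thesis using Qg PQg by (simp add: algebra_simps)
	qed
	have kt: "j * s^2 > 0" using j s by simp
	have k1: "j \<le> j * s^2" using j s by (simp add: mult_le_cancel_left1 power2_eq_square mult_ge1_I)
	have YX: "Y^2 \<ge> 0" "\<gamma>m * Y^2 \<ge> 0" using gamma_m_pos by auto
	have Xle: "j * s^2 * X \<le> F"
	proof (cases "X = 0")
		case True then show ?thesis using F0 by simp
	next
		case False
		then have "X > 0" using X0 by simp
		moreover have "j * s^2 * X * X \<le> F * X" using main YX by (simp add: power2_eq_square)
		ultimately show ?thesis by simp
	qed
	have Xk: "j * X \<le> F"
		using Xle mult_right_mono[OF k1 X0] by linarith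
	have Yle: "\<gamma>m * j * Y^2 \<le> F^2"
	proof -
		have "\<gamma>m * Y^2 \<le> F * X" using main kt X0 by (smt (verit) mult_nonneg_nonneg zero_le_power2)
		then have "j * (\<gamma>m * Y^2) \<le> j * (F * X)" using j by (intro mult_left_mono) auto
		also have "\<dots> = F * (j * X)" by simp
		also have "\<dots> \<le> F * F" using Xk F0 by (intro mult_left_mono) auto
		finally show ?thesis by (simp add: power2_eq_square algebra_simps)
	qed
	have Qle: "\<gamma>m * j^2 * (L2_norm Q)^2 \<le> F^2"
	proof -
		have "(LINT x. \<gamma>m * (norm (Q x))^2) \<le> (LINT x. \<gamma>0 x * (Q x \<bullet> Q x))"
		proof (rule integral_mono)
			show "integrable lebesgue (%x. \<gamma>m * (norm (Q x))^2)" using QL by (simp add: L2_def)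
			show "integrable lebesgue (%x. \<gamma>0 x * (Q x \<bullet> Q x))" by (rule gamma0_inner_integrable[OF QL QL])
			show "\<gamma>m * (norm (Q x))^2 \<le> \<gamma>0 x * (Q x \<bullet> Q x)" for x
				using gamma0_bounds(1)[of x] by (simp add: dot_square_norm mult_right_mono)
		qed
		then have "\<gamma>m * (L2_norm Q)^2 \<le> (1 - j) * s^2 * X^2" using Qg by (simp add: L2_norm_power2)
		also have "\<dots> \<le> 1 * s^2 * X^2" using j by (intro mult_right_mono) auto
		finally have "j^2 * (\<gamma>m * (L2_norm Q)^2) \<le> j^2 * (s^2 * X^2)" by (intro mult_left_mono) auto
		also have "\<dots> = (j * (s * X))^2" by (simp add: power_mult_distrib)
		also have "\<dots> \<le> F^2"
		proof (rule power_mono)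
			have "s * X \<le> s^2 * X" using s X0 by (intro mult_right_mono) (auto simp: power2_eq_square mult_le_cancel_left1)
			then have "j * (s * X) \<le> j * (s^2 * X)" using j by (intro mult_left_mono) auto
			then show "j * (s * X) \<le> F" using Xle by (simp add: mult.assoc)
			show "0 \<le> j * (s * X)" using j s X0 by simp
		qed
		finally show ?thesis by (simp add: algebra_simps)
	qed
	\<comment> \<open>P is the difference of P + Q and Q, each with squared norm at most F^2 /
	  (\<gamma>m j^2); hence the factor 4.\<close>
	have "(L2_norm P)^2 \<le> 2 * Y^2 + 2 * (L2_norm Q)^2"
	proof -
		have "L2_norm P \<le> Y + L2_norm Q"
			using L2_norm_triangle[OF PQ L2_minus[OF QL]] by (simp add: Y_def L2_norm_uminus)
		then have "(L2_norm P)^2 \<le> (Y + L2_norm Q)^2" by (intro power_mono) auto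
		also have "\<dots> \<le> 2 * Y^2 + 2 * (L2_norm Q)^2" using sum_squares_bound[of Y "L2_norm Q"] by (simp add: power2_sum)
		finally show ?thesis .
	qed
	then have "\<gamma>m * j^2 * (L2_norm P)^2 \<le> \<gamma>m * j^2 * (2 * Y^2 + 2 * (L2_norm Q)^2)"
		using gamma_m_pos by (intro mult_left_mono) auto
	also have "\<dots> = 2 * (j * (\<gamma>m * j * Y^2)) + 2 * (\<gamma>m * j^2 * (L2_norm Q)^2)" by (simp add: power2_eq_square algebra_simps)
	also have "\<dots> \<le> 2 * (1 * F^2) + 2 * F^2"
		using j Yle Qle gamma_m_pos by (intro add_mono mult_left_mono mult_mono) auto
	finally have "\<gamma>m * j^2 * (L2_norm P)^2 \<le> 4 * F^2" by simp
	moreover have "\<gamma>m * j^2 > 0" using gamma_m_pos j by simp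
	ultimately have "(L2_norm P)^2 \<le> 4 / (\<gamma>m * j^2) * F^2" by (simp add: pos_le_divide_eq mult.commute)
	then show "(LINT x. (norm (exp (q x) *\<^sub>R weak_gradient v x))^2) \<le> 4 / (\<gamma>m * j^2) * (exp b * L2_norm f)^2"
		by (simp add: L2_norm_power2 P_def E_def g_def F_def)
	show "(%x. exp (q x) *\<^sub>R weak_gradient v x) \<in> L2" using PL by (simp add: P_def[abs_def] E_def g_def)
qed

end

section \<open>The travel time weight and the upper bound\<close>

text \<open>A gradient longer than \<open>L\<close> contradicts the bound at a point reached by a
  short step along the gradient itself.\<close>

lemma C1_gradient_norm_le:
	fixes f :: "'a::euclidean_space => real"
	assumes G: "has_C1_gradient f G" and U: "open U" "x \<in> U" and L: "\<And>y. y \<in> U ==> \<bar>f y - f x\<bar> \<le> L * norm (y - x)"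
	shows "norm (G x) \<le> L"
proof (rule ccontr)
	assume "\<not> norm (G x) \<le> L"
	define n where "n = norm (G x)"
	define e where "e = (n - L) / 2"
	have "L < n" using \<open>\<not> norm (G x) \<le> L\<close> by (simp add: n_def)
	obtain r where r: "r > 0" "ball x r \<subseteq> U" using U open_contains_ball by metis
	\<comment> \<open>If the gradient vanished, \<open>L\<close> would be negative, which any nearby
	  point of \<open>U\<close> refutes.\<close>
	have n0: "n > 0"
	proof (rule ccontr)
		assume "\<not> n > 0"
		then have "L < 0" using \<open>L < n\<close> by simp
		obtain b :: 'a where b: "b \<in> Basis" using nonempty_Basis by blast
		have "x + (r / 2) *\<^sub>R b \<in> U" using r b by (auto simp: subset_iff dist_norm)
		then have "0 \<le> L * norm ((r / 2) *\<^sub>R b)" using L[of "x + (r / 2) *\<^sub>R b"] by (smt (verit) add_diff_cancel_left')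
		then show False using \<open>L < 0\<close> r b by (simp add: zero_le_mult_iff)
	qed
	have e: "e > 0" using \<open>L < n\<close> by (simp add: e_def)
	have "(f has_derivative (%h. G x \<bullet> h)) (at x)" using G by (simp add: has_C1_gradient_def)
	then obtain d where d: "d > 0" "\<And>y. norm (y - x) < d ==> norm (f y - f x - G x \<bullet> (y - x)) \<le> e * norm (y - x)"
		unfolding has_derivative_at_alt using e by blast
	define t where "t = min d r / (2 * n)"
	have t: "t > 0" using d r n0 by (simp add: t_def)
	have tn: "t * n < d" "t * n < r" using d r n0 by (auto simp: t_def)
	define y where "y = x + t *\<^sub>R G x"
	have yx: "y - x = t *\<^sub>R G x" "norm (y - x) = t * n" using t by (auto simp: y_def n_def)
	have "y \<in> U" using r(2) tn yx by (auto simp: subset_iff dist_norm norm_minus_commute)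
	have "G x \<bullet> (y - x) = t * n^2" unfolding yx by (simp add: n_def dot_square_norm)
	then have "t * n^2 \<le> L * (t * n) + e * (t * n)"
		using d(2)[of y] L[OF \<open>y \<in> U\<close>] tn unfolding yx(2) real_norm_def by linarith
	then have "(t * n) * n \<le> (t * n) * (L + e)" by (simp add: power2_eq_square algebra_simps)
	then have "n \<le> L + e" using t n0 by (simp add: mult_le_cancel_left_pos)
	then show False using \<open>L < n\<close> by (simp add: e_def field_simps)
qed

text \<open>The difference is an average over translates with |z| <= s. Asking for the bound only at
  such translates lets a Lipschitz constant be used that holds on a half-space only.\<close>

lemma mollify_lipschitz:
	fixes w :: "'a::euclidean_space => real"
	assumes "s > 0" "continuous_on UNIV w" "\<And>z. norm z \<le> s ==> \<bar>w (x - z) - w (y - z)\<bar> \<le> K"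
	shows "\<bar>conv w (mollifier s) x - conv w (mollifier s) y\<bar> \<le> K"
proof -
	let ?m = "mollifier s :: 'a => real"
	have i: "integrable lebesgue (%z. ?m z * w (x - z))" for x
	proof (rule continuous_vanishes_integrable[where R = s])
		show "continuous_on UNIV (%z. ?m z * w (x - z))"
			by (intro continuous_intros mollifier_continuous assms continuous_on_compose2[OF assms(2)]) auto
		show "vanishes_beyond s (%z. ?m z * w (x - z))"
			using mollifier_vanishes[OF assms(1), where 'a = 'a] by (simp add: vanishes_beyond_def)
	qed
	have "conv w ?m x - conv w ?m y = (LINT z. ?m z * w (x - z) - ?m z * w (y - z))"
		unfolding conv_def using i by simp
	also have "norm \<dots> \<le> (LINT z. norm (?m z * w (x - z) - ?m z * w (y - z)))"
		by (rule integral_norm_bound)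
	also have "\<dots> \<le> (LINT z. ?m z * K)"
	proof (rule integral_mono)
		show "integrable lebesgue (%z. norm (?m z * w (x - z) - ?m z * w (y - z)))" using i by simp
		show "integrable lebesgue (%z. ?m z * K)" by (intro integrable_mult_left mollifier_integrable assms)
		fix z :: 'a
		show "norm (?m z * w (x - z) - ?m z * w (y - z)) \<le> ?m z * K"
		proof (cases "norm z \<le> s")
			case True
			have "\<bar>?m z\<bar> * \<bar>w (x - z) - w (y - z)\<bar> \<le> ?m z * K"
				using assms(3)[OF True] mollifier_nonneg[OF assms(1), of z] by (simp add: mult_left_mono)
			then show ?thesis by (simp add: right_diff_distrib[symmetric] abs_mult)
		next
			case False
			then show ?thesis using mollifier_vanishes[OF assms(1), where 'a = 'a] by (simp add: vanishes_beyond_def)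
		qed
	qed
	also have "\<dots> = K" using mollifier_integral[OF assms(1), where 'a = 'a] by simp
	finally show ?thesis by simp
qed

context two_layer begin

text \<open>The segment from \<open>p\<close> down to \<open>x\<close> meets the interface at
  \<open>q\<close>. Going from \<open>p\<close> to \<open>q\<close> at the fast speed costs no more
  than at the slow one, and the direct way from \<open>y\<close> to \<open>q\<close> is no longer
  than the one through \<open>p\<close>. Hence leaving the fast regime at any point of the closed
  upper half-space never beats the optical distance.\<close>

lemma optical_setdist_le_detour:
	assumes "x \<in> D" "y \<in> B" "x $ 3 < 0" "p $ 3 \<ge> 0"
	shows "optical_setdist \<gamma>p \<gamma>m D B \<le> 1 / sqrt \<gamma>p * norm (p - y) + 1 / sqrt \<gamma>m * norm (x - p)"
proof -
	have ab: "1 / sqrt \<gamma>p \<le> 1 / sqrt \<gamma>m" using gamma_m_pos gamma_m_less by (intro divide_left_mono) auto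
	have b0: "1 / sqrt \<gamma>p > 0" using gamma_m_pos gamma_m_less by simp
	define t where "t = - x $ 3 / (p $ 3 - x $ 3)"
	have t: "0 \<le> t" "t \<le> 1" using assms by (auto simp: t_def field_simps)
	define q where "q = x + t *\<^sub>R (p - x)"
	have q3: "q $ 3 = 0" using assms by (simp add: q_def t_def field_simps)
	have qv: "(vector [q $ 1, q $ 2, 0] :: R3) = q" using q3 by (simp add: vec_eq_iff forall_3)
	have "p - q = (1 - t) *\<^sub>R (p - x)" by (simp add: q_def algebra_simps)
	then have pq: "norm (p - q) = (1 - t) * norm (x - p)" using t by (simp add: norm_minus_commute)
	have qx: "norm (q - x) = t * norm (x - p)" using t by (simp add: q_def norm_minus_commute)
	have "optical_setdist \<gamma>p \<gamma>m D B \<le> path_time \<gamma>p \<gamma>m x y (vector [q $ 1, q $ 2])"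
		using assms by (intro optical_setdist_le)
	also have "\<dots> = 1 / sqrt \<gamma>m * norm (q - x) + 1 / sqrt \<gamma>p * norm (q - y)"
		by (simp add: path_time_def qv)
	also have "\<dots> \<le> 1 / sqrt \<gamma>m * norm (q - x) + 1 / sqrt \<gamma>p * (norm (p - q) + norm (p - y))"
		using b0 norm_triangle_ineq[of "q - p" "p - y"] by (intro add_left_mono mult_left_mono) (auto simp: norm_minus_commute)
	also have "\<dots> = 1 / sqrt \<gamma>m * norm (q - x) + 1 / sqrt \<gamma>p * norm (p - q) + 1 / sqrt \<gamma>p * norm (p - y)"
		by (simp only: distrib_left add.assoc)
	also have "\<dots> \<le> 1 / sqrt \<gamma>m * norm (q - x) + 1 / sqrt \<gamma>m * norm (p - q) + 1 / sqrt \<gamma>p * norm (p - y)"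
		using ab by (intro add_mono mult_right_mono) auto
	also have "\<dots> = 1 / sqrt \<gamma>p * norm (p - y) + 1 / sqrt \<gamma>m * norm (x - p)"
		unfolding pq qx by (simp add: algebra_simps)
	finally show ?thesis .
qed

text \<open>The weight is the travel time from \<open>B\<close>, first through the upper layer and then with the slow speed,
	truncated at its value on \<open>D\<close>. The shift upwards before mollifying keeps the smaller Lipschitz
	constant of the upper layer valid up to the interface.\<close>

lemma weight_exists:
	assumes B: "B \<noteq> {}" "closure B \<subseteq> {x. x $ 3 > 0}" and D: "D \<noteq> {}" "D \<subseteq> {x. x $ 3 < 0}" and e: "e > 0"
	defines "l \<equiv> optical_setdist \<gamma>p \<gamma>m D B"
	obtains d G where "has_C1_gradient d G" "\<And>x. \<gamma>0 x * (norm (G x))^2 \<le> 1" "\<And>x. \<bar>d x\<bar> \<le> l + e"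
		"\<And>x. x \<in> D ==> l - e \<le> d x" "\<And>x. x \<in> closure B ==> d x \<le> e"
proof -
	define a b where "a = 1 / sqrt \<gamma>m" and "b = 1 / sqrt \<gamma>p"
	have gp: "\<gamma>p > 0" using gamma_m_pos gamma_m_less by simp
	have b0: "b > 0" and a0: "a > 0" using gp gamma_m_pos by (auto simp: a_def b_def)
	have ba: "b \<le> a" unfolding a_def b_def using gamma_m_pos gamma_m_less by (intro divide_left_mono) auto
	have l0: "l \<ge> 0" unfolding l_def using D B by (intro optical_setdist_nonneg)
	define U where "U = {p::R3. p $ 3 \<ge> 0}"
	have U: "U \<noteq> {}" by (auto simp: U_def intro: exI[of _ 0])
	\<comment> \<open>Infimum over entry points \<open>p\<close> of the fast time from \<open>B\<close>
	  to \<open>p\<close> plus the slow time from \<open>p\<close> to \<open>x\<close>. As a function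
	  of \<open>x\<close> it is Lipschitz with the slow constant \<open>a\<close>.\<close>
	define d0 where "d0 x = (INF p\<in>U. b * infdist p B + a * norm (x - p))" for x
	have d0_le: "d0 x \<le> b * infdist p B + a * norm (x - p)" if "p \<in> U" for x p
		unfolding d0_def using that a0 b0
		by (intro cINF_lower bdd_belowI2[where m = 0]) (auto simp: infdist_nonneg intro!: add_nonneg_nonneg)
	have d0_ge: "c \<le> d0 x" if "\<And>p. p \<in> U ==> c \<le> b * infdist p B + a * norm (x - p)" for c x
		unfolding d0_def using U that by (intro cINF_greatest)
	have lip0: "d0 x \<le> d0 y + a * norm (x - y)" for x y
	proof -
		have "d0 x - a * norm (x - y) \<le> d0 y"
		proof (rule d0_ge)
			fix p assume p: "p \<in> U"
			have "a * norm (x - p) \<le> a * (norm (x - y) + norm (y - p))"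
				using a0 norm_triangle_ineq[of "x - y" "y - p"] by (intro mult_left_mono) auto
			then show "d0 x - a * norm (x - y) \<le> b * infdist p B + a * norm (y - p)"
				using d0_le[OF p, of x] by (simp add: distrib_left)
		qed
		then show ?thesis by simp
	qed
	\<comment> \<open>In the upper layer the best entry point is the point itself, because b <= a; so
	  the Lipschitz constant there is \<open>b\<close>.\<close>
	have up: "d0 x = b * infdist x B" if "x \<in> U" for x
	proof (rule antisym)
		show "d0 x \<le> b * infdist x B" using d0_le[OF that, of x] by simp
		show "b * infdist x B \<le> d0 x"
		proof (rule d0_ge)
			fix p assume "p \<in> U"
			have "b * infdist x B \<le> b * (infdist p B + norm (x - p))"
				using b0 infdist_triangle[of x B p] by (intro mult_left_mono) (auto simp: dist_norm)
			also have "\<dots> \<le> b * infdist p B + a * norm (x - p)" using ba by (simp add: distrib_left mult_right_mono)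
			finally show "b * infdist x B \<le> b * infdist p B + a * norm (x - p)" .
		qed
	qed
	define dL where "dL x = min l (d0 x)" for x
	have dL_lip: "\<bar>dL x - dL y\<bar> \<le> a * norm (x - y)" for x y
		using lip0[of x y] lip0[of y x] by (simp add: dL_def norm_minus_commute min_def abs_le_iff)
	have dL_up: "\<bar>dL x - dL y\<bar> \<le> b * norm (x - y)" if "x \<in> U" "y \<in> U" for x y
	proof -
		have "b * infdist x B \<le> b * (infdist y B + norm (x - y))" "b * infdist y B \<le> b * (infdist x B + norm (x - y))"
			using b0 infdist_triangle[of x B y] infdist_triangle[of y B x]
			by (auto simp: dist_norm norm_minus_commute intro!: mult_left_mono)
		then show ?thesis unfolding dL_def up[OF that(1)] up[OF that(2)] by (simp add: distrib_left min_def abs_le_iff)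
	qed
	have d00: "d0 x \<ge> 0" for x using a0 b0 by (intro d0_ge) (simp add: infdist_nonneg)
	have dL0: "0 \<le> dL x" "dL x \<le> l" for x using d00[of x] l0 by (auto simp: dL_def)
	have dLB: "dL x = 0" if "x \<in> closure B" for x
	proof -
		have "x \<in> U" using B(2) that by (auto simp: U_def less_imp_le)
		moreover have "infdist x B = 0" using that B(1) by (simp add: in_closure_iff_infdist_zero)
		ultimately show ?thesis using l0 by (simp add: dL_def up)
	qed
	have dLD: "dL x = l" if x: "x \<in> D" for x
	proof -
		have "l \<le> d0 x"
		proof (rule d0_ge)
			fix p assume p: "p \<in> U"
			have "(l - a * norm (x - p)) / b \<le> infdist p B"
				unfolding infdist_notempty[OF B(1)]
			proof (rule cINF_greatest[OF B(1)])
				fix y assume "y \<in> B"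
				then have "l \<le> b * norm (p - y) + a * norm (x - p)"
					unfolding l_def a_def b_def using x D(2) p by (intro optical_setdist_le_detour) (auto simp: U_def)
				then show "(l - a * norm (x - p)) / b \<le> dist p y"
					using b0 by (simp add: pos_divide_le_eq dist_norm mult.commute)
			qed
			then show "l \<le> b * infdist p B + a * norm (x - p)" using b0 by (simp add: pos_divide_le_eq mult.commute)
		qed
		then show ?thesis by (simp add: dL_def)
	qed
	\<comment> \<open>Mollifying and shifting change the weight by at most \<open>a * s\<close>
	  each.\<close>
	define s where "s = e / (2 * a + 1)"
	have s: "s > 0" using e a0 by (simp add: s_def)
	have s2: "2 * (a * s) \<le> e"
	proof -
		have "2 * (a * s) = e * (2 * a / (2 * a + 1))" by (simp add: s_def)
		also have "\<dots> \<le> e * 1" using e a0 by (intro mult_left_mono) auto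
		finally show ?thesis by simp
	qed
	define w where "w x = dL (x + s *\<^sub>R axis 3 1)" for x
	have w_lip: "\<bar>w x - w y\<bar> \<le> a * norm (x - y)" for x y
		unfolding w_def using dL_lip[of "x + s *\<^sub>R axis 3 1" "y + s *\<^sub>R axis 3 1"] by simp
	have wc: "continuous_on UNIV w"
	proof (rule lipschitz_on_continuous_on)
		show "a-lipschitz_on UNIV w" using w_lip a0 by (intro lipschitz_onI) (auto simp: dist_norm)
	qed
	let ?m = "mollifier s :: R3 => real"
	define d where "d = conv w ?m"
	obtain M where M: "has_C1_gradient ?m M" using Ck_has_C1_gradient[OF Ck_mollifier[OF s]] by metis
	have "has_C1_gradient (conv ?m w) (conv M w)"
		by (rule conv_derivative[OF M mollifier_vanishes[OF s] continuous_loc_integrable[OF wc]])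
	moreover have "conv ?m w = d"
		unfolding d_def by (intro conv_commute continuous_lebesgue_measurable wc mollifier_continuous s)
	ultimately have G: "has_C1_gradient d (conv M w)" by simp
	have near: "\<bar>d x - dL x\<bar> \<le> e" for x
	proof -
		have "norm (d x - w x) \<le> a * s"
			unfolding d_def
		proof (rule mollify_uniform[OF s wc])
			fix y :: R3 assume "norm (x - y) \<le> s"
			then have "a * norm (x - y) \<le> a * s" using a0 by (intro mult_left_mono) auto
			then show "norm (w y - w x) \<le> a * s" using w_lip[of x y] by (simp add: abs_minus_commute)
		qed
		moreover have "\<bar>w x - dL x\<bar> \<le> a * s"
			unfolding w_def using dL_lip[of "x + s *\<^sub>R axis 3 1" x] s by simp
		ultimately show ?thesis using s2 by simp
	qed
	have Ga: "norm (conv M w x) \<le> a" for x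
	proof (rule C1_gradient_norm_le[OF G open_UNIV])
		show "\<bar>d y - d x\<bar> \<le> a * norm (y - x)" for y
			unfolding d_def
		proof (rule mollify_lipschitz[OF s wc])
			show "\<bar>w (y - z) - w (x - z)\<bar> \<le> a * norm (y - x)" for z using w_lip[of "y - z" "x - z"] by simp
		qed
	qed simp
	have Gb: "norm (conv M w x) \<le> b" if x: "x $ 3 > 0" for x
	proof (rule C1_gradient_norm_le[OF G])
		show "open {x::R3. x $ 3 > 0}" by (intro open_Collect_less continuous_intros)
		show "x \<in> {x. x $ 3 > 0}" using x by simp
		show "\<bar>d y - d x\<bar> \<le> b * norm (y - x)" if y: "y \<in> {x. x $ 3 > 0}" for y
			unfolding d_def
		proof (rule mollify_lipschitz[OF s wc])
			fix z :: R3 assume z: "norm z \<le> s"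
			have "\<bar>z $ 3\<bar> \<le> s" using component_le_norm_cart[of z 3] z by linarith
			then have "x - z + s *\<^sub>R axis 3 1 \<in> U" "y - z + s *\<^sub>R axis 3 1 \<in> U"
				using x y by (auto simp: U_def axis_def)
			from dL_up[OF this(2,1)] show "\<bar>w (y - z) - w (x - z)\<bar> \<le> b * norm (y - x)" by (simp add: w_def)
		qed
	qed
	have "\<gamma>0 x * (norm (conv M w x))^2 \<le> 1" for x
	proof (cases "x $ 3 > 0")
		case True
		have "\<gamma>0 x * (norm (conv M w x))^2 \<le> \<gamma>p * b^2"
			using Gb[OF True] True gp by (intro mult_mono power_mono) (auto simp: gamma0_def)
		then show ?thesis using gp by (simp add: b_def power_divide)
	next
		case False
		have "\<gamma>0 x * (norm (conv M w x))^2 \<le> \<gamma>m * a^2"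
			using Ga False gamma_m_pos by (intro mult_mono power_mono) (auto simp: gamma0_def)
		then show ?thesis using gamma_m_pos by (simp add: a_def power_divide)
	qed
	moreover have "\<bar>d x\<bar> \<le> l + e" for x using near[of x] dL0[of x] by linarith
	moreover have "l - e \<le> d x" if "x \<in> D" for x using near[of x] dLD[OF that] by linarith
	moreover have "d x \<le> e" if "x \<in> closure B" for x using near[of x] dLB[OF that] by linarith
	ultimately show ?thesis using that[OF G] by blast
qed

text \<open>The exponent of the weight is close to \<open>s l\<close> on \<open>D\<close> and close
  to 0 on the closure of \<open>B\<close>, which carries the source; the squares in the weighted
  estimate turn this into the rate 2 l.\<close>

lemma gradient_upper_bound:
	assumes v: "\<forall>s>0. elliptic_weak_solution \<gamma>0 s f (v s)"
		and f: "f \<in> L2" "AE x. x \<notin> closure B --> f x = 0"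
		and B: "B \<noteq> {}" "closure B \<subseteq> {x. x $ 3 > 0}" and D: "D \<noteq> {}" "open D" "D \<subseteq> {x. x $ 3 < 0}" and a: "a > 0"
	shows "\<exists>C>0. \<forall>s\<ge>1. (LINT x. indicator D x * (norm (weak_gradient (v s) x))^2)
		\<le> C * exp (- 2 * s * (optical_setdist \<gamma>p \<gamma>m D B - a))"
proof -
	define l where "l = optical_setdist \<gamma>p \<gamma>m D B"
	have l0: "l \<ge> 0" unfolding l_def using D B by (intro optical_setdist_nonneg)
	\<comment> \<open>The margin \<open>e\<close> is lost three times: in the mollified weight on
	  \<open>D\<close>, in the factor 1 - h, and in the size of the weight on the support of the
	  source. The total 3 e is at most \<open>a\<close>.\<close>
	define e where "e = min (a / 4) 1"
	have e: "e > 0" "e \<le> a / 4" using a by (auto simp: e_def)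
	obtain d G where G: "has_C1_gradient d G" and G1: "\<And>x. \<gamma>0 x * (norm (G x))^2 \<le> 1" and db: "\<And>x. \<bar>d x\<bar> \<le> l + e"
		and dD: "\<And>x. x \<in> D ==> l - e \<le> d x" and dB: "\<And>x. x \<in> closure B ==> d x \<le> e"
		using weight_exists[OF B D(1,3) e(1), folded l_def] by metis
	\<comment> \<open>The weight enters with the factor (1 - h) s, whence the eikonal margin j = 1 - (1
	  - h)^2; \<open>h\<close> is chosen so that this costs at most \<open>e\<close> in the
	  rate.\<close>
	define h where "h = min (1 / 2) (e / (l + 1))"
	have h: "0 < h" "h \<le> 1 / 2" "h * (l + 1) \<le> e"
	proof -
		show "0 < h" using e l0 by (auto simp: h_def)
		show "h \<le> 1 / 2" unfolding h_def by (rule min.cobounded1)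
		have "h \<le> e / (l + 1)" unfolding h_def by (rule min.cobounded2)
		then show "h * (l + 1) \<le> e" using l0 by (simp add: pos_le_divide_eq)
	qed
	define j where "j = 1 - (1 - h)^2"
	have j: "0 < j" "j \<le> 1"
	proof -
		have "(1 - h)^2 < 1^2" using h by (intro power_strict_mono) auto
		then show "0 < j" by (simp add: j_def)
		show "j \<le> 1" by (simp add: j_def)
	qed
	define C where "C = 4 / (\<gamma>m * j^2) * (L2_norm f)^2 + 1"
	have C: "C > 0" using gamma_m_pos j by (simp add: C_def add_nonneg_pos)
	have "(LINT x. indicator D x * (norm (weak_gradient (v s) x))^2) \<le> C * exp (- 2 * s * (l - a))" if s: "s \<ge> 1" for s
	proof -
		have tp: "s > 0" using s by simp
		define g where "g = weak_gradient (v s)"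
		have vH: "v s \<in> H1" using v[rule_format, OF tp] by (simp add: elliptic_weak_solution_def)
		have gL: "g \<in> L2" unfolding g_def by (rule H1_gradient_L2[OF vH])
		define c where "c = s * (1 - h)"
		have c: "c > 0" "c \<le> s" using tp h by (auto simp: c_def mult_le_cancel_left1)
		define S where "S = c * (l + e) + c / sqrt \<gamma>m"
		have q: "has_C1_gradient (%x. c * d x) (%x. c *\<^sub>R G x)"
		proof -
			have "((%t. c * t) has_real_derivative c) (at t)" for t by (auto intro!: derivative_eq_intros)
			from has_C1_gradient_compose[OF G this] show ?thesis by simp
		qed
		have S1: "\<bar>c * d x\<bar> \<le> S" for x
		proof -
			have "\<bar>c * d x\<bar> \<le> c * (l + e)" using c db[of x] by (simp add: abs_mult)
			then show ?thesis using c gamma_m_pos by (simp add: S_def add_increasing2)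
		qed
		have S2: "norm (c *\<^sub>R G x) \<le> S" for x
		proof -
			have "\<gamma>m * (norm (G x))^2 \<le> 1"
				using mult_right_mono[OF gamma0_bounds(1)[of x], of "(norm (G x))^2"] G1[of x] by simp
			then have "(norm (G x))^2 \<le> (1 / sqrt \<gamma>m)^2" using gamma_m_pos by (simp add: power_divide pos_le_divide_eq mult.commute)
			then have "norm (G x) \<le> 1 / sqrt \<gamma>m" by (rule power2_le_imp_le) (use gamma_m_pos in simp)
			then have "c * norm (G x) \<le> c * (1 / sqrt \<gamma>m)" using c by (intro mult_left_mono) auto
			moreover have "0 \<le> c * (l + e)" using c l0 e by simp
			ultimately show ?thesis using c by (simp add: S_def)
		qed
		have K: "\<gamma>0 x * (norm (c *\<^sub>R G x))^2 \<le> (1 - j) * s^2" for x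
		proof -
			have "\<gamma>0 x * (norm (c *\<^sub>R G x))^2 = c^2 * (\<gamma>0 x * (norm (G x))^2)" by (simp add: power_mult_distrib)
			also have "\<dots> \<le> c^2 * 1" by (intro mult_left_mono G1) auto
			also have "\<dots> = (1 - j) * s^2" by (simp add: c_def j_def power_mult_distrib mult.commute)
			finally show ?thesis .
		qed
		have b: "AE x. f x \<noteq> 0 --> c * d x \<le> s * e"
			using f(2)
		proof (rule eventually_mono, intro impI)
			fix x assume "x \<notin> closure B --> f x = 0" "f x \<noteq> 0"
			then have "d x \<le> e" using dB by blast
			then have "c * d x \<le> c * e" using c by (intro mult_left_mono) auto
			also have "\<dots> \<le> s * e" using c e by (intro mult_right_mono) auto
			finally show "c * d x \<le> s * e" .
		qed
		note ag = agmon_estimate[OF s v[rule_format, OF tp] f(1) q S1 S2 j K b, folded g_def]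
		have cl: "s * (l - 2 * e) \<le> c * (l - e)"
		proof -
			have "h * (l - e) \<le> h * (l + 1)" using h e by (intro mult_left_mono) auto
			then have "l - 2 * e \<le> (1 - h) * (l - e)" using h(3) by (simp add: algebra_simps)
			then show ?thesis using tp by (simp add: c_def mult_left_mono)
		qed
		have Dm: "(indicator D :: R3 => real) \<in> borel_measurable lebesgue"
			using D(2) by (intro borel_measurable_indicator) (simp add: sets_completionI_sets)
		have gD: "(%z. indicator D z *\<^sub>R g z) \<in> L2" by (rule L2_bounded_mult[OF gL Dm, of 1]) (simp add: indicator_def)
		have iD: "integrable lebesgue (%x. indicator D x * (norm (g x))^2)"
		proof -
			have "(%x. (norm (indicator D x *\<^sub>R g x))^2) = (%x. indicator D x * (norm (g x))^2)" by (auto simp: indicator_def)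
			then show ?thesis using L2_integrable_square[OF gD] by simp
		qed
		have "exp (2 * s * (l - 2 * e)) * (LINT x. indicator D x * (norm (g x))^2)
			 = (LINT x. exp (2 * s * (l - 2 * e)) * (indicator D x * (norm (g x))^2))" by simp
		also have "\<dots> \<le> (LINT x. (norm (exp (c * d x) *\<^sub>R g x))^2)"
		proof (rule integral_mono)
			show "integrable lebesgue (%x. exp (2 * s * (l - 2 * e)) * (indicator D x * (norm (g x))^2))" using iD by simp
			show "integrable lebesgue (%x. (norm (exp (c * d x) *\<^sub>R g x))^2)" by (rule L2_integrable_square[OF ag(2)])
			show "exp (2 * s * (l - 2 * e)) * (indicator D x * (norm (g x))^2) \<le> (norm (exp (c * d x) *\<^sub>R g x))^2" for x
			proof (cases "x \<in> D")
				case True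
				have "c * (l - e) \<le> c * d x" using c dD[OF True] by (intro mult_left_mono) auto
				then have "2 * s * (l - 2 * e) \<le> c * d x + c * d x" using cl by simp
				then have "exp (2 * s * (l - 2 * e)) \<le> (exp (c * d x))^2" unfolding power2_eq_square exp_add[symmetric] by simp
				then have "exp (2 * s * (l - 2 * e)) * (norm (g x))^2 \<le> (exp (c * d x))^2 * (norm (g x))^2"
					by (intro mult_right_mono) auto
				then show ?thesis using True by (simp add: power_mult_distrib)
			qed simp
		qed
		also have "\<dots> \<le> 4 / (\<gamma>m * j^2) * (exp (s * e) * L2_norm f)^2" by (rule ag(1))
		also have "\<dots> = exp (2 * s * e) * (4 / (\<gamma>m * j^2) * (L2_norm f)^2)"
		proof -
			have "(exp (s * e))^2 = exp (2 * s * e)" unfolding power2_eq_square exp_add[symmetric] by simp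
			then show ?thesis by (simp add: power_mult_distrib)
		qed
		also have "\<dots> \<le> exp (2 * s * e) * C" by (intro mult_left_mono) (auto simp: C_def)
		finally have "exp (2 * s * (l - 2 * e)) * (LINT x. indicator D x * (norm (g x))^2) \<le> exp (2 * s * e) * C" .
		then have "exp (- (2 * s * (l - 2 * e))) * (exp (2 * s * (l - 2 * e)) * (LINT x. indicator D x * (norm (g x))^2))
			\<le> exp (- (2 * s * (l - 2 * e))) * (exp (2 * s * e) * C)" by (intro mult_left_mono) auto
		then have "(LINT x. indicator D x * (norm (g x))^2) \<le> exp (- (2 * s * (l - 2 * e)) + 2 * s * e) * C"
			unfolding mult.assoc[symmetric] exp_add[symmetric] by simp
		also have "\<dots> \<le> exp (- 2 * s * (l - a)) * C"
		proof (rule mult_right_mono)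
			have "2 * s * (3 * e) \<le> 2 * s * a" using tp e a by (intro mult_left_mono) auto
			then show "exp (- (2 * s * (l - 2 * e)) + 2 * s * e) \<le> exp (- 2 * s * (l - a))" by (simp add: algebra_simps)
		qed (use C in simp)
		finally show ?thesis by (simp add: g_def mult.commute)
	qed
	then show ?thesis unfolding l_def using C by blast
qed

end

section \<open>The Laplace transform in time\<close>

lemma H1_norm_eq:
	assumes "u \<in> L2" "is_weak_gradient u g"
	shows "H1_norm u = sqrt ((L2_norm u)^2 + (L2_norm g)^2)"
proof -
	have "L2_norm (weak_gradient u) = L2_norm g"
		using weak_gradient_AE[OF assms] H1_gradient_L2[OF H1I[OF assms]] weak_gradient_L2[OF assms(2)]
		by (intro L2_norm_cong_AE) (auto intro: L2_measurable)
	then show ?thesis by (simp add: H1_norm_def)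
qed

lemma H1_norm_nonneg [simp]: "0 \<le> H1_norm u"
	by (simp add: H1_norm_def)

lemma L2_norm_le_H1_norm: "L2_norm u \<le> H1_norm u" "L2_norm (weak_gradient u) \<le> H1_norm u"
	unfolding H1_norm_def by (auto intro: real_le_rsqrt)

lemma H1_zero: "(%x. 0) \<in> H1" and H1_norm_zero: "H1_norm (%x. 0) = 0"
proof -
	have wg: "is_weak_gradient (%x. 0) (%x. 0)"
		by (rule is_weak_gradientI[OF L2_zero]) simp
	show "(%x. 0) \<in> H1" by (rule H1I[OF L2_zero wg])
	show "H1_norm (%x. 0) = 0" unfolding H1_norm_eq[OF L2_zero wg] by (simp add: L2_norm_def)
qed

lemma H1_add:
	assumes "u \<in> H1" "v \<in> H1"
	shows "(%x. u x + v x) \<in> H1" "is_weak_gradient (%x. u x + v x) (%x. weak_gradient u x + weak_gradient v x)"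
		"H1_norm (%x. u x + v x) \<le> H1_norm u + H1_norm v"
proof -
	note uv = H1_L2[OF assms(1)] H1_weak_gradient[OF assms(1)] H1_L2[OF assms(2)] H1_weak_gradient[OF assms(2)]
	have L: "(%x. u x + v x) \<in> L2" by (rule L2_add[OF uv(1,3)])
	show wg: "is_weak_gradient (%x. u x + v x) (%x. weak_gradient u x + weak_gradient v x)"
		by (rule is_weak_gradient_add[OF uv])
	show "(%x. u x + v x) \<in> H1" by (rule H1I[OF L wg])
	have "H1_norm (%x. u x + v x) \<le> sqrt ((L2_norm u + L2_norm v)^2 + (L2_norm (weak_gradient u) + L2_norm (weak_gradient v))^2)"
		unfolding H1_norm_eq[OF L wg]
		by (intro real_sqrt_le_mono add_mono power_mono L2_norm_triangle uv weak_gradient_L2[OF uv(2)] weak_gradient_L2[OF uv(4)]) auto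
	also have "\<dots> \<le> H1_norm u + H1_norm v"
		unfolding H1_norm_def by (rule real_sqrt_sum_squares_triangle_ineq)
	finally show "H1_norm (%x. u x + v x) \<le> H1_norm u + H1_norm v" .
qed

lemma H1_scale:
	assumes "u \<in> H1"
	shows "(%x. c * u x) \<in> H1" "is_weak_gradient (%x. c * u x) (%x. c *\<^sub>R weak_gradient u x)"
		"H1_norm (%x. c * u x) = \<bar>c\<bar> * H1_norm u"
proof -
	have L: "(%x. c * u x) \<in> L2" using L2_scale[OF H1_L2[OF assms], of c] by simp
	show wg: "is_weak_gradient (%x. c * u x) (%x. c *\<^sub>R weak_gradient u x)"
		by (rule is_weak_gradient_scale[OF H1_weak_gradient[OF assms]])
	show "(%x. c * u x) \<in> H1" by (rule H1I[OF L wg])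
	have "H1_norm (%x. c * u x) = sqrt (c^2 * ((L2_norm u)^2 + (L2_norm (weak_gradient u))^2))"
		unfolding H1_norm_eq[OF L wg] L2_norm_scale using L2_norm_scale[of c u]
		by (simp add: power_mult_distrib distrib_left)
	then show "H1_norm (%x. c * u x) = \<bar>c\<bar> * H1_norm u" by (simp add: H1_norm_def real_sqrt_mult)
qed

lemma H1_diff:
	assumes "u \<in> H1" "v \<in> H1"
	shows "(%x. u x - v x) \<in> H1" "is_weak_gradient (%x. u x - v x) (%x. weak_gradient u x - weak_gradient v x)"
		"H1_norm (%x. u x - v x) \<le> H1_norm u + H1_norm v"
proof -
	note uv = H1_L2[OF assms(1)] H1_weak_gradient[OF assms(1)] H1_L2[OF assms(2)] H1_weak_gradient[OF assms(2)]
	show wg: "is_weak_gradient (%x. u x - v x) (%x. weak_gradient u x - weak_gradient v x)"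
		by (rule is_weak_gradient_diff[OF uv])
	show "(%x. u x - v x) \<in> H1" by (rule H1I[OF L2_diff[OF uv(1,3)] wg])
	show "H1_norm (%x. u x - v x) \<le> H1_norm u + H1_norm v"
		using H1_add(3)[OF assms(1) H1_scale(1)[OF assms(2), of "-1"]] H1_scale(3)[OF assms(2), of "-1"] by simp
qed

lemma H1_norm_triangle_diff:
	assumes "u \<in> H1" "v \<in> H1" "w \<in> H1"
	shows "H1_norm (%x. u x - w x) \<le> H1_norm (%x. u x - v x) + H1_norm (%x. v x - w x)"
	using H1_add(3)[OF H1_diff(1)[OF assms(1,2)] H1_diff(1)[OF assms(2,3)]] by simp

lemma H1_norm_commute:
	assumes "u \<in> H1" "v \<in> H1" shows "H1_norm (%x. u x - v x) = H1_norm (%x. v x - u x)"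
	using H1_scale(3)[OF H1_diff(1)[OF assms(2,1)], of "-1"] by simp

lemma L2_norm_gradient_diff:
	assumes "u \<in> H1" "v \<in> H1"
	shows "L2_norm (%x. weak_gradient u x - weak_gradient v x) \<le> H1_norm (%x. u x - v x)"
	unfolding H1_norm_eq[OF H1_L2[OF H1_diff(1)[OF assms]] H1_diff(2)[OF assms]] by (auto intro: real_le_rsqrt)

text \<open>Rescaling \<open>p\<close> to norm one. Norm zero is a separate case, since
  \<open>H1_norm\<close> is only a seminorm on functions; there the boundedness of \<open>F\<close>
  gives F p = 0.\<close>

lemma H1_dual_bound:
	assumes F: "F \<in> H1_dual" and p: "p \<in> H1"
	shows "\<bar>F p\<bar> \<le> H1_dual_norm F * H1_norm p"
proof -
	obtain K where K: "\<And>p. p \<in> H1 ==> \<bar>F p\<bar> \<le> K * H1_norm p" using F unfolding H1_dual_def by blast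
	have scale: "F (%x. c * p x) = c * F p" for c using F p by (simp add: H1_dual_def)
	have bdd: "bdd_above ((%p. \<bar>F p\<bar>) ` {p \<in> H1. H1_norm p \<le> 1})"
	proof (rule bdd_aboveI2[where M = "\<bar>K\<bar>"])
		fix q assume "q \<in> {p \<in> H1. H1_norm p \<le> 1}"
		then have "\<bar>F q\<bar> \<le> K * H1_norm q" "H1_norm q \<le> 1" using K by auto
		moreover have "K * H1_norm q \<le> \<bar>K\<bar> * 1" using \<open>H1_norm q \<le> 1\<close> by (intro mult_mono) auto
		ultimately show "\<bar>F q\<bar> \<le> \<bar>K\<bar>" by simp
	qed
	show ?thesis
	proof (cases "H1_norm p = 0")
		case True then show ?thesis using K[OF p] by simp
	next
		case False
		then have n: "H1_norm p > 0" using H1_norm_nonneg[of p] by linarith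
		define c where "c = 1 / H1_norm p"
		have "(%x. c * p x) \<in> {p \<in> H1. H1_norm p \<le> 1}"
			using H1_scale(1,3)[OF p, of c] n by (simp add: c_def)
		then have "\<bar>F (%x. c * p x)\<bar> \<le> H1_dual_norm F" unfolding H1_dual_norm_def by (rule cSUP_upper[OF _ bdd])
		then have "\<bar>c * F p\<bar> \<le> H1_dual_norm F" by (simp only: scale)
		then have "\<bar>F p\<bar> / H1_norm p \<le> H1_dual_norm F" using n by (simp add: c_def abs_mult)
		then show ?thesis using n by (simp add: pos_divide_le_eq)
	qed
qed

lemma H1_dual_diff:
	assumes "F \<in> H1_dual" "G \<in> H1_dual" shows "F - G \<in> H1_dual"
proof -
	obtain K L where K: "\<forall>p\<in>H1. \<bar>F p\<bar> \<le> K * H1_norm p" and L: "\<forall>p\<in>H1. \<bar>G p\<bar> \<le> L * H1_norm p"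
		using assms by (auto simp: H1_dual_def)
	have "\<bar>F p - G p\<bar> \<le> (K + L) * H1_norm p" if "p \<in> H1" for p
	proof -
		have "\<bar>F p\<bar> \<le> K * H1_norm p" "\<bar>G p\<bar> \<le> L * H1_norm p" using K L that by auto
		then show ?thesis unfolding distrib_right by linarith
	qed
	then have "\<exists>K. \<forall>p\<in>H1. \<bar>(F - G) p\<bar> \<le> K * H1_norm p" by (intro exI[of _ "K + L"]) simp
	moreover have "\<forall>p\<in>H1. \<forall>q\<in>H1. (F - G) (%x. p x + q x) = (F - G) p + (F - G) q"
		"\<forall>c. \<forall>p\<in>H1. (F - G) (%x. c * p x) = c * (F - G) p"
		using assms by (simp_all add: H1_dual_def algebra_simps)
	ultimately show ?thesis unfolding H1_dual_def by blast
qed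

lemma H1_dual_norm_nonneg: "F \<in> H1_dual ==> 0 \<le> H1_dual_norm F"
proof -
	assume F: "F \<in> H1_dual"
	have z: "F (%x. 0) = 0"
	proof -
		have "\<forall>c. \<forall>p\<in>H1. F (%x. c * p x) = c * F p" using F unfolding H1_dual_def by blast
		from this[rule_format, OF H1_zero, of 0] show ?thesis by simp
	qed
	obtain K where K: "\<And>p. p \<in> H1 ==> \<bar>F p\<bar> \<le> K * H1_norm p" using F unfolding H1_dual_def by blast
	have bdd: "bdd_above ((%p. \<bar>F p\<bar>) ` {p \<in> H1. H1_norm p \<le> 1})"
	proof (rule bdd_aboveI2[where M = "\<bar>K\<bar>"])
		fix q assume "q \<in> {p \<in> H1. H1_norm p \<le> 1}"
		then have "\<bar>F q\<bar> \<le> K * H1_norm q" "H1_norm q \<le> 1" using K by auto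
		moreover have "K * H1_norm q \<le> \<bar>K\<bar> * 1" using \<open>H1_norm q \<le> 1\<close> by (intro mult_mono) auto
		ultimately show "\<bar>F q\<bar> \<le> \<bar>K\<bar>" by simp
	qed
	have "\<bar>F (%x. 0)\<bar> \<le> H1_dual_norm F"
		unfolding H1_dual_norm_def using H1_zero H1_norm_zero by (intro cSUP_upper[OF _ bdd]) auto
	then show ?thesis using z by simp
qed

lemma L2_functional_dual:
	assumes "g \<in> L2" shows "L2_functional g \<in> H1_dual"
proof -
	have "\<bar>LINT x. g x * p x\<bar> \<le> L2_norm g * H1_norm p" if p: "p \<in> H1" for p
	proof -
		have "\<bar>LINT x. g x * p x\<bar> \<le> L2_norm g * L2_norm p"
			using L2_Cauchy_Schwarz[OF assms H1_L2[OF p]] by simp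
		also have "\<dots> \<le> L2_norm g * H1_norm p" by (intro mult_left_mono L2_norm_le_H1_norm) simp
		finally show ?thesis .
	qed
	moreover have "(LINT x. g x * (p x + q x)) = (LINT x. g x * p x) + (LINT x. g x * q x)"
		if "p \<in> H1" "q \<in> H1" for p q
		using L2_mult_integrable[OF assms H1_L2[OF that(1)]] L2_mult_integrable[OF assms H1_L2[OF that(2)]]
		by (simp add: distrib_left)
	moreover have "(LINT x. g x * (c * p x)) = c * (LINT x. g x * p x)" for c p
		by (simp add: mult.left_commute)
	ultimately show ?thesis unfolding H1_dual_def L2_functional_def by blast
qed

text \<open>Completeness of Lebesgue measure, carried over to the restriction by extending functions
  with zero.\<close>

lemma lebesgue_on_measurable_AE:
	fixes f g :: "'a::euclidean_space => real"
	assumes S: "S \<in> sets lebesgue" and f: "f \<in> borel_measurable (lebesgue_on S)" and ae: "AE x in lebesgue_on S. f x = g x"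
	shows "g \<in> borel_measurable (lebesgue_on S)"
proof -
	have sp: "S \<inter> space lebesgue \<in> sets lebesgue" using S by simp
	have "AE x. x \<in> S --> f x = g x" using ae AE_restrict_space_iff[OF sp] by simp
	then have "AE x. indicator S x *\<^sub>R f x = indicator S x *\<^sub>R g x"
		by (rule eventually_mono) (auto simp: indicator_def)
	moreover have "(%x. indicator S x *\<^sub>R f x) \<in> borel_measurable lebesgue"
		using f borel_measurable_restrict_space_iff[OF sp, of f] by (simp add: mult.commute)
	ultimately have "(%x. indicator S x *\<^sub>R g x) \<in> borel_measurable lebesgue"
		by (rule borel_measurable_AE[rotated])
	then show ?thesis using borel_measurable_restrict_space_iff[OF sp, of g] by (simp add: mult.commute)
qed

section \<open>Scalar functions of time and integration by parts against an exponential\<close>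

abbreviation time :: "real => real measure" where "time T \<equiv> lebesgue_on {0<..<T}"

lemma space_time [simp]: "space (time T) = {0<..<T}"
	by simp

lemma finite_measure_time: "finite_measure (time T)"
proof (rule finite_measureI)
	show "emeasure (time T) (space (time T)) \<noteq> \<infinity>"
		by (cases "0 \<le> T") (auto simp: emeasure_restrict_space)
qed

lemma time_AE_limit_measurable:
	fixes f :: "real => real"
	assumes "\<And>n. s n \<in> borel_measurable (time T)" "AE t in time T. (%n. s n t) \<longlonglongrightarrow> f t"
	shows "f \<in> borel_measurable (time T)"
proof (rule lebesgue_on_measurable_AE)
	show "(%t. lim (%n. s n t)) \<in> borel_measurable (time T)"
		using assms(1) by (rule borel_measurable_lim_metric)
	show "AE t in time T. lim (%n. s n t) = f t"
		using assms(2) by (rule eventually_mono) (simp add: limI)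
qed simp

lemma integrable_time_exp:
	assumes "integrable (time T) f" shows "integrable (time T) (%t. exp (- s * t) * f t :: real)"
proof (rule Bochner_Integration.integrable_bound)
	show "integrable (time T) (%t. exp (\<bar>s\<bar> * \<bar>T\<bar>) * f t)" using assms by simp
	have "(%t. exp (- s * t)) \<in> borel_measurable (time T)"
		by (intro measurable_restrict_space1 continuous_lebesgue_measurable continuous_intros)
	then show "(%t. exp (- s * t) * f t) \<in> borel_measurable (time T)" using assms by simp
	show "AE t in time T. norm (exp (- s * t) * f t) \<le> norm (exp (\<bar>s\<bar> * \<bar>T\<bar>) * f t)"
	proof (rule AE_I2)
		fix t assume "t \<in> space (time T)"
		then have "\<bar>s\<bar> * t \<le> \<bar>s\<bar> * \<bar>T\<bar>" by (intro mult_left_mono) auto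
		moreover have "- s * t \<le> \<bar>s\<bar> * t" using \<open>t \<in> space (time T)\<close> by (intro mult_right_mono) auto
		ultimately have "exp (- s * t) \<le> exp (\<bar>s\<bar> * \<bar>T\<bar>)" by simp
		then show "norm (exp (- s * t) * f t) \<le> norm (exp (\<bar>s\<bar> * \<bar>T\<bar>) * f t)"
			by (simp add: abs_mult mult_right_mono)
	qed
qed

text \<open>The definition provides integrability of the square. The norm itself is recovered as a
  square root, up to the null set where \<open>F t\<close> is not in \<open>V\<close>, and it is
  integrable because the time interval has finite measure.\<close>

lemma bochner_L2_norm_integrable:
	assumes F: "F \<in> bochner_L2 V nrm T" and n: "\<And>v. v \<in> V ==> 0 \<le> nrm v"
	shows "integrable (time T) (%t. nrm (F t))"
proof -
	interpret finite_measure "time T" by (rule finite_measure_time)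
	have sq: "integrable (time T) (%t. (nrm (F t))^2)" and ae: "AE t in time T. F t \<in> V"
		using F by (auto simp: bochner_L2_def)
	have "(%t. sqrt ((nrm (F t))^2)) \<in> borel_measurable (time T)"
		by (rule measurable_compose[OF borel_measurable_integrable[OF sq] borel_measurable_continuous_onI[of sqrt]])
			(intro continuous_intros)
	then have "(%t. \<bar>nrm (F t)\<bar>) \<in> borel_measurable (time T)" by simp
	moreover have "AE t in time T. \<bar>nrm (F t)\<bar> = nrm (F t)" using ae by (rule eventually_mono) (simp add: n)
	ultimately have m: "(%t. nrm (F t)) \<in> borel_measurable (time T)"
		by (rule lebesgue_on_measurable_AE[rotated]) simp
	show ?thesis
	proof (rule Bochner_Integration.integrable_bound)
		show "integrable (time T) (%t. 1 + (nrm (F t))^2)" using sq by simp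
		have q: "norm x \<le> norm (1 + x^2)" for x :: real
		proof -
			have "2 * \<bar>x\<bar> \<le> 1 + x^2" using sum_squares_bound[of 1 "\<bar>x\<bar>"] by simp
			then show ?thesis unfolding real_norm_def using abs_ge_zero[of x] abs_ge_self[of "1 + x^2"] by linarith
		qed
		show "AE t in time T. norm (nrm (F t)) \<le> norm (1 + (nrm (F t))^2)" by (rule AE_I2) (rule q)
	qed (rule m)
qed

text \<open>Strong measurability becomes scalar measurability, since the values on the simple
  approximations converge. \<open>\<Lambda>\<close> is Lipschitz rather than linear because the
  value type offers nothing but subtraction.\<close>

lemma bochner_L2_pairing:
	assumes F: "F \<in> bochner_L2 V nrm T" and n: "\<And>v. v \<in> V ==> 0 \<le> nrm v"
		and L: "\<And>v w. v \<in> V ==> w \<in> V ==> \<bar>\<Lambda> v - \<Lambda> w\<bar> \<le> K * nrm (v - w)" "\<And>v. v \<in> V ==> \<bar>\<Lambda> v\<bar> \<le> K * nrm v"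
	shows "integrable (time T) (%t. \<Lambda> (F t) :: real)"
proof (rule Bochner_Integration.integrable_bound)
	obtain s where s: "\<And>k::nat. simple_function (time T) (s k)" "\<And>k. s k ` {0<..<T} \<subseteq> V"
		and lim: "AE t in time T. (%k. nrm (s k t - F t)) \<longlonglongrightarrow> 0"
		using F by (auto simp: bochner_L2_def)
	have s2: "s k t \<in> V" if "t \<in> {0<..<T}" for k t using s(2) that by blast
	have V: "AE t in time T. F t \<in> V" using F by (simp add: bochner_L2_def)
	show "integrable (time T) (%t. K * nrm (F t))" using bochner_L2_norm_integrable[OF F n] by simp
	show "AE t in time T. norm (\<Lambda> (F t)) \<le> norm (K * nrm (F t))"
		using V by (rule eventually_mono) (use L(2) in force)
	show "(%t. \<Lambda> (F t)) \<in> borel_measurable (time T)"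
	proof (rule time_AE_limit_measurable)
		show "(%t. \<Lambda> (s k t)) \<in> borel_measurable (time T)" for k
			by (rule borel_measurable_simple_function[OF simple_function_compose1[OF s(1)]])
		show "AE t in time T. (%k. \<Lambda> (s k t)) \<longlonglongrightarrow> \<Lambda> (F t)"
			using V lim AE_space
		proof eventually_elim
			case (elim t)
			have "(%k. \<Lambda> (s k t) - \<Lambda> (F t)) \<longlonglongrightarrow> 0"
			proof (rule Lim_null_comparison)
				show "(%k. K * nrm (s k t - F t)) \<longlonglongrightarrow> 0" using tendsto_mult_right_zero[OF elim(2)] .
				show "\<forall>\<^sub>F k in sequentially. norm (\<Lambda> (s k t) - \<Lambda> (F t)) \<le> K * nrm (s k t - F t)"
					using s2 elim by (intro always_eventually allI) (auto intro!: L(1))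
			qed
			then show ?case by (rule LIM_zero_cancel)
		qed
	qed
qed

text \<open>Used with \<open>p\<close> an end point of the interval, where the kernels concentrate
  from inside; this is why continuity of \<open>Y\<close> is taken on the closed interval.\<close>

lemma tendsto_approximate_identity:
	fixes Y :: "real => real"
	assumes Y: "continuous_on {0..T} Y" and p: "p \<in> {0..T}"
		and k: "\<And>n. continuous_on UNIV (k n)" "\<And>n t. k n t \<ge> 0"
			"\<And>n t. t \<in> {0..T} ==> k n t \<noteq> 0 ==> \<bar>t - p\<bar> \<le> 2 / real (Suc n)"
			"\<And>n. n \<ge> N ==> (LINT t|time T. k n t) = 1"
	shows "(%n. LINT t|time T. Y t * k n t) \<longlonglongrightarrow> Y p"
proof (rule LIMSEQ_I)
	fix e :: real assume "e > 0"
	have int: "integrable (time T) g" if g: "continuous_on {0..T} g" for g :: "real => real"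
	proof -
		have "integrable lborel (%x. indicator {0..T} x *\<^sub>R g x)" by (rule borel_integrable_compact[OF _ g]) simp
		moreover have m: "(%x. indicator {0..T} x *\<^sub>R g x) \<in> borel_measurable borel"
			using borel_integrable_compact[OF _ g] by auto
		ultimately have "integrable lebesgue (%x. indicator {0..T} x *\<^sub>R g x)"
			by (simp add: integrable_completion)
		then have "integrable lebesgue (%x. indicator {0<..<T} x *\<^sub>R (indicator {0..T} x *\<^sub>R g x))"
			by (rule integrable_mult_indicator[rotated]) simp
		moreover have "(%x. indicator {0<..<T} x *\<^sub>R (indicator {0..T} x *\<^sub>R g x)) = (%x. indicator {0<..<T} x *\<^sub>R g x)"
			by (auto simp: indicator_def)
		ultimately have "integrable lebesgue (%x. indicator {0<..<T} x *\<^sub>R g x)" by (simp only:)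
		moreover have "{0<..<T} \<inter> space lebesgue \<in> sets lebesgue" by simp
		ultimately show ?thesis by (simp only: integrable_restrict_space)
	qed
	obtain d where d: "d > 0" "\<And>t. t \<in> {0..T} ==> \<bar>t - p\<bar> < d ==> \<bar>Y t - Y p\<bar> < e / 2"
		using Y[unfolded continuous_on_iff, rule_format, OF p, of "e / 2"] \<open>e > 0\<close> by (auto simp: dist_real_def)
	obtain N' where N': "1 / real (Suc N') < d / 2" using half_gt_zero[OF d(1)] by (rule nat_approx_posE)
	have "norm ((LINT t|time T. Y t * k n t) - Y p) < e" if n: "n \<ge> max N N'" for n
	proof -
		have "1 / real (Suc n) \<le> 1 / real (Suc N')" using n by (simp add: frac_le)
		then have small: "2 / real (Suc n) < d" using N' by linarith
		have kc: "continuous_on {0..T} (k n)" using k(1) by (rule continuous_on_subset) simp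
		have i1: "integrable (time T) (%t. Y t * k n t)" by (intro int continuous_on_mult Y kc)
		have i2: "integrable (time T) (%t. Y p * k n t)" by (intro int continuous_on_mult continuous_on_const kc)
		have one: "(LINT t|time T. k n t) = 1" using k(4) n by simp
		have "(LINT t|time T. Y t * k n t) - Y p = (LINT t|time T. Y t * k n t - Y p * k n t)"
			using i1 i2 one by simp
		also have "norm \<dots> \<le> (LINT t|time T. norm (Y t * k n t - Y p * k n t))" by (rule integral_norm_bound)
		also have "\<dots> \<le> (LINT t|time T. e / 2 * k n t)"
		proof (rule integral_mono)
			show "integrable (time T) (%t. norm (Y t * k n t - Y p * k n t))" using i1 i2 by simp
			show "integrable (time T) (%t. e / 2 * k n t)" by (intro int continuous_on_mult continuous_on_const kc)
			fix t assume "t \<in> space (time T)"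
			then have t: "t \<in> {0..T}" by simp
			show "norm (Y t * k n t - Y p * k n t) \<le> e / 2 * k n t"
			proof (cases "k n t = 0")
				case False
				then have "\<bar>Y t - Y p\<bar> < e / 2" using d(2)[OF t] k(3)[OF t False] small by linarith
				then have "\<bar>Y t - Y p\<bar> * k n t \<le> e / 2 * k n t" using k(2) by (intro mult_right_mono) auto
				then show ?thesis using k(2) by (simp add: left_diff_distrib[symmetric] abs_mult)
			qed simp
		qed
		also have "\<dots> = e / 2" using one by simp
		finally show ?thesis using \<open>e > 0\<close> by simp
	qed
	then show "\<exists>no. \<forall>n\<ge>no. norm ((LINT t|time T. Y t * k n t) - Y p) < e" by blast
qed

text \<open>The fundamental theorem of calculus on the closed interval; its two end points form a
  null set.\<close>

lemma time_integral_derivative: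
	fixes F f :: "real => real"
	assumes "0 \<le> T" "\<And>t. (F has_real_derivative f t) (at t)" "continuous_on UNIV f"
	shows "(LINT t|time T. f t) = F T - F 0"
proof -
	have "has_bochner_integral lborel (%x. indicator {0..T} x *\<^sub>R f x) (F T - F 0)"
		using assms
		by (intro has_bochner_integral_FTC_Icc)
			(auto simp: has_real_derivative_iff_has_vector_derivative[symmetric] has_field_derivative_at_within intro: continuous_on_subset)
	then have i: "(LINT x|lborel. indicator {0..T} x *\<^sub>R f x) = F T - F 0" by (rule has_bochner_integral_integral_eq)
	have m: "(%x. indicator {0..T} x *\<^sub>R f x) \<in> borel_measurable borel"
		using borel_measurable_continuous_onI[OF assms(3)] by simp
	have "(LINT t|time T. f t) = (LINT x. indicator {0<..<T} x *\<^sub>R f x)"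
		by (subst integral_restrict_space) auto
	also have "\<dots> = (LINT x. indicator {0..T} x *\<^sub>R f x)"
	proof (rule integral_cong_AE)
		have "AE x. x \<notin> {0, T}"
			using negligible_finite[of "{0, T}"] by (intro AE_not_in) (simp add: negligible_iff_null_sets)
		then show "AE x. indicator {0<..<T} x *\<^sub>R f x = indicator {0..T} x *\<^sub>R f x"
			by (rule eventually_mono) (auto simp: indicator_def)
		show "(%x. indicator {0<..<T} x *\<^sub>R f x) \<in> borel_measurable lebesgue"
			"(%x. indicator {0..T} x *\<^sub>R f x) \<in> borel_measurable lebesgue"
			by (intro borel_measurable_scaleR borel_measurable_indicator continuous_lebesgue_measurable[OF assms(3)]; simp)+
	qed
	also have "\<dots> = (LINT x|lborel. indicator {0..T} x *\<^sub>R f x)" using m by (simp add: integral_completion)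
	finally show ?thesis using i by simp
qed

text \<open>The test function is exp (- s t) times a C^1 cut-off that vanishes within 1 / (n + 1) of
  both end points. The two parts of the derivative of the cut-off are, up to sign, approximate
  identities at 0 and \<open>T\<close> and produce the values of the continuous representative
  \<open>R\<close> there. This is how end point values enter a derivative that is defined on the
  open interval only.\<close>

lemma time_integration_by_parts:
	fixes r q R :: "real => real"
	assumes T: "0 < T" and r: "integrable (time T) r" and q: "integrable (time T) q"
		and weak: "\<And>p. p \<in> test_functions {0<..<T} ==> (LINT t|time T. deriv p t * r t) = - (LINT t|time T. p t * q t)"
		and R: "continuous_on {0..T} R" and ae: "AE t in time T. r t = R t"
	shows "(LINT t|time T. exp (- s * t) * q t) = exp (- s * T) * R T - R 0 + s * (LINT t|time T. exp (- s * t) * r t)"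
proof -
	let ?E = "{0<..<T} :: real set"
	have sp: "?E \<inter> space lebesgue \<in> sets lebesgue" by simp
	\<comment> \<open>Extension by zero to the whole line, where the C^1 version of the weak identity
	  is available.\<close>
	define r0 where "r0 t = indicator ?E t * r t" for t
	define q0 where "q0 t = indicator ?E t * q t" for t
	have tr: "(LINT t|time T. g t) = (LINT t. indicator ?E t * g t)" for g :: "real => real"
		using integral_restrict_space[OF sp, of g] by simp
	have r0: "integrable lebesgue r0" "integrable lebesgue q0"
		using r q integrable_restrict_space[OF sp, of r] integrable_restrict_space[OF sp, of q]
		by (simp_all add: r0_def[abs_def] q0_def[abs_def])
	have weak0: "(LINT x. r0 x * frechet_derivative p (at x) 1) = - (LINT x. q0 x * p x)"
		if p: "p \<in> test_functions ?E" for p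
	proof -
		have "frechet_derivative p (at x) 1 = deriv p x" for x
		proof -
			have "Ck 1 p" using p by (auto simp: test_functions_def)
			then have "p differentiable (at x)" by simp
			then have "p field_differentiable (at x)" using differentiable_def has_field_derivative_def real_differentiable_def
				field_differentiable_def by metis
			then have "(p has_derivative (%h. deriv p x * h)) (at x)"
				by (simp add: field_differentiable_derivI has_field_derivative_imp_has_derivative)
			from frechet_derivative_at[OF this] show ?thesis by (metis mult.right_neutral)
		qed
		then show ?thesis using weak[OF p] unfolding tr by (simp add: r0_def q0_def mult_ac)
	qed
	define a where "a n = 1 / real (Suc n)" for n
	have a: "a n > 0" for n by (simp add: a_def)
	define c where "c n t = smooth_step n (t - a n) * smooth_step n (T - t - a n)" for n t
	define k1 where "k1 n t = smooth_step' n (t - a n)" for n t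
	define k2 where "k2 n t = smooth_step' n (T - t - a n)" for n t
	define \<theta>' where "\<theta>' n t = k1 n t * smooth_step n (T - t - a n) - smooth_step n (t - a n) * k2 n t" for n t
	have d1: "((%t. smooth_step n (t - a n)) has_real_derivative k1 n t) (at t)" for n t
	proof -
		have g: "((%t. t - a n) has_real_derivative 1) (at t)" by (auto intro!: derivative_eq_intros)
		show ?thesis
			using DERIV_chain2[where f = "smooth_step n" and g = "%t. t - a n", OF DERIV_smooth_step g] by (simp add: k1_def)
	qed
	have d2: "((%t. smooth_step n (T - t - a n)) has_real_derivative - k2 n t) (at t)" for n t
	proof -
		have g: "((%t. T - t - a n) has_real_derivative - 1) (at t)" by (auto intro!: derivative_eq_intros)
		show ?thesis
			using DERIV_chain2[where f = "smooth_step n" and g = "%t. T - t - a n", OF DERIV_smooth_step g] by (simp add: k2_def)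
	qed
	have css: "continuous_on UNIV (smooth_step n)" for n
		using DERIV_smooth_step by (meson DERIV_isCont continuous_at_imp_continuous_on)
	have ck: "continuous_on UNIV (k1 n)" "continuous_on UNIV (k2 n)" for n
		unfolding k1_def[abs_def] k2_def[abs_def]
		by (auto intro!: continuous_on_compose2[OF continuous_smooth_step'] continuous_intros)
	have cs: "continuous_on UNIV (%t. smooth_step n (t - a n))" "continuous_on UNIV (%t. smooth_step n (T - t - a n))" for n
		by (auto intro!: continuous_on_compose2[OF css] continuous_intros)
	have ce: "continuous_on UNIV (%t. exp (- s * t))" by (intro continuous_intros)
	define G where "G n t = exp (- s * t) * \<theta>' n t - s * exp (- s * t) * c n t" for n t
	have C1: "has_C1_gradient (%t. exp (- s * t) * c n t) (G n)" for n
		unfolding has_C1_gradient_def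
	proof (intro conjI allI)
		show "continuous_on UNIV (G n)"
			unfolding G_def[abs_def] c_def \<theta>'_def by (intro continuous_intros ck cs)
		fix t
		have "((%t. exp (- s * t)) has_real_derivative exp (- s * t) * (- s)) (at t)"
			by (auto intro!: derivative_eq_intros)
		from DERIV_mult[OF this DERIV_mult[OF d1 d2]]
		have "((%t. exp (- s * t) * c n t) has_real_derivative G n t) (at t)"
			unfolding c_def G_def \<theta>'_def by (rule DERIV_cong) (simp add: algebra_simps)
		then show "((%t. exp (- s * t) * c n t) has_derivative (\<bullet>) (G n t)) (at t)"
			by (simp add: has_field_derivative_def inner_real_def)
	qed
	have van: "exp (- s * t) * c n t = 0" if "t \<notin> {a n..T - a n}" for n t
		using that by (auto simp: c_def smooth_step_eq_0)
	have eqn: "(LINT x. r0 x * G n x) = - (LINT x. q0 x * (exp (- s * x) * c n x))" for n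
	proof -
		have "(LINT x. r0 x * (G n x \<bullet> 1)) = - (LINT x. q0 x * (exp (- s * x) * c n x))"
		proof (rule weak_derivative_C1[OF integrable_loc_integrable[OF r0(1)] integrable_loc_integrable[OF r0(2)] _ _ weak0 C1])
			show "compact {a n..T - a n}" by simp
			show "{a n..T - a n} \<subseteq> ?E"
			proof
				fix t assume "t \<in> {a n..T - a n}"
				then show "t \<in> ?E" using a[of n] by simp
			qed
		qed (use van in auto)
		then show ?thesis by simp
	qed
	have \<theta>01: "\<bar>c n t\<bar> \<le> 1" for n t
		using smooth_step_bounds unfolding c_def abs_mult by (intro mult_le_one) (auto simp: abs_le_iff intro: order_trans[of _ 0])
	have a0: "a \<longlonglongrightarrow> 0" unfolding a_def[abs_def] by (rule LIMSEQ_Suc[OF lim_1_over_n])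
	have \<theta>lim: "(%n. c n t) \<longlonglongrightarrow> 1" if t: "t \<in> ?E" for t
	proof -
		have "\<forall>\<^sub>F n in sequentially. a n < min t (T - t) / 2" using a0 t by (intro order_tendstoD(2)) auto
		then have "\<forall>\<^sub>F n in sequentially. c n t = 1"
		proof (rule eventually_mono)
			fix n assume n: "a n < min t (T - t) / 2"
			then have "2 * a n < t" "2 * a n < T - t" by auto
			then have "smooth_step n (t - a n) = 1" "smooth_step n (T - t - a n) = 1"
				by (intro smooth_step_eq_1; simp add: a_def)+
			then show "c n t = 1" by (simp add: c_def)
		qed
		then show ?thesis by (rule tendsto_eventually)
	qed
	have expb: "\<bar>exp (- s * t)\<bar> \<le> exp (\<bar>s\<bar> * T)" if "t \<in> ?E" for t
	proof -
		have "- s * t \<le> \<bar>s\<bar> * t" using that by (intro mult_right_mono) auto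
		also have "\<dots> \<le> \<bar>s\<bar> * T" using that by (intro mult_left_mono) auto
		finally show ?thesis by simp
	qed
	have dom: "(%n. LINT t|time T. exp (- s * t) * c n t * g t) \<longlonglongrightarrow> (LINT t|time T. exp (- s * t) * g t)"
		if g: "integrable (time T) g" for g
	proof (rule integral_dominated_convergence[where w = "%t. exp (\<bar>s\<bar> * T) * \<bar>g t\<bar>"])
		have mt: "h \<in> borel_measurable (time T)" if "continuous_on UNIV h" for h :: "real => real"
			by (intro measurable_restrict_space1 continuous_lebesgue_measurable that)
		show "(%t. exp (- s * t) * g t) \<in> borel_measurable (time T)" using mt[OF ce] g by simp
		have "continuous_on UNIV (%t. exp (- s * t) * c n t)" for n unfolding c_def by (intro continuous_intros cs)
		then show "(%t. exp (- s * t) * c n t * g t) \<in> borel_measurable (time T)" for n using mt g by simp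
		show "integrable (time T) (%t. exp (\<bar>s\<bar> * T) * \<bar>g t\<bar>)" using g by simp
		show "AE t in time T. (%n. exp (- s * t) * c n t * g t) \<longlonglongrightarrow> exp (- s * t) * g t"
		proof (rule AE_I2)
			fix t assume "t \<in> space (time T)"
			then have "(%n. exp (- s * t) * c n t * g t) \<longlonglongrightarrow> exp (- s * t) * 1 * g t" by (intro tendsto_intros \<theta>lim) simp
			then show "(%n. exp (- s * t) * c n t * g t) \<longlonglongrightarrow> exp (- s * t) * g t" by simp
		qed
		show "AE t in time T. norm (exp (- s * t) * c n t * g t) \<le> exp (\<bar>s\<bar> * T) * \<bar>g t\<bar>" for n
		proof (rule AE_I2)
			fix t assume "t \<in> space (time T)"
			then have t: "t \<in> ?E" by simp
			have "\<bar>exp (- s * t)\<bar> * \<bar>c n t\<bar> \<le> exp (\<bar>s\<bar> * T) * 1" using expb[OF t] \<theta>01 by (intro mult_mono) auto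
			then have "\<bar>exp (- s * t)\<bar> * \<bar>c n t\<bar> * \<bar>g t\<bar> \<le> exp (\<bar>s\<bar> * T) * \<bar>g t\<bar>" by (intro mult_right_mono) auto
			then show "norm (exp (- s * t) * c n t * g t) \<le> exp (\<bar>s\<bar> * T) * \<bar>g t\<bar>" by (simp add: abs_mult)
		qed
	qed
	\<comment> \<open>From \<open>N\<close> on the two transition layers, each within
	  \<open>2 * a n\<close> of its end point, are disjoint: each factor of the cut-off equals 1 where
	  the derivative of the other is supported.\<close>
	obtain N where N: "1 / real (Suc N) < T / 4" using T nat_approx_posE[of "T / 4"] by auto
	have aN: "4 * a n < T" if "n \<ge> N" for n
	proof -
		have "1 / real (Suc n) \<le> 1 / real (Suc N)" using that by (simp add: frac_le)
		then show ?thesis using N by (simp add: a_def)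
	qed
	have aN2: "2 * a n \<le> T" if "n \<ge> N" for n using aN[OF that] a[of n] by simp
	define Y where "Y t = exp (- s * t) * R t" for t
	have Yc: "continuous_on {0..T} Y" unfolding Y_def[abs_def] by (intro continuous_intros R)
	have k1s: "a n \<le> t \<and> t \<le> 2 * a n" if "k1 n t \<noteq> 0" for n t
	proof -
		have "\<not> t - a n \<le> 0" using that smooth_step_eq_0(2)[of "t - a n" n] by (auto simp: k1_def)
		moreover have "\<not> t - a n \<ge> 1 / real (Suc n)" using that smooth_step_eq_1(2)[of n "t - a n"] by (auto simp: k1_def)
		ultimately show ?thesis by (simp add: a_def)
	qed
	have k2s: "a n \<le> T - t \<and> T - t \<le> 2 * a n" if "k2 n t \<noteq> 0" for n t
	proof -
		have "\<not> T - t - a n \<le> 0" using that smooth_step_eq_0(2)[of "T - t - a n" n] by (auto simp: k2_def)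
		moreover have "\<not> T - t - a n \<ge> 1 / real (Suc n)" using that smooth_step_eq_1(2)[of n "T - t - a n"] by (auto simp: k2_def)
		ultimately show ?thesis by (simp add: a_def)
	qed
	have L1: "(%n. LINT t|time T. Y t * k1 n t) \<longlonglongrightarrow> Y 0"
	proof (rule tendsto_approximate_identity[OF Yc _ ck(1), where N = N])
		show "k1 n t \<ge> 0" for n t by (simp add: k1_def smooth_step'_nonneg)
		show "\<bar>t - 0\<bar> \<le> 2 / real (Suc n)" if "t \<in> {0..T}" "k1 n t \<noteq> 0" for n t
			using k1s[OF that(2)] that(1) by (simp add: a_def)
		show "(LINT t|time T. k1 n t) = 1" if "n \<ge> N" for n
		proof -
			have "(LINT t|time T. k1 n t) = smooth_step n (T - a n) - smooth_step n (0 - a n)"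
				using T by (intro time_integral_derivative d1 ck) auto
			moreover have "smooth_step n (T - a n) = 1" using aN2[OF that] by (intro smooth_step_eq_1) (simp add: a_def)
			moreover have "smooth_step n (0 - a n) = 0" using a[of n] by (intro smooth_step_eq_0) simp
			ultimately show ?thesis by simp
		qed
	qed (use T in auto)
	have L2: "(%n. LINT t|time T. Y t * k2 n t) \<longlonglongrightarrow> Y T"
	proof (rule tendsto_approximate_identity[OF Yc _ ck(2), where N = N])
		show "k2 n t \<ge> 0" for n t by (simp add: k2_def smooth_step'_nonneg)
		show "\<bar>t - T\<bar> \<le> 2 / real (Suc n)" if "t \<in> {0..T}" "k2 n t \<noteq> 0" for n t
			using k2s[OF that(2)] that(1) by (simp add: a_def)
		show "(LINT t|time T. k2 n t) = 1" if "n \<ge> N" for n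
		proof -
			have "(LINT t|time T. - k2 n t) = smooth_step n (T - T - a n) - smooth_step n (T - 0 - a n)"
				using T by (intro time_integral_derivative d2 continuous_on_minus ck) auto
			moreover have "smooth_step n (T - 0 - a n) = 1" using aN2[OF that] by (intro smooth_step_eq_1) (simp add: a_def)
			moreover have "smooth_step n (T - T - a n) = 0" using a[of n] by (intro smooth_step_eq_0) simp
			ultimately show ?thesis by simp
		qed
	qed (use T in auto)
	have split: "(LINT x. r0 x * G n x) = (LINT t|time T. Y t * k1 n t) - (LINT t|time T. Y t * k2 n t)
			- s * (LINT t|time T. exp (- s * t) * c n t * r t)" if n: "n \<ge> N" for n
	proof -
		have bc: "integrable (time T) (%t. h t * r t)" if h: "continuous_on UNIV h" for h :: "real => real"
		proof -
			have "bounded (h ` {0..T})" using h by (intro compact_imp_bounded compact_continuous_image) (auto intro: continuous_on_subset)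
			then obtain B where "\<forall>x\<in>h ` {0..T}. norm x \<le> B" unfolding bounded_iff by blast
			then have B: "\<And>t. t \<in> {0..T} ==> norm (h t) \<le> B" by simp
			show ?thesis
			proof (rule Bochner_Integration.integrable_bound)
			show "integrable (time T) (%t. B * \<bar>r t\<bar>)" using r by simp
			show "(%t. h t * r t) \<in> borel_measurable (time T)"
				using measurable_restrict_space1[OF continuous_lebesgue_measurable[OF h]] r by simp
			show "AE t in time T. norm (h t * r t) \<le> norm (B * \<bar>r t\<bar>)"
			proof (rule AE_I2)
				fix t assume "t \<in> space (time T)"
				then have "\<bar>h t\<bar> \<le> B" using B[of t] by simp
				moreover then have "0 \<le> B" by linarith
				ultimately show "norm (h t * r t) \<le> norm (B * \<bar>r t\<bar>)" by (simp add: abs_mult mult_right_mono)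
			qed
			qed
		qed
		have sep: "k1 n t * smooth_step n (T - t - a n) = k1 n t" "smooth_step n (t - a n) * k2 n t = k2 n t" for t
		proof -
			show "k1 n t * smooth_step n (T - t - a n) = k1 n t"
			proof (cases "k1 n t = 0")
				case False
				then have "smooth_step n (T - t - a n) = 1" using k1s[OF False] aN[OF n] by (intro smooth_step_eq_1) (simp add: a_def)
				then show ?thesis by simp
			qed simp
			show "smooth_step n (t - a n) * k2 n t = k2 n t"
			proof (cases "k2 n t = 0")
				case False
				then have "smooth_step n (t - a n) = 1" using k2s[OF False] aN[OF n] by (intro smooth_step_eq_1) (simp add: a_def)
				then show ?thesis by simp
			qed simp
		qed
		have i: "integrable (time T) (%t. exp (- s * t) * k1 n t * r t)" "integrable (time T) (%t. exp (- s * t) * k2 n t * r t)"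
			"integrable (time T) (%t. exp (- s * t) * c n t * r t)"
			by (intro bc continuous_intros ck; simp add: c_def continuous_intros cs ck)+
		have "(LINT x. r0 x * G n x) = (LINT t|time T. exp (- s * t) * k1 n t * r t - exp (- s * t) * k2 n t * r t - s * (exp (- s * t) * c n t * r t))"
			unfolding tr r0_def G_def \<theta>'_def sep by (intro Bochner_Integration.integral_cong) (auto simp: algebra_simps)
		also have "\<dots> = (LINT t|time T. exp (- s * t) * k1 n t * r t) - (LINT t|time T. exp (- s * t) * k2 n t * r t) - s * (LINT t|time T. exp (- s * t) * c n t * r t)"
			using i by simp
		also have "(LINT t|time T. exp (- s * t) * k1 n t * r t) = (LINT t|time T. Y t * k1 n t)"
		proof (rule integral_cong_AE)
			show m: "(%t. exp (- s * t) * k1 n t * r t) \<in> borel_measurable (time T)" using i(1) by simp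
			show e: "AE t in time T. exp (- s * t) * k1 n t * r t = Y t * k1 n t"
				using ae by (rule eventually_mono) (simp add: Y_def)
			show "(%t. Y t * k1 n t) \<in> borel_measurable (time T)" by (rule lebesgue_on_measurable_AE[OF _ m e]) simp
		qed
		also have "(LINT t|time T. exp (- s * t) * k2 n t * r t) = (LINT t|time T. Y t * k2 n t)"
		proof (rule integral_cong_AE)
			show m: "(%t. exp (- s * t) * k2 n t * r t) \<in> borel_measurable (time T)" using i(2) by simp
			show e: "AE t in time T. exp (- s * t) * k2 n t * r t = Y t * k2 n t"
				using ae by (rule eventually_mono) (simp add: Y_def)
			show "(%t. Y t * k2 n t) \<in> borel_measurable (time T)" by (rule lebesgue_on_measurable_AE[OF _ m e]) simp
		qed
		finally show ?thesis .
	qed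
	have "(%n. (LINT t|time T. Y t * k1 n t) - (LINT t|time T. Y t * k2 n t) - s * (LINT t|time T. exp (- s * t) * c n t * r t))
		 \<longlonglongrightarrow> Y 0 - Y T - s * (LINT t|time T. exp (- s * t) * r t)"
		by (intro tendsto_intros L1 L2 dom r)
	then have lim1: "(%n. LINT x. r0 x * G n x) \<longlonglongrightarrow> Y 0 - Y T - s * (LINT t|time T. exp (- s * t) * r t)"
		by (rule Lim_transform_eventually) (rule eventually_sequentiallyI[of N], rule split[symmetric])
	have "(LINT x. q0 x * (exp (- s * x) * c n x)) = (LINT t|time T. exp (- s * t) * c n t * q t)" for n
		unfolding tr q0_def by (intro Bochner_Integration.integral_cong) auto
	then have "(%n. - (LINT x. q0 x * (exp (- s * x) * c n x))) \<longlonglongrightarrow> - (LINT t|time T. exp (- s * t) * q t)"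
		using tendsto_minus[OF dom[OF q]] by simp
	from LIMSEQ_unique[OF this lim1[unfolded eqn]]
	show ?thesis by (simp add: Y_def)
qed

text \<open>\<open>\<Phi>\<close> is an arbitrary map: point evaluation, a norm or a pairing. The
  coefficients do not depend on it, so the time integral of a simple function is the same finite
  linear combination in each of these readings.\<close>

lemma simple_time_integral:
	fixes \<Phi> :: "'v => 'b::{banach, second_countable_topology}"
	assumes s: "simple_function (time T) s" and e: "integrable (time T) (e :: real => real)"
	shows "integrable (time T) (%t. e t *\<^sub>R \<Phi> (s t))"
		and "(LINT t|time T. e t *\<^sub>R \<Phi> (s t)) = (\<Sum>h\<in>s ` {0<..<T}. (LINT t|time T. indicator (s -` {h} \<inter> {0<..<T}) t *\<^sub>R e t) *\<^sub>R \<Phi> h)"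
proof -
	let ?R = "s ` {0<..<T}"
	have fin: "finite ?R" and meas: "\<And>h. s -` {h} \<inter> {0<..<T} \<in> sets (time T)"
		using simple_functionD[OF s] by auto
	have i: "integrable (time T) (%t. indicator (s -` {h} \<inter> {0<..<T}) t *\<^sub>R e t)" for h
		by (rule integrable_mult_indicator[OF meas e])
	have eq: "e t *\<^sub>R \<Phi> (s t) = (\<Sum>h\<in>?R. (indicator (s -` {h} \<inter> {0<..<T}) t *\<^sub>R e t) *\<^sub>R \<Phi> h)" if t: "t \<in> {0<..<T}" for t
	proof -
		have "(\<Sum>h\<in>?R. (indicator (s -` {h} \<inter> {0<..<T}) t *\<^sub>R e t) *\<^sub>R \<Phi> h) = (\<Sum>h\<in>?R. if h = s t then e t *\<^sub>R \<Phi> h else 0)"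
			using t by (intro sum.cong) (auto simp: indicator_def)
		also have "\<dots> = e t *\<^sub>R \<Phi> (s t)" using fin t by (simp add: sum.delta)
		finally show ?thesis by simp
	qed
	have "integrable (time T) (%t. \<Sum>h\<in>?R. (indicator (s -` {h} \<inter> {0<..<T}) t *\<^sub>R e t) *\<^sub>R \<Phi> h)"
		by (rule Bochner_Integration.integrable_sum) (rule integrable_scaleR_left[OF i])
	then show "integrable (time T) (%t. e t *\<^sub>R \<Phi> (s t))"
		by (subst Bochner_Integration.integrable_cong[OF refl eq]) auto
	have "(LINT t|time T. e t *\<^sub>R \<Phi> (s t)) = (LINT t|time T. (\<Sum>h\<in>?R. (indicator (s -` {h} \<inter> {0<..<T}) t *\<^sub>R e t) *\<^sub>R \<Phi> h))"
		by (intro Bochner_Integration.integral_cong refl eq) simp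
	also have "\<dots> = (\<Sum>h\<in>?R. LINT t|time T. (indicator (s -` {h} \<inter> {0<..<T}) t *\<^sub>R e t) *\<^sub>R \<Phi> h)"
		by (rule Bochner_Integration.integral_sum) (rule integrable_scaleR_left[OF i])
	also have "\<dots> = (\<Sum>h\<in>?R. (LINT t|time T. indicator (s -` {h} \<inter> {0<..<T}) t *\<^sub>R e t) *\<^sub>R \<Phi> h)"
		by (intro sum.cong refl integral_scaleR_left i)
	finally show "(LINT t|time T. e t *\<^sub>R \<Phi> (s t)) = (\<Sum>h\<in>?R. (LINT t|time T. indicator (s -` {h} \<inter> {0<..<T}) t *\<^sub>R e t) *\<^sub>R \<Phi> h)" .
qed

section \<open>Superposition in time of functions with values in H^1\<close>

lemma L2_sum:
	fixes c :: "'i => real" and g :: "'i => R3 => 'b::euclidean_space"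
	assumes "finite I" "\<And>i. i \<in> I ==> g i \<in> L2"
	shows "(%x. \<Sum>i\<in>I. c i *\<^sub>R g i x) \<in> L2 \<and> L2_norm (%x. \<Sum>i\<in>I. c i *\<^sub>R g i x) \<le> (\<Sum>i\<in>I. \<bar>c i\<bar> * L2_norm (g i))"
	using assms
proof (induction I rule: finite_induct)
	case empty then show ?case by (simp add: L2_zero L2_norm_def)
next
	case (insert j I)
	have 1: "(%x. c j *\<^sub>R g j x) \<in> L2" using insert by (intro L2_scale) auto
	have 2: "(%x. \<Sum>i\<in>I. c i *\<^sub>R g i x) \<in> L2" "L2_norm (%x. \<Sum>i\<in>I. c i *\<^sub>R g i x) \<le> (\<Sum>i\<in>I. \<bar>c i\<bar> * L2_norm (g i))"
		using insert by auto
	show ?case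
		using L2_add[OF 1 2(1)] L2_norm_triangle[OF 1 2(1)] 2(2) L2_norm_scale[of "c j" "g j"] insert(1,2) by simp
qed

lemma is_weak_gradient_sum:
	fixes c :: "'i => real"
	assumes "finite I" "\<And>i. i \<in> I ==> g i \<in> H1"
	shows "is_weak_gradient (%x. \<Sum>i\<in>I. c i *\<^sub>R g i x) (%x. \<Sum>i\<in>I. c i *\<^sub>R weak_gradient (g i) x)"
	using assms
proof (induction I rule: finite_induct)
	case empty show ?case by (simp add: is_weak_gradientI[OF L2_zero])
next
	case (insert j I)
	have j: "g j \<in> H1" and I: "\<And>i. i \<in> I ==> g i \<in> H1" using insert by auto
	have 1: "(%x. c j *\<^sub>R g j x) \<in> L2" using H1_L2[OF j] by (intro L2_scale)
	have 2: "(%x. \<Sum>i\<in>I. c i *\<^sub>R g i x) \<in> L2" using L2_sum[OF insert(1), of g c] H1_L2[OF I] by blast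
	have 3: "is_weak_gradient (%x. c j *\<^sub>R g j x) (%x. c j *\<^sub>R weak_gradient (g j) x)" using H1_scale(2)[OF j, of "c j"] by simp
	show ?case using is_weak_gradient_add[OF 1 3 2 insert.IH[OF I]] insert(1,2) by simp
qed

text \<open>The integral is taken pointwise in \<open>x\<close>. It is used for simple
  \<open>s\<close>, where it is a finite linear combination; the general case is reached by limits
  in L^2.\<close>

definition superpose :: "(real => real) => real => (real => R3 => 'b::euclidean_space) => R3 => 'b" where
	"superpose e T s x = (LINT t|time T. e t *\<^sub>R s t x)"

context
	fixes T :: real and e :: "real => real"
	assumes e: "integrable (time T) e" "\<And>t. t \<in> {0<..<T} ==> 0 \<le> e t \<and> e t \<le> 1"
begin

lemma superpose_L2:
	fixes j :: "real => R3 => 'b::euclidean_space"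
	assumes s: "simple_function (time T) j" "\<And>t. t \<in> {0<..<T} ==> j t \<in> L2"
	shows "superpose e T j \<in> L2" and "L2_norm (superpose e T j) \<le> (LINT t|time T. L2_norm (j t))"
		and "k \<in> L2 ==> (LINT x. superpose e T j x \<bullet> k x) = (LINT t|time T. e t * (LINT x. j t x \<bullet> k x))"
proof -
	interpret finite_measure "time T" by (rule finite_measure_time)
	let ?R = "j ` {0<..<T}"
	\<comment> \<open>\<open>c h\<close> and \<open>q h\<close> are the masses of the set where the
	  value is \<open>h\<close>, with weight \<open>e\<close> and without; e <= 1 compares them, which
	  yields the norm bound.\<close>
	define c where "c h = (LINT t|time T. indicator (j -` {h} \<inter> {0<..<T}) t *\<^sub>R e t)" for h
	define q where "q h = (LINT t|time T. indicator (j -` {h} \<inter> {0<..<T}) t *\<^sub>R (1::real))" for h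
	have fin: "finite ?R" and meas: "\<And>h. j -` {h} \<inter> {0<..<T} \<in> sets (time T)"
		using simple_functionD[OF s(1)] by auto
	have R: "h \<in> L2" if "h \<in> ?R" for h using s(2) that by auto
	have rep: "superpose e T j = (%x. \<Sum>h\<in>?R. c h *\<^sub>R h x)"
		unfolding superpose_def[abs_def] c_def
		by (rule ext) (rule simple_time_integral(2)[OF s(1) e(1), where \<Phi> = "%h. h x" for x])
	note sm = L2_sum[OF fin, of "%h. h" c, OF R]
	show "superpose e T j \<in> L2" unfolding rep using sm by blast
	have c\<mu>: "\<bar>c h\<bar> \<le> q h" for h
	proof -
		have "0 \<le> c h" unfolding c_def using e(2) by (intro integral_nonneg_AE AE_I2) (auto simp: indicator_def)
		moreover have "c h \<le> q h"
			unfolding c_def q_def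
		proof (rule integral_mono)
			show "integrable (time T) (%t. indicator (j -` {h} \<inter> {0<..<T}) t *\<^sub>R e t)" by (rule integrable_mult_indicator[OF meas e(1)])
			show "integrable (time T) (%t. indicator (j -` {h} \<inter> {0<..<T}) t *\<^sub>R (1::real))" by (rule integrable_mult_indicator[OF meas]) simp
			show "indicator (j -` {h} \<inter> {0<..<T}) t *\<^sub>R e t \<le> indicator (j -` {h} \<inter> {0<..<T}) t *\<^sub>R (1::real)" for t
				using e(2)[of t] by (auto simp: indicator_def)
		qed
		ultimately show ?thesis by simp
	qed
	have "L2_norm (superpose e T j) \<le> (\<Sum>h\<in>?R. \<bar>c h\<bar> * L2_norm h)" unfolding rep using sm by blast
	also have "\<dots> \<le> (\<Sum>h\<in>?R. q h * L2_norm h)" by (intro sum_mono mult_right_mono c\<mu>) simp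
	also have "\<dots> = (LINT t|time T. 1 *\<^sub>R L2_norm (j t))"
		using simple_time_integral(2)[OF s(1), of "%_. 1" L2_norm] by (simp add: q_def)
	finally show "L2_norm (superpose e T j) \<le> (LINT t|time T. L2_norm (j t))" by simp
	assume k: "k \<in> L2"
	have "(LINT x. superpose e T j x \<bullet> k x) = (LINT x. (\<Sum>h\<in>?R. c h * (h x \<bullet> k x)))"
		unfolding rep by (simp add: inner_sum_left)
	also have "\<dots> = (\<Sum>h\<in>?R. LINT x. c h * (h x \<bullet> k x))"
		by (rule Bochner_Integration.integral_sum) (rule integrable_mult_right[OF L2_inner_integrable[OF R k]])
	also have "\<dots> = (\<Sum>h\<in>?R. c h * (LINT x. h x \<bullet> k x))" by simp
	also have "\<dots> = (LINT t|time T. e t *\<^sub>R (LINT x. j t x \<bullet> k x))"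
		using simple_time_integral(2)[OF s(1) e(1), of "%h. LINT x. h x \<bullet> k x"] by (simp add: c_def)
	finally show "(LINT x. superpose e T j x \<bullet> k x) = (LINT t|time T. e t * (LINT x. j t x \<bullet> k x))" by simp
qed

lemma superpose_weak_gradient:
	assumes s: "simple_function (time T) j" "\<And>t. t \<in> {0<..<T} ==> j t \<in> H1"
	shows "is_weak_gradient (superpose e T j) (superpose e T (%t. weak_gradient (j t)))"
proof -
	let ?R = "j ` {0<..<T}"
	define c where "c h = (LINT t|time T. indicator (j -` {h} \<inter> {0<..<T}) t *\<^sub>R e t)" for h
	have fin: "finite ?R" using simple_functionD[OF s(1)] by auto
	have rep: "superpose e T j = (%x. \<Sum>h\<in>?R. c h *\<^sub>R h x)"
		unfolding superpose_def[abs_def] c_def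
		by (rule ext) (rule simple_time_integral(2)[OF s(1) e(1), where \<Phi> = "%h. h x" for x])
	have rep2: "superpose e T (%t. weak_gradient (j t)) = (%x. \<Sum>h\<in>?R. c h *\<^sub>R weak_gradient h x)"
		unfolding superpose_def[abs_def] c_def
		by (rule ext) (rule simple_time_integral(2)[OF s(1) e(1), where \<Phi> = "%h. weak_gradient h x" for x])
	show ?thesis unfolding rep rep2 by (rule is_weak_gradient_sum[OF fin]) (use s(2) in auto)
qed

lemma superpose_diff:
	fixes j \<sigma>' :: "real => R3 => 'b::euclidean_space"
	assumes "simple_function (time T) j" "simple_function (time T) \<sigma>'"
	shows "superpose e T j x - superpose e T \<sigma>' x = superpose e T (%t x. j t x - \<sigma>' t x) x"
	unfolding superpose_def
	using simple_time_integral(1)[OF assms(1) e(1), of "%h. h x"] simple_time_integral(1)[OF assms(2) e(1), of "%h. h x"]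
	by (simp add: scaleR_diff_right)

text \<open>Strong measurability gives convergence almost everywhere only. Replacing a value by zero
  where its norm exceeds twice that of \<open>u t\<close> yields the majorant
  \<open>3 * H1_norm (u t)\<close> and hence convergence of the integrals.\<close>

lemma H1_simple_approximation:
	assumes u: "u \<in> bochner_L2 H1 H1_norm T"
	obtains s where "\<And>n::nat. simple_function (time T) (s n)" "\<And>n t. t \<in> {0<..<T} ==> s n t \<in> H1"
		"\<And>n. integrable (time T) (%t. H1_norm (%x. s n t x - u t x))"
		"(%n. LINT t|time T. H1_norm (%x. s n t x - u t x)) \<longlonglongrightarrow> 0"
proof -
	obtain s0 where s0: "\<And>n::nat. simple_function (time T) (s0 n)" "\<And>n. s0 n ` {0<..<T} \<subseteq> H1"
		and lim: "AE t in time T. (%n. H1_norm (s0 n t - u t)) \<longlonglongrightarrow> 0"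
		using u by (auto simp: bochner_L2_def)
	have ui: "integrable (time T) (%t. H1_norm (u t))" by (rule bochner_L2_norm_integrable[OF u]) simp
	have uH: "AE t in time T. u t \<in> H1" using u by (simp add: bochner_L2_def)
	have s0H: "s0 n t \<in> H1" if "t \<in> {0<..<T}" for n t using s0(2) that by blast
	define A where "A n = {t \<in> {0<..<T}. H1_norm (s0 n t) \<le> 2 * H1_norm (u t)}" for n
	have Am: "A n \<in> sets (time T)" for n
	proof -
		have "(%t. H1_norm (s0 n t)) \<in> borel_measurable (time T)"
			by (rule borel_measurable_simple_function[OF simple_function_compose1[OF s0(1)]])
		moreover have "(%t. 2 * H1_norm (u t)) \<in> borel_measurable (time T)" using ui by simp
		ultimately have "{t \<in> space (time T). H1_norm (s0 n t) \<le> 2 * H1_norm (u t)} \<in> sets (time T)"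
			by (rule borel_measurable_le)
		then show ?thesis by (simp add: A_def)
	qed
	define s where "s n t = (if t \<in> A n then s0 n t else (%x. 0))" for n t
	have ss: "simple_function (time T) (s n)" for n
		unfolding s_def[abs_def] using Am[of n] sets.sets_into_space[OF Am[of n]]
		by (intro simple_function_If_set s0) (auto simp: Int_absorb2)
	have sH: "s n t \<in> H1" if "t \<in> {0<..<T}" for n t using s0H[OF that] H1_zero by (simp add: s_def)
	have bound: "H1_norm (%x. s n t x - u t x) \<le> 3 * H1_norm (u t)" if "t \<in> {0<..<T}" "u t \<in> H1" for n t
	proof -
		have "H1_norm (s n t) \<le> 2 * H1_norm (u t)" by (simp add: s_def A_def H1_norm_zero)
		then show ?thesis using H1_diff(3)[OF sH[OF that(1)] that(2), of n] by simp
	qed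
	have conv: "AE t in time T. (%n. H1_norm (%x. s n t x - u t x)) \<longlonglongrightarrow> 0"
		using uH lim AE_space
	proof eventually_elim
		case (elim t)
		then have t: "t \<in> {0<..<T}" by simp
		have fd: "H1_norm (s0 n t - u t) = H1_norm (%x. s0 n t x - u t x)" for n by (simp add: fun_diff_def)
		show ?case
		proof (cases "H1_norm (u t) = 0")
			\<comment> \<open>Where \<open>u t\<close> has norm zero the truncation may discard every value;
			  the majorant is zero there and gives convergence.\<close>
			case True
			then have "H1_norm (%x. s n t x - u t x) = 0" for n
				using bound[OF t elim(1), of n] H1_norm_nonneg[of "%x. s n t x - u t x"] by simp
			then show ?thesis by simp
		next
			case False
			then have pos: "H1_norm (u t) > 0" using H1_norm_nonneg[of "u t"] by linarith
			have "\<forall>\<^sub>F n in sequentially. H1_norm (s0 n t - u t) < H1_norm (u t)"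
				using elim(2) pos by (rule order_tendstoD)
			then have "\<forall>\<^sub>F n in sequentially. H1_norm (s0 n t - u t) = H1_norm (%x. s n t x - u t x)"
			proof (rule eventually_mono)
				fix n assume n: "H1_norm (s0 n t - u t) < H1_norm (u t)"
				have "H1_norm (s0 n t) \<le> H1_norm (%x. s0 n t x - u t x) + H1_norm (u t)"
					using H1_add(3)[OF H1_diff(1)[OF s0H[OF t] elim(1)] elim(1), of n] by simp
				then have "t \<in> A n" using n t by (simp add: A_def fd)
				then show "H1_norm (s0 n t - u t) = H1_norm (%x. s n t x - u t x)" by (simp add: s_def fd)
			qed
			with elim(2) show ?thesis by (rule Lim_transform_eventually)
		qed
	qed
	\<comment> \<open>The norm of \<open>s n t - u t\<close> is measurable as the limit in
	  \<open>m\<close> of the norms of the simple functions \<open>s n t - s m t\<close>.\<close>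
	have meas: "(%t. H1_norm (%x. s n t x - u t x)) \<in> borel_measurable (time T)" for n
	proof (rule time_AE_limit_measurable)
		show "(%t. H1_norm (%x. s n t x - s m t x)) \<in> borel_measurable (time T)" for m
			by (rule borel_measurable_simple_function[OF simple_function_compose2[OF ss ss, where h = "%a b. H1_norm (%x. a x - b x)"]])
		show "AE t in time T. (%m. H1_norm (%x. s n t x - s m t x)) \<longlonglongrightarrow> H1_norm (%x. s n t x - u t x)"
			using uH conv AE_space
		proof eventually_elim
			case (elim t)
			then have t: "t \<in> {0<..<T}" by simp
			show ?case
			proof (rule LIM_zero_cancel, rule Lim_null_comparison)
				show "(%m. H1_norm (%x. s m t x - u t x)) \<longlonglongrightarrow> 0" by (rule elim(2))
				show "\<forall>\<^sub>F m in sequentially. norm (H1_norm (%x. s n t x - s m t x) - H1_norm (%x. s n t x - u t x)) \<le> H1_norm (%x. s m t x - u t x)"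
				proof (intro always_eventually allI)
					fix m
					note a = sH[OF t, of n] and b = sH[OF t, of m]
					show "norm (H1_norm (%x. s n t x - s m t x) - H1_norm (%x. s n t x - u t x)) \<le> H1_norm (%x. s m t x - u t x)"
						using H1_norm_triangle_diff[OF a b elim(1)] H1_norm_triangle_diff[OF a elim(1) b] H1_norm_commute[OF elim(1) b] by simp
				qed
			qed
		qed
	qed
	have int: "integrable (time T) (%t. H1_norm (%x. s n t x - u t x))" for n
	proof (rule Bochner_Integration.integrable_bound)
		show "integrable (time T) (%t. 3 * H1_norm (u t))" using ui by simp
		show "AE t in time T. norm (H1_norm (%x. s n t x - u t x)) \<le> norm (3 * H1_norm (u t))"
			using uH AE_space by eventually_elim (use bound in auto)
	qed (rule meas)
	have "(%n. LINT t|time T. H1_norm (%x. s n t x - u t x)) \<longlonglongrightarrow> (LINT t|time T. 0)"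
	proof (rule integral_dominated_convergence[where w = "%t. 3 * H1_norm (u t)"])
		show "AE t in time T. norm (H1_norm (%x. s n t x - u t x)) \<le> 3 * H1_norm (u t)" for n
			using uH AE_space by eventually_elim (use bound in auto)
	qed (use ui meas conv in auto)
	then show ?thesis using that[OF ss sH int] by simp
qed

text \<open>The superpositions of the simple approximations and of their gradients are Cauchy in
  L^2, because their distances are bounded by time integrals of distances in H^1. The limits inherit
  the weak gradient relation, and pairings with L^2 functions, which characterise \<open>W\<close>
  and \<open>g\<close>, pass to the limit.\<close>

lemma superpose_H1:
	assumes u: "u \<in> bochner_L2 H1 H1_norm T"
	obtains W g where "W \<in> L2" "is_weak_gradient W g"
		"\<And>k. k \<in> L2 ==> (LINT x. W x * k x) = (LINT t|time T. e t * (LINT x. u t x * k x))"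
		"\<And>k. k \<in> L2 ==> (LINT x. g x \<bullet> k x) = (LINT t|time T. e t * (LINT x. weak_gradient (u t) x \<bullet> k x))"
proof -
	obtain s where ss: "\<And>n::nat. simple_function (time T) (s n)" and sH: "\<And>n t. t \<in> {0<..<T} ==> s n t \<in> H1"
		and int: "\<And>n. integrable (time T) (%t. H1_norm (%x. s n t x - u t x))"
		and lim: "(%n. LINT t|time T. H1_norm (%x. s n t x - u t x)) \<longlonglongrightarrow> 0"
		using H1_simple_approximation[OF u] by blast
	have uH: "AE t in time T. u t \<in> H1" using u by (simp add: bochner_L2_def)
	interpret finite_measure "time T" by (rule finite_measure_time)
	define D where "D n = (LINT t|time T. H1_norm (%x. s n t x - u t x))" for n
	define Wn where "Wn n = superpose e T (s n)" for n
	define Gn where "Gn n = superpose e T (%t. weak_gradient (s n t))" for n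
	have sg: "simple_function (time T) (%t. weak_gradient (s n t))" for n by (rule simple_function_compose1[OF ss])
	have WL: "Wn n \<in> L2" for n unfolding Wn_def by (rule superpose_L2(1)[OF ss H1_L2[OF sH]])
	have GL: "Gn n \<in> L2" for n unfolding Gn_def by (rule superpose_L2(1)[OF sg H1_gradient_L2[OF sH]])
	have WG: "is_weak_gradient (Wn n) (Gn n)" for n unfolding Wn_def Gn_def by (rule superpose_weak_gradient[OF ss sH])
	have smi: "integrable (time T) (%t. \<Phi> (s n t) (s m t))" for \<Phi> :: "_ => _ => real" and n m
	proof -
		have "simple_function (time T) (%t. (s n t, s m t))" by (rule simple_function_Pair[OF ss ss])
		from simple_time_integral(1)[OF this, of "%_. 1" "%(a, b). \<Phi> a b"] show ?thesis by simp
	qed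
	have HD: "(LINT t|time T. H1_norm (%x. s n t x - s m t x)) \<le> D n + D m" for n m
	proof -
		have "(LINT t|time T. H1_norm (%x. s n t x - s m t x)) \<le> (LINT t|time T. H1_norm (%x. s n t x - u t x) + H1_norm (%x. s m t x - u t x))"
		proof (rule integral_mono_AE)
			show "integrable (time T) (%t. H1_norm (%x. s n t x - s m t x))" by (rule smi[of "%a b. H1_norm (%x. a x - b x)"])
			show "AE t in time T. H1_norm (%x. s n t x - s m t x) \<le> H1_norm (%x. s n t x - u t x) + H1_norm (%x. s m t x - u t x)"
				using uH AE_space
			proof eventually_elim
				case (elim t)
				then have t: "t \<in> {0<..<T}" by simp
				show ?case using H1_norm_triangle_diff[OF sH[OF t] elim(1) sH[OF t], of n m] H1_norm_commute[OF elim(1) sH[OF t], of m] by simp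
			qed
		qed (use int in simp)
		then show ?thesis using int by (simp add: D_def)
	qed
	have W1: "L2_norm (%x. Wn n x - Wn m x) \<le> D n + D m" for n m
	proof -
		have "L2_norm (%x. Wn n x - Wn m x) = L2_norm (superpose e T (%t x. s n t x - s m t x))"
			unfolding Wn_def superpose_diff[OF ss ss] by simp
		also have "\<dots> \<le> (LINT t|time T. L2_norm (%x. s n t x - s m t x))"
			by (rule superpose_L2(2)[OF simple_function_compose2[OF ss ss, where h = "%a b x. a x - b x"] L2_diff[OF H1_L2[OF sH] H1_L2[OF sH]]])
		also have "\<dots> \<le> (LINT t|time T. H1_norm (%x. s n t x - s m t x))"
			by (intro integral_mono L2_norm_le_H1_norm smi[of "%a b. L2_norm (%x. a x - b x)"] smi[of "%a b. H1_norm (%x. a x - b x)"])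
		also have "\<dots> \<le> D n + D m" by (rule HD)
		finally show ?thesis .
	qed
	have G1: "L2_norm (%x. Gn n x - Gn m x) \<le> D n + D m" for n m
	proof -
		have "L2_norm (%x. Gn n x - Gn m x) = L2_norm (superpose e T (%t x. weak_gradient (s n t) x - weak_gradient (s m t) x))"
			unfolding Gn_def superpose_diff[OF sg sg] by simp
		also have "\<dots> \<le> (LINT t|time T. L2_norm (%x. weak_gradient (s n t) x - weak_gradient (s m t) x))"
			by (rule superpose_L2(2)[OF simple_function_compose2[OF sg sg, where h = "%a b x. a x - b x"] L2_diff[OF H1_gradient_L2[OF sH] H1_gradient_L2[OF sH]]])
		also have "\<dots> \<le> (LINT t|time T. H1_norm (%x. s n t x - s m t x))"
		proof (rule integral_mono)
			show "integrable (time T) (%t. L2_norm (%x. weak_gradient (s n t) x - weak_gradient (s m t) x))"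
				by (rule smi[of "%a b. L2_norm (%x. weak_gradient a x - weak_gradient b x)"])
			show "integrable (time T) (%t. H1_norm (%x. s n t x - s m t x))" by (rule smi[of "%a b. H1_norm (%x. a x - b x)"])
		qed (use L2_norm_gradient_diff sH in auto)
		also have "\<dots> \<le> D n + D m" by (rule HD)
		finally show ?thesis .
	qed
	have D0: "D \<longlonglongrightarrow> 0" using lim by (simp add: D_def[abs_def])
	have Cauchy: "\<exists>N. \<forall>m\<ge>N. \<forall>n\<ge>N. D m + D n < r" if "r > 0" for r
	proof -
		have "\<forall>\<^sub>F n in sequentially. D n < r / 2" using D0 that by (intro order_tendstoD) auto
		then obtain N where "\<And>n. n \<ge> N ==> D n < r / 2" by (auto simp: eventually_sequentially)
		then show ?thesis by (intro exI[of _ N]) (auto simp: add_strict_mono intro: order_less_le_trans[OF add_strict_mono[of _ "r / 2" _ "r / 2"]])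
	qed
	obtain W where W: "W \<in> L2" "(%n. L2_norm (%x. Wn n x - W x)) \<longlonglongrightarrow> 0"
	proof (rule L2_complete[OF WL])
		show "\<exists>N. \<forall>m\<ge>N. \<forall>n\<ge>N. L2_norm (%x. Wn m x - Wn n x) < r" if "r > 0" for r
			using Cauchy[OF that] W1 by (meson order_le_less_trans)
	qed
	obtain g where g: "g \<in> L2" "(%n. L2_norm (%x. Gn n x - g x)) \<longlonglongrightarrow> 0"
	proof (rule L2_complete[OF GL])
		show "\<exists>N. \<forall>m\<ge>N. \<forall>n\<ge>N. L2_norm (%x. Gn m x - Gn n x) < r" if "r > 0" for r
			using Cauchy[OF that] G1 by (meson order_le_less_trans)
	qed
	have eb: "AE t in time T. \<bar>e t\<bar> \<le> 1" using e(2) by (intro AE_I2) auto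
	\<comment> \<open>Any functional that is Lipschitz and bounded in the H^1 norm passes to the limit;
	  both pairings below are of this kind.\<close>
	have transfer: "(%n. LINT t|time T. e t * \<Lambda> (s n t)) \<longlonglongrightarrow> (LINT t|time T. e t * \<Lambda> (u t))"
		if L: "\<And>v w. v \<in> H1 ==> w \<in> H1 ==> \<bar>\<Lambda> v - \<Lambda> w\<bar> \<le> K * H1_norm (%x. v x - w x)" and L2: "\<And>v. v \<in> H1 ==> \<bar>\<Lambda> v\<bar> \<le> K * H1_norm v"
		for \<Lambda> :: "(R3 => real) => real" and K
	proof (rule LIM_zero_cancel, rule Lim_null_comparison)
		show "(%n. K * D n) \<longlonglongrightarrow> 0" using tendsto_mult_right_zero[OF D0] .
		have em: "e \<in> borel_measurable (time T)" using e(1) by simp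
		have iu: "integrable (time T) (%t. \<Lambda> (u t))"
			using L L2 by (intro bochner_L2_pairing[OF u, where K = K]) (auto simp: fun_diff_def)
		have ieu: "integrable (time T) (%t. e t * \<Lambda> (u t))"
		proof (rule Bochner_Integration.integrable_bound[OF iu])
			show "AE t in time T. norm (e t * \<Lambda> (u t)) \<le> norm (\<Lambda> (u t))"
				using eb by (rule eventually_mono) (simp add: abs_mult mult_left_le_one_le)
		qed (use em iu in simp)
		show "\<forall>\<^sub>F n in sequentially. norm ((LINT t|time T. e t * \<Lambda> (s n t)) - (LINT t|time T. e t * \<Lambda> (u t))) \<le> K * D n"
		proof (intro always_eventually allI)
			fix n
			have ies: "integrable (time T) (%t. e t * \<Lambda> (s n t))" using simple_time_integral(1)[OF ss e(1), of \<Lambda>] by simp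
			have "(LINT t|time T. e t * \<Lambda> (s n t)) - (LINT t|time T. e t * \<Lambda> (u t)) = (LINT t|time T. e t * \<Lambda> (s n t) - e t * \<Lambda> (u t))"
				using ies ieu by simp
			also have "norm \<dots> \<le> (LINT t|time T. norm (e t * \<Lambda> (s n t) - e t * \<Lambda> (u t)))" by (rule integral_norm_bound)
			also have "\<dots> \<le> (LINT t|time T. K * H1_norm (%x. s n t x - u t x))"
			proof (rule integral_mono_AE)
				show "AE t in time T. norm (e t * \<Lambda> (s n t) - e t * \<Lambda> (u t)) \<le> K * H1_norm (%x. s n t x - u t x)"
					using uH eb AE_space
				proof eventually_elim
					case (elim t)
					then have t: "t \<in> {0<..<T}" by simp
					have "\<bar>e t\<bar> * \<bar>\<Lambda> (s n t) - \<Lambda> (u t)\<bar> \<le> 1 * (K * H1_norm (%x. s n t x - u t x))"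
						using elim(2) L[OF sH[OF t] elim(1), of n] by (intro mult_mono) auto
					then show ?case by (simp add: right_diff_distrib[symmetric] abs_mult)
				qed
			qed (use ies ieu int in auto)
			also have "\<dots> = K * D n" by (simp add: D_def)
			finally show "norm ((LINT t|time T. e t * \<Lambda> (s n t)) - (LINT t|time T. e t * \<Lambda> (u t))) \<le> K * D n" .
		qed
	qed
	show ?thesis
	proof (rule that)
		show "W \<in> L2" by (rule W)
		show "is_weak_gradient W g" by (rule is_weak_gradient_limit[OF WL WG W(1) g(1) W(2) g(2)])
		show "(LINT x. W x * k x) = (LINT t|time T. e t * (LINT x. u t x * k x))" if k: "k \<in> L2" for k
		proof (rule LIMSEQ_unique)
			show "(%n. LINT x. Wn n x \<bullet> k x) \<longlonglongrightarrow> (LINT x. W x * k x)"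
				using L2_tendsto_pairing[OF WL W(1) k W(2)] by simp
			have "(LINT x. Wn n x \<bullet> k x) = (LINT t|time T. e t * (LINT x. s n t x * k x))" for n
				unfolding Wn_def using superpose_L2(3)[OF ss H1_L2[OF sH] k] by simp
			moreover have "(%n. LINT t|time T. e t * (LINT x. s n t x * k x)) \<longlonglongrightarrow> (LINT t|time T. e t * (LINT x. u t x * k x))"
			proof (rule transfer[where K = "L2_norm k" and \<Lambda> = "%v. LINT x. v x * k x"])
				have b: "\<bar>LINT x. v x * k x\<bar> \<le> L2_norm k * H1_norm v" if "v \<in> H1" for v
				proof -
					have "\<bar>LINT x. v x * k x\<bar> \<le> L2_norm v * L2_norm k" using L2_Cauchy_Schwarz[OF H1_L2[OF that] k] by simp
					also have "\<dots> \<le> H1_norm v * L2_norm k" by (intro mult_right_mono L2_norm_le_H1_norm) simp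
					finally show ?thesis by (simp add: mult.commute)
				qed
				show "\<bar>LINT x. v x * k x\<bar> \<le> L2_norm k * H1_norm v" if "v \<in> H1" for v by (rule b[OF that])
				show "\<bar>(LINT x. v x * k x) - (LINT x. w x * k x)\<bar> \<le> L2_norm k * H1_norm (%x. v x - w x)"
					if "v \<in> H1" "w \<in> H1" for v w
					using b[OF H1_diff(1)[OF that]] L2_mult_integrable[OF H1_L2[OF that(1)] k] L2_mult_integrable[OF H1_L2[OF that(2)] k]
					by (simp add: left_diff_distrib)
			qed
			ultimately show "(%n. LINT x. Wn n x \<bullet> k x) \<longlonglongrightarrow> (LINT t|time T. e t * (LINT x. u t x * k x))" by simp
		qed
		show "(LINT x. g x \<bullet> k x) = (LINT t|time T. e t * (LINT x. weak_gradient (u t) x \<bullet> k x))" if k: "k \<in> L2" for k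
		proof (rule LIMSEQ_unique)
			show "(%n. LINT x. Gn n x \<bullet> k x) \<longlonglongrightarrow> (LINT x. g x \<bullet> k x)"
				by (rule L2_tendsto_pairing[OF GL g(1) k g(2)])
			have "(LINT x. Gn n x \<bullet> k x) = (LINT t|time T. e t * (LINT x. weak_gradient (s n t) x \<bullet> k x))" for n
				unfolding Gn_def by (rule superpose_L2(3)[OF sg H1_gradient_L2[OF sH] k])
			moreover have "(%n. LINT t|time T. e t * (LINT x. weak_gradient (s n t) x \<bullet> k x)) \<longlonglongrightarrow> (LINT t|time T. e t * (LINT x. weak_gradient (u t) x \<bullet> k x))"
			proof (rule transfer[where K = "L2_norm k" and \<Lambda> = "%v. LINT x. weak_gradient v x \<bullet> k x"])
				show "\<bar>LINT x. weak_gradient v x \<bullet> k x\<bar> \<le> L2_norm k * H1_norm v" if "v \<in> H1" for v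
				proof -
					have "\<bar>LINT x. weak_gradient v x \<bullet> k x\<bar> \<le> L2_norm (weak_gradient v) * L2_norm k" by (rule L2_Cauchy_Schwarz[OF H1_gradient_L2[OF that] k])
					also have "\<dots> \<le> H1_norm v * L2_norm k" by (intro mult_right_mono L2_norm_le_H1_norm) simp
					finally show ?thesis by (simp add: mult.commute)
				qed
				show "\<bar>(LINT x. weak_gradient v x \<bullet> k x) - (LINT x. weak_gradient w x \<bullet> k x)\<bar> \<le> L2_norm k * H1_norm (%x. v x - w x)"
					if "v \<in> H1" "w \<in> H1" for v w
				proof -
					note vw = H1_gradient_L2[OF that(1)] H1_gradient_L2[OF that(2)]
					have "(LINT x. weak_gradient v x \<bullet> k x) - (LINT x. weak_gradient w x \<bullet> k x) = (LINT x. (weak_gradient v x - weak_gradient w x) \<bullet> k x)"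
						using L2_inner_integrable[OF vw(1) k] L2_inner_integrable[OF vw(2) k] by (simp add: inner_diff_left)
					then have "\<bar>(LINT x. weak_gradient v x \<bullet> k x) - (LINT x. weak_gradient w x \<bullet> k x)\<bar> \<le> L2_norm (%x. weak_gradient v x - weak_gradient w x) * L2_norm k"
						using L2_Cauchy_Schwarz[OF L2_diff[OF vw] k] by simp
					also have "\<dots> \<le> H1_norm (%x. v x - w x) * L2_norm k" by (intro mult_right_mono L2_norm_gradient_diff that) simp
					finally show ?thesis by (simp add: mult.commute)
				qed
			qed
			ultimately show "(%n. LINT x. Gn n x \<bullet> k x) \<longlonglongrightarrow> (LINT t|time T. e t * (LINT x. weak_gradient (u t) x \<bullet> k x))" by simp
		qed
	qed
qed

end

text \<open>By Fubini's theorem the pointwise transform and the abstract superposition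
  \<open>W\<close> have the same pairings with Borel functions in L^2, and the fundamental lemma
  gives equality. Integrability on the product comes from bounding each time slice by a product of
  norms.\<close>

lemma laplace_wave_AE:
	fixes u :: "real => R3 => real"
	assumes meas: "(%(t, x). u t x) \<in> borel_measurable (lebesgue_on ({0<..<T} \<times> UNIV))"
		and u: "u \<in> bochner_L2 H1 H1_norm T"
		and W: "W \<in> L2" "\<And>k. k \<in> L2 ==> (LINT x. W x * k x) = (LINT t|time T. exp (- s * t) * (LINT x. u t x * k x))"
	shows "AE x. laplace_wave u T x s = W x"
proof -
	have sp: "{0<..<T} \<inter> space lebesgue \<in> sets lebesgue" by simp
	define E :: "real => real" where "E t = indicator {0<..<T} t * exp (- s * t)" for t
	have Em [measurable]: "E \<in> borel_measurable borel" unfolding E_def[abs_def] by measurable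
	have E0: "E t \<ge> 0" for t by (simp add: E_def)
	define u1 where "u1 p = indicator ({0<..<T} \<times> UNIV) p * (case p of (t, x) => u t x)" for p :: "real \<times> R3"
	have "open ({0<..<T} \<times> (UNIV :: R3 set))" by (intro open_Times) auto
	then have S: "({0<..<T} \<times> (UNIV :: R3 set)) \<inter> space lebesgue \<in> sets lebesgue" by simp
	have u1m: "u1 \<in> borel_measurable lebesgue"
		using meas borel_measurable_restrict_space_iff[OF S, of "%(t, x). u t x"]
		by (simp add: u1_def[abs_def] mult.commute)
	\<comment> \<open>Fubini's theorem is applied to the Borel product, so \<open>u1\<close> is
	  replaced by a Borel function equal to it off a null set \<open>N\<close>; almost every slice of
	  \<open>N\<close> is null in either variable.\<close>
	obtain ut where ut [measurable]: "ut \<in> borel_measurable lborel" and aeu: "AE p in lborel. u1 p = ut p"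
		using completion_ex_borel_measurable_real[OF u1m] by blast
	obtain N where N: "\<And>p. p \<notin> N ==> u1 p = ut p" "N \<in> null_sets lborel"
	proof (rule AE_E3[OF aeu])
		fix N assume a: "\<And>p. p \<in> space lborel - N ==> u1 p = ut p" "N \<in> null_sets lborel"
		show thesis by (rule that[OF _ a(2)]) (rule a(1), simp)
	qed
	have N1: "ut (t, x) = indicator {0<..<T} t * u t x" if "(t, x) \<notin> N" for t x
		using N(1)[OF that] by (simp add: u1_def indicator_def)
	have utm [measurable]: "ut \<in> borel_measurable (borel \<Otimes>\<^sub>M borel)"
		using ut by (simp add: borel_prod)
	have Nae: "AE p in lborel \<Otimes>\<^sub>M lborel. p \<notin> N" unfolding lborel_prod by (rule AE_not_in[OF N(2)])
	have ae1: "AE t in lborel. AE x in lborel. (t, x) \<notin> N" using lborel_pair.AE_pair[OF Nae] .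
	have Nm: "{p \<in> space (lborel \<Otimes>\<^sub>M lborel). (fst p, snd p) \<notin> N} \<in> sets (lborel \<Otimes>\<^sub>M lborel)"
	proof -
		have "N \<in> sets lborel" using N(2) by (rule null_setsD2)
		then have "- N \<in> sets (lborel \<Otimes>\<^sub>M lborel)" unfolding lborel_prod by simp
		moreover have "{p \<in> space (lborel \<Otimes>\<^sub>M lborel). (fst p, snd p) \<notin> N} = - N" by (auto simp: space_pair_measure)
		ultimately show ?thesis by simp
	qed
	have ae2: "AE x in lborel. AE t in lborel. (t, x) \<notin> N"
		using ae1 lborel_pair.AE_commute[OF Nm] by simp
	have uH: "AE t in lborel. t \<in> {0<..<T} --> u t \<in> H1"
		using u AE_restrict_space_iff[OF sp] by (simp add: bochner_L2_def AE_completion_iff)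
	have Hn: "integrable (time T) (%t. H1_norm (u t))" by (rule bochner_L2_norm_integrable[OF u]) simp
	define wt where "wt x = (LINT t|lborel. E t * ut (t, x))" for x
	have key: "integrable lebesgue (%x. wt x * q x) \<and> (LINT x. wt x * q x) = (LINT x. W x * q x)"
		if \<phi>m [measurable]: "q \<in> borel_measurable borel" and q: "q \<in> L2" for q
	proof -
		define F where "F t x = E t * (ut (t, x) * q x)" for t x
		have Fm [measurable]: "(%(t, x). F t x) \<in> borel_measurable (borel \<Otimes>\<^sub>M borel)" unfolding F_def by measurable
		have Fm': "case_prod F \<in> borel_measurable (lborel \<Otimes>\<^sub>M lborel)" using Fm unfolding lborel_prod by (simp add: borel_prod)
		have slice: "integrable lborel (F t)" "(LINT x|lborel. F t x) = E t * (LINT x. u t x * q x)"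
			"(LINT x|lborel. norm (F t x)) \<le> E t * (H1_norm (u t) * L2_norm q)"
			if t: "AE x in lborel. (t, x) \<notin> N" "t \<in> {0<..<T} --> u t \<in> H1" for t
		proof -
			have Ftm [measurable]: "F t \<in> borel_measurable borel" unfolding F_def[abs_def] by measurable
			have all: "integrable lebesgue (F t) \<and> (LINT x. F t x) = E t * (LINT x. u t x * q x) \<and>
					(LINT x. norm (F t x)) \<le> E t * (H1_norm (u t) * L2_norm q)"
			proof (cases "t \<in> {0<..<T}")
				case False
				then have "F t = (%x. 0)" "E t = 0" by (auto simp: F_def E_def)
				then show ?thesis by simp
			next
				case True
				then have uL: "u t \<in> L2" and uH: "u t \<in> H1" using t(2) H1_L2 by auto
				have i: "integrable lebesgue (%x. E t * (u t x * q x))" using L2_mult_integrable[OF uL q] by simp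
				have e: "AE x. E t * (u t x * q x) = F t x"
					using AE_completion[OF t(1)] by (rule eventually_mono) (drule N1, use True in \<open>simp add: F_def\<close>)
				have m: "F t \<in> borel_measurable lebesgue" by (rule borel_measurable_AE[OF borel_measurable_integrable[OF i] e])
				have 1: "integrable lebesgue (F t)" using integrable_cong_AE_imp[OF i m] e by (simp add: eq_commute)
				have 2: "(LINT x. E t * (u t x * q x)) = (LINT x. F t x)"
					by (rule integral_cong_AE[OF borel_measurable_integrable[OF i] m e])
				have "(LINT x. norm (F t x)) = (LINT x. E t * (norm (u t x) * norm (q x)))"
				proof (rule integral_cong_AE)
					show "(%x. norm (F t x)) \<in> borel_measurable lebesgue" using m by simp
					show "(%x. E t * (norm (u t x) * norm (q x))) \<in> borel_measurable lebesgue"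
						using L2_measurable[OF uL] L2_measurable[OF q] by simp
					show "AE x. norm (F t x) = E t * (norm (u t x) * norm (q x))"
						using e by (rule eventually_mono) (drule sym, simp add: abs_mult E0)
				qed
				also have "\<dots> = E t * (LINT x. norm (u t x) * norm (q x))" by simp
				also have "\<dots> \<le> E t * (L2_norm (u t) * L2_norm q)"
					using L2_Cauchy_Schwarz_norm[OF uL q] E0 by (intro mult_left_mono) auto
				also have "\<dots> \<le> E t * (H1_norm (u t) * L2_norm q)"
					using E0 by (intro mult_left_mono mult_right_mono L2_norm_le_H1_norm) auto
				finally show ?thesis using 1 2 by simp
			qed
			show "integrable lborel (F t)" using all by (simp add: integrable_completion)
			show "(LINT x|lborel. F t x) = E t * (LINT x. u t x * q x)" using all by (simp add: integral_completion)
			show "(LINT x|lborel. norm (F t x)) \<le> E t * (H1_norm (u t) * L2_norm q)" using all by (simp add: integral_completion)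
		qed
		have ae: "AE t in lborel. (AE x in lborel. (t, x) \<notin> N) \<and> (t \<in> {0<..<T} --> u t \<in> H1)"
			using ae1 uH by (rule AE_conjI)
		have Ginn: "(%t. LINT x|lborel. norm (F t x)) \<in> borel_measurable lborel"
			"(%t. LINT x|lborel. F t x) \<in> borel_measurable lborel"
			by measurable
		have int1: "integrable lborel (%t. LINT x|lborel. norm (F t x))"
		proof -
			have "integrable lebesgue (%t. LINT x|lborel. norm (F t x))"
			proof (rule Bochner_Integration.integrable_bound)
				have "integrable (time T) (%t. exp (- s * t) * (H1_norm (u t) * L2_norm q))"
					using integrable_time_exp[of T "%t. H1_norm (u t) * L2_norm q" s] Hn by simp
				then show "integrable lebesgue (%t. E t * (H1_norm (u t) * L2_norm q))"
					by (simp add: integrable_restrict_space[OF sp] E_def mult.assoc)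
				show "(%t. LINT x|lborel. norm (F t x)) \<in> borel_measurable lebesgue" by (rule measurable_completion[OF Ginn(1)])
				show "AE t. norm (LINT x|lborel. norm (F t x)) \<le> norm (E t * (H1_norm (u t) * L2_norm q))"
					using AE_completion[OF ae]
				proof (rule eventually_mono)
					fix t assume t: "(AE x in lborel. (t, x) \<notin> N) \<and> (t \<in> {0<..<T} --> u t \<in> H1)"
					have "0 \<le> (LINT x|lborel. norm (F t x))" by (rule Bochner_Integration.integral_nonneg) simp
					then show "norm (LINT x|lborel. norm (F t x)) \<le> norm (E t * (H1_norm (u t) * L2_norm q))"
						using slice(3)[of t] t E0[of t] by simp
				qed
			qed
			then show ?thesis using integrable_completion[OF Ginn(1)] by blast
		qed
		have Fint: "integrable (lborel \<Otimes>\<^sub>M lborel) (case_prod F)"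
		proof (rule lborel_pair.Fubini_integrable[OF Fm'])
			show "integrable lborel (%t. LINT x|lborel. norm (case_prod F (t, x)))" using int1 by simp
			show "AE t in lborel. integrable lborel (%x. case_prod F (t, x))"
				using ae by (rule eventually_mono) (use slice(1) in simp)
		qed
		have inner: "(LINT t|lborel. F t x) = wt x * q x" for x
		proof -
			have "(LINT t|lborel. F t x) = (LINT t|lborel. (E t * ut (t, x)) * q x)" unfolding F_def by (simp add: mult.assoc)
			then show ?thesis by (simp add: wt_def)
		qed
		have i2: "integrable lborel (%x. wt x * q x)"
			using lborel_pair.integrable_snd[OF Fint] by (simp add: inner)
		have "(LINT x. wt x * q x) = (LINT x|lborel. wt x * q x)"
			by (rule integral_completion[OF borel_measurable_integrable[OF i2]])
		also have "\<dots> = (LINT t|lborel. LINT x|lborel. F t x)"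
			using lborel_pair.Fubini_integral[OF Fint] by (simp add: inner)
		also have "\<dots> = (LINT t. LINT x|lborel. F t x)"
			by (rule integral_completion[OF Ginn(2), symmetric])
		also have "\<dots> = (LINT t. E t * (LINT x. u t x * q x))"
		proof (rule integral_cong_AE)
			show m: "(%t. LINT x|lborel. F t x) \<in> borel_measurable lebesgue" by (rule measurable_completion[OF Ginn(2)])
			show e: "AE t. (LINT x|lborel. F t x) = E t * (LINT x. u t x * q x)"
				using AE_completion[OF ae] by (rule eventually_mono) (use slice(2) in simp)
			show "(%t. E t * (LINT x. u t x * q x)) \<in> borel_measurable lebesgue" by (rule borel_measurable_AE[OF m e])
		qed
		also have "\<dots> = (LINT t|time T. exp (- s * t) * (LINT x. u t x * q x))"
			by (simp add: integral_restrict_space[OF sp] E_def mult.assoc)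
		also have "\<dots> = (LINT x. W x * q x)" by (rule W(2)[OF q, symmetric])
		finally have "(LINT x. wt x * q x) = (LINT x. W x * q x)" .
		moreover have "integrable lebesgue (%x. wt x * q x)"
			using i2 integrable_completion[OF borel_measurable_integrable[OF i2]] by blast
		ultimately show ?thesis by blast
	qed
	have wtW: "AE x. wt x - W x = 0"
	proof (rule fundamental_lemma)
		show "loc_integrable (%x. wt x - W x)"
			unfolding loc_integrable_def
		proof
			fix r :: real
			have "(%x. indicator (cball (0::R3) r) x :: real) \<in> L2"
			proof -
				have "integrable lebesgue (indicator (cball (0::R3) r) :: R3 => real)"
					using lmeasurable_cball[of "0::R3" r] by (auto simp: fmeasurable_def)
				moreover have "(%x. (norm (indicator (cball 0 r) x :: real))^2) = (indicator (cball 0 r) :: R3 => real)" by (auto simp: indicator_def)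
				ultimately show ?thesis by (simp add: L2_def)
			qed
			then have "integrable lebesgue (%x. wt x * indicator (cball 0 r) x)" by (intro key[THEN conjunct1]) (auto intro!: borel_measurable_indicator)
			moreover have "integrable lebesgue (%x. indicator (cball 0 r) x * W x)"
				using L2_loc_integrable[OF W(1)] by (simp add: loc_integrable_def)
			ultimately have "integrable lebesgue (%x. wt x * indicator (cball 0 r) x - indicator (cball 0 r) x * W x)"
				by (rule Bochner_Integration.integrable_diff)
			then show "integrable lebesgue (%x. indicator (cball 0 r) x * (wt x - W x))"
				by (simp add: algebra_simps)
		qed
		fix q :: "R3 => real" assume q: "q \<in> test_functions UNIV"
		obtain R where \<phi>': "continuous_on UNIV q" "vanishes_beyond R q"
			using test_functionsE[OF q] has_C1_gradient_continuous by metis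
		have L: "q \<in> L2" by (rule L2_continuous_vanishes[OF \<phi>'])
		show "(LINT x. (wt x - W x) * q x) = 0"
			using key[OF borel_measurable_continuous_onI[OF \<phi>'(1)] L] L2_mult_integrable[OF W(1) L] by (simp add: left_diff_distrib)
	qed
	have lap: "AE x. laplace_wave u T x s = wt x"
		using AE_completion[OF ae2]
	proof (rule eventually_mono)
		fix x assume x: "AE t in lborel. (t, x) \<notin> N"
		have m0: "(%t. E t * ut (t, x)) \<in> borel_measurable borel" by measurable
		then have m: "(%t. E t * ut (t, x)) \<in> borel_measurable lebesgue" by (intro measurable_completion) simp
		have e: "AE t. E t * ut (t, x) = indicator {0<..<T} t *\<^sub>R (exp (- s * t) * u t x)"
			using AE_completion[OF x]
			by (rule eventually_mono) (drule N1, simp add: E_def indicator_def)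
		have "laplace_wave u T x s = (LINT t. indicator {0<..<T} t *\<^sub>R (exp (- s * t) * u t x))"
			unfolding laplace_wave_def by (rule integral_restrict_space[OF sp])
		also have "\<dots> = (LINT t. E t * ut (t, x))"
			by (rule integral_cong_AE[symmetric, OF m borel_measurable_AE[OF m e] e])
		also have "\<dots> = wt x" unfolding wt_def using m0 by (intro integral_completion) simp
		finally show "laplace_wave u T x s = wt x" .
	qed
	show ?thesis using lap wtW by eventually_elim simp
qed

section \<open>Matrix coefficients and the transformed wave equation\<close>

lemma matrix_vector_expand: "A *v y = (\<Sum>i\<in>UNIV. \<Sum>j\<in>UNIV. (A $ i $ j * y $ j) *\<^sub>R axis i 1)"
	for A :: "real^'n^'m" and y :: "real^'n"
proof (rule iffD2[OF vec_eq_iff], rule allI)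
	fix k
	have "(\<Sum>i\<in>UNIV. \<Sum>j\<in>UNIV. (A $ i $ j * y $ j) *\<^sub>R axis i (1::real)) $ k
			= (\<Sum>i\<in>UNIV. \<Sum>j\<in>UNIV. A $ i $ j * y $ j * (if k = i then 1 else 0))"
		by (simp add: axis_def)
	also have "\<dots> = (\<Sum>i\<in>UNIV. if k = i then (\<Sum>j\<in>UNIV. A $ i $ j * y $ j) else 0)"
		by (intro sum.cong) auto
	finally have "(\<Sum>i\<in>UNIV. \<Sum>j\<in>UNIV. (A $ i $ j * y $ j) *\<^sub>R axis i (1::real)) $ k
			= (\<Sum>i\<in>UNIV. if k = i then (\<Sum>j\<in>UNIV. A $ i $ j * y $ j) else 0)" .
	then show "(A *v y) $ k = (\<Sum>i\<in>UNIV. \<Sum>j\<in>UNIV. (A $ i $ j * y $ j) *\<^sub>R axis i (1::real)) $ k"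
		by (simp add: matrix_vector_mult_def)
qed

lemma Linfty_UNIV: "g \<in> Linfty UNIV \<longleftrightarrow> g \<in> borel_measurable lebesgue \<and> (\<exists>M. AE x. \<bar>g x\<bar> \<le> M)"
	unfolding Linfty_def lebesgue_on_UNIV_eq by simp

lemma AE_all_pairs:
	fixes P :: "'i::finite => 'j::finite => 'a => bool"
	assumes "\<And>i j. AE x in M. P i j x"
	shows "AE x in M. \<forall>i j. P i j x"
proof -
	have "AE x in M. \<forall>j\<in>UNIV. P i j x" for i by (rule AE_finite_allI[OF finite assms])
	then have "AE x in M. \<forall>i\<in>UNIV. \<forall>j\<in>UNIV. P i j x" by (rule AE_finite_allI[OF finite])
	then show ?thesis by simp
qed

lemma matrix_bounded:
	fixes a :: "R3 => real^3^3"
	assumes "\<And>i j. (%x. a x $ i $ j) \<in> Linfty UNIV"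
	obtains M where "M > 0" "AE x. \<forall>y. norm (a x *v y) \<le> M * norm y"
proof -
	have "\<exists>K. AE x. \<bar>a x $ i $ j\<bar> \<le> K" for i j using assms by (simp add: Linfty_UNIV)
	then obtain K where K: "\<And>i j. AE x. \<bar>a x $ i $ j\<bar> \<le> K i j" by metis
	define M where "M = 1 + (\<Sum>i\<in>UNIV. \<Sum>j\<in>UNIV. \<bar>K i j\<bar>)"
	have "AE x. \<forall>i j. \<bar>a x $ i $ j\<bar> \<le> K i j" by (rule AE_all_pairs[OF K])
	then have "AE x. \<forall>y. norm (a x *v y) \<le> M * norm y"
	proof (rule eventually_mono)
		fix x assume x: "\<forall>i j. \<bar>a x $ i $ j\<bar> \<le> K i j"
		show "\<forall>y. norm (a x *v y) \<le> M * norm y"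
		proof
			fix y :: R3
			have "norm (a x *v y) \<le> (\<Sum>i\<in>UNIV. \<Sum>j\<in>UNIV. norm ((a x $ i $ j * y $ j) *\<^sub>R (axis i 1 :: R3)))"
				unfolding matrix_vector_expand by (intro order_trans[OF norm_sum] sum_mono norm_sum)
			also have "\<dots> \<le> (\<Sum>i\<in>(UNIV :: 3 set). \<Sum>j\<in>(UNIV :: 3 set). \<bar>K i j\<bar> * norm y)"
			proof (intro sum_mono)
				fix i j
				have "\<bar>a x $ i $ j\<bar> * \<bar>y $ j\<bar> \<le> \<bar>K i j\<bar> * norm y"
					using x by (intro mult_mono component_le_norm_cart) (auto intro: order_trans[OF _ abs_ge_self])
				then show "norm ((a x $ i $ j * y $ j) *\<^sub>R (axis i 1 :: R3)) \<le> \<bar>K i j\<bar> * norm y"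
					by (simp add: abs_mult)
			qed
			also have "\<dots> = (M - 1) * norm y" by (simp add: M_def sum_distrib_right)
			also have "\<dots> \<le> M * norm y" by (intro mult_right_mono) auto
			finally show "norm (a x *v y) \<le> M * norm y" .
		qed
	qed
	moreover have "M > 0" unfolding M_def by (intro add_pos_nonneg sum_nonneg) auto
	ultimately show ?thesis using that by blast
qed

lemma matrix_measurable:
	fixes a :: "R3 => real^3^3"
	assumes a: "\<And>i j. (%x. a x $ i $ j) \<in> Linfty UNIV" and g: "g \<in> borel_measurable lebesgue"
	shows "(%x. a x *v g x) \<in> borel_measurable lebesgue"
proof -
	have "(%x. g x $ j) \<in> borel_measurable lebesgue" for j
		using g by (simp add: cart_eq_inner_axis)
	moreover have "(%x. a x $ i $ j) \<in> borel_measurable lebesgue" for i j using a by (simp add: Linfty_UNIV)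
	ultimately show ?thesis
		unfolding matrix_vector_expand by (intro borel_measurable_sum borel_measurable_scaleR borel_measurable_times) auto
qed

lemma matrix_L2:
	fixes a :: "R3 => real^3^3"
	assumes a: "\<And>i j. (%x. a x $ i $ j) \<in> Linfty UNIV" and g: "g \<in> L2"
	shows "(%x. a x *v g x) \<in> L2"
proof -
	obtain M where M: "AE x. \<forall>y. norm (a x *v y) \<le> M * norm y" using matrix_bounded[OF a] by blast
	show ?thesis
		by (rule L2_dominated[OF g matrix_measurable[OF a L2_measurable[OF g]], where c = M])
			(use M in \<open>auto elim: eventually_mono\<close>)
qed

lemma matrix_symmetric_AE:
	fixes a :: "R3 => real^3^3"
	assumes "\<And>i j. AE x. a x $ i $ j = a x $ j $ i"
	shows "AE x. \<forall>y h. (a x *v y) \<bullet> h = y \<bullet> (a x *v h)"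
proof -
	have "AE x. \<forall>i j. a x $ i $ j = a x $ j $ i" by (rule AE_all_pairs[OF assms])
	then show ?thesis
	proof (rule eventually_mono)
		fix x assume "\<forall>i j. a x $ i $ j = a x $ j $ i"
		then have "transpose (a x) = a x" by (simp add: vec_eq_iff transpose_def)
		then show "\<forall>y h. (a x *v y) \<bullet> h = y \<bullet> (a x *v h)" by (metis dot_lmul_matrix vector_transpose_matrix inner_commute)
	qed
qed

lemma continuous_on_pairing:
	fixes \<Lambda> :: "'v::minus => real"
	assumes U: "\<forall>t\<in>S. U t \<in> V" "\<forall>s\<in>S. ((%t. nrm (U t - U s)) \<longlongrightarrow> 0) (at s within S)"
		and L: "\<And>v w. v \<in> V ==> w \<in> V ==> \<bar>\<Lambda> v - \<Lambda> w\<bar> \<le> K * nrm (v - w)"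
	shows "continuous_on S (%t. \<Lambda> (U t) :: real)"
	unfolding continuous_on_def
proof
	fix s :: 'a assume s: "s \<in> S"
	show "((%t. \<Lambda> (U t)) \<longlongrightarrow> \<Lambda> (U s)) (at s within S)"
	proof (rule LIM_zero_cancel, rule Lim_null_comparison)
		show "((%t. K * nrm (U t - U s)) \<longlongrightarrow> 0) (at s within S)" using U(2) s by (intro tendsto_mult_right_zero) blast
		have "\<forall>\<^sub>F t in at s within S. t \<in> S" by (simp add: eventually_at_filter)
		then show "\<forall>\<^sub>F t in at s within S. norm (\<Lambda> (U t) - \<Lambda> (U s)) \<le> K * nrm (U t - U s)"
			by (rule eventually_mono) (use U(1) s L in simp)
	qed
qed

lemma is_weak_gradient_cong_AE:
	assumes W: "W \<in> L2" "is_weak_gradient W g" and ae: "AE x. W x = w x"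
	shows "w \<in> L2" "is_weak_gradient w g"
proof -
	have m: "w \<in> borel_measurable lebesgue" by (rule borel_measurable_AE[OF L2_measurable[OF W(1)] ae])
	show w: "w \<in> L2"
		by (rule L2_dominated[OF W(1) m, where c = 1]) (use ae in \<open>auto elim: eventually_mono\<close>)
	have "L2_norm (%x. W x - w x) = L2_norm (%x :: R3. 0 :: real)"
		using ae by (intro L2_norm_cong_AE) (use L2_measurable[OF L2_diff[OF W(1) w]] in auto)
	then have 0: "L2_norm (%x. W x - w x) = 0" by (simp add: L2_norm_def)
	show "is_weak_gradient w g"
		by (rule is_weak_gradient_limit[where u = "%_. W" and g = "%_. g", OF W w weak_gradient_L2[OF W(2)]])
			(simp_all add: 0 L2_norm_def)
qed

text \<open>Two integrations by parts in time, for a fixed spatial test function. \<open>uT\<close>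
  and \<open>FT\<close> are the values at time \<open>T\<close> of the continuous representatives of
  \<open>u\<close> and of its time derivative; the initial values contribute 0 and the source
  \<open>f\<close>.\<close>

lemma wave_laplace_equation:
	fixes a :: "R3 => real^3^3"
	assumes wave: "wave_weak_solution a f T u" and T: "0 < T" and f: "f \<in> L2"
		and a: "\<And>i j. (%x. a x $ i $ j) \<in> Linfty UNIV" and sym: "\<And>i j. AE x. a x $ i $ j = a x $ j $ i"
	obtains uT FT where "uT \<in> L2" "FT \<in> H1_dual"
		"\<And>n. n > 0 ==> (%x. laplace_wave u T x n) \<in> H1"
		"\<And>n p. n > 0 ==> p \<in> H1 ==>
			(LINT x. (a x *v weak_gradient (%x. laplace_wave u T x n) x) \<bullet> weak_gradient p x)
				+ n^2 * (LINT x. laplace_wave u T x n * p x)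
			= (LINT x. f x * p x) - exp (- n * T) * (FT p + n * (LINT x. uT x * p x))"
proof -
	interpret finite_measure "time T" by (rule finite_measure_time)
	have meas: "(%(t, x). u t x) \<in> borel_measurable (lebesgue_on ({0<..<T} \<times> UNIV))"
		and u: "u \<in> bochner_L2 H1 H1_norm T"
		using wave unfolding wave_weak_solution_def by blast+
	obtain u' u'' where u': "u' \<in> bochner_L2 L2 L2_norm T" and u'': "u'' \<in> bochner_L2 H1_dual H1_dual_norm T"
		and d1: "has_time_derivative T (%t. L2_functional (u t)) (%t. L2_functional (u' t))"
		and d2: "has_time_derivative T (%t. L2_functional (u' t)) u''"
		and eqn: "\<forall>p\<in>H1. AE t in time T. u'' t p + (LINT x. (a x *v weak_gradient (u t) x) \<bullet> weak_gradient p x) = 0"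
		and i1: "has_initial_value L2 L2_norm T u (%x. 0)"
		and i2: "has_initial_value H1_dual H1_dual_norm T (%t. L2_functional (u' t)) (L2_functional f)"
		using wave unfolding wave_weak_solution_def by blast
	obtain U where U: "\<forall>t\<in>{0..T}. U t \<in> L2" "\<forall>s\<in>{0..T}. ((%t. L2_norm (U t - U s)) \<longlongrightarrow> 0) (at s within {0..T})"
		and Uae: "AE t in time T. L2_norm (U t - u t) = 0" and U0: "L2_norm (U 0 - (%x. 0)) = 0"
		using i1 unfolding has_initial_value_def by blast
	obtain V where V: "\<forall>t\<in>{0..T}. V t \<in> H1_dual" "\<forall>s\<in>{0..T}. ((%t. H1_dual_norm (V t - V s)) \<longlongrightarrow> 0) (at s within {0..T})"
		and Vae: "AE t in time T. H1_dual_norm (V t - L2_functional (u' t)) = 0" and V0: "H1_dual_norm (V 0 - L2_functional f) = 0"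
		using i2 unfolding has_initial_value_def by blast
	have uH: "AE t in time T. u t \<in> H1" using u by (simp add: bochner_L2_def)
	have u'L: "AE t in time T. u' t \<in> L2" using u' by (simp add: bochner_L2_def)
	have L2_pair: "\<bar>(LINT x. v x * k x) - (LINT x. w x * k x)\<bar> \<le> L2_norm k * L2_norm (v - w)"
		if "v \<in> L2" "w \<in> L2" "k \<in> L2" for v w k :: "R3 => real"
	proof -
		have "(LINT x. (v x - w x) * k x) = (LINT x. v x * k x) - (LINT x. w x * k x)"
			using L2_mult_integrable[OF that(1,3)] L2_mult_integrable[OF that(2,3)] by (simp add: left_diff_distrib)
		then show ?thesis
			using L2_Cauchy_Schwarz[OF L2_diff[OF that(1,2)] that(3)] by (simp add: fun_diff_def mult.commute[of "L2_norm k"])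
	qed
	have L2_pair0: "\<bar>LINT x. v x * k x\<bar> \<le> L2_norm k * L2_norm v"
		if "v \<in> L2" "k \<in> L2" for v k :: "R3 => real"
		using L2_Cauchy_Schwarz[OF that] by (simp add: mult.commute)
	have dual_pair: "\<bar>F p - G p\<bar> \<le> H1_norm p * H1_dual_norm (F - G)" if "F \<in> H1_dual" "G \<in> H1_dual" "p \<in> H1" for F G p
		using H1_dual_bound[OF H1_dual_diff[OF that(1,2)] that(3)] by (simp add: mult.commute)
	have H1_L2_norm: "L2_norm k * L2_norm v \<le> L2_norm k * H1_norm v" for k v :: "R3 => real"
		by (intro mult_left_mono L2_norm_le_H1_norm) simp
	have parts1: "(LINT t|time T. exp (- n * t) * (LINT x. u' t x * p x))
			= exp (- n * T) * (LINT x. U T x * p x) + n * (LINT t|time T. exp (- n * t) * (LINT x. u t x * p x))"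
		if p: "p \<in> H1" for p n
	proof -
		have \<phi>L: "p \<in> L2" by (rule H1_L2[OF p])
		have r: "integrable (time T) (%t. LINT x. u t x * p x)"
		proof (rule bochner_L2_pairing[OF u, where \<Lambda> = "%v. LINT x. v x * p x" and K = "L2_norm p"])
			show "\<bar>(LINT x. v x * p x) - (LINT x. w x * p x)\<bar> \<le> L2_norm p * H1_norm (v - w)" if "v \<in> H1" "w \<in> H1" for v w
				by (rule order_trans[OF L2_pair[OF H1_L2[OF that(1)] H1_L2[OF that(2)] \<phi>L] H1_L2_norm])
			show "\<bar>LINT x. v x * p x\<bar> \<le> L2_norm p * H1_norm v" if "v \<in> H1" for v
				by (rule order_trans[OF L2_pair0[OF H1_L2[OF that] \<phi>L] H1_L2_norm])
		qed simp
		have q: "integrable (time T) (%t. LINT x. u' t x * p x)"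
			by (rule bochner_L2_pairing[OF u', where \<Lambda> = "%v. LINT x. v x * p x" and K = "L2_norm p"])
				(rule L2_norm_nonneg, rule L2_pair[OF _ _ \<phi>L], assumption+, rule L2_pair0[OF _ \<phi>L])
		have weak: "(LINT t|time T. deriv y t * (LINT x. u t x * p x)) = - (LINT t|time T. y t * (LINT x. u' t x * p x))"
			if "y \<in> test_functions {0<..<T}" for y
			using d1 p that unfolding has_time_derivative_def L2_functional_def by blast
		have R: "continuous_on {0..T} (%t. LINT x. U t x * p x)"
			by (rule continuous_on_pairing[where U = U and V = L2 and nrm = L2_norm and \<Lambda> = "%v. LINT x. v x * p x" and K = "L2_norm p", OF U])
				(rule L2_pair[OF _ _ \<phi>L])
		have ae: "AE t in time T. (LINT x. u t x * p x) = (LINT x. U t x * p x)"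
			using uH Uae AE_space
		proof eventually_elim
			case (elim t)
			then show ?case using L2_pair[OF bspec[OF U(1)] H1_L2[OF elim(1)] \<phi>L, of t] by simp
		qed
		have "(LINT x. U 0 x * p x) = 0"
			using L2_pair0[OF bspec[OF U(1)] \<phi>L, of 0] U0 T by (simp add: fun_diff_def)
		then show ?thesis using time_integration_by_parts[OF T r q weak R ae, of n] by simp
	qed
	have parts2: "(LINT t|time T. exp (- n * t) * u'' t p)
			= exp (- n * T) * V T p - (LINT x. f x * p x) + n * (LINT t|time T. exp (- n * t) * (LINT x. u' t x * p x))"
		and u''i: "integrable (time T) (%t. u'' t p)"
		if p: "p \<in> H1" for p n
	proof -
		have \<phi>L: "p \<in> L2" by (rule H1_L2[OF p])
		have r: "integrable (time T) (%t. LINT x. u' t x * p x)"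
			by (rule bochner_L2_pairing[OF u', where \<Lambda> = "%v. LINT x. v x * p x" and K = "L2_norm p"])
				(rule L2_norm_nonneg, rule L2_pair[OF _ _ \<phi>L], assumption+, rule L2_pair0[OF _ \<phi>L])
		show q: "integrable (time T) (%t. u'' t p)"
		proof (rule bochner_L2_pairing[OF u'' H1_dual_norm_nonneg, where \<Lambda> = "%F. F p" and K = "H1_norm p"])
			show "\<bar>F p - G p\<bar> \<le> H1_norm p * H1_dual_norm (F - G)" if "F \<in> H1_dual" "G \<in> H1_dual" for F G
				by (rule dual_pair[OF that p])
			show "\<bar>F p\<bar> \<le> H1_norm p * H1_dual_norm F" if "F \<in> H1_dual" for F
				using H1_dual_bound[OF that p] by (simp add: mult.commute)
		qed
		have weak: "(LINT t|time T. deriv y t * (LINT x. u' t x * p x)) = - (LINT t|time T. y t * u'' t p)"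
			if "y \<in> test_functions {0<..<T}" for y
			using d2 p that unfolding has_time_derivative_def L2_functional_def by blast
		have R: "continuous_on {0..T} (%t. V t p)"
			by (rule continuous_on_pairing[where U = V and V = H1_dual and nrm = H1_dual_norm and \<Lambda> = "%F. F p" and K = "H1_norm p", OF V]) (rule dual_pair[OF _ _ p])
		have ae: "AE t in time T. (LINT x. u' t x * p x) = V t p"
			using u'L Vae AE_space
		proof eventually_elim
			case (elim t)
			then show ?case
				using dual_pair[OF bspec[OF V(1)] L2_functional_dual[OF elim(1)] p, of t] by (simp add: L2_functional_def)
		qed
		have "V 0 p = (LINT x. f x * p x)"
			using dual_pair[OF bspec[OF V(1)] L2_functional_dual[OF f] p, of 0] V0 T by (simp add: L2_functional_def)
		then show "(LINT t|time T. exp (- n * t) * u'' t p)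
			= exp (- n * T) * V T p - (LINT x. f x * p x) + n * (LINT t|time T. exp (- n * t) * (LINT x. u' t x * p x))"
			using time_integration_by_parts[OF T r q weak R ae, of n] by simp
	qed
	have main: "(%x. laplace_wave u T x n) \<in> H1 \<and> (\<forall>p\<in>H1.
			(LINT x. (a x *v weak_gradient (%x. laplace_wave u T x n) x) \<bullet> weak_gradient p x)
				+ n^2 * (LINT x. laplace_wave u T x n * p x)
			= (LINT x. f x * p x) - exp (- n * T) * (V T p + n * (LINT x. U T x * p x)))"
		if n: "n > 0" for n
	proof -
		let ?w = "%x. laplace_wave u T x n"
		have ei: "integrable (time T) (%t. exp (- n * t))" using integrable_time_exp[of T "%_. 1" n] by simp
		have e01: "0 \<le> exp (- n * t) \<and> exp (- n * t) \<le> 1" if "t \<in> {0<..<T}" for t using that n by simp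
		obtain W g where W: "W \<in> L2" "is_weak_gradient W g"
			and Wk: "\<And>k. k \<in> L2 ==> (LINT x. W x * k x) = (LINT t|time T. exp (- n * t) * (LINT x. u t x * k x))"
			and gk: "\<And>k. k \<in> L2 ==> (LINT x. g x \<bullet> k x) = (LINT t|time T. exp (- n * t) * (LINT x. weak_gradient (u t) x \<bullet> k x))"
			by (rule superpose_H1[OF ei e01 u]) blast+
		have lap: "AE x. ?w x = W x" by (rule laplace_wave_AE[OF meas u W(1) Wk])
		have "AE x. W x = ?w x" using lap by (rule eventually_mono) simp
		note w = is_weak_gradient_cong_AE[OF W this]
		have wH: "?w \<in> H1" by (rule H1I[OF w])
		have gL: "g \<in> L2" by (rule weak_gradient_L2[OF W(2)])
		have "(LINT x. (a x *v weak_gradient ?w x) \<bullet> weak_gradient p x) + n^2 * (LINT x. ?w x * p x)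
			= (LINT x. f x * p x) - exp (- n * T) * (V T p + n * (LINT x. U T x * p x))" if p: "p \<in> H1" for p
		proof -
			have \<phi>L: "p \<in> L2" and PL: "weak_gradient p \<in> L2" by (rule H1_L2[OF p], rule H1_gradient_L2[OF p])
			\<comment> \<open>Symmetry moves the matrix to the test function, so that the superposed gradient
			  is paired with one fixed L^2 function.\<close>
			define k where "k x = a x *v weak_gradient p x" for x
			have kL: "k \<in> L2" unfolding k_def[abs_def] by (rule matrix_L2[OF a PL])
			have move: "(LINT x. (a x *v G x) \<bullet> weak_gradient p x) = (LINT x. H x \<bullet> k x)"
				if "G \<in> L2" "H \<in> L2" "AE x. G x = H x" for G H
			proof (rule integral_cong_AE)
				show "(%x. (a x *v G x) \<bullet> weak_gradient p x) \<in> borel_measurable lebesgue"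
					by (rule borel_measurable_integrable[OF L2_inner_integrable[OF matrix_L2[OF a that(1)] PL]])
				show "(%x. H x \<bullet> k x) \<in> borel_measurable lebesgue"
					by (rule borel_measurable_integrable[OF L2_inner_integrable[OF that(2) kL]])
				show "AE x. (a x *v G x) \<bullet> weak_gradient p x = H x \<bullet> k x"
					using matrix_symmetric_AE[OF sym] that(3) by eventually_elim (simp add: k_def)
			qed
			have 1: "(LINT x. (a x *v weak_gradient ?w x) \<bullet> weak_gradient p x) = (LINT x. g x \<bullet> k x)"
				by (rule move[OF H1_gradient_L2[OF wH] gL weak_gradient_AE[OF w]])
			have eqn\<phi>: "AE t in time T. - u'' t p = (LINT x. weak_gradient (u t) x \<bullet> k x)"
				using bspec[OF eqn p] uH
			proof eventually_elim
				case (elim t)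
				note uG = H1_gradient_L2[OF elim(2)]
				show ?case using elim(1) move[OF uG uG] by simp
			qed
			have "(LINT t|time T. exp (- n * t) * (- u'' t p)) = (LINT t|time T. exp (- n * t) * (LINT x. weak_gradient (u t) x \<bullet> k x))"
			proof (rule integral_cong_AE)
				have i: "integrable (time T) (%t. - u'' t p)" using u''i[OF p] by simp
				show m: "(%t. exp (- n * t) * (- u'' t p)) \<in> borel_measurable (time T)"
					by (rule borel_measurable_integrable[OF integrable_time_exp[OF i]])
				show e: "AE t in time T. exp (- n * t) * (- u'' t p) = exp (- n * t) * (LINT x. weak_gradient (u t) x \<bullet> k x)"
					using eqn\<phi> by (rule eventually_mono) simp
				show "(%t. exp (- n * t) * (LINT x. weak_gradient (u t) x \<bullet> k x)) \<in> borel_measurable (time T)"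
					by (rule lebesgue_on_measurable_AE[OF _ m e]) simp
			qed
			then have 2: "(LINT x. g x \<bullet> k x) = - (LINT t|time T. exp (- n * t) * u'' t p)"
				by (simp add: gk[OF kL])
			have 3: "(LINT x. ?w x * p x) = (LINT t|time T. exp (- n * t) * (LINT x. u t x * p x))"
			proof -
				have "(LINT x. ?w x * p x) = (LINT x. W x * p x)"
				proof (rule integral_cong_AE)
					show "(%x. ?w x * p x) \<in> borel_measurable lebesgue" by (rule borel_measurable_integrable[OF L2_mult_integrable[OF w(1) \<phi>L]])
					show "(%x. W x * p x) \<in> borel_measurable lebesgue" by (rule borel_measurable_integrable[OF L2_mult_integrable[OF W(1) \<phi>L]])
					show "AE x. ?w x * p x = W x * p x" using lap by (rule eventually_mono) simp
				qed
				then show ?thesis by (simp only: Wk[OF \<phi>L])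
			qed
			show ?thesis unfolding 1 2 3 parts2[OF p] parts1[OF p] by (simp add: algebra_simps power2_eq_square)
		qed
		then show ?thesis using wH by blast
	qed
	show ?thesis
	proof (rule that)
		show "U T \<in> L2" "V T \<in> H1_dual" using U(1) V(1) T by auto
	qed (use main in blast)+
qed

section \<open>Energy identities\<close>

lemma L2_indicator:
	fixes a :: "R3 => 'b::euclidean_space"
	assumes a: "a \<in> L2" and D: "D \<in> sets lebesgue"
	shows "(%x. indicator D x *\<^sub>R a x) \<in> L2"
		and "(L2_norm (%x. indicator D x *\<^sub>R a x))^2 = (LINT x. indicator D x * (norm (a x))^2)"
		and "L2_norm (%x. indicator D x *\<^sub>R a x) \<le> L2_norm a"
proof -
	have m: "(%x. indicator D x *\<^sub>R a x) \<in> borel_measurable lebesgue" using D L2_measurable[OF a] by simp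
	show L: "(%x. indicator D x *\<^sub>R a x) \<in> L2"
		by (rule L2_dominated[OF a m, where c = 1]) (auto simp: indicator_def)
	show "(L2_norm (%x. indicator D x *\<^sub>R a x))^2 = (LINT x. indicator D x * (norm (a x))^2)"
		unfolding L2_norm_power2 by (intro Bochner_Integration.integral_cong) (auto simp: indicator_def)
	show "L2_norm (%x. indicator D x *\<^sub>R a x) \<le> L2_norm a"
		using L2_norm_mono[OF a L, of 1] by (auto simp: indicator_def)
qed

text \<open>Since \<open>k\<close> vanishes off \<open>D\<close>, both arguments may be restricted
  to \<open>D\<close>; this is how only the gradient inside the obstacle enters the
  estimates.\<close>

lemma matrix_form_bound:
	fixes k :: "R3 => real^3^3"
	assumes k: "\<And>i j. (%x. k x $ i $ j) \<in> Linfty UNIV" and supp: "\<And>x. x \<notin> D ==> k x = 0"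
		and M: "M \<ge> 0" "AE x. \<forall>y. norm (k x *v y) \<le> M * norm y" and D: "D \<in> sets lebesgue"
		and ab: "a \<in> L2" "b \<in> L2"
	shows "\<bar>LINT x. (k x *v a x) \<bullet> b x\<bar> \<le> M * L2_norm (%x. indicator D x *\<^sub>R a x) * L2_norm (%x. indicator D x *\<^sub>R b x)"
proof -
	have eq: "(k x *v a x) \<bullet> b x = (k x *v a x) \<bullet> (indicator D x *\<^sub>R b x)" for x using supp[of x] by (cases "x \<in> D") auto
	have "\<bar>LINT x. (k x *v a x) \<bullet> b x\<bar> \<le> L2_norm (%x. k x *v a x) * L2_norm (%x. indicator D x *\<^sub>R b x)"
		unfolding eq by (rule L2_Cauchy_Schwarz[OF matrix_L2[OF k ab(1)] L2_indicator(1)[OF ab(2) D]])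
	also have "L2_norm (%x. k x *v a x) \<le> M * L2_norm (%x. indicator D x *\<^sub>R a x)"
	proof (rule L2_norm_mono[OF L2_indicator(1)[OF ab(1) D] matrix_L2[OF k ab(1)] _ M(1)])
		show "AE x. norm (k x *v a x) \<le> M * norm (indicator D x *\<^sub>R a x)"
			using M(2)
		proof (rule eventually_mono)
			fix x assume "\<forall>y. norm (k x *v y) \<le> M * norm y"
			then show "norm (k x *v a x) \<le> M * norm (indicator D x *\<^sub>R a x)" using supp[of x] by (cases "x \<in> D") auto
		qed
	qed
	finally show ?thesis by (simp add: mult_right_mono)
qed

context two_layer
begin

text \<open>The equation is tested with \<open>v\<close> itself. These powers of \<open>s\<close>
  later give the term from time \<open>T\<close>, evaluated at \<open>v\<close>, its factor 1 /
  s.\<close>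

lemma elliptic_decay:
	assumes v: "elliptic_weak_solution \<gamma>0 s f v" and f: "f \<in> L2" and s: "s > 0"
	shows "L2_norm v \<le> L2_norm f / s^2" "L2_norm (weak_gradient v) \<le> L2_norm f / (sqrt \<gamma>m * s)"
proof -
	have vH: "v \<in> H1" using v by (simp add: elliptic_weak_solution_def)
	have vL: "v \<in> L2" and gL: "weak_gradient v \<in> L2" by (rule H1_L2[OF vH], rule H1_gradient_L2[OF vH])
	have "\<gamma>m * (L2_norm (weak_gradient v))^2 = (LINT x. \<gamma>m * (norm (weak_gradient v x))^2)" by (simp add: L2_norm_power2)
	also have "\<dots> \<le> (LINT x. \<gamma>0 x * (weak_gradient v x \<bullet> weak_gradient v x))"
		using L2_integrable_square[OF gL] gamma0_inner_integrable[OF gL gL]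
		by (intro integral_mono) (auto simp: power2_norm_eq_inner intro!: mult_right_mono gamma0_bounds)
	finally have "\<gamma>m * (L2_norm (weak_gradient v))^2 \<le> (LINT x. \<gamma>0 x * (weak_gradient v x \<bullet> weak_gradient v x))" .
	moreover have "(LINT x. f x * v x) \<le> L2_norm f * L2_norm v"
		using L2_Cauchy_Schwarz[OF f vL] by simp
	moreover have "(L2_norm v)^2 = (LINT x. v x * v x)" unfolding L2_norm_power2 by (simp add: power2_eq_square)
	ultimately have *: "\<gamma>m * (L2_norm (weak_gradient v))^2 + s^2 * (L2_norm v)^2 \<le> L2_norm f * L2_norm v"
		using elliptic_test[OF v vL H1_weak_gradient[OF vH]] by simp
	have g0: "\<gamma>m * (L2_norm (weak_gradient v))^2 \<ge> 0" using gamma_m_pos by simp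
	have "(s^2 * L2_norm v) * L2_norm v \<le> L2_norm f * L2_norm v" using * g0 by (simp add: power2_eq_square)
	then have 1: "s^2 * L2_norm v \<le> L2_norm f"
		by (cases "L2_norm v = 0") (use L2_norm_nonneg[of v] in \<open>auto simp: less_le\<close>)
	then show 2: "L2_norm v \<le> L2_norm f / s^2" using s by (simp add: pos_le_divide_eq mult.commute)
	have "\<gamma>m * (L2_norm (weak_gradient v))^2 \<le> L2_norm f * L2_norm v"
	proof -
		have "s^2 * (L2_norm v)^2 \<ge> 0" by simp
		with * show ?thesis by linarith
	qed
	also have "\<dots> \<le> L2_norm f * (L2_norm f / s^2)" by (rule mult_left_mono[OF 2]) simp
	finally have "(sqrt \<gamma>m * L2_norm (weak_gradient v))^2 \<le> (L2_norm f / s)^2"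
		using gamma_m_pos by (simp add: power_mult_distrib power_divide less_imp_le power2_eq_square[of "L2_norm f"])
	then have "sqrt \<gamma>m * L2_norm (weak_gradient v) \<le> L2_norm f / s"
		by (rule power2_le_imp_le) (use s in simp)
	then have "L2_norm (weak_gradient v) \<le> L2_norm f / s / sqrt \<gamma>m"
		using gamma_m_pos by (simp only: pos_le_divide_eq[of "sqrt \<gamma>m"] real_sqrt_gt_zero mult.commute)
	then show "L2_norm (weak_gradient v) \<le> L2_norm f / (sqrt \<gamma>m * s)" by (simp add: mult.commute)
qed

text \<open>All claims are linear combinations of four tests: \<open>e1\<close> and
  \<open>e2\<close> test the equation of \<open>v\<close> with \<open>v\<close> and
  \<open>w\<close>, \<open>e3\<close> and \<open>e4\<close> test that of \<open>w\<close> with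
  \<open>v\<close> and \<open>z\<close>. The third identity is the difference of the two equations
  tested with \<open>z\<close>; it bounds \<open>z\<close> by \<open>\<Phi>\<close> and by the
  gradient of \<open>v\<close> where \<open>k\<close> lives.\<close>

lemma energy_identities:
	fixes k :: "R3 => real^3^3"
	assumes k: "\<And>i j. (%x. k x $ i $ j) \<in> Linfty UNIV"
		and sym: "AE x. \<forall>X h. (k x *v X) \<bullet> h = X \<bullet> (k x *v h)"
		and f: "f \<in> L2" and v: "elliptic_weak_solution \<gamma>0 s f v" and w: "w \<in> H1"
		and weq: "\<And>q. q \<in> H1 ==> (LINT x. \<gamma>0 x * (weak_gradient w x \<bullet> weak_gradient q x))
			+ (LINT x. (k x *v weak_gradient w x) \<bullet> weak_gradient q x)
			+ s^2 * (LINT x. w x * q x) = (LINT x. f x * q x) - \<Phi> q"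
	defines "z \<equiv> %x. w x - v x" and "y \<equiv> %x. weak_gradient w x - weak_gradient v x"
	defines "A \<equiv> (LINT x. \<gamma>0 x * (norm (y x))^2) + s^2 * (L2_norm z)^2"
	defines "H \<equiv> %a b. LINT x. (k x *v a x) \<bullet> b x"
	shows "(LINT x. f x * z x) = - H (weak_gradient v) (weak_gradient v) + (A + H y y) + \<Phi> z - \<Phi> v"
		and "(LINT x. f x * z x) = - H (weak_gradient w) (weak_gradient w) - A - \<Phi> z - \<Phi> v"
		and "A + H y y = - H (weak_gradient v) y - \<Phi> z"
proof -
	define g p where "g = weak_gradient v" and "p = weak_gradient w"
	have vH: "v \<in> H1" using v by (simp add: elliptic_weak_solution_def)
	have vL: "v \<in> L2" and gL: "g \<in> L2" and wL: "w \<in> L2" and pL: "p \<in> L2"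
		unfolding g_def p_def using vH w by (auto intro: H1_L2 H1_gradient_L2)
	note gI = gamma0_inner_integrable and kI = L2_inner_integrable[OF matrix_L2[OF k]] and mI = L2_mult_integrable
	have zH: "z \<in> H1" and zg: "is_weak_gradient z y"
		unfolding z_def y_def by (rule H1_diff(1)[OF w vH], rule H1_diff(2)[OF w vH])
	have zL: "z \<in> L2" by (rule H1_L2[OF zH])
	have y: "y x = p x - g x" for x by (simp add: y_def g_def p_def)
	have \<zeta>L: "y \<in> L2" by (rule weak_gradient_L2[OF zg])
	have zae: "AE x. weak_gradient z x = y x" by (rule weak_gradient_AE[OF zL zg])
	define A0 where "A0 a b = (LINT x. \<gamma>0 x * (a x \<bullet> b x))" for a b :: "R3 => R3"
	define m where "m a b = (LINT x. a x * b x)" for a b :: "R3 => real"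
	have msym: "m a b = m b a" for a b by (simp add: m_def mult.commute)
	have Asym: "A0 a b = A0 b a" for a b by (simp add: A0_def inner_commute)
	have Hsym: "H a b = H b a" if "a \<in> L2" "b \<in> L2" for a b
		unfolding H_def
	proof (rule integral_cong_AE[OF borel_measurable_integrable[OF kI[OF that]] borel_measurable_integrable[OF kI[OF that(2,1)]]])
		show "AE x. (k x *v a x) \<bullet> b x = (k x *v b x) \<bullet> a x"
			using sym by (rule eventually_mono) (simp add: inner_commute)
	qed
	have md: "m a z = m a w - m a v" if "a \<in> L2" for a
		unfolding m_def z_def using mI[OF that wL] mI[OF that vL] by (simp add: right_diff_distrib)
	have Ad: "A0 a y = A0 a p - A0 a g" if "a \<in> L2" for a
		unfolding A0_def y using gI[OF that pL] gI[OF that gL] by (simp add: inner_diff_right right_diff_distrib)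
	have Hd: "H a y = H a p - H a g" if "a \<in> L2" for a
		unfolding H_def y using kI[OF that pL] kI[OF that gL] by (simp add: inner_diff_right)
	have e1: "A0 g g + s^2 * m v v = m f v"
		using elliptic_test[OF v vL H1_weak_gradient[OF vH]] by (simp add: A0_def m_def g_def)
	have e2: "A0 g p + s^2 * m v w = m f w"
		using elliptic_test[OF v wL H1_weak_gradient[OF w]] by (simp add: A0_def m_def g_def p_def)
	have e3: "A0 p g + H p g + s^2 * m w v = m f v - \<Phi> v"
		using weq[OF vH] by (simp add: A0_def m_def H_def g_def p_def)
	have "(LINT x. \<gamma>0 x * (p x \<bullet> weak_gradient z x)) = A0 p y"
		unfolding A0_def
		by (rule integral_cong_AE[OF borel_measurable_integrable[OF gI[OF pL H1_gradient_L2[OF zH]]] borel_measurable_integrable[OF gI[OF pL \<zeta>L]]])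
			(use zae in \<open>auto elim: eventually_mono\<close>)
	moreover have "(LINT x. (k x *v p x) \<bullet> weak_gradient z x) = H p y"
		unfolding H_def
		by (rule integral_cong_AE[OF borel_measurable_integrable[OF kI[OF pL H1_gradient_L2[OF zH]]] borel_measurable_integrable[OF kI[OF pL \<zeta>L]]])
			(use zae in \<open>auto elim: eventually_mono\<close>)
	ultimately have e4: "A0 p y + H p y + s^2 * m w z = m f z - \<Phi> z"
		using weq[OF zH] by (simp add: m_def p_def)
	have A: "A = A0 y y + s^2 * m z z"
	proof -
		have "(L2_norm z)^2 = m z z" unfolding L2_norm_power2 m_def by (simp add: power2_eq_square)
		then show ?thesis unfolding A_def A0_def by (simp only: power2_norm_eq_inner)
	qed
	note ex = Ad[OF \<zeta>L] Ad[OF gL] Ad[OF pL] Hd[OF \<zeta>L] Hd[OF gL] Hd[OF pL] md[OF zL] md[OF vL] md[OF wL] md[OF f]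
	have zz: "m z z = m w w - 2 * m w v + m v v" using ex msym[of z w] msym[of z v] msym[of v w] by simp
	have AA: "A0 y y = A0 p p - 2 * A0 p g + A0 g g" using ex Asym[of y p] Asym[of y g] Asym[of g p] by simp
	have HH: "H y y = H p p - 2 * H p g + H g g"
		using ex Hsym[OF \<zeta>L pL] Hsym[OF \<zeta>L gL] Hsym[OF gL pL] by simp
	have A': "A = A0 p p - 2 * A0 p g + A0 g g + s^2 * m w w - 2 * (s^2 * m w v) + s^2 * m v v"
		unfolding A zz AA by (simp add: algebra_simps)
	have e4': "A0 p p - A0 p g + H p p - H p g + s^2 * m w w - s^2 * m w v = m f z - \<Phi> z"
		using e4 unfolding ex by (simp add: algebra_simps)
	note e2' = e2[unfolded Asym[of g p] msym[of v w]]
	note fz = md[OF f]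
	show "(LINT x. f x * z x) = - H (weak_gradient v) (weak_gradient v) + (A + H y y) + \<Phi> z - \<Phi> v"
		unfolding m_def[symmetric] g_def[symmetric] A' HH using e1 e2' e3 e4' fz by linarith
	show "(LINT x. f x * z x) = - H (weak_gradient w) (weak_gradient w) - A - \<Phi> z - \<Phi> v"
		unfolding m_def[symmetric] p_def[symmetric] A' using e1 e2' e3 e4' fz by linarith
	show "A + H y y = - H (weak_gradient v) y - \<Phi> z"
		unfolding g_def[symmetric] A' HH Hd[OF gL] Hsym[OF gL pL] using e1 e2' e3 e4' fz by linarith
qed

end

text \<open>The square is completed with a constant four times the optimal one, which suffices to
  absorb a term linear in \<open>N\<close>.\<close>

lemma quadratic_bound:
	fixes m :: real assumes "m > 0" shows "m * N^2 - b * N \<ge> - (b^2 / m)"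
proof -
	have "0 \<le> (m * N - b / 2)^2 + 3 * b^2 / 4" by simp
	also have "\<dots> = m * (m * N^2 - b * N + b^2 / m)" using assms by (simp add: field_simps power2_eq_square)
	finally have "0 \<le> m * N^2 - b * N + b^2 / m" using assms by (simp only: zero_le_mult_iff) auto
	then show ?thesis by linarith
qed

text \<open>The factor \<open>s\<close> will be 1 or -1, so that one lemma serves both jump
  conditions.\<close>

lemma matrix_form_lower:
	fixes k :: "R3 => real^3^3"
	assumes k: "\<And>i j. (%x. k x $ i $ j) \<in> Linfty UNIV" and supp: "\<And>x. x \<notin> D ==> k x = 0"
		and D: "D \<in> sets lebesgue" and a: "a \<in> L2"
		and low: "AE x. x \<in> D --> (\<forall>y. c * (norm y)^2 \<le> s * ((k x *v y) \<bullet> y))"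
	shows "c * (LINT x. indicator D x * (norm (a x))^2) \<le> s * (LINT x. (k x *v a x) \<bullet> a x)"
proof -
	have i: "integrable lebesgue (%x. indicator D x * (norm (a x))^2)"
		using integrable_mult_indicator[OF D L2_integrable_square[OF a]] by simp
	have "(LINT x. c * (indicator D x * (norm (a x))^2)) \<le> (LINT x. s * ((k x *v a x) \<bullet> a x))"
	proof (rule integral_mono_AE)
		show "AE x. c * (indicator D x * (norm (a x))^2) \<le> s * ((k x *v a x) \<bullet> a x)"
			using low
		proof (rule eventually_mono)
			fix x assume "x \<in> D --> (\<forall>y. c * (norm y)^2 \<le> s * ((k x *v y) \<bullet> y))"
			then show "c * (indicator D x * (norm (a x))^2) \<le> s * ((k x *v a x) \<bullet> a x)" using supp[of x] by (cases "x \<in> D") auto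
		qed
	qed (use i L2_inner_integrable[OF matrix_L2[OF k a] a] in auto)
	then show ?thesis by simp
qed

section \<open>Comparison of the indicator function with the energy in \<open>D\<close>\<close>

context two_layer
begin

context
	fixes k :: "R3 => real^3^3" and D :: "R3 set" and C T :: real and f uT :: "R3 => real" and v w :: "real => R3 => real"
		and FT :: "(R3 => real) => real" and E I s :: "real => real"
	assumes k: "\<And>i j. (%x. k x $ i $ j) \<in> Linfty UNIV" and supp: "\<And>x. x \<notin> D ==> k x = 0" and D: "D \<in> sets lebesgue"
		and sym: "AE x. \<forall>e u. (k x *v e) \<bullet> u = e \<bullet> (k x *v u)"
		and C: "C > 0" "AE x. \<forall>e. C * (norm e)^2 \<le> \<gamma>0 x * (norm e)^2 + (k x *v e) \<bullet> e"
		and f: "f \<in> L2" and v: "\<forall>n>0. elliptic_weak_solution \<gamma>0 n f (v n)" and w: "\<And>n. n > 0 ==> w n \<in> H1"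
		and uT: "uT \<in> L2" and FT: "FT \<in> H1_dual"
		and weq: "\<And>n p. n > 0 ==> p \<in> H1 ==> (LINT x. \<gamma>0 x * (weak_gradient (w n) x \<bullet> weak_gradient p x))
			+ (LINT x. (k x *v weak_gradient (w n) x) \<bullet> weak_gradient p x)
			+ n^2 * (LINT x. w n x * p x)
			= (LINT x. f x * p x) - exp (- n * T) * (FT p + n * (LINT x. uT x * p x))"
		and E_def: "E = (%n. LINT x. indicator D x * (norm (weak_gradient (v n) x))^2)"
		and I_def: "I = (%n. LINT x. f x * (w n x - v n x))"
		and s_def: "s = (%n. n^2 * exp (- 2 * n * T) + exp (- n * T) / n)"
begin

text \<open>On H^1 the term from time \<open>T\<close> has norm at most \<open>b n\<close>.
  Absorbing b N in m N^2, where \<open>N\<close> is the H^1 norm of \<open>z\<close>, leaves b^2 /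
  m, which is the first part of \<open>s\<close>; the decay of \<open>v\<close> makes its value at
  \<open>v\<close> the second part. For the upper bound, \<open>N\<close> itself is estimated by the
  third energy identity.\<close>

lemma energy_estimates:
	shows "\<exists>K>0. \<forall>n\<ge>1. \<bar>I n\<bar> \<le> K * (E n + s n)"
		and "c > 0 ==> AE x. x \<in> D --> (\<forall>e. c * (norm e)^2 \<le> - ((k x *v e) \<bullet> e)) ==>
			\<exists>c'>0. \<exists>K>0. \<forall>n\<ge>1. c' * E n - K * s n \<le> I n"
		and "c > 0 ==> AE x. x \<in> D --> (\<forall>e. c * (norm e)^2 \<le> (k x *v e) \<bullet> e) ==>
			\<exists>c'>0. \<exists>K>0. \<forall>n\<ge>1. c' * E n - K * s n \<le> - I n"
proof -
	obtain M where M: "M > 0" "AE x. \<forall>e. norm (k x *v e) \<le> M * norm e" by (rule matrix_bounded[OF k])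
	\<comment> \<open>A common coercivity constant: \<open>\<gamma>m\<close> for the form with
	  \<open>\<gamma>0\<close>, \<open>C\<close> for the perturbed form, and 1 for the zeroth order
	  term, as n^2 >= 1.\<close>
	define m where "m = min (min C \<gamma>m) 1"
	have m: "m > 0" "m \<le> C" "m \<le> \<gamma>m" "m \<le> 1" using C gamma_m_pos by (auto simp: m_def)
	define d where "d = H1_dual_norm FT + L2_norm uT"
	define P where "P = L2_norm f + L2_norm f / sqrt \<gamma>m"
	have d: "d \<ge> 0" and P: "P \<ge> 0" using H1_dual_norm_nonneg[OF FT] gamma_m_pos by (auto simp: d_def P_def)
	define \<Phi> where "\<Phi> n p = exp (- n * T) * (FT p + n * (LINT x. uT x * p x))" for n p
	define z where "z n = (%x. w n x - v n x)" for n
	define y where "y n = (%x. weak_gradient (w n) x - weak_gradient (v n) x)" for n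
	define A where "A n = (LINT x. \<gamma>0 x * (norm (y n x))^2) + n^2 * (L2_norm (z n))^2" for n
	define H where "H a b = (LINT x. (k x *v a x) \<bullet> b x)" for a b
	define X where "X n = A n + H (y n) (y n)" for n
	define N where "N n = H1_norm (z n)" for n
	define b where "b n = d * n * exp (- n * T)" for n
	have b2: "(b n)^2 = d^2 * (n^2 * exp (- 2 * n * T))" for n
	proof -
		have "(exp (- n * T))^2 = exp (- 2 * n * T)" by (simp add: power2_eq_square flip: exp_add)
		then show ?thesis by (simp add: b_def power_mult_distrib)
	qed
	have vH: "v n \<in> H1" if "n \<ge> 1" for n using v that by (simp add: elliptic_weak_solution_def)
	have wH: "w n \<in> H1" if "n \<ge> 1" for n using w that by simp
	have id: "I n = - H (weak_gradient (v n)) (weak_gradient (v n)) + X n + \<Phi> n (z n) - \<Phi> n (v n)"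
		"I n = - H (weak_gradient (w n)) (weak_gradient (w n)) - A n - \<Phi> n (z n) - \<Phi> n (v n)"
		"X n = - H (weak_gradient (v n)) (y n) - \<Phi> n (z n)" if t: "n \<ge> 1" for n
	proof -
		have tp: "n > 0" using t by simp
		note en = energy_identities[where \<Phi> = "\<Phi> n", OF k sym f v[rule_format, OF tp] wH[OF t] weq[OF tp, folded \<Phi>_def]]
		show "I n = - H (weak_gradient (v n)) (weak_gradient (v n)) + X n + \<Phi> n (z n) - \<Phi> n (v n)"
			using en(1) unfolding I_def X_def A_def H_def y_def z_def by (simp only: algebra_simps)
		show "I n = - H (weak_gradient (w n)) (weak_gradient (w n)) - A n - \<Phi> n (z n) - \<Phi> n (v n)"
			using en(2) unfolding I_def X_def A_def H_def y_def z_def by (simp only: algebra_simps)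
		show "X n = - H (weak_gradient (v n)) (y n) - \<Phi> n (z n)"
			using en(3) unfolding I_def X_def A_def H_def y_def z_def by (simp only: algebra_simps)
	qed
	have \<Phi>b: "\<bar>\<Phi> n p\<bar> \<le> exp (- n * T) * (H1_dual_norm FT * H1_norm p + n * (L2_norm uT * L2_norm p))"
		if t: "n \<ge> 1" and p: "p \<in> H1" for n p
	proof -
		have "\<bar>LINT x. uT x * p x\<bar> \<le> L2_norm uT * L2_norm p" using L2_Cauchy_Schwarz[OF uT H1_L2[OF p]] by simp
		then have "n * \<bar>LINT x. uT x * p x\<bar> \<le> n * (L2_norm uT * L2_norm p)" using t by (intro mult_left_mono) auto
		moreover have "\<bar>FT p + n * (LINT x. uT x * p x)\<bar> \<le> \<bar>FT p\<bar> + n * \<bar>LINT x. uT x * p x\<bar>"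
			using abs_triangle_ineq[of "FT p" "n * (LINT x. uT x * p x)"] t by (simp add: abs_mult)
		ultimately have "\<bar>FT p + n * (LINT x. uT x * p x)\<bar> \<le> H1_dual_norm FT * H1_norm p + n * (L2_norm uT * L2_norm p)"
			using H1_dual_bound[OF FT p] by linarith
		then show ?thesis unfolding \<Phi>_def abs_mult by simp
	qed
	have \<Phi>z: "\<bar>\<Phi> n p\<bar> \<le> b n * H1_norm p" if t: "n \<ge> 1" and p: "p \<in> H1" for n p
	proof -
		have "H1_dual_norm FT * H1_norm p \<le> n * (H1_dual_norm FT * H1_norm p)"
			using t H1_dual_norm_nonneg[OF FT] mult_right_mono[of 1 n "H1_dual_norm FT * H1_norm p"] by simp
		moreover have "n * (L2_norm uT * L2_norm p) \<le> n * (L2_norm uT * H1_norm p)"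
			using t by (intro mult_left_mono L2_norm_le_H1_norm) auto
		ultimately have "H1_dual_norm FT * H1_norm p + n * (L2_norm uT * L2_norm p) \<le> d * n * H1_norm p"
			unfolding d_def by (simp add: algebra_simps)
		then have "exp (- n * T) * (H1_dual_norm FT * H1_norm p + n * (L2_norm uT * L2_norm p)) \<le> exp (- n * T) * (d * n * H1_norm p)"
			by (rule mult_left_mono) simp
		also have "\<dots> = b n * H1_norm p" by (simp add: b_def)
		finally show ?thesis using \<Phi>b[OF t p] by linarith
	qed
	have \<Phi>v: "\<bar>\<Phi> n (v n)\<bar> \<le> d * P * (exp (- n * T) / n)" if t: "n \<ge> 1" for n
	proof -
		have tp: "n > 0" using t by simp
		note dec = elliptic_decay[OF v[rule_format, OF tp] f tp]
		have "n \<le> n^2" using t by (simp add: power2_eq_square)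
		then have "L2_norm f / n^2 \<le> L2_norm f / n" using tp by (intro divide_left_mono) auto
		moreover have "H1_norm (v n) \<le> L2_norm (v n) + L2_norm (weak_gradient (v n))"
			unfolding H1_norm_def by (rule sqrt_sum_squares_le_sum) auto
		moreover have "L2_norm f / (sqrt \<gamma>m * n) = L2_norm f / sqrt \<gamma>m / n" by simp
		ultimately have h: "H1_norm (v n) \<le> P / n" using dec by (simp add: P_def add_divide_distrib)
		have "n * L2_norm (v n) \<le> n * (L2_norm f / n^2)" using dec(1) tp by (intro mult_left_mono) auto
		also have "\<dots> = L2_norm f / n" using tp by (simp add: power2_eq_square)
		also have "\<dots> \<le> P / n" using tp gamma_m_pos by (intro divide_right_mono) (auto simp: P_def)
		finally have l: "n * L2_norm (v n) \<le> P / n" .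
		have "H1_dual_norm FT * H1_norm (v n) \<le> H1_dual_norm FT * (P / n)" using h H1_dual_norm_nonneg[OF FT] by (rule mult_left_mono)
		moreover have "L2_norm uT * (n * L2_norm (v n)) \<le> L2_norm uT * (P / n)" using l by (rule mult_left_mono) simp
		ultimately have "H1_dual_norm FT * H1_norm (v n) + n * (L2_norm uT * L2_norm (v n)) \<le> d * (P / n)"
			unfolding d_def distrib_right by (simp only: mult.left_commute)
		then have "exp (- n * T) * (H1_dual_norm FT * H1_norm (v n) + n * (L2_norm uT * L2_norm (v n))) \<le> exp (- n * T) * (d * (P / n))"
			by (rule mult_left_mono) simp
		also have "\<dots> = d * P * (exp (- n * T) / n)" by simp
		finally show ?thesis using \<Phi>b[OF t vH[OF t]] by linarith
	qed
	have zH: "z n \<in> H1" and zg: "is_weak_gradient (z n) (y n)" if t: "n \<ge> 1" for n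
		unfolding z_def y_def by (rule H1_diff(1)[OF wH[OF t] vH[OF t]], rule H1_diff(2)[OF wH[OF t] vH[OF t]])
	have N2: "(N n)^2 = (L2_norm (z n))^2 + (L2_norm (y n))^2" if t: "n \<ge> 1" for n
		unfolding N_def H1_norm_eq[OF H1_L2[OF zH[OF t]] zg[OF t]] by simp
	have N0: "N n \<ge> 0" for n by (simp add: N_def)
	have \<zeta>L: "y n \<in> L2" if t: "n \<ge> 1" for n by (rule weak_gradient_L2[OF zg[OF t]])
	have gL: "weak_gradient (v n) \<in> L2" and pL: "weak_gradient (w n) \<in> L2" if t: "n \<ge> 1" for n
		by (rule H1_gradient_L2[OF vH[OF t]], rule H1_gradient_L2[OF wH[OF t]])
	have coer: "m * (N n)^2 \<le> r * (L2_norm (y n))^2 + n^2 * (L2_norm (z n))^2" if t: "n \<ge> 1" and r: "m \<le> r" for n r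
	proof -
		have "1 \<le> n^2" using t by simp
		then have "m * (L2_norm (z n))^2 \<le> n^2 * (L2_norm (z n))^2" using m(4) by (intro mult_right_mono) auto
		moreover have "m * (L2_norm (y n))^2 \<le> r * (L2_norm (y n))^2" using r by (intro mult_right_mono) auto
		ultimately show ?thesis unfolding N2[OF t] by (simp add: distrib_left)
	qed
	have \<gamma>i: "integrable lebesgue (%x. \<gamma>0 x * (norm (y n x))^2)" if t: "n \<ge> 1" for n
		using gamma0_inner_integrable[OF \<zeta>L[OF t] \<zeta>L[OF t]] by (simp only: power2_norm_eq_inner)
	have mA: "m * (N n)^2 \<le> A n" if t: "n \<ge> 1" for n
	proof -
		have "\<gamma>m * (L2_norm (y n))^2 = (LINT x. \<gamma>m * (norm (y n x))^2)" by (simp add: L2_norm_power2)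
		also have "\<dots> \<le> (LINT x. \<gamma>0 x * (norm (y n x))^2)"
			using \<gamma>i[OF t] L2_integrable_square[OF \<zeta>L[OF t]] by (intro integral_mono) (auto intro!: mult_right_mono gamma0_bounds)
		finally show ?thesis using coer[OF t m(3)] by (simp add: A_def)
	qed
	have mX: "m * (N n)^2 \<le> X n" if t: "n \<ge> 1" for n
	proof -
		have ki: "integrable lebesgue (%x. (k x *v y n x) \<bullet> y n x)"
			by (rule L2_inner_integrable[OF matrix_L2[OF k \<zeta>L[OF t]] \<zeta>L[OF t]])
		have "C * (L2_norm (y n))^2 = (LINT x. C * (norm (y n x))^2)" by (simp add: L2_norm_power2)
		also have "\<dots> \<le> (LINT x. \<gamma>0 x * (norm (y n x))^2 + (k x *v y n x) \<bullet> y n x)"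
		proof (rule integral_mono_AE)
			show "integrable lebesgue (%x. C * (norm (y n x))^2)" using L2_integrable_square[OF \<zeta>L[OF t]] by simp
			show "integrable lebesgue (%x. \<gamma>0 x * (norm (y n x))^2 + (k x *v y n x) \<bullet> y n x)"
				by (rule Bochner_Integration.integrable_add[OF \<gamma>i[OF t] ki])
			show "AE x. C * (norm (y n x))^2 \<le> \<gamma>0 x * (norm (y n x))^2 + (k x *v y n x) \<bullet> y n x"
				using C(2) by (rule eventually_mono) simp
		qed
		also have "\<dots> = (LINT x. \<gamma>0 x * (norm (y n x))^2) + H (y n) (y n)"
			unfolding H_def by (rule Bochner_Integration.integral_add[OF \<gamma>i[OF t] ki])
		finally show ?thesis using coer[OF t m(2)] by (simp add: X_def A_def)
	qed
	have E0: "E n \<ge> 0" for n unfolding E_def by (intro Bochner_Integration.integral_nonneg) simp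
	have sE: "L2_norm (%x. indicator D x *\<^sub>R weak_gradient (v n) x) = sqrt (E n)" if t: "n \<ge> 1" for n
		unfolding E_def L2_indicator(2)[OF gL[OF t] D, symmetric] by simp
	have Hg: "\<bar>H (weak_gradient (v n)) (weak_gradient (v n))\<bar> \<le> M * E n" if t: "n \<ge> 1" for n
		using matrix_form_bound[OF k supp less_imp_le[OF M(1)] M(2) D gL[OF t] gL[OF t]] E0[of n]
		unfolding sE[OF t] H_def by (simp add: mult.assoc)
	have Xb: "X n \<le> (M * sqrt (E n) + b n) * N n" if t: "n \<ge> 1" for n
	proof -
		have "\<bar>H (weak_gradient (v n)) (y n)\<bar> \<le> M * sqrt (E n) * L2_norm (%x. indicator D x *\<^sub>R y n x)"
			using matrix_form_bound[OF k supp less_imp_le[OF M(1)] M(2) D gL[OF t] \<zeta>L[OF t]]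
			unfolding sE[OF t] H_def .
		also have "\<dots> \<le> M * sqrt (E n) * N n"
		proof (rule mult_left_mono)
			have "L2_norm (y n) \<le> N n" by (rule power2_le_imp_le) (simp_all add: N2[OF t] N0)
			then show "L2_norm (%x. indicator D x *\<^sub>R y n x) \<le> N n" using L2_indicator(3)[OF \<zeta>L[OF t] D] by linarith
			show "0 \<le> M * sqrt (E n)" using M(1) E0 by simp
		qed
		finally have "\<bar>H (weak_gradient (v n)) (y n)\<bar> \<le> M * sqrt (E n) * N n" .
		then show ?thesis using id(3)[OF t] \<Phi>z[OF t zH[OF t]] unfolding distrib_right N_def by linarith
	qed
	have s1: "K1 * (n^2 * exp (- 2 * n * T)) + K2 * (exp (- n * T) / n) \<le> (K1 + K2) * s n" if "n \<ge> 1" "K1 \<ge> 0" "K2 \<ge> 0" for n K1 K2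
	proof -
		have "0 \<le> K1 * (exp (- n * T) / n)" "0 \<le> K2 * (n^2 * exp (- 2 * n * T))" using that by auto
		then show ?thesis unfolding s_def by (simp only: distrib_left distrib_right)
	qed
	have s0: "s n \<ge> 0" if "n \<ge> 1" for n using that by (simp add: s_def)
	show "\<exists>K>0. \<forall>n\<ge>1. \<bar>I n\<bar> \<le> K * (E n + s n)"
	proof (intro exI conjI allI impI)
		let ?KE = "M + 4 * M^2 / m" and ?KS = "4 * d^2 / m + d * P"
		show "?KE + ?KS > 0" using M(1) m(1) d P by (intro add_pos_nonneg) auto
		fix n :: real assume t: "n \<ge> 1"
		define q where "q = M * sqrt (E n) + b n"
		have b0: "b n \<ge> 0" using d t by (simp add: b_def)
		then have q0: "q \<ge> 0" "b n \<le> q" using M(1) E0[of n] by (auto simp: q_def)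
		have "m * (N n)^2 \<le> q * N n" using mX[OF t] Xb[OF t] by (simp add: q_def)
		then have "(m * N n) * N n \<le> q * N n" by (simp add: power2_eq_square)
		then have "m * N n \<le> q" by (cases "N n = 0") (use N0[of n] q0 in \<open>auto simp: less_le\<close>)
		then have Nq: "N n \<le> q / m" using m(1) by (simp add: pos_le_divide_eq mult.commute)
		have "q * N n \<le> q * (q / m)" using Nq q0 by (intro mult_left_mono) auto
		then have 1: "q * N n \<le> q^2 / m" by (simp add: power2_eq_square)
		have 2: "b n * N n \<le> q * N n" using q0 N0 by (intro mult_right_mono) auto
		have 3: "q^2 \<le> 2 * (M^2 * E n) + 2 * (b n)^2"
		proof -
			have "0 \<le> (M * sqrt (E n) - b n)^2" by simp
			moreover have "(M * sqrt (E n))^2 = M^2 * E n" using E0[of n] by (simp add: power_mult_distrib)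
			ultimately show ?thesis unfolding q_def power2_sum power2_diff by linarith
		qed
		have "q^2 / m \<le> (2 * (M^2 * E n) + 2 * (b n)^2) / m" using 3 m(1) by (intro divide_right_mono) auto
		then have 4: "2 * (q^2 / m) \<le> 4 * M^2 / m * E n + 4 * d^2 / m * (n^2 * exp (- 2 * n * T))"
			unfolding b2 by (simp add: add_divide_distrib)
		have X0: "0 \<le> X n" using mX[OF t] m(1) by (meson order_trans mult_nonneg_nonneg less_imp_le zero_le_power2)
		have "\<bar>I n\<bar> \<le> M * E n + X n + b n * N n + d * P * (exp (- n * T) / n)"
			using id(1)[OF t] Hg[OF t] \<Phi>z[OF t zH[OF t]] \<Phi>v[OF t] X0 unfolding N_def by linarith
		also have "\<dots> \<le> M * E n + 2 * (q^2 / m) + d * P * (exp (- n * T) / n)"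
			using Xb[OF t, folded q_def] 1 2 by linarith
		also have "\<dots> \<le> ?KE * E n + (4 * d^2 / m * (n^2 * exp (- 2 * n * T)) + d * P * (exp (- n * T) / n))"
			using 4 by (simp add: distrib_right)
		also have "\<dots> \<le> ?KE * E n + ?KS * s n"
			using s1[OF t, of "4 * d^2 / m" "d * P"] m(1) d P by simp
		also have "\<dots> \<le> (?KE + ?KS) * (E n + s n)"
		proof -
			have "0 \<le> ?KE * s n" "0 \<le> ?KS * E n" using M(1) m(1) d P s0[OF t] E0[of n] by auto
			then show ?thesis by (simp only: distrib_left distrib_right)
		qed
		finally show "\<bar>I n\<bar> \<le> (?KE + ?KS) * (E n + s n)" .
	qed
	\<comment> \<open>The common end of both lower bounds: the square of \<open>N n\<close> absorbs the
	  linear term.\<close>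
	have low: "\<exists>c'>0. \<exists>K>0. \<forall>n\<ge>1. c' * E n - K * s n \<le> J n"
		if c': "c' > 0" and g: "g > 0" and J: "\<And>n. n \<ge> 1 ==> c' * E n + g * (N n)^2 - b n * N n - \<bar>\<Phi> n (v n)\<bar> \<le> J n" for c' g J
	proof (intro exI conjI allI impI)
		show "c' > 0" by (rule c')
		show "d^2 / g + d * P + 1 > 0" using g d P by (intro add_nonneg_pos) auto
		fix n :: real assume t: "n \<ge> 1"
		have "(b n)^2 / g = d^2 / g * (n^2 * exp (- 2 * n * T))" unfolding b2 by simp
		then have "- (d^2 / g * (n^2 * exp (- 2 * n * T))) \<le> g * (N n)^2 - b n * N n"
			using quadratic_bound[OF g, of "b n" "N n"] by linarith
		moreover have "d^2 / g * (n^2 * exp (- 2 * n * T)) + d * P * (exp (- n * T) / n) \<le> (d^2 / g + d * P) * s n"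
			using s1[OF t, of "d^2 / g" "d * P"] g d P by simp
		moreover have "(d^2 / g + d * P) * s n \<le> (d^2 / g + d * P + 1) * s n" using s0[OF t] by (simp add: distrib_right)
		ultimately show "c' * E n - (d^2 / g + d * P + 1) * s n \<le> J n" using J[OF t] \<Phi>v[OF t] by linarith
	qed
	show "\<exists>c'>0. \<exists>K>0. \<forall>n\<ge>1. c' * E n - K * s n \<le> I n"
		if c: "c > 0" and neg: "AE x. x \<in> D --> (\<forall>e. c * (norm e)^2 \<le> - ((k x *v e) \<bullet> e))"
	proof (rule low[OF c m(1)])
		fix n :: real assume t: "n \<ge> 1"
		have "c * E n \<le> - H (weak_gradient (v n)) (weak_gradient (v n))"
			using matrix_form_lower[OF k supp D gL[OF t], of c "-1"] neg by (simp add: E_def H_def)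
		then show "c * E n + m * (N n)^2 - b n * N n - \<bar>\<Phi> n (v n)\<bar> \<le> I n"
			using id(1)[OF t] mX[OF t] \<Phi>z[OF t zH[OF t]] unfolding N_def by linarith
	qed
	show "\<exists>c'>0. \<exists>K>0. \<forall>n\<ge>1. c' * E n - K * s n \<le> - I n"
		if c: "c > 0" and pos: "AE x. x \<in> D --> (\<forall>e. c * (norm e)^2 \<le> (k x *v e) \<bullet> e)"
	proof -
		\<comment> \<open>The second identity bounds the gradient of \<open>w\<close> instead of that of
		  \<open>v\<close>. Passing to \<open>v\<close> costs a multiple of the squared norm of
		  \<open>z\<close>, and \<open>c1\<close> is so small that half of the coercivity remains.\<close>
		define c1 where "c1 = min c (m / 2)"
		have c1: "c1 > 0" "c1 \<le> c" "c1 \<le> m / 2" using c m(1) by (auto simp: c1_def)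
		show ?thesis
		proof (rule low[of "c1 / 2" "m / 2"])
			fix n :: real assume t: "n \<ge> 1"
			define Q where "Q = (LINT x. indicator D x * (norm (weak_gradient (w n) x))^2)"
			have i: "integrable lebesgue (%x. indicator D x * (norm (a x))^2)" if "a \<in> L2" for a :: "R3 => R3"
				using integrable_mult_indicator[OF D L2_integrable_square[OF that]] by simp
			have "E n \<le> (LINT x. 2 * (indicator D x * (norm (weak_gradient (w n) x))^2) + 2 * (norm (y n x))^2)"
				unfolding E_def
			proof (rule integral_mono)
				fix x
				have "norm (weak_gradient (v n) x) \<le> norm (weak_gradient (w n) x) + norm (y n x)"
					unfolding y_def by (metis norm_minus_commute norm_triangle_sub)
				then have "(norm (weak_gradient (v n) x))^2 \<le> (norm (weak_gradient (w n) x) + norm (y n x))^2" by (rule power_mono) simp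
				also have "\<dots> \<le> 2 * (norm (weak_gradient (w n) x))^2 + 2 * (norm (y n x))^2"
					unfolding power2_sum using sum_squares_bound[of "norm (weak_gradient (w n) x)" "norm (y n x)"] by linarith
				finally show "indicator D x * (norm (weak_gradient (v n) x))^2 \<le> 2 * (indicator D x * (norm (weak_gradient (w n) x))^2) + 2 * (norm (y n x))^2"
					by (auto simp: indicator_def)
			qed (use i[OF gL[OF t]] i[OF pL[OF t]] L2_integrable_square[OF \<zeta>L[OF t]] in simp_all)
			also have "\<dots> = 2 * Q + 2 * (L2_norm (y n))^2"
				using i[OF pL[OF t]] L2_integrable_square[OF \<zeta>L[OF t]] by (simp add: Q_def L2_norm_power2)
			also have "\<dots> \<le> 2 * Q + 2 * (N n)^2" unfolding N2[OF t] by simp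
			finally have "E n / 2 \<le> Q + (N n)^2" by simp
			then have "c1 * (E n / 2) \<le> c1 * (Q + (N n)^2)" using c1(1) by (intro mult_left_mono) auto
			moreover have "c1 * (N n)^2 \<le> m / 2 * (N n)^2" using c1(3) by (rule mult_right_mono) simp
			moreover have "c1 * Q \<le> c * Q" using c1(2) unfolding Q_def by (intro mult_right_mono Bochner_Integration.integral_nonneg) auto
			moreover have "c * Q \<le> H (weak_gradient (w n)) (weak_gradient (w n))"
				using matrix_form_lower[OF k supp D pL[OF t], of c 1] pos by (simp add: Q_def H_def)
			ultimately have "c1 / 2 * E n \<le> H (weak_gradient (w n)) (weak_gradient (w n)) + m / 2 * (N n)^2"
				unfolding distrib_left by linarith
			then show "c1 / 2 * E n + m / 2 * (N n)^2 - b n * N n - \<bar>\<Phi> n (v n)\<bar> \<le> - I n"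
				using id(2)[OF t] mA[OF t] \<Phi>z[OF t zH[OF t]] unfolding N_def by linarith
		qed (use c1 m in auto)
	qed
qed

end

end

section \<open>Asymptotics of the indicator function\<close>

context
	fixes E I s :: "real => real" and l T :: real
	assumes T: "T > 0" and l: "l \<ge> 0"
		and up: "\<And>d. d > 0 ==> \<exists>C>0. \<forall>j\<ge>1. E j \<le> C * exp (- 2 * j * (l - d))"
		and lo: "\<And>d. d > 0 ==> \<exists>C>0. \<exists>\<tau>0. \<forall>j\<ge>\<tau>0. C * exp (- 2 * j * (l + d)) \<le> E j"
		and Iup: "\<exists>K>0. \<forall>j\<ge>1. \<bar>I j\<bar> \<le> K * (E j + s j)"
		and s_def: "s = (%j. j^2 * exp (- 2 * j * T) + exp (- j * T) / j)"
begin

lemma remainder_limit: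
	assumes "2 * p \<le> T"
	shows "((%j. exp (2 * j * p) * s j) \<longlongrightarrow> 0) at_top"
proof -
	define h where "h = 2 * (T - p)"
	have h: "h > 0" using assms T by (simp add: h_def)
	have "((%j. j^2 * exp (- h * j) + inverse j) \<longlongrightarrow> 0) at_top" using h by real_asymp
	then show ?thesis
	proof (rule Lim_null_comparison[rotated])
		show "\<forall>\<^sub>F j in at_top. norm (exp (2 * j * p) * s j) \<le> j^2 * exp (- h * j) + inverse j"
			using eventually_gt_at_top[of 0]
		proof (rule eventually_mono)
			fix j :: real assume t: "j > 0"
			have 1: "exp (2 * j * p) * exp (- 2 * j * T) = exp (- h * j)" unfolding exp_add[symmetric] h_def by (simp add: algebra_simps)
			have 2: "exp (2 * j * p) * exp (- j * T) \<le> 1"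
			proof -
				have "j * (2 * p) \<le> j * T" using assms t by (intro mult_left_mono) auto
				then show ?thesis unfolding exp_add[symmetric] by (simp add: algebra_simps)
			qed
			have "exp (2 * j * p) * s j = j^2 * (exp (2 * j * p) * exp (- 2 * j * T)) + exp (2 * j * p) * exp (- j * T) * inverse j"
				unfolding s_def by (simp add: algebra_simps divide_inverse)
			also have "\<dots> \<le> j^2 * exp (- h * j) + 1 * inverse j"
				unfolding 1 using 2 t by (intro add_left_mono mult_right_mono) auto
			finally have "exp (2 * j * p) * s j \<le> j^2 * exp (- h * j) + inverse j" by simp
			moreover have "exp (2 * j * p) * s j \<ge> 0" using t by (simp add: s_def)
			ultimately show "norm (exp (2 * j * p) * s j) \<le> j^2 * exp (- h * j) + inverse j" by simp
		qed
	qed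
qed

lemma remainder_small:
	assumes "2 * p \<le> T" "n > 0"
	shows "\<forall>\<^sub>F j in at_top. s j \<le> n * exp (- 2 * j * p)"
proof -
	have "\<forall>\<^sub>F j in at_top. exp (2 * j * p) * s j < n" using remainder_limit[OF assms(1)] assms(2) by (rule order_tendstoD)
	then show ?thesis
	proof (rule eventually_mono)
		fix j assume "exp (2 * j * p) * s j < n"
		then have "exp (- 2 * j * p) * (exp (2 * j * p) * s j) \<le> exp (- 2 * j * p) * n" by (intro mult_left_mono) auto
		moreover have "exp (- 2 * j * p) * (exp (2 * j * p) * s j) = s j"
		proof -
			have "exp (- 2 * j * p) * exp (2 * j * p) = 1" unfolding exp_add[symmetric] by simp
			then show ?thesis by (simp only: mult.assoc[symmetric] mult_1_left)
		qed
		ultimately show "s j \<le> n * exp (- 2 * j * p)" using mult.commute[of n "exp (- 2 * j * p)"] by linarith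
	qed
qed

lemma upper_asymptotics:
	assumes "2 * (l - d) \<le> T" "d > 0"
	shows "\<exists>B>0. \<forall>\<^sub>F j in at_top. \<bar>I j\<bar> \<le> B * exp (- 2 * j * (l - d))"
proof -
	obtain K where K: "K > 0" "\<And>j. j \<ge> 1 ==> \<bar>I j\<bar> \<le> K * (E j + s j)" using Iup by blast
	obtain C where C: "C > 0" "\<And>j. j \<ge> 1 ==> E j \<le> C * exp (- 2 * j * (l - d))" using up[OF assms(2)] by blast
	have "\<forall>\<^sub>F j in at_top. \<bar>I j\<bar> \<le> K * (C + 1) * exp (- 2 * j * (l - d))"
		using remainder_small[OF assms(1) zero_less_one] eventually_ge_at_top[of 1]
	proof eventually_elim
		case (elim j)
		have "K * (E j + s j) \<le> K * (C * exp (- 2 * j * (l - d)) + 1 * exp (- 2 * j * (l - d)))"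
			using K(1) C(2)[OF elim(2)] elim(1) by (intro mult_left_mono add_mono) auto
		then show ?case using K(2)[OF elim(2)] by (simp only: distrib_right[symmetric] mult.assoc)
	qed
	then show ?thesis using K(1) C(1) by (intro exI[of _ "K * (C + 1)"]) simp
qed

lemma indicator_vanishes:
	assumes "T < 2 * l" shows "((%j. exp (j * T) * I j) \<longlongrightarrow> 0) at_top"
proof -
	obtain K where K: "K > 0" "\<And>j. j \<ge> 1 ==> \<bar>I j\<bar> \<le> K * (E j + s j)" using Iup by blast
	\<comment> \<open>With this \<open>d\<close> the exponent 2 (l - d) - T equals
	  \<open>h\<close>.\<close>
	define d h where "d = (2 * l - T) / 4" and "h = (2 * l - T) / 2"
	have d: "d > 0" "h > 0" using assms by (auto simp: d_def h_def)
	obtain C where C: "C > 0" "\<And>j. j \<ge> 1 ==> E j \<le> C * exp (- 2 * j * (l - d))" using up[OF d(1)] by blast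
	have "((%j. exp (- h * j)) \<longlongrightarrow> 0) at_top" using d(2) by real_asymp
	from tendsto_add[OF tendsto_mult_right_zero[OF this, of "K * C"] tendsto_mult_right_zero[OF remainder_limit[of "T / 2"], of K]]
	have "((%j. K * C * exp (- h * j) + K * (exp (2 * j * (T / 2)) * s j)) \<longlongrightarrow> 0) at_top" by simp
	then show ?thesis
	proof (rule Lim_null_comparison[rotated])
		show "\<forall>\<^sub>F j in at_top. norm (exp (j * T) * I j) \<le> K * C * exp (- h * j) + K * (exp (2 * j * (T / 2)) * s j)"
			using eventually_ge_at_top[of 1]
		proof (rule eventually_mono)
			fix j :: real assume t: "j \<ge> 1"
			have e: "exp (j * T) * exp (- 2 * j * (l - d)) = exp (- h * j)"
				unfolding exp_add[symmetric] h_def d_def by (simp add: field_simps)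
			have "K * (E j + s j) \<le> K * (C * exp (- 2 * j * (l - d)) + s j)" using K(1) C(2)[OF t] by (intro mult_left_mono) auto
			then have "\<bar>I j\<bar> \<le> K * (C * exp (- 2 * j * (l - d)) + s j)" using K(2)[OF t] by linarith
			then have "exp (j * T) * \<bar>I j\<bar> \<le> exp (j * T) * (K * (C * exp (- 2 * j * (l - d)) + s j))" by (rule mult_left_mono) simp
			also have "\<dots> = K * C * (exp (j * T) * exp (- 2 * j * (l - d))) + K * (exp (j * T) * s j)" by (simp only: algebra_simps)
			finally show "norm (exp (j * T) * I j) \<le> K * C * exp (- h * j) + K * (exp (2 * j * (T / 2)) * s j)"
				unfolding e by (simp add: abs_mult)
		qed
	qed
qed

context
	fixes J :: "real => real"
	assumes T2: "T > 2 * l" and J: "\<exists>c>0. \<exists>K>0. \<forall>j\<ge>1. c * E j - K * s j \<le> J j"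
begin

text \<open>\<open>J\<close> will be the indicator function or its negative, according to the sign
  of the jump. The condition on \<open>d\<close> makes the remainder small compared with the lower
  bound for \<open>E\<close>.\<close>

lemma lower_asymptotics:
	assumes "2 * (l + d) \<le> T" "d > 0"
	shows "\<exists>b>0. \<forall>\<^sub>F j in at_top. b * exp (- 2 * j * (l + d)) \<le> J j"
proof -
	obtain c K where cK: "c > 0" "K > 0" "\<And>j. j \<ge> 1 ==> c * E j - K * s j \<le> J j" using J by blast
	obtain C \<tau>0 where C: "C > 0" "\<And>j. j \<ge> \<tau>0 ==> C * exp (- 2 * j * (l + d)) \<le> E j" using lo[OF assms(2)] by blast
	\<comment> \<open>With this \<open>n\<close> the remainder takes at most half of the lower bound
	  for \<open>c * E j\<close>.\<close>
	define n where "n = c * C / (2 * K)"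
	have n: "n > 0" using cK C by (simp add: n_def)
	have "\<forall>\<^sub>F j in at_top. c * C / 2 * exp (- 2 * j * (l + d)) \<le> J j"
		using remainder_small[OF assms(1) n] eventually_ge_at_top[of 1] eventually_ge_at_top[of \<tau>0]
	proof eventually_elim
		case (elim j)
		have "K * s j \<le> K * (n * exp (- 2 * j * (l + d)))" using cK(2) elim(1) by (intro mult_left_mono) auto
		also have "\<dots> = c * C / 2 * exp (- 2 * j * (l + d))" using cK(2) by (simp add: n_def)
		finally have "K * s j \<le> c * C / 2 * exp (- 2 * j * (l + d))" .
		moreover have "c * (C * exp (- 2 * j * (l + d))) \<le> c * E j" using C(2)[OF elim(3)] cK(1) by (intro mult_left_mono) auto
		moreover have "c * (C * exp (- 2 * j * (l + d))) = c * C / 2 * exp (- 2 * j * (l + d)) + c * C / 2 * exp (- 2 * j * (l + d))" by simp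
		ultimately show ?case using cK(3)[OF elim(2)] by linarith
	qed
	then show ?thesis using cK(1) C(1) by (intro exI[of _ "c * C / 2"]) simp
qed

lemma indicator_diverges: "filterlim (%j. exp (j * T) * J j) at_top at_top"
proof -
	\<comment> \<open>With this \<open>d\<close> the exponent T - 2 (l + d) equals
	  \<open>h\<close>.\<close>
	define d h where "d = (T - 2 * l) / 4" and "h = (T - 2 * l) / 2"
	have d: "d > 0" "h > 0" "2 * (l + d) \<le> T" using T2 by (auto simp: d_def h_def field_simps)
	obtain b where b: "b > 0" "\<forall>\<^sub>F j in at_top. b * exp (- 2 * j * (l + d)) \<le> J j" using lower_asymptotics[OF d(3,1)] by blast
	have "filterlim (%j. b * exp (h * j)) at_top at_top" using b(1) d(2) by real_asymp
	then show ?thesis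
	proof (rule filterlim_at_top_mono)
		show "\<forall>\<^sub>F j in at_top. b * exp (h * j) \<le> exp (j * T) * J j"
			using b(2)
		proof (rule eventually_mono)
			fix j assume "b * exp (- 2 * j * (l + d)) \<le> J j"
			then have "exp (j * T) * (b * exp (- 2 * j * (l + d))) \<le> exp (j * T) * J j" by (rule mult_left_mono) simp
			moreover have "exp (j * T) * exp (- 2 * j * (l + d)) = exp (h * j)"
				unfolding exp_add[symmetric] h_def d_def by (simp add: field_simps)
			ultimately show "b * exp (h * j) \<le> exp (j * T) * J j" by (simp only: mult.left_commute)
		qed
	qed
qed

text \<open>After division by \<open>j\<close> the constants in front of the exponentials contribute
  only ln b / j, which tends to 0. Each half takes a margin \<open>d\<close> small compared with the
  distance of \<open>a\<close> from the limit.\<close>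

lemma indicator_logarithm:
	assumes IJ: "\<And>j. J j \<le> \<bar>I j\<bar>"
	shows "((%j. 1 / j * ln \<bar>I j\<bar>) \<longlongrightarrow> - 2 * l) at_top"
proof -
	have ln0: "((%j. ln b / j + r) \<longlongrightarrow> r) at_top" for b r :: real by real_asymp
	have low: "\<forall>\<^sub>F j in at_top. \<bar>I j\<bar> > 0 \<and> ln b / j + (- 2 * (l + d)) \<le> 1 / j * ln \<bar>I j\<bar>"
		if b: "b > 0" "\<forall>\<^sub>F j in at_top. b * exp (- 2 * j * (l + d)) \<le> J j" for b d
		using b(2) eventually_gt_at_top[of 0]
	proof eventually_elim
		case (elim j)
		have pos: "b * exp (- 2 * j * (l + d)) > 0" using b(1) by simp
		have ge: "b * exp (- 2 * j * (l + d)) \<le> \<bar>I j\<bar>" using elim(1) IJ[of j] by linarith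
		then have p: "\<bar>I j\<bar> > 0" using pos by linarith
		have "ln b + - 2 * j * (l + d) = ln (b * exp (- 2 * j * (l + d)))" using b(1) by (subst ln_mult) auto
		also have "\<dots> \<le> ln \<bar>I j\<bar>" using ge pos p by (subst ln_le_cancel_iff) auto
		finally have "(ln b + - 2 * j * (l + d)) / j \<le> ln \<bar>I j\<bar> / j" using elim(2) by (intro divide_right_mono) auto
		moreover have "(ln b + - 2 * j * (l + d)) / j = ln b / j + (- 2 * (l + d))" using elim(2) by (simp add: field_simps)
		ultimately show ?case using p by simp
	qed
	show ?thesis
	proof (rule order_tendstoI)
		fix a assume a: "a < - 2 * l"
		define d where "d = min ((- 2 * l - a) / 4) ((T - 2 * l) / 4)"
		have d: "d > 0" "d \<le> (- 2 * l - a) / 4" "d \<le> (T - 2 * l) / 4"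
			using a T2 unfolding d_def by (simp_all only: min.cobounded1 min.cobounded2 min_less_iff_conj) auto
		then have e: "2 * (l + d) \<le> T" "a < - 2 * (l + d)" using T2 a by (auto simp: field_simps)
		obtain b where b: "b > 0" "\<forall>\<^sub>F j in at_top. b * exp (- 2 * j * (l + d)) \<le> J j" using lower_asymptotics[OF e(1) d(1)] by blast
		have "\<forall>\<^sub>F j in at_top. a < ln b / j + (- 2 * (l + d))" using ln0 e(2) by (rule order_tendstoD)
		then show "\<forall>\<^sub>F j in at_top. a < 1 / j * ln \<bar>I j\<bar>" using low[OF b] by eventually_elim linarith
	next
		fix a assume a: "- 2 * l < a"
		define d where "d = (a + 2 * l) / 4"
		have d: "d > 0" "- 2 * (l - d) < a" "2 * (l - d) \<le> T" using a T2 by (auto simp: d_def field_simps)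
		\<comment> \<open>Monotonicity of \<open>ln\<close> requires |I j| > 0 in the upper estimate as
		  well; the lower bound with this fixed margin provides it.\<close>
		define \<epsilon>' where "\<epsilon>' = (T - 2 * l) / 4"
		have e': "2 * (l + \<epsilon>') \<le> T" "\<epsilon>' > 0" using T2 by (auto simp: \<epsilon>'_def field_simps)
		obtain b where b: "b > 0" "\<forall>\<^sub>F j in at_top. b * exp (- 2 * j * (l + \<epsilon>')) \<le> J j" using lower_asymptotics[OF e'] by blast
		obtain B where B: "B > 0" "\<forall>\<^sub>F j in at_top. \<bar>I j\<bar> \<le> B * exp (- 2 * j * (l - d))" using upper_asymptotics[OF d(3,1)] by blast
		have "\<forall>\<^sub>F j in at_top. ln B / j + (- 2 * (l - d)) < a" using ln0 d(2) by (rule order_tendstoD)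
		then show "\<forall>\<^sub>F j in at_top. 1 / j * ln \<bar>I j\<bar> < a"
			using low[OF b] B(2) eventually_gt_at_top[of 0]
		proof eventually_elim
			case (elim j)
			have "ln \<bar>I j\<bar> \<le> ln (B * exp (- 2 * j * (l - d)))" using elim B(1) by (subst ln_le_cancel_iff) auto
			also have "\<dots> = ln B + - 2 * j * (l - d)" using B(1) by (subst ln_mult) auto
			finally have "ln \<bar>I j\<bar> / j \<le> (ln B + - 2 * j * (l - d)) / j" using elim by (intro divide_right_mono) auto
			moreover have "(ln B + - 2 * j * (l - d)) / j = ln B / j + (- 2 * (l - d))" using elim by (simp add: field_simps)
			ultimately show ?case using elim(1) by simp
		qed
	qed
qed

end

end

section \<open>The sign of the source, the perturbation of the coefficient, and the
  conclusion\<close>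

lemma ess_inf_pos_bound:
	assumes pos: "ess_inf M g > 0" and g: "g \<in> borel_measurable M"
	obtains c where "c > 0" "AE x in M. c \<le> g x"
proof -
	have "esssup M (%x. - ereal (g x)) < 0" using pos by (simp add: ess_inf_def ereal_uminus_less_reorder)
	then obtain r where r: "esssup M (%x. - ereal (g x)) < ereal r" "ereal r < 0" using ereal_dense2 by blast
	have "AE x in M. - ereal (g x) \<le> esssup M (%x. - ereal (g x))" by (rule esssup_AE)
	then have "AE x in M. - r \<le> g x"
	proof (rule eventually_mono)
		fix x assume "- ereal (g x) \<le> esssup M (%x. - ereal (g x))"
		then have "- ereal (g x) < ereal r" using r(1) by order
		then show "- r \<le> g x" by simp
	qed
	moreover have "- r > 0" using r(2) by (simp add: zero_ereal_def)
	ultimately show ?thesis using that by blast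
qed

text \<open>The sphere is a null set, so a positive bound on the open ball and vanishing outside the
  closed one determine the sign of \<open>f\<close> almost everywhere.\<close>

lemma ess_inf_ball:
	fixes f :: "R3 => real"
	assumes f: "f \<in> L2" "AE x. x \<notin> closure (ball b r) --> f x = 0"
		and pos: "ess_inf (lebesgue_on (ball b r)) f > 0"
	obtains c where "c > 0" "AE x. x \<in> ball b r --> c \<le> f x" "AE x. 0 \<le> f x"
proof -
	have "f \<in> borel_measurable (lebesgue_on (ball b r))" using L2_measurable[OF f(1)] by (rule measurable_restrict_space1)
	from ess_inf_pos_bound[OF pos this] obtain c where c: "c > 0" "AE x in lebesgue_on (ball b r). c \<le> f x" by blast
	have sp: "ball b r \<inter> space lebesgue \<in> sets lebesgue" by simp
	have 1: "AE x. x \<in> ball b r --> c \<le> f x" using c(2) AE_restrict_space_iff[OF sp] by simp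
	have "negligible (frontier (ball b r))" by (rule negligible_convex_frontier[OF convex_ball])
	then have "AE x. x \<notin> frontier (ball b r)" by (intro AE_not_in) (simp only: negligible_iff_null_sets)
	then have "AE x. 0 \<le> f x"
		using f(2) 1
	proof eventually_elim
		case (elim x)
		then show ?case using c(1) by (cases "x \<in> closure (ball b r)") (auto simp: frontier_def interior_open)
	qed
	with c(1) 1 show ?thesis using that by blast
qed

text \<open>Reduces a negative source to a positive one: \<open>f\<close> and \<open>v\<close>
  change sign together, while the norm of the gradient stays the same.\<close>

lemma elliptic_uminus:
	assumes a: "a \<in> borel_measurable lebesgue" and v: "elliptic_weak_solution a s f v"
	shows "elliptic_weak_solution a s (%x. - f x) (%x. - v x)"
		and "AE x. weak_gradient (%x. - v x) x = - weak_gradient v x"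
proof -
	have vH: "v \<in> H1" using v by (simp add: elliptic_weak_solution_def)
	have nH: "(%x. - v x) \<in> H1" and ng: "is_weak_gradient (%x. - v x) (%x. - weak_gradient v x)"
		using H1_scale(1,2)[OF vH, of "-1"] by simp_all
	show ae: "AE x. weak_gradient (%x. - v x) x = - weak_gradient v x"
		by (rule weak_gradient_AE[OF H1_L2[OF nH] ng])
	show "elliptic_weak_solution a s (%x. - f x) (%x. - v x)"
		unfolding elliptic_weak_solution_def
	proof (intro conjI ballI nH)
		fix p assume p: "p \<in> H1"
		have "(LINT x. (a x *\<^sub>R weak_gradient (%x. - v x) x) \<bullet> weak_gradient p x) = (LINT x. - ((a x *\<^sub>R weak_gradient v x) \<bullet> weak_gradient p x))"
		proof (rule integral_cong_AE)
			note m = L2_measurable[OF H1_gradient_L2]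
			show "(%x. (a x *\<^sub>R weak_gradient (%x. - v x) x) \<bullet> weak_gradient p x) \<in> borel_measurable lebesgue"
				using a m[OF nH] m[OF p] by simp
			show "(%x. - ((a x *\<^sub>R weak_gradient v x) \<bullet> weak_gradient p x)) \<in> borel_measurable lebesgue"
				using a m[OF vH] m[OF p] by simp
			show "AE x. (a x *\<^sub>R weak_gradient (%x. - v x) x) \<bullet> weak_gradient p x = - ((a x *\<^sub>R weak_gradient v x) \<bullet> weak_gradient p x)"
				using ae by (rule eventually_mono) simp
		qed
		then show "(LINT x. (a x *\<^sub>R weak_gradient (%x. - v x) x) \<bullet> weak_gradient p x)
				+ s^2 * (LINT x. - v x * p x) = (LINT x. - f x * p x)"
			using bspec[OF conjunct2[OF v[unfolded elliptic_weak_solution_def]] p] by (simp; linarith)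
	qed
qed

lemma gamma_decompose:
	fixes h :: "R3 => real^3^3"
	shows "gamma \<gamma>p \<gamma>m D h x *v y = gamma0 \<gamma>p \<gamma>m x *\<^sub>R y + (if x \<in> D then h x else 0) *v y"
	by (simp add: gamma_def matrix_vector_mult_add_rdistrib scaleR_matrix_vector_assoc[symmetric])

text \<open>The extension of \<open>h\<close> by zero is measurable and bounded on the whole space
  because it is the difference of \<open>gamma\<close> and a bounded multiple of the identity
  matrix.\<close>

lemma (in two_layer) perturbation_Linfty:
	fixes h :: "R3 => real^3^3"
	assumes "(%x. gamma \<gamma>p \<gamma>m D h x $ i $ j) \<in> Linfty UNIV"
	shows "(%x. (if x \<in> D then h x else 0) $ i $ j) \<in> Linfty UNIV"
proof -
	have eq: "(if x \<in> D then h x else 0) $ i $ j = gamma \<gamma>p \<gamma>m D h x $ i $ j - \<gamma>0 x * (mat 1 :: real^3^3) $ i $ j" for x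
		by (simp add: gamma_def)
	obtain M where M: "AE x. \<bar>gamma \<gamma>p \<gamma>m D h x $ i $ j\<bar> \<le> M" using assms by (auto simp: Linfty_UNIV)
	have "AE x. \<bar>gamma \<gamma>p \<gamma>m D h x $ i $ j - \<gamma>0 x * (mat 1 :: real^3^3) $ i $ j\<bar> \<le> M + \<gamma>p"
		using M
	proof (rule eventually_mono)
		fix x assume "\<bar>gamma \<gamma>p \<gamma>m D h x $ i $ j\<bar> \<le> M"
		moreover have "\<bar>\<gamma>0 x * (mat 1 :: real^3^3) $ i $ j\<bar> \<le> \<gamma>p" using gamma0_bounds(4)[of x] abs_ge_zero[of "\<gamma>0 x"] by (auto simp: mat_def)
		ultimately show "\<bar>gamma \<gamma>p \<gamma>m D h x $ i $ j - \<gamma>0 x * (mat 1 :: real^3^3) $ i $ j\<bar> \<le> M + \<gamma>p" by linarith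
	qed
	then show ?thesis
		unfolding eq using assms gamma0_measurable by (auto simp: Linfty_UNIV)
qed

lemma (in two_layer) gradient_lower_bound_signed:
	assumes v: "\<forall>s>0. elliptic_weak_solution \<gamma>0 s f (v s)"
		and f: "f \<in> L2" "AE x. x \<notin> closure B --> f x = 0"
		and B: "B = ball b r" "0 < r" "closure B \<subseteq> {x. x $ 3 > 0}"
		and D: "open D" "D \<noteq> {}" "D \<subseteq> {x. x $ 3 < 0}"
		and pos: "ess_inf (lebesgue_on B) f > 0 \<or> ess_inf (lebesgue_on B) (%x. - f x) > 0" and e: "e > 0"
	shows "\<exists>C>0. \<exists>\<tau>0. \<forall>s\<ge>\<tau>0. C * exp (- 2 * s * (optical_setdist \<gamma>p \<gamma>m D B + e))
		\<le> (LINT z. indicator D z * (norm (weak_gradient (v s) z))^2)"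
proof -
	have B': "open B" "B \<noteq> {}" using B(1,2) by auto
	have B3: "B \<subseteq> {x. x $ 3 > 0}" using B(3) closure_subset[of B] by blast
	have fD: "AE x. x \<in> D --> f x = 0"
		using f(2) by (rule eventually_mono) (use B(3) D(3) in fastforce)
	show ?thesis
		using pos
	proof
		assume "ess_inf (lebesgue_on B) f > 0"
		then obtain c where c: "c > 0" "AE x. x \<in> B --> c \<le> f x" "AE x. 0 \<le> f x"
			using ess_inf_ball[OF f(1), of b r] f(2) unfolding B(1) by blast
		show ?thesis by (rule gradient_lower_bound[OF v f(1) c(3,1,2) B' B3 D(1,2) fD e])
	next
		assume neg: "ess_inf (lebesgue_on B) (%x. - f x) > 0"
		have nf: "(%x. - f x) \<in> L2" by (rule L2_minus[OF f(1)])
		have nf0: "AE x. x \<notin> closure B --> - f x = 0" using f(2) by (rule eventually_mono) simp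
		obtain c where c: "c > 0" "AE x. x \<in> B --> c \<le> - f x" "AE x. 0 \<le> - f x"
			using ess_inf_ball[OF nf, of b r] neg nf0 unfolding B(1) by blast
		have nv: "\<forall>s>0. elliptic_weak_solution \<gamma>0 s (%x. - f x) (%x. - v s x)"
			using elliptic_uminus(1)[OF gamma0_measurable] v by blast
		have nfD: "AE x. x \<in> D --> - f x = 0" using fD by (rule eventually_mono) simp
		obtain C \<tau>0 where C: "C > 0" "\<And>s. s \<ge> \<tau>0 ==> C * exp (- 2 * s * (optical_setdist \<gamma>p \<gamma>m D B + e))
			\<le> (LINT z. indicator D z * (norm (weak_gradient (%x. - v s x) z))^2)"
			using gradient_lower_bound[OF nv nf c(3,1,2) B' B3 D(1,2) nfD e] by blast
		have "(LINT z. indicator D z * (norm (weak_gradient (%x. - v s x) z))^2) = (LINT z. indicator D z * (norm (weak_gradient (v s) z))^2)"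
			if t: "s > 0" for s
		proof (rule integral_cong_AE)
			have DL: "D \<in> sets lebesgue" using D(1) by simp
			have m: "(%z. indicator D z * (norm (weak_gradient y z))^2) \<in> borel_measurable lebesgue" if "y \<in> H1" for y
				using DL L2_measurable[OF H1_gradient_L2[OF that]] by simp
			have "v s \<in> H1" "(%x. - v s x) \<in> H1" using v nv t by (auto simp: elliptic_weak_solution_def)
			then show "(%z. indicator D z * (norm (weak_gradient (v s) z))^2) \<in> borel_measurable lebesgue"
				"(%z. indicator D z * (norm (weak_gradient (%x. - v s x) z))^2) \<in> borel_measurable lebesgue" using m by auto
			show "AE z. indicator D z * (norm (weak_gradient (%x. - v s x) z))^2 = indicator D z * (norm (weak_gradient (v s) z))^2"
				using elliptic_uminus(2)[OF gamma0_measurable v[rule_format, OF t]] by (rule eventually_mono) simp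
		qed
		note cong = this
		show ?thesis
		proof (intro exI conjI allI impI)
			show "C > 0" by (rule C(1))
			fix s assume "s \<ge> max \<tau>0 1"
			then have t: "s \<ge> \<tau>0" "s > 0" by auto
			show "C * exp (- 2 * s * (optical_setdist \<gamma>p \<gamma>m D B + e)) \<le> (LINT z. indicator D z * (norm (weak_gradient (v s) z))^2)"
				using C(2)[OF t(1)] unfolding cong[OF t(2)] .
		qed
	qed
qed

theorem theorem1p1:
  fixes \<gamma>\<^sub>p \<gamma>\<^sub>m T b\<^sub>r :: real
    and D B :: "(real^3) set"
    and h :: "real^3 \<Rightarrow> real^3^3"
    and b\<^sub>c :: "real^3"
    and f :: "real^3 \<Rightarrow> real"
    and u v :: "real \<Rightarrow> real^3 \<Rightarrow> real"
  defines "\<gamma> \<equiv> gamma \<gamma>\<^sub>p \<gamma>\<^sub>m D h"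
    and "l \<equiv> optical_setdist \<gamma>\<^sub>p \<gamma>\<^sub>m D B"
    and "I \<equiv> indicator_function f u v"
  assumes "0 < \<gamma>\<^sub>m" and "\<gamma>\<^sub>m < \<gamma>\<^sub>p"
    and "D \<noteq> {}" and "bounded D" and "open D" and "C2_boundary D"
    and "closure D \<subseteq> {x. x $ 3 < 0}"
    and "\<And>i j. (\<lambda>x. h x $ i $ j) \<in> Linfty D"
    and "\<And>i j. (\<lambda>x. \<gamma> x $ i $ j) \<in> Linfty UNIV"
    and "\<And>i j. AE x in lebesgue. \<gamma> x $ i $ j = \<gamma> x $ j $ i"
    and "uniformly_elliptic \<gamma>"
    and "0 < b\<^sub>r" and "B = ball b\<^sub>c b\<^sub>r" and "closure B \<subseteq> {x. x $ 3 > 0}"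
    and "f \<in> L2" and "AE x in lebesgue. x \<notin> closure B \<longrightarrow> f x = 0"
    and "ess_inf (lebesgue_on B) f > 0 \<or> ess_inf (lebesgue_on B) (\<lambda>x. - f x) > 0"
    and "0 < T"
    and "wave_weak_solution \<gamma> f T u"
    and "\<And>\<tau>. \<tau> > 0 \<Longrightarrow> elliptic_weak_solution (gamma0 \<gamma>\<^sub>p \<gamma>\<^sub>m) \<tau> f (v \<tau>)"
  shows "(T < 2 * l \<longrightarrow> ((\<lambda>\<tau>. exp (\<tau> * T) * I \<tau> T) \<longlongrightarrow> 0) at_top) \<and>
    (T > 2 * l \<and> jump_plus D h \<longrightarrow> filterlim (\<lambda>\<tau>. exp (\<tau> * T) * I \<tau> T) at_bot at_top) \<and>
    (T > 2 * l \<and> jump_minus D h \<longrightarrow> filterlim (\<lambda>\<tau>. exp (\<tau> * T) * I \<tau> T) at_top at_top) \<and>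
    ((jump_plus D h \<or> jump_minus D h) \<and> T > 2 * l \<longrightarrow>
       ((\<lambda>\<tau>. 1 / \<tau> * ln \<bar>I \<tau> T\<bar>) \<longlongrightarrow> - 2 * l) at_top)"
proof -
	interpret two_layer \<gamma>\<^sub>p \<gamma>\<^sub>m by unfold_locales (use assms in auto)
	have DB: "D \<noteq> {}" "open D" "closure D \<subseteq> {x. x $ 3 < 0}" and B: "0 < b\<^sub>r" "B = ball b\<^sub>c b\<^sub>r" "closure B \<subseteq> {x. x $ 3 > 0}"
		and f: "f \<in> L2" "AE x. x \<notin> closure B --> f x = 0"
		and pos: "ess_inf (lebesgue_on B) f > 0 \<or> ess_inf (lebesgue_on B) (%x. - f x) > 0"
		and T: "0 < T" and wave: "wave_weak_solution \<gamma> f T u" and ell: "uniformly_elliptic \<gamma>"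
		using assms by blast+
	have \<gamma>L: "\<And>i j. (%x. \<gamma> x $ i $ j) \<in> Linfty UNIV" and \<gamma>s: "\<And>i j. AE x. \<gamma> x $ i $ j = \<gamma> x $ j $ i"
		and v: "\<forall>\<tau>>0. elliptic_weak_solution (gamma0 \<gamma>\<^sub>p \<gamma>\<^sub>m) \<tau> f (v \<tau>)"
		using assms by blast+
	have D3: "D \<subseteq> {x. x $ 3 < 0}" using DB(3) closure_subset[of D] by blast
	have Bne: "B \<noteq> {}" using B(1,2) by simp
	have DL: "D \<in> sets lebesgue" using DB(2) by simp
	have l0: "l \<ge> 0" unfolding l_def by (rule optical_setdist_nonneg[OF DB(1) Bne])
	\<comment> \<open>Extending \<open>h\<close> by zero splits the coefficient on the whole space, so
	  that the energy estimates apply with \<open>k\<close> as perturbation.\<close>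
	define k where "k x = (if x \<in> D then h x else 0)" for x
	have \<gamma>k: "\<gamma> x *v \<xi> = gamma0 \<gamma>\<^sub>p \<gamma>\<^sub>m x *\<^sub>R \<xi> + k x *v \<xi>" for x \<xi>
		unfolding \<gamma>_def k_def by (rule gamma_decompose)
	have k: "(%x. k x $ i $ j) \<in> Linfty UNIV" for i j
		unfolding k_def by (rule perturbation_Linfty[OF \<gamma>L[unfolded \<gamma>_def]])
	have supp: "k x = 0" if "x \<notin> D" for x using that by (simp add: k_def)
	have ksym: "AE x. \<forall>\<xi> \<eta>. (k x *v \<xi>) \<bullet> \<eta> = \<xi> \<bullet> (k x *v \<eta>)"
		using matrix_symmetric_AE[OF \<gamma>s] by (rule eventually_mono) (simp add: \<gamma>k inner_add_left inner_add_right)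
	obtain C where C: "C > 0" "AE x. \<forall>\<xi>. (\<gamma> x *v \<xi>) \<bullet> \<xi> \<ge> C * (norm \<xi>)^2"
		using ell unfolding uniformly_elliptic_def by blast
	have Ck: "AE x. \<forall>\<xi>. C * (norm \<xi>)^2 \<le> gamma0 \<gamma>\<^sub>p \<gamma>\<^sub>m x * (norm \<xi>)^2 + (k x *v \<xi>) \<bullet> \<xi>"
		using C(2) by (rule eventually_mono) (simp add: \<gamma>k inner_add_left power2_norm_eq_inner)
	define w where "w \<tau> x = laplace_wave u T x \<tau>" for \<tau> x
	obtain uT FT where uF: "uT \<in> L2" "FT \<in> H1_dual" and wH: "\<And>\<tau>. \<tau> > 0 ==> w \<tau> \<in> H1"
		and weq: "\<And>\<tau> \<phi>. \<tau> > 0 ==> \<phi> \<in> H1 ==>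
			(LINT x. (\<gamma> x *v weak_gradient (w \<tau>) x) \<bullet> weak_gradient \<phi> x) + \<tau>^2 * (LINT x. w \<tau> x * \<phi> x)
			= (LINT x. f x * \<phi> x) - exp (- \<tau> * T) * (FT \<phi> + \<tau> * (LINT x. uT x * \<phi> x))"
		using wave_laplace_equation[OF wave T f(1) \<gamma>L \<gamma>s] unfolding w_def[abs_def] by blast
	have weq': "(LINT x. gamma0 \<gamma>\<^sub>p \<gamma>\<^sub>m x * (weak_gradient (w \<tau>) x \<bullet> weak_gradient \<phi> x))
			+ (LINT x. (k x *v weak_gradient (w \<tau>) x) \<bullet> weak_gradient \<phi> x) + \<tau>^2 * (LINT x. w \<tau> x * \<phi> x)
			= (LINT x. f x * \<phi> x) - exp (- \<tau> * T) * (FT \<phi> + \<tau> * (LINT x. uT x * \<phi> x))"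
		if t: "\<tau> > 0" and \<phi>: "\<phi> \<in> H1" for \<tau> \<phi>
	proof -
		note L = H1_gradient_L2[OF wH[OF t]] H1_gradient_L2[OF \<phi>]
		have "(LINT x. (\<gamma> x *v weak_gradient (w \<tau>) x) \<bullet> weak_gradient \<phi> x)
			= (LINT x. gamma0 \<gamma>\<^sub>p \<gamma>\<^sub>m x * (weak_gradient (w \<tau>) x \<bullet> weak_gradient \<phi> x) + (k x *v weak_gradient (w \<tau>) x) \<bullet> weak_gradient \<phi> x)"
			unfolding \<gamma>k by (simp add: inner_add_left)
		also have "\<dots> = (LINT x. gamma0 \<gamma>\<^sub>p \<gamma>\<^sub>m x * (weak_gradient (w \<tau>) x \<bullet> weak_gradient \<phi> x)) + (LINT x. (k x *v weak_gradient (w \<tau>) x) \<bullet> weak_gradient \<phi> x)"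
			by (rule Bochner_Integration.integral_add[OF gamma0_inner_integrable[OF L] L2_inner_integrable[OF matrix_L2[OF k L(1)] L(2)]])
		finally show ?thesis using weq[OF t \<phi>] by simp
	qed
	define E where "E = (%\<tau>. LINT x. indicator D x * (norm (weak_gradient (v \<tau>) x))^2)"
	define J where "J \<tau> = I \<tau> T" for \<tau>
	have J_eq: "J = (%\<tau>. LINT x. f x * (w \<tau> x - v \<tau> x))"
		by (simp add: fun_eq_iff J_def I_def indicator_function_def w_def)
	define s where "s = (%\<tau>. \<tau>^2 * exp (- 2 * \<tau> * T) + exp (- \<tau> * T) / \<tau>)"
	note energy = k supp DL ksym C(1) Ck f(1) v wH uF weq' E_def J_eq s_def
	have est: "\<exists>K>0. \<forall>\<tau>\<ge>1. \<bar>J \<tau>\<bar> \<le> K * (E \<tau> + s \<tau>)" by (rule energy_estimates(1)[OF energy])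
	have up: "\<exists>C>0. \<forall>\<tau>\<ge>1. E \<tau> \<le> C * exp (- 2 * \<tau> * (l - \<epsilon>))" if "\<epsilon> > 0" for \<epsilon>
		unfolding E_def l_def by (rule gradient_upper_bound[OF v f Bne B(3) DB(1,2) D3 that])
	have lo: "\<exists>C>0. \<exists>\<tau>\<^sub>0. \<forall>\<tau>\<ge>\<tau>\<^sub>0. C * exp (- 2 * \<tau> * (l + \<epsilon>)) \<le> E \<tau>" if "\<epsilon> > 0" for \<epsilon>
		unfolding E_def l_def by (rule gradient_lower_bound_signed[OF v f B(2,1,3) DB(2,1) D3 pos that])
	note asym = T l0 up lo est s_def
	have sp: "D \<inter> space lebesgue \<in> sets lebesgue" using DL by simp
	\<comment> \<open>A positive jump makes the indicator function negative, so the asymptotic lemmas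
	  are applied to \<open>- J\<close> in this case.\<close>
	have plus: "\<exists>c>0. \<exists>K>0. \<forall>\<tau>\<ge>1. c * E \<tau> - K * s \<tau> \<le> - J \<tau>" if jp: "jump_plus D h"
	proof -
		obtain c where c: "c > 0" "AE x in lebesgue_on D. \<forall>\<xi>. (h x *v \<xi>) \<bullet> \<xi> \<ge> c * (norm \<xi>)^2"
			using jp unfolding jump_plus_def by blast
		have "AE x. x \<in> D --> (\<forall>\<xi>. (h x *v \<xi>) \<bullet> \<xi> \<ge> c * (norm \<xi>)^2)"
			using c(2) AE_restrict_space_iff[OF sp] by simp
		then have ae: "AE x. x \<in> D --> (\<forall>\<xi>. c * (norm \<xi>)^2 \<le> (k x *v \<xi>) \<bullet> \<xi>)"
			by (rule eventually_mono) (simp add: k_def)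
		show ?thesis by (rule energy_estimates(3)[OF energy c(1) ae])
	qed
	have minus: "\<exists>c>0. \<exists>K>0. \<forall>\<tau>\<ge>1. c * E \<tau> - K * s \<tau> \<le> J \<tau>" if jm: "jump_minus D h"
	proof -
		obtain c where c: "c > 0" "AE x in lebesgue_on D. \<forall>\<xi>. - ((h x *v \<xi>) \<bullet> \<xi>) \<ge> c * (norm \<xi>)^2"
			using jm unfolding jump_minus_def by blast
		have "AE x. x \<in> D --> (\<forall>\<xi>. - ((h x *v \<xi>) \<bullet> \<xi>) \<ge> c * (norm \<xi>)^2)"
			using c(2) AE_restrict_space_iff[OF sp] by simp
		then have ae: "AE x. x \<in> D --> (\<forall>\<xi>. c * (norm \<xi>)^2 \<le> - ((k x *v \<xi>) \<bullet> \<xi>))"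
			by (rule eventually_mono) (simp add: k_def)
		show ?thesis by (rule energy_estimates(2)[OF energy c(1) ae])
	qed
	show ?thesis
		unfolding J_def[symmetric]
	proof (intro conjI impI)
		show "((%\<tau>. exp (\<tau> * T) * J \<tau>) \<longlongrightarrow> 0) at_top" if "T < 2 * l"
			by (rule indicator_vanishes[OF asym that])
		show "filterlim (%\<tau>. exp (\<tau> * T) * J \<tau>) at_bot at_top" if "T > 2 * l \<and> jump_plus D h"
		proof -
			have "filterlim (%\<tau>. exp (\<tau> * T) * - J \<tau>) at_top at_top"
				by (rule indicator_diverges[OF asym conjunct1[OF that] plus[OF conjunct2[OF that]]])
			then show ?thesis by (simp add: filterlim_uminus_at_bot)
		qed
		show "filterlim (%\<tau>. exp (\<tau> * T) * J \<tau>) at_top at_top" if "T > 2 * l \<and> jump_minus D h"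
			by (rule indicator_diverges[OF asym conjunct1[OF that] minus[OF conjunct2[OF that]]])
		assume jumps: "(jump_plus D h \<or> jump_minus D h) \<and> T > 2 * l"
		show "((%\<tau>. 1 / \<tau> * ln \<bar>J \<tau>\<bar>) \<longlongrightarrow> - 2 * l) at_top"
			using conjunct1[OF jumps]
		proof
			assume "jump_plus D h"
			then show ?thesis by - (rule indicator_logarithm[OF asym conjunct2[OF jumps] plus]; simp)
		next
			assume "jump_minus D h"
			then show ?thesis by - (rule indicator_logarithm[OF asym conjunct2[OF jumps] minus]; simp)
		qed
	qed
qed

end
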